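(* Let $Z$ be a finite scheme over $\mathbb{K}$ with an action of a linearly reductive algebraic group $G$, and suppose that $Z$ admits a $G$-equivariant smoothing $\mathcal{Z}$. Then $\mathcal{Z}/\!/G$ is a smoothing of $Z/\!/G$; in particular $Z/\!/G$ is smoothable.
   Context: $\mathbb{K}$ is an algebraically closed field of characteristic zero. A smoothing of a finite scheme $Z=\operatorname{Spec}(A)$ is $\mathcal{Z}=\operatorname{Spec}(\mathcal{A})$, where $\mathcal{A}$ is a $\mathbb{K}[[t]]$-algebra that is free of finite rank as a $\mathbb{K}[[t]]$-module, with $\mathcal{A}/t\mathcal{A}\simeq A$ as $\mathbb{K}$-algebras and with $\mathcal{A}[t^{-1}]$ a smooth $\mathbb{K}[[t]][t^{-1}]$-algebra. $Z$ is smoothable if it has a smoothing. A smoothing of $Z$ is $G$-equivariant if $G$ acts on $\mathcal{Z}$ over $\operatorname{Spec}\mathbb{K}[[t]]$ (with trivial action on the base) so that the identification of the special fibre $\operatorname{Spec}(\mathcal{A}/t\mathcal{A})$ with $Z$ is $G$-equivariant. For an affine scheme $\operatorname{Spec}(B)$ with $G$-action, $\operatorname{Spec}(B)/\!/G=\operatorname{Spec}(B^G)$. *)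

theory Defs
  imports
    "HOL-Algebra.QuotRing"
    "HOL-Algebra.Group_Action"
    "HOL-Computational_Algebra.Formal_Laurent_Series"
    "HOL-Library.Poly_Mapping"
    "Jordan_Normal_Form.VS_Connect"
begin

hide_const (open) Multiset.mult Polynomial.smult Modules.module

section \<open>Conventions\<close>

text \<open>
  The field \<open>K\<close>, the power series ring \<open>K[[t]]\<close> and the Laurent series field
  \<open>K((t)) = K[[t]][1/t]\<close> are the types \<open>'k\<close>, \<open>'k fps\<close>, \<open>'k fls\<close>.  Algebras over them are
  commutative and carrier-based: \<open>algebra class_ring B\<close>, where \<open>class_ring\<close> is the
  scalar type viewed as a ring.  Affine schemes are represented by their coordinate algebras.
\<close>

definition alg_hom :: "('r, 'a) module \<Rightarrow> ('r, 'b) module \<Rightarrow> ('a \<Rightarrow> 'b) set" where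
  "alg_hom S T =
     {h \<in> Ring.ring_hom S T. \<forall>r. \<forall>x\<in>carrier S. h (r \<odot>\<^bsub>S\<^esub> x) = r \<odot>\<^bsub>T\<^esub> h x}"

definition alg_iso :: "('r, 'a) module \<Rightarrow> ('r, 'b) module \<Rightarrow> ('a \<Rightarrow> 'b) set" where
  "alg_iso S T = {h \<in> alg_hom S T. bij_betw h (carrier S) (carrier T)}"

definition self_algebra :: "('r::comm_ring_1, 'r) module" where
  "self_algebra =
     \<lparr>carrier = UNIV, mult = (*), one = 1, zero = 0, add = (+), smult = (*)\<rparr>"

definition fin_gen_algebra :: "('r::comm_ring_1, 'a) module \<Rightarrow> bool" where
  "fin_gen_algebra S \<longleftrightarrow>
     algebra class_ring S \<and>
     (\<exists>F. finite F \<and> F \<subseteq> carrier S \<and>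
        (\<forall>B. F \<subseteq> B \<and> B \<subseteq> carrier S \<and> algebra class_ring (S\<lparr>carrier := B\<rparr>)
             \<longrightarrow> B = carrier S))"

text \<open>The coordinate algebras of finite schemes over the base, possibly non-reduced or zero.\<close>

definition finite_algebra :: "('r::comm_ring_1, 'a) module \<Rightarrow> bool" where
  "finite_algebra A \<longleftrightarrow>
     algebra class_ring A \<and>
     (\<exists>E. finite E \<and> E \<subseteq> carrier A \<and> module.span class_ring A E = carrier A)"

definition free_of_finite_rank :: "('r::comm_ring_1, 'a) module \<Rightarrow> bool" where
  "free_of_finite_rank M \<longleftrightarrow>
     (\<exists>E. finite E \<and> E \<subseteq> carrier M \<and> \<not> module.lin_dep class_ring M E \<and>
          module.span class_ring M E = carrier M)"


section \<open>Smooth algebras\<close>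

subsection \<open>Polynomial algebras\<close>

text \<open>\<open>R[x\<^sub>0,\<dots>,x\<^sub>n\<^sub>-\<^sub>1]\<close>; a monomial is its exponent function \<open>nat \<Rightarrow>\<^sub>0 nat\<close>.\<close>

definition mpoly_algebra :: "nat \<Rightarrow> ('r::comm_ring_1, (nat \<Rightarrow>\<^sub>0 nat) \<Rightarrow>\<^sub>0 'r) module" where
  "mpoly_algebra n =
     \<lparr>carrier = {p. \<forall>m \<in> Poly_Mapping.keys p. Poly_Mapping.keys m \<subseteq> {..<n}},
      mult = (*), one = 1, zero = 0, add = (+),
      smult = (\<lambda>r p. Poly_Mapping.single 0 r * p)\<rparr>"

text \<open>For exponent \<open>0\<close> the truncated monomial \<open>m - x\<^sub>j\<close> occurs with coefficient \<open>0\<close>.\<close>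

definition mpoly_pderiv ::
    "nat \<Rightarrow> ((nat \<Rightarrow>\<^sub>0 nat) \<Rightarrow>\<^sub>0 'r::comm_ring_1) \<Rightarrow> ((nat \<Rightarrow>\<^sub>0 nat) \<Rightarrow>\<^sub>0 'r)" where
  "mpoly_pderiv j p =
     (\<Sum>m \<in> Poly_Mapping.keys p.
        Poly_Mapping.single (m - Poly_Mapping.single j 1)
          (of_nat (Poly_Mapping.lookup m j) * Poly_Mapping.lookup p m))"

subsection \<open>Localization at the powers of an element\<close>

text \<open>The pair \<open>(a, n)\<close> stands for the fraction \<open>a / g\<^sup>n\<close>.\<close>

definition loc_rel :: "('r, 's) module \<Rightarrow> 's \<Rightarrow> (('s \<times> nat) \<times> ('s \<times> nat)) set" where
  "loc_rel S g =
     {((a, n), (b, m)). a \<in> carrier S \<and> b \<in> carrier S \<and>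
        (\<exists>k::nat. (g [^]\<^bsub>S\<^esub> k) \<otimes>\<^bsub>S\<^esub> ((g [^]\<^bsub>S\<^esub> m) \<otimes>\<^bsub>S\<^esub> a) =
                  (g [^]\<^bsub>S\<^esub> k) \<otimes>\<^bsub>S\<^esub> ((g [^]\<^bsub>S\<^esub> n) \<otimes>\<^bsub>S\<^esub> b))}"

definition loc_frac :: "('r, 's) module \<Rightarrow> 's \<Rightarrow> 's \<Rightarrow> nat \<Rightarrow> ('s \<times> nat) set" where
  "loc_frac S g a n = loc_rel S g `` {(a, n)}"

definition localization :: "('r, 's) module \<Rightarrow> 's \<Rightarrow> ('r, ('s \<times> nat) set) module" where
  "localization S g =
     \<lparr>carrier = {loc_frac S g a n | a n. a \<in> carrier S},
      mult = (\<lambda>X Y. \<Union>(a, n)\<in>X. \<Union>(b, m)\<in>Y. loc_frac S g (a \<otimes>\<^bsub>S\<^esub> b) (n + m)),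
      one = loc_frac S g \<one>\<^bsub>S\<^esub> 0,
      zero = loc_frac S g \<zero>\<^bsub>S\<^esub> 0,
      add = (\<lambda>X Y. \<Union>(a, n)\<in>X. \<Union>(b, m)\<in>Y.
               loc_frac S g (((g [^]\<^bsub>S\<^esub> m) \<otimes>\<^bsub>S\<^esub> a) \<oplus>\<^bsub>S\<^esub> ((g [^]\<^bsub>S\<^esub> n) \<otimes>\<^bsub>S\<^esub> b)) (n + m)),
      smult = (\<lambda>r X. \<Union>(a, n)\<in>X. loc_frac S g (r \<odot>\<^bsub>S\<^esub> a) n)\<rparr>"

subsection \<open>Smoothness\<close>

text \<open>
  \<open>S\<close> is standard smooth over \<open>R\<close> if \<open>S = R[x\<^sub>0,\<dots>,x\<^sub>n\<^sub>-\<^sub>1] / (f\<^sub>0,\<dots>,f\<^sub>c\<^sub>-\<^sub>1)\<close> with \<open>c \<le> n\<close> and the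
  determinant of \<open>(\<partial>f\<^sub>i / \<partial>x\<^sub>j)\<close>, \<open>i, j < c\<close>, becomes a unit in \<open>S\<close>;
  \<open>S\<close> is smooth if it is standard smooth on the members of a finite cover of \<open>Spec S\<close>
  by principal open sets.
\<close>

definition standard_smooth :: "('r::comm_ring_1, 's) module \<Rightarrow> bool" where
  "standard_smooth S \<longleftrightarrow>
     (\<exists>n c f h. c \<le> n \<and> (\<forall>i<c. f i \<in> carrier (mpoly_algebra n)) \<and>
        h \<in> alg_hom (mpoly_algebra n) S \<and>
        h ` carrier (mpoly_algebra n) = carrier S \<and>
        a_kernel (mpoly_algebra n) S h = genideal (mpoly_algebra n) (f ` {..<c}) \<and>
        h (det (mat c c (\<lambda>(i, j). mpoly_pderiv j (f i)))) \<in> Units S)"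

definition smooth_algebra :: "('r::comm_ring_1, 's) module \<Rightarrow> bool" where
  "smooth_algebra S \<longleftrightarrow>
     algebra class_ring S \<and>
     (\<exists>\<Gamma>. finite \<Gamma> \<and> \<Gamma> \<subseteq> carrier S \<and> genideal S \<Gamma> = carrier S \<and>
          (\<forall>g\<in>\<Gamma>. standard_smooth (localization S g)))"


section \<open>Smoothings\<close>

definition special_ideal :: "('k::field fps, 'b) module \<Rightarrow> 'b set" where
  "special_ideal \<A> = cgenideal \<A> (fps_X \<odot>\<^bsub>\<A>\<^esub> \<one>\<^bsub>\<A>\<^esub>)"

text \<open>The \<open>K\<close>-algebra \<open>\<A>/t\<A>\<close>.\<close>

definition special_fibre :: "('k::field fps, 'b) module \<Rightarrow> ('k, 'b set) module" where
  "special_fibre \<A> =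
     ring.extend (\<A> Quot special_ideal \<A>)
       (module.fields
         (\<lambda>c X. \<Union>x\<in>X. special_ideal \<A> +>\<^bsub>\<A>\<^esub> (fps_const c \<odot>\<^bsub>\<A>\<^esub> x)))"

text \<open>
  The \<open>K((t))\<close>-algebra \<open>\<A>[1/t]\<close>.  A Laurent series \<open>f\<close> is \<open>p / t\<^sup>m\<close> with \<open>m\<close> its pole order
  and \<open>p = f t\<^sup>m\<close> a power series, so that \<open>f (a / t\<^sup>n) = (p a) / t\<^sup>n\<^sup>+\<^sup>m\<close>.
\<close>

definition generic_fibre :: "('k::field fps, 'b) module \<Rightarrow> ('k fls, ('b \<times> nat) set) module" where
  "generic_fibre \<A> =
     (let t = fps_X \<odot>\<^bsub>\<A>\<^esub> \<one>\<^bsub>\<A>\<^esub>; L = localization \<A> t in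
      \<lparr>carrier = carrier L, mult = mult L, one = one L, zero = zero L, add = add L,
       smult = (\<lambda>f X. let m = nat (- fls_subdegree f); p = fls_regpart (f * fls_X ^ m) in
                  \<Union>(a, n)\<in>X. loc_frac \<A> t (p \<odot>\<^bsub>\<A>\<^esub> a) (n + m))\<rparr>)"

text \<open>\<open>\<A>\<close> is a smoothing of the finite algebra \<open>A\<close>, with special fibre identified with \<open>A\<close> by \<open>\<phi>\<close>.\<close>

definition smoothing_via ::
    "('k::field, 'a) module \<Rightarrow> ('k fps, 'b) module \<Rightarrow> ('b set \<Rightarrow> 'a) \<Rightarrow> bool" where
  "smoothing_via A \<A> \<phi> \<longleftrightarrow>
     finite_algebra A \<and>
     algebra class_ring \<A> \<and> free_of_finite_rank \<A> \<and>
     \<phi> \<in> alg_iso (special_fibre \<A>) A \<and>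
     smooth_algebra (generic_fibre \<A>)"

definition is_smoothing :: "('k::field, 'a) module \<Rightarrow> ('k fps, 'b) module \<Rightarrow> bool" where
  "is_smoothing A \<A> \<longleftrightarrow> (\<exists>\<phi>. smoothing_via A \<A> \<phi>)"

text \<open>
  Every \<open>K[[t]]\<close>-algebra that is free of rank \<open>n\<close> is isomorphic to one whose carrier consists of
  vectors of length \<open>n\<close>, so fixing the element type here loses no generality.
\<close>

definition smoothable :: "('k::field, 'a) module \<Rightarrow> bool" where
  "smoothable A \<longleftrightarrow> (\<exists>\<A> :: ('k fps, 'k fps vec) module. is_smoothing A \<A>)"


section \<open>Linearly reductive groups and their actions\<close>

subsection \<open>Affine algebraic groups\<close>

text \<open>
  An affine variety over an algebraically closed field \<open>K\<close> is given by its set \<open>X\<close> of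
  \<open>K\<close>-points and its coordinate algebra \<open>\<O>\<close> of \<open>K\<close>-valued functions on \<open>X\<close>.
\<close>

definition function_algebra ::
    "'x set \<Rightarrow> ('x \<Rightarrow> 'k::comm_ring_1) set \<Rightarrow> ('k, 'x \<Rightarrow> 'k) module" where
  "function_algebra X \<O> =
     \<lparr>carrier = \<O>,
      mult = (\<lambda>u v. \<lambda>x\<in>X. u x * v x), one = (\<lambda>x\<in>X. 1),
      zero = (\<lambda>x\<in>X. 0), add = (\<lambda>u v. \<lambda>x\<in>X. u x + v x),
      smult = (\<lambda>c u. \<lambda>x\<in>X. c * u x)\<rparr>"

definition affine_variety :: "'x set \<Rightarrow> ('x \<Rightarrow> 'k::alg_closed_field) set \<Rightarrow> bool" where
  "affine_variety X \<O> \<longleftrightarrow>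
     \<O> \<subseteq> extensional X \<and>
     fin_gen_algebra (function_algebra X \<O>) \<and>
     (\<forall>\<chi> \<in> alg_hom (function_algebra X \<O>) self_algebra.
        \<exists>!x. x \<in> X \<and> (\<forall>f\<in>\<O>. \<chi> f = f x))"

text \<open>The last two conditions say that multiplication and inversion are morphisms of varieties.\<close>

definition affine_algebraic_group ::
    "('g, 'm) monoid_scheme \<Rightarrow> ('g \<Rightarrow> 'k::alg_closed_field) set \<Rightarrow> bool" where
  "affine_algebraic_group G \<O> \<longleftrightarrow>
     group G \<and> affine_variety (carrier G) \<O> \<and>
     (\<forall>f\<in>\<O>. \<exists>(m::nat) u v. (\<forall>i<m. u i \<in> \<O> \<and> v i \<in> \<O>) \<and>
        (\<forall>x\<in>carrier G. \<forall>y\<in>carrier G. f (x \<otimes>\<^bsub>G\<^esub> y) = (\<Sum>i<m. u i x * v i y))) \<and>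
     (\<forall>f\<in>\<O>. (\<lambda>x\<in>carrier G. f (inv\<^bsub>G\<^esub> x)) \<in> \<O>)"

subsection \<open>Linear reductivity\<close>

definition rational_representation ::
    "('g, 'm) monoid_scheme \<Rightarrow> ('g \<Rightarrow> 'k::alg_closed_field) set \<Rightarrow> nat \<Rightarrow> ('g \<Rightarrow> 'k mat) \<Rightarrow> bool" where
  "rational_representation G \<O> n \<rho> \<longleftrightarrow>
     (\<forall>g\<in>carrier G. \<rho> g \<in> carrier_mat n n) \<and>
     \<rho> \<one>\<^bsub>G\<^esub> = 1\<^sub>m n \<and>
     (\<forall>g\<in>carrier G. \<forall>h\<in>carrier G. \<rho> (g \<otimes>\<^bsub>G\<^esub> h) = \<rho> g * \<rho> h) \<and>
     (\<forall>i<n. \<forall>j<n. (\<lambda>g\<in>carrier G. \<rho> g $$ (i, j)) \<in> \<O>)"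

definition subrepresentation ::
    "('g, 'm) monoid_scheme \<Rightarrow> nat \<Rightarrow> ('g \<Rightarrow> 'k::alg_closed_field mat) \<Rightarrow> 'k vec set \<Rightarrow> bool" where
  "subrepresentation G n \<rho> W \<longleftrightarrow>
     LinearCombinations.submodule class_ring W (module_vec TYPE('k) n) \<and>
     (\<forall>g\<in>carrier G. \<forall>w\<in>W. \<rho> g *\<^sub>v w \<in> W)"

definition completely_reducible ::
    "('g, 'm) monoid_scheme \<Rightarrow> nat \<Rightarrow> ('g \<Rightarrow> 'k::alg_closed_field mat) \<Rightarrow> bool" where
  "completely_reducible G n \<rho> \<longleftrightarrow>
     (\<forall>W. subrepresentation G n \<rho> W \<longrightarrow>
        (\<exists>W'. subrepresentation G n \<rho> W' \<and> W \<inter> W' = {0\<^sub>v n} \<and>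
              (\<forall>v\<in>carrier_vec n. \<exists>w\<in>W. \<exists>w'\<in>W'. v = w + w')))"

definition linearly_reductive ::
    "('g, 'm) monoid_scheme \<Rightarrow> ('g \<Rightarrow> 'k::alg_closed_field) set \<Rightarrow> bool" where
  "linearly_reductive G \<O> \<longleftrightarrow>
     affine_algebraic_group G \<O> \<and>
     (\<forall>n \<rho>. rational_representation G \<O> n \<rho> \<longrightarrow> completely_reducible G n \<rho>)"

subsection \<open>Actions on affine schemes\<close>

text \<open>
  An action of \<open>G\<close> on \<open>Spec B\<close> over \<open>Spec R\<close> (trivial on the base), where \<open>R\<close> is a \<open>K\<close>-algebra with
  structure map \<open>\<iota>\<close>: an action of \<open>G(K)\<close> on \<open>B\<close> by \<open>R\<close>-algebra automorphisms given by a coaction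
  \<open>B \<rightarrow> B \<otimes>\<^sub>K K[G]\<close>, \<open>b \<mapsto> \<Sum> v\<^sub>i \<otimes> u\<^sub>i\<close>.  The left action on \<open>B\<close> is
  \<open>(g b)(z) = b (g\<^sup>-\<^sup>1 z)\<close>.
\<close>

definition algebraic_action ::
    "('g, 'm) monoid_scheme \<Rightarrow> ('g \<Rightarrow> 'k::alg_closed_field) set \<Rightarrow> ('k \<Rightarrow> 'r::comm_ring_1) \<Rightarrow>
     ('r, 'b) module \<Rightarrow> ('g \<Rightarrow> 'b \<Rightarrow> 'b) \<Rightarrow> bool" where
  "algebraic_action G \<O> \<iota> B \<alpha> \<longleftrightarrow>
     group_action G (carrier B) \<alpha> \<and>
     (\<forall>g\<in>carrier G. \<alpha> g \<in> alg_hom B B) \<and>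
     (\<forall>b\<in>carrier B. \<exists>(m::nat) u v. (\<forall>i<m. u i \<in> \<O> \<and> v i \<in> carrier B) \<and>
        (\<forall>g\<in>carrier G. \<alpha> g b = (\<Oplus>\<^bsub>B\<^esub>i\<in>{..<m}. \<iota> (u i g) \<odot>\<^bsub>B\<^esub> v i)))"

text \<open>The coordinate algebra \<open>B\<^sup>G\<close> of \<open>Spec B // G\<close>.\<close>

definition invariant_algebra ::
    "('g, 'm) monoid_scheme \<Rightarrow> ('r, 'b) module \<Rightarrow> ('g \<Rightarrow> 'b \<Rightarrow> 'b) \<Rightarrow> ('r, 'b) module" where
  "invariant_algebra G B \<alpha> =
     B\<lparr>carrier := {b \<in> carrier B. \<forall>g\<in>carrier G. \<alpha> g b = b}\<rparr>"

definition equivariant_smoothing ::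
    "('g, 'm) monoid_scheme \<Rightarrow> ('g \<Rightarrow> 'k::alg_closed_field) set \<Rightarrow>
     ('k, 'a) module \<Rightarrow> ('g \<Rightarrow> 'a \<Rightarrow> 'a) \<Rightarrow>
     ('k fps, 'b) module \<Rightarrow> ('g \<Rightarrow> 'b \<Rightarrow> 'b) \<Rightarrow> bool" where
  "equivariant_smoothing G \<O> A \<alpha> \<A> \<beta> \<longleftrightarrow>
     algebraic_action G \<O> fps_const \<A> \<beta> \<and>
     (\<exists>\<phi>. smoothing_via A \<A> \<phi> \<and>
        (\<forall>g\<in>carrier G. \<forall>a\<in>carrier \<A>.
           \<phi> (special_ideal \<A> +>\<^bsub>\<A>\<^esub> \<beta> g a) = \<alpha> g (\<phi> (special_ideal \<A> +>\<^bsub>\<A>\<^esub> a))))"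

end

theory Submission
  imports Defs "HOL-Algebra.Algebraic_Closure_Type" "HOL-Library.Function_Algebras"
    "Jordan_Normal_Form.Char_Poly"
begin

text \<open>
  Let \<open>L\<close> be an algebraic closure of \<open>K((t))\<close>.  A finite smooth algebra has no point derivations
  with values in \<open>L\<close>, so every functional on \<open>\<A>\<close> is a combination of \<open>L\<close>-points.  In particular
  the \<open>L\<close>-points separate the elements of \<open>\<A>\<^sup>G\<close>.  An invariant \<open>\<theta>\<close> that separates their
  restrictions to \<open>\<A>\<^sup>G\<close> generates \<open>\<A>\<^sup>G[1/t]\<close>: the interpolation polynomials descend to
  \<open>K((t))\<close>, and the minimal polynomial of \<open>\<theta>\<close> is separable, so \<open>\<A>\<^sup>G[1/t]\<close> is smooth.
  Linear reductivity lifts the invariants of \<open>A\<close> to invariants of \<open>\<A>\<close>, and \<open>\<A>\<^sup>G\<close> is saturated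
  with respect to \<open>t\<close>, so \<open>\<A>\<^sup>G/t\<A>\<^sup>G = A\<^sup>G\<close>.  A basis of \<open>A\<^sup>G\<close> lifts to a basis of \<open>\<A>\<^sup>G\<close>.
\<close>

hide_const (open) Multiset.mult Polynomial.smult Modules.module
  Polynomials.degree Polynomials.lead_coeff UnivPoly.up_ring.coeff UnivPoly.up_ring.monom

section \<open>Multivariate polynomials\<close>

text \<open>Smoothness is given by presentations on a principal cover, which need not restrict to a
  subalgebra such as \<A>^G. It is therefore translated into a property that subalgebras inherit.
  Over \<open>L\<close> a finite smooth algebra becomes a product of copies of \<open>L\<close>;
  without tensor products this is said dually, by expanding every functional in terms of points. The
  points then separate the elements of any subalgebra, and a single generator leads back to a
  presentation. Linear reductivity enters only in the lifting of invariants.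

  Point derivations are excluded by formal arcs over \<open>L\<close>, in a new variable X that is
  unrelated to t. An element satisfying a polynomial of degree m has no X-coefficient along an arc,
  and this is visible modulo X^(m+1), so finitely many Newton steps suffice and no limit is formed.

  Descent from \<open>L\<close> to K((t)) uses a linear retraction instead of Galois theory; it
  turns interpolation polynomials over \<open>L\<close> into ones over K((t)). Characteristic zero
  supplies infinitely many integers for generic linear combinations.\<close>

lemma poly_mapping_sum_single: "(\<Sum>m\<in>Poly_Mapping.keys p. Poly_Mapping.single m (Poly_Mapping.lookup p m)) = p"
  by (rule poly_mapping_eqI)
     (auto simp: lookup_sum lookup_single when_def in_keys_iff sum.delta' if_distrib cong: if_cong)

lemma poly_mapping_add_induct [case_names single add]:
  fixes p :: "'a \<Rightarrow>\<^sub>0 'r::comm_monoid_add"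
  assumes single: "\<And>m c. P (Poly_Mapping.single m c)"
    and add: "\<And>p q. P p \<Longrightarrow> P q \<Longrightarrow> P (p + q)"
  shows "P p"
proof -
  have "P (\<Sum>m\<in>A. Poly_Mapping.single m (Poly_Mapping.lookup p m))" if "finite A" for A
    using that
  proof induction
    case empty
    then show ?case using single[of undefined 0] by simp
  next
    case (insert x F)
    then show ?case using add single by simp
  qed
  then show ?thesis using poly_mapping_sum_single[of p] finite_keys[of p] by metis
qed

definition mpoly_var :: "nat \<Rightarrow> (nat \<Rightarrow>\<^sub>0 nat) \<Rightarrow>\<^sub>0 'r::comm_ring_1" where
  "mpoly_var j = Poly_Mapping.single (Poly_Mapping.single j 1) 1"

lemma mpoly_carrier_single:
  "Poly_Mapping.keys m \<subseteq> {..<n} \<Longrightarrow> Poly_Mapping.single m c \<in> carrier (mpoly_algebra n)"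
  by (simp add: mpoly_algebra_def)

lemma mpoly_carrier_const: "Poly_Mapping.single 0 c \<in> carrier (mpoly_algebra n)"
  by (rule mpoly_carrier_single) simp

lemma mpoly_carrier_var: "j < n \<Longrightarrow> mpoly_var j \<in> carrier (mpoly_algebra n)"
  unfolding mpoly_var_def by (rule mpoly_carrier_single) simp

lemma mpoly_carrier_add:
  "p \<in> carrier (mpoly_algebra n) \<Longrightarrow> q \<in> carrier (mpoly_algebra n) \<Longrightarrow> p + q \<in> carrier (mpoly_algebra n)"
  using keys_add[of p q] by (auto simp: mpoly_algebra_def)

lemma mpoly_carrier_mult:
  assumes "p \<in> carrier (mpoly_algebra n)" "q \<in> carrier (mpoly_algebra n)"
  shows "p * q \<in> carrier (mpoly_algebra n)"
  unfolding mpoly_algebra_def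
proof (simp, intro ballI)
  fix m assume "m \<in> Poly_Mapping.keys (p * q)"
  then obtain a b where ab: "a \<in> Poly_Mapping.keys p" "b \<in> Poly_Mapping.keys q" "m = a + b"
    using keys_mult[of p q] by auto
  have "Poly_Mapping.keys m \<subseteq> Poly_Mapping.keys a \<union> Poly_Mapping.keys b"
    unfolding ab(3) by (rule keys_add)
  also have "\<dots> \<subseteq> {..<n}"
    using assms ab(1,2) by (simp add: mpoly_algebra_def)
  finally show "Poly_Mapping.keys m \<subseteq> {..<n}" .
qed

lemma mpoly_carrier_uminus: "p \<in> carrier (mpoly_algebra n) \<Longrightarrow> - p \<in> carrier (mpoly_algebra n)"
  by (simp add: mpoly_algebra_def)

lemma mpoly_carrier_0: "0 \<in> carrier (mpoly_algebra n)"
  and mpoly_carrier_1: "1 \<in> carrier (mpoly_algebra n)"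
  by (simp_all add: mpoly_algebra_def)

lemma mpoly_carrier_sum:
  "(\<And>i. i \<in> I \<Longrightarrow> f i \<in> carrier (mpoly_algebra n)) \<Longrightarrow> sum f I \<in> carrier (mpoly_algebra n)"
  by (induction I rule: infinite_finite_induct) (auto intro: mpoly_carrier_0 mpoly_carrier_add)

lemma mpoly_carrier_prod:
  "(\<And>i. i \<in> I \<Longrightarrow> f i \<in> carrier (mpoly_algebra n)) \<Longrightarrow> prod f I \<in> carrier (mpoly_algebra n)"
  by (induction I rule: infinite_finite_induct) (auto intro: mpoly_carrier_1 mpoly_carrier_mult)

lemma mpoly_carrier_power:
  "p \<in> carrier (mpoly_algebra n) \<Longrightarrow> p ^ k \<in> carrier (mpoly_algebra n)"
  by (induction k) (auto intro: mpoly_carrier_1 mpoly_carrier_mult)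

lemma mpoly_cring: "cring (mpoly_algebra n :: ('r::comm_ring_1, _) module)"
proof -
  have "\<exists>y\<in>carrier (mpoly_algebra n). x + y = 0" if "x \<in> carrier (mpoly_algebra n)" for x
    :: "(nat \<Rightarrow>\<^sub>0 nat) \<Rightarrow>\<^sub>0 'r"
    using that mpoly_carrier_uminus by (intro bexI[of _ "- x"]) auto
  moreover have "y + x = 0 \<longleftrightarrow> x + y = 0" for x y :: "(nat \<Rightarrow>\<^sub>0 nat) \<Rightarrow>\<^sub>0 'r"
    by (simp add: add.commute)
  moreover have "mult (mpoly_algebra n) = ((*) :: _ \<Rightarrow> _ \<Rightarrow> (nat \<Rightarrow>\<^sub>0 nat) \<Rightarrow>\<^sub>0 'r)" 
    "add (mpoly_algebra n) = ((+) :: _ \<Rightarrow> _ \<Rightarrow> (nat \<Rightarrow>\<^sub>0 nat) \<Rightarrow>\<^sub>0 'r)"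
    "one (mpoly_algebra n) = (1 :: (nat \<Rightarrow>\<^sub>0 nat) \<Rightarrow>\<^sub>0 'r)"
    "zero (mpoly_algebra n) = (0 :: (nat \<Rightarrow>\<^sub>0 nat) \<Rightarrow>\<^sub>0 'r)"
    by (simp_all add: mpoly_algebra_def)
  ultimately show ?thesis
    by (intro cringI abelian_groupI comm_monoidI)
       (simp_all add: mpoly_carrier_0 mpoly_carrier_1 mpoly_carrier_add mpoly_carrier_mult
          algebra_simps)
qed

lemma mpoly_monomial_power:
  "Poly_Mapping.single (Poly_Mapping.single j k) 1 = (mpoly_var j ^ k :: (nat \<Rightarrow>\<^sub>0 nat) \<Rightarrow>\<^sub>0 'r::comm_ring_1)"
proof (induction k)
  case (Suc k)
  have "Poly_Mapping.single (Poly_Mapping.single j (Suc k)) 1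
      = (Poly_Mapping.single (Poly_Mapping.single j 1 + Poly_Mapping.single j k) (1 * 1) :: (nat \<Rightarrow>\<^sub>0 nat) \<Rightarrow>\<^sub>0 'r)"
    by (simp add: single_add[symmetric])
  also have "\<dots> = mpoly_var j * Poly_Mapping.single (Poly_Mapping.single j k) 1"
    unfolding mpoly_var_def by (simp add: mult_single)
  finally show ?case using Suc by simp
qed simp

text \<open>Sums and products of constants and variables exhaust the polynomials. Evaluations and
  derivatives are compared through this rule, which keeps the operands inside the carrier.\<close>

lemma mpoly_induct [consumes 1, case_names const var add mult]:
  assumes p: "p \<in> carrier (mpoly_algebra n)"
    and const: "\<And>c. P (Poly_Mapping.single 0 c)"
    and var: "\<And>j. j < n \<Longrightarrow> P (mpoly_var j)"
    and add: "\<And>p q. p \<in> carrier (mpoly_algebra n) \<Longrightarrow> q \<in> carrier (mpoly_algebra n) \<Longrightarrow> P p \<Longrightarrow> P q \<Longrightarrow> P (p + q)"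
    and mult: "\<And>p q. p \<in> carrier (mpoly_algebra n) \<Longrightarrow> q \<in> carrier (mpoly_algebra n) \<Longrightarrow> P p \<Longrightarrow> P q \<Longrightarrow> P (p * q)"
  shows "P p"
proof -
  note cl = mpoly_carrier_single mpoly_carrier_const mpoly_carrier_var
  have pow: "P (mpoly_var j ^ k)" if "j < n" for j k
  proof (induction k)
    case 0
    then show ?case using const[of 1] by simp
  next
    case (Suc k)
    then show ?case using that by (auto intro!: mult var cl mpoly_carrier_power)
  qed
  have mon: "P (Poly_Mapping.single m c)" if "Poly_Mapping.keys m \<subseteq> {..<n}" for m c
    using that
  proof (induction m rule: update_induct)
    case const
    then show ?case using assms(2) by simp
  next
    case (update m j k)
    \<comment> \<open>\<open>update_induct\<close> only updates an index outside the support of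
      \<open>m\<close>, so the update is an addition of exponents and the monomial splits off a
      power of the j-th variable.\<close>
    have eq: "Poly_Mapping.update j k m = m + Poly_Mapping.single j k"
      using update(1) by (intro poly_mapping_eqI) (auto simp: lookup_update lookup_add lookup_single when_def in_keys_iff)
    have "Poly_Mapping.keys (Poly_Mapping.update j k m) = insert j (Poly_Mapping.keys m)"
      using update(2) by (simp add: keys_update)
    then have j: "j < n" and m: "Poly_Mapping.keys m \<subseteq> {..<n}" using update(4) by auto
    have "Poly_Mapping.single (Poly_Mapping.update j k m) c
        = Poly_Mapping.single m c * mpoly_var j ^ k"
      unfolding eq by (simp add: mult_single mpoly_monomial_power[symmetric])
    then show ?case
      using mult[OF mpoly_carrier_single[OF m] mpoly_carrier_power[OF mpoly_carrier_var[OF j]]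
          update(3)[OF m] pow[OF j]] by simp
  qed
  have "P (\<Sum>m\<in>A. Poly_Mapping.single m (Poly_Mapping.lookup p m))" if "finite A" "A \<subseteq> Poly_Mapping.keys p" for A
    using that
  proof induction
    case empty
    then show ?case using const[of 0] by simp
  next
    case (insert x F)
    have *: "Poly_Mapping.keys m \<subseteq> {..<n}" if "m \<in> Poly_Mapping.keys p" for m
      using that p by (simp add: mpoly_algebra_def)
    show ?case
      using insert by (auto intro!: add mpoly_carrier_sum mpoly_carrier_single mon * simp del: keys_sum)
  qed
  from this[OF finite_keys order_refl] show ?thesis
    by (simp add: poly_mapping_sum_single)
qed

section \<open>Evaluation of polynomials in a commutative ring\<close>

definition monom_eval :: "(nat \<Rightarrow> 'a::comm_ring_1) \<Rightarrow> (nat \<Rightarrow>\<^sub>0 nat) \<Rightarrow> 'a" where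
  "monom_eval u m = (\<Prod>j\<in>Poly_Mapping.keys m. u j ^ Poly_Mapping.lookup m j)"

definition mpoly_eval ::
    "('r::comm_ring_1 \<Rightarrow> 'a::comm_ring_1) \<Rightarrow> (nat \<Rightarrow> 'a) \<Rightarrow> ((nat \<Rightarrow>\<^sub>0 nat) \<Rightarrow>\<^sub>0 'r) \<Rightarrow> 'a" where
  "mpoly_eval \<phi> u p = (\<Sum>m\<in>Poly_Mapping.keys p. \<phi> (Poly_Mapping.lookup p m) * monom_eval u m)"

lemma monom_eval_superset:
  "finite A \<Longrightarrow> Poly_Mapping.keys m \<subseteq> A \<Longrightarrow> monom_eval u m = (\<Prod>j\<in>A. u j ^ Poly_Mapping.lookup m j)"
  unfolding monom_eval_def by (rule prod.mono_neutral_left) (auto simp: in_keys_iff)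

lemma monom_eval_add: "monom_eval u (m + m') = monom_eval u m * monom_eval u m'"
proof -
  let ?A = "Poly_Mapping.keys m \<union> Poly_Mapping.keys m'"
  have "Poly_Mapping.keys (m + m') \<subseteq> ?A" by (rule keys_add)
  then show ?thesis
    by (simp add: monom_eval_superset[of ?A] lookup_add power_add prod.distrib)
qed

lemma monom_eval_0 [simp]: "monom_eval u 0 = 1"
  by (simp add: monom_eval_def)

context
  fixes \<phi> :: "'r::comm_ring_1 \<Rightarrow> 'a::comm_ring_1"
  assumes \<phi>: "comm_ring_hom \<phi>"
begin

interpretation comm_ring_hom \<phi> by (rule \<phi>)

lemma mpoly_eval_superset:
  "finite A \<Longrightarrow> Poly_Mapping.keys p \<subseteq> A \<Longrightarrow> mpoly_eval \<phi> u p = (\<Sum>m\<in>A. \<phi> (Poly_Mapping.lookup p m) * monom_eval u m)"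
  unfolding mpoly_eval_def by (rule sum.mono_neutral_left) (auto simp: in_keys_iff)

lemma mpoly_eval_add: "mpoly_eval \<phi> u (p + q) = mpoly_eval \<phi> u p + mpoly_eval \<phi> u q"
proof -
  let ?A = "Poly_Mapping.keys p \<union> Poly_Mapping.keys q"
  have "Poly_Mapping.keys (p + q) \<subseteq> ?A" by (rule keys_add)
  then show ?thesis
    by (simp add: mpoly_eval_superset[of ?A] lookup_add hom_add distrib_right sum.distrib)
qed

lemma mpoly_eval_single: "mpoly_eval \<phi> u (Poly_Mapping.single m c) = \<phi> c * monom_eval u m"
  by (subst mpoly_eval_superset[of "{m}"]) auto

lemma mpoly_eval_mult: "mpoly_eval \<phi> u (p * q) = mpoly_eval \<phi> u p * mpoly_eval \<phi> u q"
proof (induction p rule: poly_mapping_add_induct)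
  case (single m c)
  show ?case
    by (induction q rule: poly_mapping_add_induct)
       (simp_all add: mult_single mpoly_eval_single monom_eval_add hom_mult
         mpoly_eval_add algebra_simps)
qed (simp add: distrib_right mpoly_eval_add)

lemma mpoly_eval_var: "mpoly_eval \<phi> u (mpoly_var j) = u j"
  by (simp add: mpoly_var_def mpoly_eval_single monom_eval_def)

lemma mpoly_eval_const: "mpoly_eval \<phi> u (Poly_Mapping.single 0 c) = \<phi> c"
  by (simp add: mpoly_eval_single)

lemma mpoly_eval_hom: "comm_ring_hom (mpoly_eval \<phi> u)"
  by unfold_locales
     (simp_all add: mpoly_eval_add mpoly_eval_mult mpoly_eval_const[where c = 1, simplified]
       mpoly_eval_def[where p = 0])

end

section \<open>Formal partial derivatives and the Leibniz rule\<close>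

lemma mpoly_pderiv_superset:
  assumes "finite A" "Poly_Mapping.keys p \<subseteq> A"
  shows "mpoly_pderiv j p =
     (\<Sum>m\<in>A. Poly_Mapping.single (m - Poly_Mapping.single j 1) (of_nat (Poly_Mapping.lookup m j) * Poly_Mapping.lookup p m))"
  unfolding mpoly_pderiv_def using assms by (intro sum.mono_neutral_left) (auto simp: in_keys_iff)

lemma mpoly_pderiv_add: "mpoly_pderiv j (p + q) = mpoly_pderiv j p + mpoly_pderiv j q"
proof -
  let ?A = "Poly_Mapping.keys p \<union> Poly_Mapping.keys q"
  have "Poly_Mapping.keys (p + q) \<subseteq> ?A" by (rule keys_add)
  then show ?thesis
    by (simp add: mpoly_pderiv_superset[of ?A] lookup_add distrib_left single_add sum.distrib)
qed

lemma mpoly_pderiv_single: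
  "mpoly_pderiv j (Poly_Mapping.single m c)
    = Poly_Mapping.single (m - Poly_Mapping.single j 1) (of_nat (Poly_Mapping.lookup m j) * c)"
  by (subst mpoly_pderiv_superset[of "{m}"]) auto

text \<open>The exponent of the product can be lowered in either factor. Truncated subtraction
  agrees with this only if that factor contains the j-th variable; otherwise the coefficient is
  0.\<close>

lemma mpoly_pderiv_mult_single:
  fixes c d :: "'r::comm_ring_1"
  shows "mpoly_pderiv j (Poly_Mapping.single m c * Poly_Mapping.single m' d)
    = mpoly_pderiv j (Poly_Mapping.single m c) * Poly_Mapping.single m' d
      + Poly_Mapping.single m c * mpoly_pderiv j (Poly_Mapping.single m' d)"
proof -
  let ?e = "Poly_Mapping.single j (1::nat)"
  have *: "Poly_Mapping.single (m + m' - ?e) (of_nat (Poly_Mapping.lookup m j) * x)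
      = Poly_Mapping.single (m - ?e + m') (of_nat (Poly_Mapping.lookup m j) * x)" for m m' and x :: 'r
  proof (cases "Poly_Mapping.lookup m j = 0")
    case False
    then have "m + m' - ?e = m - ?e + m'"
      by (intro poly_mapping_eqI) (auto simp: lookup_add lookup_minus lookup_single when_def)
    then show ?thesis by simp
  qed simp
  have "mpoly_pderiv j (Poly_Mapping.single m c * Poly_Mapping.single m' d)
    = Poly_Mapping.single (m + m' - ?e) (of_nat (Poly_Mapping.lookup m j) * (c * d))
      + Poly_Mapping.single (m' + m - ?e) (of_nat (Poly_Mapping.lookup m' j) * (c * d))"
    by (simp add: mult_single mpoly_pderiv_single lookup_add distrib_right single_add add.commute)
  also have "\<dots> = Poly_Mapping.single (m - ?e + m') (of_nat (Poly_Mapping.lookup m j) * (c * d))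
      + Poly_Mapping.single (m' - ?e + m) (of_nat (Poly_Mapping.lookup m' j) * (c * d))"
    by (simp only: *)
  finally show ?thesis
    by (simp add: mult_single mpoly_pderiv_single mult_ac add.commute)
qed

lemma mpoly_pderiv_mult: "mpoly_pderiv j (p * q) = mpoly_pderiv j p * q + p * mpoly_pderiv j q"
proof (induction p rule: poly_mapping_add_induct)
  case (single m c)
  show ?case
    by (induction q rule: poly_mapping_add_induct)
       (simp_all add: mpoly_pderiv_mult_single distrib_left mpoly_pderiv_add algebra_simps)
qed (simp add: distrib_right mpoly_pderiv_add algebra_simps)

lemma mpoly_pderiv_const [simp]: "mpoly_pderiv j (Poly_Mapping.single 0 c) = 0"
  by (simp add: mpoly_pderiv_single)

lemma mpoly_pderiv_var: "mpoly_pderiv j (mpoly_var i) = (if i = j then 1 else 0)"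
  by (simp add: mpoly_var_def mpoly_pderiv_single lookup_single)

lemma mpoly_pderiv_carrier:
  assumes "p \<in> carrier (mpoly_algebra n)"
  shows "mpoly_pderiv j p \<in> carrier (mpoly_algebra n)"
  using assms
  by (induction p rule: mpoly_induct)
     (simp_all add: mpoly_pderiv_var mpoly_carrier_0 mpoly_carrier_1 mpoly_pderiv_add
        mpoly_pderiv_mult mpoly_carrier_add mpoly_carrier_mult)

section \<open>Taylor expansion and Newton iteration along formal arcs\<close>

lemma fps_const_comm_ring_hom: "comm_ring_hom (fps_const :: 'a::comm_ring_1 \<Rightarrow> 'a fps)"
  by unfold_locales simp_all

lemma fps_X_dvd_iff: "fps_X dvd (f :: 'a::comm_ring_1 fps) \<longleftrightarrow> fps_nth f 0 = 0"
proof
  assume "fps_nth f 0 = 0"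
  then have "f = fps_X * fps_shift 1 f"
    by (intro fps_ext) (auto simp: fps_X_mult_nth)
  then show "fps_X dvd f" by (metis dvdI)
qed auto

lemma fps_X_power_dvd_iff: "fps_X ^ n dvd (f :: 'a::comm_ring_1 fps) \<longleftrightarrow> (\<forall>i<n. fps_nth f i = 0)"
proof
  assume "\<forall>i<n. fps_nth f i = 0"
  then have "f = fps_X ^ n * fps_shift n f"
    by (intro fps_ext) (auto simp: fps_X_power_mult_nth)
  then show "fps_X ^ n dvd f" by (metis dvdI)
qed (auto simp: fps_X_power_mult_nth)

lemma comm_ring_hom_comp: "comm_ring_hom f \<Longrightarrow> comm_ring_hom g \<Longrightarrow> comm_ring_hom (\<lambda>x. f (g x))"
  unfolding comm_ring_hom_def ring_hom_def semiring_hom_def comm_monoid_add_hom_def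
    monoid_mult_hom_def monoid_add_hom_def one_hom_def zero_hom_def semigroup_add_hom_def
    semigroup_mult_hom_def times_hom_def plus_hom_def
  by simp

lemma mpoly_eval_nth_0:
  assumes \<phi>: "comm_ring_hom (\<phi> :: 'r::comm_ring_1 \<Rightarrow> 'l::comm_ring_1)" and p: "p \<in> carrier (mpoly_algebra n)"
  shows "fps_nth (mpoly_eval (\<lambda>c. fps_const (\<phi> c)) u p) 0 = mpoly_eval \<phi> (\<lambda>j. fps_nth (u j) 0) p"
proof -
  have h: "comm_ring_hom (\<lambda>c. fps_const (\<phi> c))"
    by (rule comm_ring_hom_comp[OF fps_const_comm_ring_hom \<phi>])
  show ?thesis
    using p by (induction p rule: mpoly_induct)
      (simp_all add: mpoly_eval_const[OF \<phi>] mpoly_eval_const[OF h] mpoly_eval_var[OF \<phi>]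
        mpoly_eval_var[OF h] mpoly_eval_add[OF \<phi>] mpoly_eval_add[OF h] mpoly_eval_mult[OF \<phi>]
        mpoly_eval_mult[OF h])
qed

text \<open>This is the product case of the Taylor expansion, with x the arc variable,
  \<open>K\<close> = x^k, \<open>p0\<close> and \<open>q0\<close> the constant terms and
  \<open>sp\<close>, \<open>sq\<close> the directional derivatives. The hypothesis
  \<open>K = x * I\<close> expresses k \<ge> 1 and makes the product of the two increments, of order
  2k, divisible by x^(k+1).\<close>

lemma taylor_product_identity:
  fixes a :: "'a::comm_ring_1"
  assumes "a = p0 + x * z" "b = q0 + x * z'" "K = x * I"
  shows "(a + sp * K + x * K * w) * (b + sq * K + x * K * w') - a * b - (sp * q0 + p0 * sq) * K
    = x * K * (sp * z' + sq * z + I * sp * sq + w * b + w' * a + K * w * sq + K * w' * sp + x * K * w * w')"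
proof -
  have "sp * K * b = sp * q0 * K + x * K * (sp * z')" "a * (sq * K) = p0 * sq * K + x * K * (sq * z)"
    "sp * K * (sq * K) = x * K * (I * sp * sq)"
    unfolding assms by (simp_all add: algebra_simps)
  moreover have "(a + sp * K + x * K * w) * (b + sq * K + x * K * w')
    = a * b + sp * K * b + a * (sq * K) + sp * K * (sq * K)
      + x * K * (w * b + w' * a + K * w * sq + K * w' * sp + x * K * w * w')"
    by (simp add: algebra_simps)
  ultimately show ?thesis by (simp add: algebra_simps)
qed

text \<open>Constants and variables satisfy the congruence exactly, and sums and products preserve
  it by the Leibniz rule. The derivatives are needed only at the constant terms of the arc, because
  their variation along the arc has order X and is multiplied by X^k.\<close>

lemma mpoly_eval_taylor:
  fixes \<phi> :: "'r::comm_ring_1 \<Rightarrow> 'l::comm_ring_1"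
  assumes \<phi>: "comm_ring_hom \<phi>" and k: "k \<ge> 1" and p: "p \<in> carrier (mpoly_algebra n)"
  defines "E \<equiv> \<lambda>u. mpoly_eval (\<lambda>c. fps_const (\<phi> c)) u"
  shows "fps_X ^ Suc k dvd E (\<lambda>j. u j + fps_const (d j) * fps_X ^ k) p - E u p
    - fps_const (\<Sum>j<n. mpoly_eval \<phi> (\<lambda>j. fps_nth (u j) 0) (mpoly_pderiv j p) * d j) * fps_X ^ k"
proof -
  have h: "comm_ring_hom (\<lambda>c. fps_const (\<phi> c))"
    by (rule comm_ring_hom_comp[OF fps_const_comm_ring_hom \<phi>])
  interpret E0: comm_ring_hom "mpoly_eval \<phi> (\<lambda>j. fps_nth (u j) 0)"
    by (rule mpoly_eval_hom[OF \<phi>])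
  define s where "s p = (\<Sum>j<n. mpoly_eval \<phi> (\<lambda>j. fps_nth (u j) 0) (mpoly_pderiv j p) * d j)" for p
  define u' where "u' = (\<lambda>j. u j + fps_const (d j) * fps_X ^ k)"
  have "fps_X ^ Suc k dvd E u' p - E u p - fps_const (s p) * fps_X ^ k"
    using p
  proof (induction p rule: mpoly_induct)
    case (const c)
    then show ?case by (simp add: E_def mpoly_eval_const[OF h] s_def)
  next
    case (var j)
    have "s (mpoly_var j) = (\<Sum>i<n. if j = i then d i else 0)"
      unfolding s_def by (rule sum.cong) (auto simp: mpoly_pderiv_var)
    also have "\<dots> = d j" using var by simp
    finally show ?case by (simp add: E_def mpoly_eval_var[OF h] u'_def)
  next
    case (add p q)
    have "s (p + q) = s p + s q"
      by (simp add: s_def mpoly_pderiv_add E0.hom_add distrib_right sum.distrib)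
    then have "E u' (p + q) - E u (p + q) - fps_const (s (p + q)) * fps_X ^ k
      = (E u' p - E u p - fps_const (s p) * fps_X ^ k) + (E u' q - E u q - fps_const (s q) * fps_X ^ k)"
      by (simp add: E_def mpoly_eval_add[OF h] algebra_simps flip: fps_const_add)
    then show ?case using add by (simp add: dvd_add del: power_Suc)
  next
    case (mult p q)
    define a where "a p = mpoly_eval \<phi> (\<lambda>j. fps_nth (u j) 0) p" for p
    have s: "s (p * q) = s p * a q + a p * s q"
      by (simp add: s_def a_def mpoly_pderiv_mult E0.hom_add E0.hom_mult sum.distrib
          sum_distrib_left sum_distrib_right algebra_simps)
    obtain w where "E u' p - E u p - fps_const (s p) * fps_X ^ k = fps_X ^ Suc k * w"
      using mult(3) by (rule dvdE)
    then have w: "E u' p = E u p + fps_const (s p) * fps_X ^ k + fps_X ^ Suc k * w"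
      unfolding diff_eq_eq by (simp only: ac_simps)
    obtain w' where "E u' q - E u q - fps_const (s q) * fps_X ^ k = fps_X ^ Suc k * w'"
      using mult(4) by (rule dvdE)
    then have w': "E u' q = E u q + fps_const (s q) * fps_X ^ k + fps_X ^ Suc k * w'"
      unfolding diff_eq_eq by (simp only: ac_simps)
    have "fps_X dvd E u p - fps_const (a p)" "fps_X dvd E u q - fps_const (a q)"
      using mult(1,2) by (auto simp: fps_X_dvd_iff E_def mpoly_eval_nth_0[OF \<phi>] a_def)
    then obtain z z' where z: "E u p = fps_const (a p) + fps_X * z" "E u q = fps_const (a q) + fps_X * z'"
      unfolding dvd_def by (auto simp: algebra_simps)
    obtain i where i: "k = Suc i" using k by (cases k) auto
    have "E u' (p * q) - E u (p * q) - fps_const (s (p * q)) * fps_X ^ k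
      = (E u p + fps_const (s p) * fps_X ^ k + fps_X ^ Suc k * w)
        * (E u q + fps_const (s q) * fps_X ^ k + fps_X ^ Suc k * w') - E u p * E u q
        - (fps_const (s p) * fps_const (a q) + fps_const (a p) * fps_const (s q)) * fps_X ^ k"
      unfolding w[symmetric] w'[symmetric] unfolding E_def mpoly_eval_mult[OF h] s by simp
    also have "\<dots> = fps_X ^ Suc k * (fps_const (s p) * z' + fps_const (s q) * z
        + fps_X ^ i * fps_const (s p) * fps_const (s q)
        + w * E u q + w' * E u p + fps_X ^ k * w * fps_const (s q) + fps_X ^ k * w' * fps_const (s p)
        + fps_X ^ Suc k * w * w')"
      unfolding power_Suc by (rule taylor_product_identity[OF z]) (simp add: i)
    finally show ?case by simp
  qed
  then show ?thesis by (simp add: s_def u'_def)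
qed

text \<open>Under a correction of order X^k the X^k-coefficients of the equations change linearly,
  with the Jacobian at the base point as matrix. Its invertibility allows all of them to be
  cancelled at once.\<close>

lemma mpoly_newton_step:
  fixes \<phi> :: "'r::comm_ring_1 \<Rightarrow> 'l::field"
  assumes \<phi>: "comm_ring_hom \<phi>" and k: "k \<ge> 1" and cn: "c \<le> n"
    and f: "\<And>i. i < c \<Longrightarrow> f i \<in> carrier (mpoly_algebra n)"
    and det: "det (mat c c (\<lambda>(i, j). mpoly_eval \<phi> (\<lambda>j. fps_nth (u j) 0) (mpoly_pderiv j (f i)))) \<noteq> 0"
    and zero: "\<And>i. i < c \<Longrightarrow> fps_X ^ k dvd mpoly_eval (\<lambda>c. fps_const (\<phi> c)) u (f i)"
  shows "\<exists>u'. (\<forall>j. fps_X ^ k dvd u' j - u j) \<and>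
     (\<forall>i<c. fps_X ^ Suc k dvd mpoly_eval (\<lambda>c. fps_const (\<phi> c)) u' (f i))"
proof -
  let ?E = "mpoly_eval (\<lambda>c. fps_const (\<phi> c))"
  define M where "M = mat c c (\<lambda>(i, j). mpoly_eval \<phi> (\<lambda>j. fps_nth (u j) 0) (mpoly_pderiv j (f i)))"
  have M: "M \<in> carrier_mat c c" by (simp add: M_def)
  have "M \<in> Units (ring_mat TYPE('l) c ())"
    by (rule det_non_zero_imp_unit[OF M]) (use det in \<open>simp add: M_def\<close>)
  then obtain B where B: "B \<in> carrier_mat c c" "M * B = 1\<^sub>m c"
    unfolding Units_def by (auto simp: ring_mat_simps)
  define r where "r = vec c (\<lambda>i. - (fps_nth (?E u (f i)) k))"
  define dv where "dv = B *\<^sub>v r"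
  have r: "r \<in> carrier_vec c" by (simp add: r_def)
  have dv: "dv \<in> carrier_vec c" unfolding dv_def using B(1) r by (rule mult_mat_vec_carrier)
  have Md: "M *\<^sub>v dv = r"
    unfolding dv_def using assoc_mult_mat_vec[OF M B(1) r] B(2) r by simp
  \<comment> \<open>Only the first c coordinates move; the Jacobian minor of a standard smooth
    presentation involves just these.\<close>
  define d where "d j = (if j < c then vec_index dv j else 0)" for j
  have sum: "(\<Sum>j<n. mpoly_eval \<phi> (\<lambda>j. fps_nth (u j) 0) (mpoly_pderiv j (f i)) * d j) = - (fps_nth (?E u (f i)) k)"
    if i: "i < c" for i
  proof -
    have "(\<Sum>j<n. mpoly_eval \<phi> (\<lambda>j. fps_nth (u j) 0) (mpoly_pderiv j (f i)) * d j)
      = (\<Sum>j<c. mpoly_eval \<phi> (\<lambda>j. fps_nth (u j) 0) (mpoly_pderiv j (f i)) * d j)"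
      using cn by (intro sum.mono_neutral_right) (auto simp: d_def)
    also have "\<dots> = vec_index (M *\<^sub>v dv) i"
      using i dv M by (simp add: M_def scalar_prod_def d_def row_def atLeast0LessThan)
    also have "\<dots> = - (fps_nth (?E u (f i)) k)" unfolding Md using i by (simp add: r_def)
    finally show ?thesis .
  qed
  define u' where "u' = (\<lambda>j. u j + fps_const (d j) * fps_X ^ k)"
  have "fps_X ^ Suc k dvd ?E u' (f i)" if i: "i < c" for i
  proof -
    let ?e = "fps_nth (?E u (f i)) k"
    have "fps_X ^ Suc k dvd ?E u' (f i) - ?E u (f i) - fps_const (- ?e) * fps_X ^ k"
      using mpoly_eval_taylor[OF \<phi> k f[OF i], of u d] unfolding sum[OF i] u'_def .
    moreover have "fps_X ^ Suc k dvd ?E u (f i) + fps_const (- ?e) * fps_X ^ k"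
      using zero[OF i] unfolding fps_X_power_dvd_iff
      by (auto simp: less_Suc_eq fps_X_power_mult_right_nth)
    ultimately have "fps_X ^ Suc k dvd (?E u' (f i) - ?E u (f i) - fps_const (- ?e) * fps_X ^ k)
       + (?E u (f i) + fps_const (- ?e) * fps_X ^ k)"
      by (rule dvd_add)
    then show ?thesis by simp
  qed
  then show ?thesis by (intro exI[of _ u']) (auto simp: u'_def)
qed

text \<open>All corrections have order at least \<open>K\<close> \<ge> 1, so they keep the constant
  terms and the same Jacobian serves in every step. Any prescribed finite order is reached.\<close>

lemma mpoly_newton:
  fixes \<phi> :: "'r::comm_ring_1 \<Rightarrow> 'l::field"
  assumes \<phi>: "comm_ring_hom \<phi>" and K: "K \<ge> 1" and cn: "c \<le> n"
    and f: "\<And>i. i < c \<Longrightarrow> f i \<in> carrier (mpoly_algebra n)"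
    and det: "det (mat c c (\<lambda>(i, j). mpoly_eval \<phi> (\<lambda>j. fps_nth (u j) 0) (mpoly_pderiv j (f i)))) \<noteq> 0"
    and zero: "\<And>i. i < c \<Longrightarrow> fps_X ^ K dvd mpoly_eval (\<lambda>c. fps_const (\<phi> c)) u (f i)"
  shows "\<exists>u'. (\<forall>j. fps_X ^ K dvd u' j - u j) \<and>
     (\<forall>i<c. fps_X ^ (K + k) dvd mpoly_eval (\<lambda>c. fps_const (\<phi> c)) u' (f i))"
proof (induction k)
  case 0
  then show ?case using zero by (intro exI[of _ u]) simp
next
  case (Suc k)
  then obtain u' where u': "\<And>j. fps_X ^ K dvd u' j - u j"
    "\<And>i. i < c \<Longrightarrow> fps_X ^ (K + k) dvd mpoly_eval (\<lambda>c. fps_const (\<phi> c)) u' (f i)" by blast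
  have "fps_nth (u' j) 0 = fps_nth (u j) 0" for j
    using u'(1)[of j] K unfolding fps_X_power_dvd_iff by auto
  with det have det': "det (mat c c (\<lambda>(i, j). mpoly_eval \<phi> (\<lambda>j. fps_nth (u' j) 0) (mpoly_pderiv j (f i)))) \<noteq> 0"
    by simp
  have "K + k \<ge> 1" using K by simp
  from mpoly_newton_step[OF \<phi> this cn f det' u'(2)] obtain u'' where
      u'': "\<forall>j. fps_X ^ (K + k) dvd u'' j - u' j"
      "\<forall>i<c. fps_X ^ Suc (K + k) dvd mpoly_eval (\<lambda>c. fps_const (\<phi> c)) u'' (f i)"
    by blast
  have "fps_X ^ K dvd u'' j - u j" for j
  proof -
    have "fps_X ^ K dvd u'' j - u' j"
      using u''(1) power_le_dvd[of fps_X "K + k" "u'' j - u' j" K] by simp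
    from dvd_add[OF this u'(1)[of j]] show ?thesis by simp
  qed
  then show ?case using u''(2) by (intro exI[of _ u'']) (simp del: power_Suc)
qed

text \<open>Over the algebraically closed field \<open>q\<close> splits into linear factors. As
  \<open>v\<close> has a nonzero linear coefficient, each v - \<alpha> has order at most 1.\<close>

lemma poly_fps_subdegree_bound:
  fixes q :: "'l::alg_closed_field poly"
  assumes "fps_nth v 1 \<noteq> 0" "q \<noteq> 0"
  shows "poly (map_poly fps_const q) v \<noteq> 0 \<and> subdegree (poly (map_poly fps_const q) v) \<le> degree q"
  using assms(2)
proof (induction "degree q" arbitrary: q)
  case 0
  then obtain a where "q = [:a:]" "a \<noteq> 0" by (metis degree_eq_zeroE pCons_0_0)
  then have "poly (map_poly fps_const q) v = fps_const a" by (simp add: map_poly_pCons)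
  then show ?case using \<open>a \<noteq> 0\<close> by simp
next
  case (Suc d)
  interpret fc: comm_ring_hom "fps_const :: 'l \<Rightarrow> 'l fps" by (rule fps_const_comm_ring_hom)
  interpret mp: map_poly_comm_ring_hom "fps_const :: 'l \<Rightarrow> 'l fps" ..
  obtain \<alpha> where "poly q \<alpha> = 0" using Suc(2) by (metis alg_closed_imp_poly_has_root zero_less_Suc)
  then obtain q1 where q1: "q = [:-\<alpha>, 1:] * q1" by (metis dvdE poly_eq_0_iff_dvd)
  then have q1_0: "q1 \<noteq> 0" using Suc(3) by auto
  have deg: "degree q = Suc (degree q1)" unfolding q1 using q1_0 by (subst degree_mult_eq) auto
  have IH: "poly (map_poly fps_const q1) v \<noteq> 0"
    "subdegree (poly (map_poly fps_const q1) v) \<le> degree q1"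
    using Suc(1)[of q1] deg Suc(2) q1_0 by auto
  have "fps_nth (v - fps_const \<alpha>) 1 \<noteq> 0" using assms(1) by simp
  then have "v - fps_const \<alpha> \<noteq> 0" "subdegree (v - fps_const \<alpha>) \<le> 1"
    by (metis fps_zero_nth, rule subdegree_leI)
  moreover have "poly (map_poly fps_const q) v = (v - fps_const \<alpha>) * poly (map_poly fps_const q1) v"
    unfolding q1 mp.hom_mult by (simp add: map_poly_pCons algebra_simps flip: fps_const_neg)
  ultimately show ?case using IH deg by simp
qed

text \<open>A root modulo X^(degree q + 1) is enough to exclude a linear term, so algebraic elements
  can be tested on arcs known to finite order.\<close>

lemma poly_fps_algebraic_coeff_1:
  fixes q :: "'l::alg_closed_field poly"
  assumes "q \<noteq> 0" "fps_X ^ Suc (degree q) dvd poly (map_poly fps_const q) v"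
  shows "fps_nth v 1 = 0"
proof (rule ccontr)
  assume "fps_nth v 1 \<noteq> 0"
  from poly_fps_subdegree_bound[OF this assms(1)]
  have ne: "poly (map_poly fps_const q) v \<noteq> 0"
    and le: "subdegree (poly (map_poly fps_const q) v) \<le> degree q" by auto
  from ne have "fps_nth (poly (map_poly fps_const q) v) (subdegree (poly (map_poly fps_const q) v)) \<noteq> 0"
    by (rule nth_subdegree_nonzero)
  moreover have "subdegree (poly (map_poly fps_const q) v) < Suc (degree q)" using le by simp
  ultimately show False using assms(2) unfolding fps_X_power_dvd_iff by blast
qed

section \<open>Homomorphisms into type-class rings\<close>

text \<open>The target is a type-class ring, so that values at points, in \<open>L\<close> or in the
  dual numbers over it, are handled by ordinary arithmetic. Values outside the carrier are left
  free.\<close>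

definition class_ring_hom :: "('s, 'm) ring_scheme \<Rightarrow> ('s \<Rightarrow> 't::comm_ring_1) \<Rightarrow> bool" where
  "class_ring_hom S \<rho> \<longleftrightarrow>
     (\<forall>a\<in>carrier S. \<forall>b\<in>carrier S. \<rho> (a \<otimes>\<^bsub>S\<^esub> b) = \<rho> a * \<rho> b \<and> \<rho> (a \<oplus>\<^bsub>S\<^esub> b) = \<rho> a + \<rho> b) \<and>
     \<rho> \<one>\<^bsub>S\<^esub> = 1"

definition class_alg_hom ::
    "('r \<Rightarrow> 't::comm_ring_1) \<Rightarrow> ('r, 's) module \<Rightarrow> ('s \<Rightarrow> 't) \<Rightarrow> bool" where
  "class_alg_hom \<iota> S \<rho> \<longleftrightarrow>
     class_ring_hom S \<rho> \<and> (\<forall>r. \<forall>a\<in>carrier S. \<rho> (r \<odot>\<^bsub>S\<^esub> a) = \<iota> r * \<rho> a)"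

lemma class_ring_homD:
  assumes "class_ring_hom S \<rho>"
  shows "a \<in> carrier S \<Longrightarrow> b \<in> carrier S \<Longrightarrow> \<rho> (a \<otimes>\<^bsub>S\<^esub> b) = \<rho> a * \<rho> b"
    and "a \<in> carrier S \<Longrightarrow> b \<in> carrier S \<Longrightarrow> \<rho> (a \<oplus>\<^bsub>S\<^esub> b) = \<rho> a + \<rho> b"
    and "\<rho> \<one>\<^bsub>S\<^esub> = 1"
  using assms by (auto simp: class_ring_hom_def)

lemma class_alg_homD:
  assumes "class_alg_hom \<iota> S \<rho>"
  shows "a \<in> carrier S \<Longrightarrow> b \<in> carrier S \<Longrightarrow> \<rho> (a \<otimes>\<^bsub>S\<^esub> b) = \<rho> a * \<rho> b"
    and "a \<in> carrier S \<Longrightarrow> b \<in> carrier S \<Longrightarrow> \<rho> (a \<oplus>\<^bsub>S\<^esub> b) = \<rho> a + \<rho> b"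
    and "\<rho> \<one>\<^bsub>S\<^esub> = 1"
    and "a \<in> carrier S \<Longrightarrow> \<rho> (r \<odot>\<^bsub>S\<^esub> a) = \<iota> r * \<rho> a"
    and "class_ring_hom S \<rho>"
  using assms by (auto simp: class_ring_hom_def class_alg_hom_def)

lemma (in ring) class_ring_hom_zero: "class_ring_hom R \<rho> \<Longrightarrow> \<rho> \<zero> = 0"
  using class_ring_homD(2)[of R \<rho> \<zero> \<zero>] by simp

lemma (in ring) class_ring_hom_pow:
  "class_ring_hom R \<rho> \<Longrightarrow> a \<in> carrier R \<Longrightarrow> \<rho> (a [^] (n::nat)) = \<rho> a ^ n"
  by (induction n) (simp_all add: class_ring_homD mult.commute)

section \<open>Localization\<close>

locale localization_at = cring S for S :: "('r, 's) module" (structure) +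
  fixes g assumes g_closed [simp]: "g \<in> carrier S"
begin

abbreviation "L \<equiv> localization S g"
abbreviation "fr \<equiv> loc_frac S g"
abbreviation "G (n::nat) \<equiv> g [^]\<^bsub>S\<^esub> n"

lemma loc_rel_iff:
  "((a, n), (b, m)) \<in> loc_rel S g \<longleftrightarrow>
     a \<in> carrier S \<and> b \<in> carrier S \<and> (\<exists>k. G k \<otimes> (G m \<otimes> a) = G k \<otimes> (G n \<otimes> b))"
  by (simp add: loc_rel_def)

lemma G_add: "G (n + m) = G n \<otimes> G m"
  by (simp add: nat_pow_mult)

lemma loc_rel_equiv: "equiv (carrier S \<times> UNIV) (loc_rel S g)"
proof (rule equivI)
  show "loc_rel S g \<subseteq> (carrier S \<times> UNIV) \<times> (carrier S \<times> UNIV)"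
    by (auto simp: loc_rel_def)
  show "refl_on (carrier S \<times> UNIV) (loc_rel S g)"
    by (rule refl_onI) (auto simp: loc_rel_iff)
  show "sym (loc_rel S g)"
  proof (rule symI)
    fix x y assume *: "(x, y) \<in> loc_rel S g"
    obtain a n b m where x: "x = (a, n)" "y = (b, m)" by (cases x; cases y)
    from * obtain k where k: "a \<in> carrier S" "b \<in> carrier S" "G k \<otimes> (G m \<otimes> a) = G k \<otimes> (G n \<otimes> b)"
      unfolding x loc_rel_iff by blast
    show "(y, x) \<in> loc_rel S g"
      unfolding x loc_rel_iff by (intro conjI k(1,2) exI[of _ k] k(3)[symmetric])
  qed
  show "trans (loc_rel S g)"
  proof (rule transI)
    fix x y z assume xy: "(x, y) \<in> loc_rel S g" and yz: "(y, z) \<in> loc_rel S g"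
    obtain a n b m c p where x: "x = (a, n)" "y = (b, m)" "z = (c, p)" by (cases x; cases y; cases z)
    from xy obtain k where cl [simp]: "a \<in> carrier S" "b \<in> carrier S"
      and k: "G k \<otimes> (G m \<otimes> a) = G k \<otimes> (G n \<otimes> b)"
      unfolding x loc_rel_iff by blast
    from yz obtain l where cl' [simp]: "c \<in> carrier S"
      and l: "G l \<otimes> (G p \<otimes> b) = G l \<otimes> (G m \<otimes> c)"
      unfolding x loc_rel_iff by blast
    \<comment> \<open>The extra factor g^m is the denominator of the middle fraction, which cannot
      be cancelled when g is a zero divisor.\<close>
    have "G (k + l + m) \<otimes> (G p \<otimes> a) = (G l \<otimes> G p) \<otimes> (G k \<otimes> (G m \<otimes> a))"
      by (simp add: G_add m_ac)
    also have "\<dots> = (G k \<otimes> G n) \<otimes> (G l \<otimes> (G p \<otimes> b))"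
      unfolding k by (simp add: m_ac)
    also have "\<dots> = G (k + l + m) \<otimes> (G n \<otimes> c)"
      unfolding l by (simp add: G_add m_ac)
    finally show "(x, z) \<in> loc_rel S g"
      unfolding x loc_rel_iff by (intro conjI cl cl' exI[of _ "k + l + m"])
  qed
qed

lemma frac_eq_iff:
  assumes "a \<in> carrier S" "b \<in> carrier S"
  shows "fr a n = fr b m \<longleftrightarrow> (\<exists>k. G k \<otimes> (G m \<otimes> a) = G k \<otimes> (G n \<otimes> b))"
  unfolding loc_frac_def using eq_equiv_class_iff[OF loc_rel_equiv, of "(a, n)" "(b, m)"] assms
  by (simp add: loc_rel_iff)

lemma in_frac: "(b, m) \<in> fr a n \<longleftrightarrow> ((a, n), (b, m)) \<in> loc_rel S g"
  by (simp add: loc_frac_def)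

lemma frac_self: "a \<in> carrier S \<Longrightarrow> (a, n) \<in> fr a n"
  by (auto simp: in_frac loc_rel_iff)

lemma frac_memD: "(b, m) \<in> fr a n \<Longrightarrow> b \<in> carrier S \<and> a \<in> carrier S \<and> fr b m = fr a n"
  using frac_eq_iff[of a b n m] by (auto simp: in_frac loc_rel_iff)

text \<open>The operations of \<open>localization\<close> are unions over representatives. Once all
  representatives give the same class, the union is that class.\<close>

lemma UN_frac:
  assumes "a \<in> carrier S" "\<And>b m. b \<in> carrier S \<Longrightarrow> fr b m = fr a n \<Longrightarrow> F b m = C"
  shows "(\<Union>(b, m)\<in>fr a n. F b m) = C"
proof
  have "F a n = C" by (rule assms(2)[OF assms(1) refl])
  then show "C \<subseteq> (\<Union>(b, m)\<in>fr a n. F b m)"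
    using frac_self[OF assms(1), of n] by auto
  show "(\<Union>(b, m)\<in>fr a n. F b m) \<subseteq> C"
  proof
    fix y assume "y \<in> (\<Union>(b, m)\<in>fr a n. F b m)"
    then obtain b m where bm: "(b, m) \<in> fr a n" "y \<in> F b m" by auto
    then show "y \<in> C" using assms(2)[of b m] frac_memD[OF bm(1)] by simp
  qed
qed

lemma frac_mult_cong:
  assumes "fr a n = fr a' n'" "fr b m = fr b' m'"
    and [simp]: "a \<in> carrier S" "a' \<in> carrier S" "b \<in> carrier S" "b' \<in> carrier S"
  shows "fr (a \<otimes> b) (n + m) = fr (a' \<otimes> b') (n' + m')"
proof -
  obtain k l where k: "G k \<otimes> (G n' \<otimes> a) = G k \<otimes> (G n \<otimes> a')"
    and l: "G l \<otimes> (G m' \<otimes> b) = G l \<otimes> (G m \<otimes> b')"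
    using assms(1,2) by (auto simp: frac_eq_iff)
  have "G (k + l) \<otimes> (G (n' + m') \<otimes> (a \<otimes> b)) = (G k \<otimes> (G n' \<otimes> a)) \<otimes> (G l \<otimes> (G m' \<otimes> b))"
    by (simp add: G_add m_ac)
  also have "\<dots> = G (k + l) \<otimes> (G (n + m) \<otimes> (a' \<otimes> b'))"
    unfolding k l by (simp add: G_add m_ac)
  finally show ?thesis by (auto simp: frac_eq_iff)
qed

lemma frac_add_cong:
  assumes "fr a n = fr a' n'" "fr b m = fr b' m'"
    and [simp]: "a \<in> carrier S" "a' \<in> carrier S" "b \<in> carrier S" "b' \<in> carrier S"
  shows "fr ((G m \<otimes> a) \<oplus> (G n \<otimes> b)) (n + m) = fr ((G m' \<otimes> a') \<oplus> (G n' \<otimes> b')) (n' + m')"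
proof -
  obtain k l where k: "G k \<otimes> (G n' \<otimes> a) = G k \<otimes> (G n \<otimes> a')"
    and l: "G l \<otimes> (G m' \<otimes> b) = G l \<otimes> (G m \<otimes> b')"
    using assms(1,2) by (auto simp: frac_eq_iff)
  have "G (k + l) \<otimes> (G (n' + m') \<otimes> ((G m \<otimes> a) \<oplus> (G n \<otimes> b)))
    = ((G l \<otimes> G m' \<otimes> G m) \<otimes> (G k \<otimes> (G n' \<otimes> a))) \<oplus> ((G k \<otimes> G n' \<otimes> G n) \<otimes> (G l \<otimes> (G m' \<otimes> b)))"
    by (simp add: G_add m_ac r_distr)
  also have "\<dots> = G (k + l) \<otimes> (G (n + m) \<otimes> ((G m' \<otimes> a') \<oplus> (G n' \<otimes> b')))"
    unfolding k l by (simp add: G_add m_ac r_distr)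
  finally show ?thesis by (auto simp: frac_eq_iff)
qed

text \<open>Here \<psi> is an \<open>S\<close>-linear map, in practice multiplication by a scalar.
  The shift \<open>m\<close> of the denominators is 0 for \<open>localization\<close> and the pole
  order of a Laurent series for the generic fibre.\<close>

lemma frac_map_cong:
  assumes "fr a n = fr a' n'" and [simp]: "a \<in> carrier S" "a' \<in> carrier S"
    and cl: "\<And>x. x \<in> carrier S \<Longrightarrow> \<psi> x \<in> carrier S"
    and \<psi>: "\<And>x y. x \<in> carrier S \<Longrightarrow> y \<in> carrier S \<Longrightarrow> \<psi> (x \<otimes> y) = x \<otimes> \<psi> y"
  shows "fr (\<psi> a) (n + m) = fr (\<psi> a') (n' + m)"
proof -
  obtain k where k: "G k \<otimes> (G n' \<otimes> a) = G k \<otimes> (G n \<otimes> a')"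
    using assms(1) unfolding frac_eq_iff[OF assms(2,3)] by blast
  have e: "\<psi> (G i \<otimes> (G j \<otimes> x)) = G i \<otimes> (G j \<otimes> \<psi> x)" if "x \<in> carrier S" for i j x
    by (simp only: \<psi> m_closed nat_pow_closed g_closed that)
  have "G k \<otimes> (G (n' + m) \<otimes> \<psi> a) = G m \<otimes> \<psi> (G k \<otimes> (G n' \<otimes> a))"
    unfolding e[OF assms(2)] using cl[OF assms(2)] by (simp add: G_add m_ac)
  also have "\<dots> = G k \<otimes> (G (n + m) \<otimes> \<psi> a')"
    unfolding k e[OF assms(3)] using cl[OF assms(3)] by (simp add: G_add m_ac)
  finally show ?thesis
    unfolding frac_eq_iff[OF cl[OF assms(2)] cl[OF assms(3)]] by (rule exI)
qed

lemma carrier_L: "carrier L = {fr a n |a n. a \<in> carrier S}"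
  and one_L: "\<one>\<^bsub>L\<^esub> = fr \<one> 0"
  and zero_L: "\<zero>\<^bsub>L\<^esub> = fr \<zero> 0"
  by (simp_all add: localization_def)

lemma frac_in_L: "a \<in> carrier S \<Longrightarrow> fr a n \<in> carrier L"
  by (auto simp: carrier_L)

lemma L_cases: "U \<in> carrier L \<Longrightarrow> (\<And>a n. a \<in> carrier S \<Longrightarrow> U = fr a n \<Longrightarrow> thesis) \<Longrightarrow> thesis"
  by (auto simp: carrier_L)

lemma mult_L:
  assumes a: "a \<in> carrier S" and b: "b \<in> carrier S"
  shows "fr a n \<otimes>\<^bsub>L\<^esub> fr b m = fr (a \<otimes> b) (n + m)"
proof -
  have "fr a n \<otimes>\<^bsub>L\<^esub> fr b m = (\<Union>(a, n)\<in>fr a n. \<Union>(b, m)\<in>fr b m. fr (a \<otimes> b) (n + m))"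
    by (simp add: localization_def)
  also have "\<dots> = fr (a \<otimes> b) (n + m)"
  proof (rule UN_frac[OF a])
    fix a' n' assume a': "a' \<in> carrier S" "fr a' n' = fr a n"
    show "(\<Union>(b, m)\<in>fr b m. fr (a' \<otimes> b) (n' + m)) = fr (a \<otimes> b) (n + m)"
    proof (rule UN_frac[OF b])
      fix b' m' assume "b' \<in> carrier S" "fr b' m' = fr b m"
      then show "fr (a' \<otimes> b') (n' + m') = fr (a \<otimes> b) (n + m)"
        using frac_mult_cong[of a' n' a n b' m' b m] a a' b by simp
    qed
  qed
  finally show ?thesis .
qed

lemma add_L:
  assumes a: "a \<in> carrier S" and b: "b \<in> carrier S"
  shows "fr a n \<oplus>\<^bsub>L\<^esub> fr b m = fr ((G m \<otimes> a) \<oplus> (G n \<otimes> b)) (n + m)"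
proof -
  have "fr a n \<oplus>\<^bsub>L\<^esub> fr b m =
      (\<Union>(a, n)\<in>fr a n. \<Union>(b, m)\<in>fr b m. fr ((G m \<otimes> a) \<oplus> (G n \<otimes> b)) (n + m))"
    by (simp add: localization_def)
  also have "\<dots> = fr ((G m \<otimes> a) \<oplus> (G n \<otimes> b)) (n + m)"
  proof (rule UN_frac[OF a])
    fix a' n' assume a': "a' \<in> carrier S" "fr a' n' = fr a n"
    show "(\<Union>(b, m)\<in>fr b m. fr ((G m \<otimes> a') \<oplus> (G n' \<otimes> b)) (n' + m))
        = fr ((G m \<otimes> a) \<oplus> (G n \<otimes> b)) (n + m)"
    proof (rule UN_frac[OF b])
      fix b' m' assume b': "b' \<in> carrier S" "fr b' m' = fr b m"
      show "fr ((G m' \<otimes> a') \<oplus> (G n' \<otimes> b')) (n' + m') = fr ((G m \<otimes> a) \<oplus> (G n \<otimes> b)) (n + m)"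
        by (rule frac_add_cong[OF a'(2) b'(2) a'(1) a b'(1) b])
    qed
  qed
  finally show ?thesis .
qed

lemma UN_frac_map:
  assumes a: "a \<in> carrier S" and cl: "\<And>x. x \<in> carrier S \<Longrightarrow> \<psi> x \<in> carrier S"
    and \<psi>: "\<And>x y. x \<in> carrier S \<Longrightarrow> y \<in> carrier S \<Longrightarrow> \<psi> (x \<otimes> y) = x \<otimes> \<psi> y"
  shows "(\<Union>(a, n)\<in>fr a n. fr (\<psi> a) (n + m)) = fr (\<psi> a) (n + m)"
proof (rule UN_frac[OF a])
  fix a' n' assume a': "a' \<in> carrier S" "fr a' n' = fr a n"
  show "fr (\<psi> a') (n' + m) = fr (\<psi> a) (n + m)"
    by (rule frac_map_cong[of _ _ _ _ \<psi>, OF a'(2,1) a cl \<psi>])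
qed

lemma smult_L:
  assumes a: "a \<in> carrier S" and cl: "\<And>x. x \<in> carrier S \<Longrightarrow> r \<odot>\<^bsub>S\<^esub> x \<in> carrier S"
    and \<psi>: "\<And>x y. x \<in> carrier S \<Longrightarrow> y \<in> carrier S \<Longrightarrow> r \<odot>\<^bsub>S\<^esub> (x \<otimes> y) = x \<otimes> (r \<odot>\<^bsub>S\<^esub> y)"
  shows "r \<odot>\<^bsub>L\<^esub> fr a n = fr (r \<odot>\<^bsub>S\<^esub> a) n"
  unfolding localization_def
  using UN_frac_map[where \<psi> = "\<lambda>x. r \<odot>\<^bsub>S\<^esub> x" and m = 0, OF a cl \<psi>] by simp

text \<open>The extension given by the universal property, with \<open>w\<close> the inverse of
  \<rho> g. A representative is picked by choice; \<open>lift_frac\<close> shows that the value does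
  not depend on it.\<close>

definition lift :: "('s \<Rightarrow> 't::comm_ring_1) \<Rightarrow> 't \<Rightarrow> ('s \<times> nat) set \<Rightarrow> 't" where
  "lift \<rho> w U = (case SOME x. x \<in> U of (a, n) \<Rightarrow> \<rho> a * w ^ n)"

lemma lift_frac:
  assumes \<rho>: "class_ring_hom S \<rho>" and w: "\<rho> g * w = 1" and a: "a \<in> carrier S"
  shows "lift \<rho> w (fr a n) = \<rho> a * w ^ n"
proof -
  have gw: "\<rho> g ^ k * w ^ k = 1" for k
    by (simp add: w flip: power_mult_distrib)
  define x where "x = (SOME x. x \<in> fr a n)"
  have "x \<in> fr a n" unfolding x_def using frac_self[OF a] by (rule someI)
  moreover obtain b m where x: "x = (b, m)" by (cases x)
  ultimately have b: "b \<in> carrier S" and "fr b m = fr a n" using frac_memD by blast+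
  then obtain k where k: "G k \<otimes> (G n \<otimes> b) = G k \<otimes> (G m \<otimes> a)"
    using a by (auto simp: frac_eq_iff)
  then have "\<rho> (G k \<otimes> (G n \<otimes> b)) = \<rho> (G k \<otimes> (G m \<otimes> a))" by simp
  then have "\<rho> g ^ k * \<rho> g ^ n * \<rho> b = \<rho> g ^ k * \<rho> g ^ m * \<rho> a"
    using a b \<rho> by (simp add: class_ring_homD[OF \<rho>] class_ring_hom_pow[OF \<rho>] mult.assoc)
  then have "w ^ k * w ^ n * w ^ m * (\<rho> g ^ k * \<rho> g ^ n * \<rho> b)
      = w ^ k * w ^ n * w ^ m * (\<rho> g ^ k * \<rho> g ^ m * \<rho> a)" by simp
  moreover have "w ^ k * w ^ n * w ^ m * (\<rho> g ^ k * \<rho> g ^ n * \<rho> b)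
      = (\<rho> g ^ k * w ^ k) * (\<rho> g ^ n * w ^ n) * (\<rho> b * w ^ m)" by (simp add: mult_ac)
  moreover have "w ^ k * w ^ n * w ^ m * (\<rho> g ^ k * \<rho> g ^ m * \<rho> a)
      = (\<rho> g ^ k * w ^ k) * (\<rho> g ^ m * w ^ m) * (\<rho> a * w ^ n)" by (simp add: mult_ac)
  ultimately have "\<rho> b * w ^ m = \<rho> a * w ^ n" by (simp add: gw)
  then show ?thesis by (simp add: lift_def x_def[symmetric] x)
qed

lemma lift_ring_hom:
  assumes \<rho>: "class_ring_hom S \<rho>" and w: "\<rho> g * w = 1"
  shows "class_ring_hom L (lift \<rho> w)"
proof -
  have gw: "\<rho> g ^ k * w ^ k = 1" for k
    by (simp add: w flip: power_mult_distrib)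
  show ?thesis
    unfolding class_ring_hom_def
  proof (intro conjI ballI)
    fix U V assume "U \<in> carrier L" "V \<in> carrier L"
    then obtain a n b m where U: "U = fr a n" "V = fr b m"
      and cl [simp]: "a \<in> carrier S" "b \<in> carrier S" by (metis L_cases)
    show "lift \<rho> w (U \<otimes>\<^bsub>L\<^esub> V) = lift \<rho> w U * lift \<rho> w V"
      by (simp add: U mult_L lift_frac[OF \<rho> w] class_ring_homD[OF \<rho>] power_add mult_ac)
    have "(\<rho> g ^ m * \<rho> a + \<rho> g ^ n * \<rho> b) * w ^ (n + m)
      = (\<rho> g ^ m * w ^ m) * (\<rho> a * w ^ n) + (\<rho> g ^ n * w ^ n) * (\<rho> b * w ^ m)"
      by (simp add: power_add algebra_simps)
    then show "lift \<rho> w (U \<oplus>\<^bsub>L\<^esub> V) = lift \<rho> w U + lift \<rho> w V"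
      by (simp add: U add_L lift_frac[OF \<rho> w] class_ring_homD[OF \<rho>] class_ring_hom_pow[OF \<rho>] gw)
  next
    show "lift \<rho> w \<one>\<^bsub>L\<^esub> = 1"
      by (simp add: one_L lift_frac[OF \<rho> w] class_ring_homD[OF \<rho>])
  qed
qed

end

section \<open>The generic fibre\<close>

locale fps_algebra = algebra class_ring M for M :: "('k::field fps, 'b) module" (structure)
begin

definition t :: 'b where "t = fps_X \<odot>\<^bsub>M\<^esub> \<one>\<^bsub>M\<^esub>"

lemma smult_cl [simp, intro]: "x \<in> carrier M \<Longrightarrow> r \<odot>\<^bsub>M\<^esub> x \<in> carrier M"
  using smult_closed by simp

lemma smult_assoc: "x \<in> carrier M \<Longrightarrow> r \<odot>\<^bsub>M\<^esub> (s \<odot>\<^bsub>M\<^esub> x) = (r * s) \<odot>\<^bsub>M\<^esub> x"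
  using smult_assoc1[of r s x] by simp

lemma smult_mult: "x \<in> carrier M \<Longrightarrow> y \<in> carrier M \<Longrightarrow> r \<odot>\<^bsub>M\<^esub> (x \<otimes>\<^bsub>M\<^esub> y) = x \<otimes>\<^bsub>M\<^esub> (r \<odot>\<^bsub>M\<^esub> y)"
  using smult_assoc2[of r y x] m_comm[of "r \<odot>\<^bsub>M\<^esub> y" x] m_comm[of y x] by simp

lemma t_closed [simp]: "t \<in> carrier M" by (simp add: t_def)

lemma t_mult: "x \<in> carrier M \<Longrightarrow> t \<otimes>\<^bsub>M\<^esub> x = fps_X \<odot>\<^bsub>M\<^esub> x"
  unfolding t_def using smult_assoc2[of fps_X "\<one>\<^bsub>M\<^esub>" x] by simp

sublocale loc: localization_at M t
  by unfold_locales simp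

abbreviation "GF \<equiv> generic_fibre M"

lemma GF_simps:
  "carrier GF = carrier loc.L" "mult GF = mult loc.L" "one GF = one loc.L"
  "zero GF = zero loc.L" "add GF = add loc.L"
  by (simp_all add: generic_fibre_def Let_def t_def)

lemma smult_GF:
  assumes a: "a \<in> carrier M"
  shows "f \<odot>\<^bsub>GF\<^esub> loc.fr a n =
    loc.fr (fls_regpart (f * fls_X ^ nat (- fls_subdegree f)) \<odot>\<^bsub>M\<^esub> a) (n + nat (- fls_subdegree f))"
proof -
  have "f \<odot>\<^bsub>GF\<^esub> loc.fr a n = (\<Union>(a, n)\<in>loc.fr a n.
    loc.fr (fls_regpart (f * fls_X ^ nat (- fls_subdegree f)) \<odot>\<^bsub>M\<^esub> a) (n + nat (- fls_subdegree f)))"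
    by (simp add: generic_fibre_def Let_def t_def)
  also have "\<dots> = loc.fr (fls_regpart (f * fls_X ^ nat (- fls_subdegree f)) \<odot>\<^bsub>M\<^esub> a) (n + nat (- fls_subdegree f))"
    by (rule loc.UN_frac_map[where \<psi> = "\<lambda>x. fls_regpart (f * fls_X ^ nat (- fls_subdegree f)) \<odot>\<^bsub>M\<^esub> x",
          OF a smult_cl smult_mult])
  finally show ?thesis .
qed

text \<open>The power of t removes the pole, so taking the regular part loses nothing.\<close>

lemma fps_to_fls_regpart_shift:
  "fps_to_fls (fls_regpart (f * fls_X ^ nat (- fls_subdegree f))) = f * fls_X ^ nat (- fls_subdegree (f :: 'k fls))"
proof (cases "f = 0")
  case False
  have "fls_subdegree (f * fls_X ^ nat (- fls_subdegree f)) = fls_subdegree f + nat (- fls_subdegree f)"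
    using False by (simp add: fls_X_power_conv_shift_1)
  then have "fls_subdegree (f * fls_X ^ nat (- fls_subdegree f)) \<ge> 0" by simp
  then show ?thesis by (rule fls_regpart_to_fls_trivial)
qed simp

text \<open>In an algebra over K((t)) the image of t is invertible, so a K[[t]]-linear homomorphism
  extends to fractions. It is linear over K((t)) because the pole order added to the denominator is
  compensated by the same power of \<open>w\<close>.\<close>

lemma GF_alg_hom:
  fixes \<kappa> :: "'k fls \<Rightarrow> 't::comm_ring_1"
  assumes \<kappa>: "comm_ring_hom \<kappa>" and \<rho>: "class_alg_hom (\<lambda>p. \<kappa> (fps_to_fls p)) M \<rho>"
  defines "w \<equiv> \<kappa> (inverse fls_X)"
  shows "class_alg_hom \<kappa> GF (loc.lift \<rho> w)"
    and "a \<in> carrier M \<Longrightarrow> loc.lift \<rho> w (loc.fr a n) = \<rho> a * w ^ n"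
    and "\<kappa> fls_X * w = 1"
proof -
  interpret \<kappa>: comm_ring_hom \<kappa> by (rule \<kappa>)
  have Xw: "\<kappa> fls_X * w = 1"
    unfolding w_def by (subst \<kappa>.hom_mult[symmetric]) simp
  note \<rho>r = class_alg_homD(5)[OF \<rho>]
  have tw: "\<rho> t * w = 1"
    unfolding t_def using Xw by (simp add: class_alg_homD[OF \<rho>] fps_X_to_fls)
  have lf: "loc.lift \<rho> w (loc.fr a n) = \<rho> a * w ^ n" if "a \<in> carrier M" for a n
    by (rule loc.lift_frac[OF \<rho>r tw that])
  have "loc.lift \<rho> w (f \<odot>\<^bsub>GF\<^esub> U) = \<kappa> f * loc.lift \<rho> w U" if "U \<in> carrier loc.L" for f U
  proof -
    obtain a n where a [simp]: "a \<in> carrier M" and U: "U = loc.fr a n"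
      by (rule loc.L_cases[OF \<open>U \<in> carrier loc.L\<close>])
    define m where "m = nat (- fls_subdegree f)"
    have "loc.lift \<rho> w (f \<odot>\<^bsub>GF\<^esub> U) = \<kappa> (f * fls_X ^ m) * \<rho> a * w ^ (n + m)"
      unfolding U by (simp add: smult_GF lf class_alg_homD[OF \<rho>] fps_to_fls_regpart_shift m_def)
    also have "\<dots> = \<kappa> f * (\<rho> a * w ^ n) * (\<kappa> fls_X * w) ^ m"
      by (simp add: \<kappa>.hom_mult \<kappa>.hom_power power_add power_mult_distrib mult_ac)
    finally show ?thesis by (simp add: U lf Xw)
  qed
  then show "class_alg_hom \<kappa> GF (loc.lift \<rho> w)"
    using loc.lift_ring_hom[OF \<rho>r tw]
    unfolding class_alg_hom_def class_ring_hom_def GF_simps by simp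
  show "a \<in> carrier M \<Longrightarrow> loc.lift \<rho> w (loc.fr a n) = \<rho> a * w ^ n" by (rule lf)
  show "\<kappa> fls_X * w = 1" by (rule Xw)
qed

end

section \<open>Dual numbers\<close>

text \<open>A homomorphism to the dual numbers is a point together with a derivation at it.
  Derivations thus extend to localizations by the lifting of homomorphisms.\<close>

datatype 'a dual = Dual (re_dual: 'a) (eps_dual: 'a)

instantiation dual :: (comm_ring_1) comm_ring_1
begin

definition "0 = Dual 0 (0 :: 'a)"
definition "1 = Dual 1 (0 :: 'a)"
definition "x + y = Dual (re_dual x + re_dual y) (eps_dual x + eps_dual y :: 'a)"
definition "x - y = Dual (re_dual x - re_dual y) (eps_dual x - eps_dual y :: 'a)"
definition "- x = Dual (- re_dual x) (- eps_dual x :: 'a)"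
definition "x * y = Dual (re_dual x * re_dual y) (re_dual x * eps_dual y + eps_dual x * re_dual y :: 'a)"

instance
  by intro_classes
     (auto simp: zero_dual_def one_dual_def plus_dual_def minus_dual_def uminus_dual_def
        times_dual_def algebra_simps intro: dual.expand)

end

lemma dual_simps [simp]:
  "re_dual 0 = 0" "re_dual 1 = 1" "re_dual (x + y) = re_dual x + re_dual y"
  "re_dual (x * y) = re_dual x * re_dual y"
  "eps_dual 0 = 0" "eps_dual 1 = 0" "eps_dual (x + y) = eps_dual x + eps_dual y"
  "eps_dual (x * y) = re_dual x * eps_dual y + eps_dual x * re_dual y"
  by (simp_all add: zero_dual_def one_dual_def plus_dual_def times_dual_def)

lemma dual_eqI: "re_dual x = re_dual y \<Longrightarrow> eps_dual x = eps_dual y \<Longrightarrow> x = y"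
  by (rule dual.expand) simp

text \<open>The inverse of a + \<epsilon> b is 1/a - \<epsilon> b/a^2, so the real part alone
  decides.\<close>

lemma dual_unit:
  fixes x :: "'a::field dual"
  assumes "re_dual x \<noteq> 0"
  shows "\<exists>y. x * y = 1"
  using assms
  by (intro exI[of _ "Dual (1 / re_dual x) (- eps_dual x / (re_dual x)\<^sup>2)"] dual_eqI)
     (simp_all add: field_simps power2_eq_square)

lemma dual_const_hom_aux: "comm_ring_hom (\<lambda>c :: 'a::comm_ring_1. Dual c 0)"
  by unfold_locales (auto intro: dual_eqI)

lemma dual_const_hom: "comm_ring_hom \<kappa> \<Longrightarrow> comm_ring_hom (\<lambda>c. Dual (\<kappa> c) 0)"
  using comm_ring_hom_comp[of "\<lambda>c. Dual c 0" \<kappa>] by (auto intro: dual_const_hom_aux)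

text \<open>Truncation modulo X^2, which sends an arc to its tangent vector.\<close>

lemma fps_dual_hom: "comm_ring_hom (\<lambda>f :: 'a::comm_ring_1 fps. Dual (fps_nth f 0) (fps_nth f 1))"
  by unfold_locales (auto intro!: dual_eqI simp: fps_mult_nth)

section \<open>Point derivations of smooth algebras\<close>

lemma (in ring) class_ring_hom_a_inv: "class_ring_hom R \<rho> \<Longrightarrow> a \<in> carrier R \<Longrightarrow> \<rho> (\<ominus> a) = - \<rho> a"
  using class_ring_homD(2)[of R \<rho> a "\<ominus> a"] class_ring_hom_zero[of \<rho>]
  by (simp add: r_neg eq_neg_iff_add_eq_0 add.commute)

text \<open>\<open>J\<close> is an ideal of the target, given by its closure properties. The
  preimage contains a generated ideal as soon as it contains the generators; this propagates
  vanishing from equations to their consequences.\<close>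

lemma (in ring) class_ring_hom_vimage_ideal:
  fixes \<rho> :: "'a \<Rightarrow> 't::comm_ring_1"
  assumes \<rho>: "class_ring_hom R \<rho>"
    and J: "0 \<in> J" "\<And>x y. x \<in> J \<Longrightarrow> y \<in> J \<Longrightarrow> x + y \<in> J" "\<And>x y. x \<in> J \<Longrightarrow> x * y \<in> J"
  shows "ideal {x \<in> carrier R. \<rho> x \<in> J} R"
proof (rule idealI)
  show "subgroup {x \<in> carrier R. \<rho> x \<in> J} (add_monoid R)"
  proof (rule subgroup.intro)
    show "\<one>\<^bsub>add_monoid R\<^esub> \<in> {x \<in> carrier R. \<rho> x \<in> J}"
      using J(1) class_ring_hom_zero[OF \<rho>] by simp
  next
    fix x assume "x \<in> {x \<in> carrier R. \<rho> x \<in> J}"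
    then show "inv\<^bsub>add_monoid R\<^esub> x \<in> {x \<in> carrier R. \<rho> x \<in> J}"
      using J(3)[of "\<rho> x" "-1"] class_ring_hom_a_inv[OF \<rho>, of x] by (simp flip: a_inv_def)
  qed (use J(2) class_ring_homD[OF \<rho>] in auto)
next
  fix a x assume "a \<in> {x \<in> carrier R. \<rho> x \<in> J}" "x \<in> carrier R"
  then show "x \<otimes> a \<in> {x \<in> carrier R. \<rho> x \<in> J}" "a \<otimes> x \<in> {x \<in> carrier R. \<rho> x \<in> J}"
    using J(3)[of "\<rho> a" "\<rho> x"] by (simp_all add: class_ring_homD[OF \<rho>] mult.commute)
qed (rule ring_axioms)

lemma mpoly_eval_class_hom:
  "comm_ring_hom \<phi> \<Longrightarrow> class_ring_hom (mpoly_algebra n) (mpoly_eval \<phi> u)"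
  using mpoly_eval_add[of \<phi>] mpoly_eval_mult[of \<phi>] mpoly_eval_const[of \<phi> u 1]
  by (simp add: class_ring_hom_def mpoly_algebra_def comm_ring_hom_def ring_hom_def semiring_hom_def
      monoid_mult_hom_def one_hom_def)

text \<open>Used to compare the improved arc with the original one modulo X^2, where both have the
  same tangent vector.\<close>

lemma mpoly_eval_cong:
  fixes u u' :: "nat \<Rightarrow> 'a::comm_ring_1"
  assumes \<phi>: "comm_ring_hom \<phi>" and p: "p \<in> carrier (mpoly_algebra n)"
    and u: "\<And>j. z dvd u' j - u j"
  shows "z dvd mpoly_eval \<phi> u' p - mpoly_eval \<phi> u p"
  using p
proof (induction p rule: mpoly_induct)
  case (add p q)
  then have "z dvd (mpoly_eval \<phi> u' p - mpoly_eval \<phi> u p) + (mpoly_eval \<phi> u' q - mpoly_eval \<phi> u q)"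
    by (intro dvd_add)
  then show ?case by (simp add: mpoly_eval_add[OF \<phi>] algebra_simps)
next
  case (mult p q)
  then have "z dvd mpoly_eval \<phi> u' p * (mpoly_eval \<phi> u' q - mpoly_eval \<phi> u q)
      + (mpoly_eval \<phi> u' p - mpoly_eval \<phi> u p) * mpoly_eval \<phi> u q"
    by (intro dvd_add dvd_mult dvd_mult2)
  then show ?case by (simp add: mpoly_eval_mult[OF \<phi>] algebra_simps)
qed (simp_all add: mpoly_eval_const[OF \<phi>] mpoly_eval_var[OF \<phi>] u)

lemma mpoly_carrier_det:
  assumes "\<And>i j. i < c \<Longrightarrow> j < c \<Longrightarrow> F i j \<in> carrier (mpoly_algebra n)"
  shows "det (mat c c (\<lambda>(i, j). F i j)) \<in> carrier (mpoly_algebra n)"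
proof -
  have s: "(if P then 1 else - 1) \<in> carrier (mpoly_algebra n)" for P
    by (simp add: mpoly_carrier_1 mpoly_carrier_uminus)
  have "(\<Prod>i = 0..<c. mat c c (\<lambda>(i, j). F i j) $$ (i, p i)) \<in> carrier (mpoly_algebra n)"
    if "p permutes {0..<c}" for p
  proof (rule mpoly_carrier_prod)
    fix i assume i: "i \<in> {0..<c}"
    then have "p i < c" using permutes_in_image[OF that, of i] by simp
    then show "mat c c (\<lambda>(i, j). F i j) $$ (i, p i) \<in> carrier (mpoly_algebra n)"
      using i assms by simp
  qed
  then show ?thesis
    unfolding det_def by (auto intro!: mpoly_carrier_sum mpoly_carrier_mult s
        simp: sign_def mpoly_carrier_1 mpoly_carrier_uminus)
qed

text \<open>Horner's scheme in the carrier of \<open>S\<close>, with the coefficients acting through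
  multiples of the unit.\<close>

definition alg_eval :: "('r::comm_ring_1, 's) module \<Rightarrow> 'r poly \<Rightarrow> 's \<Rightarrow> 's" where
  "alg_eval S q a = foldr (\<lambda>c b. (c \<odot>\<^bsub>S\<^esub> \<one>\<^bsub>S\<^esub>) \<oplus>\<^bsub>S\<^esub> (a \<otimes>\<^bsub>S\<^esub> b)) (coeffs q) \<zero>\<^bsub>S\<^esub>"

lemma alg_eval_0 [simp]: "alg_eval S 0 a = \<zero>\<^bsub>S\<^esub>"
  by (simp add: alg_eval_def)

lemma alg_eval_pCons:
  assumes "algebra class_ring S" "a \<in> carrier S"
  shows "alg_eval S (pCons c q) a = (c \<odot>\<^bsub>S\<^esub> \<one>\<^bsub>S\<^esub>) \<oplus>\<^bsub>S\<^esub> (a \<otimes>\<^bsub>S\<^esub> alg_eval S q a)"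
\<comment> \<open>The coefficient list of the zero polynomial is empty, so this case is not an
  unfolding of \<open>foldr\<close>.\<close>
proof (cases "c = 0 \<and> q = 0")
  case True
  interpret algebra class_ring S by (rule assms(1))
  have "0 \<odot>\<^bsub>S\<^esub> \<one>\<^bsub>S\<^esub> = \<zero>\<^bsub>S\<^esub>" using smult_l_null[OF one_closed] by simp
  then show ?thesis using True assms(2) by simp
next
  case False
  then have "coeffs (pCons c q) = c # coeffs q" by auto
  then show ?thesis by (simp add: alg_eval_def)
qed

lemma alg_eval_closed:
  assumes "algebra class_ring S" "a \<in> carrier S"
  shows "alg_eval S q a \<in> carrier S"
proof -
  interpret algebra class_ring S by (rule assms(1))
  show ?thesis
    by (induction q) (use assms in \<open>simp_all add: alg_eval_pCons smult_closed\<close>)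
qed

lemma map_poly_pCons_hom: "comm_ring_hom \<iota> \<Longrightarrow> map_poly \<iota> (pCons c q) = pCons (\<iota> c) (map_poly \<iota> q)"
  by (rule poly_eqI, subst coeff_map_poly)
     (auto simp: coeff_pCons coeff_map_poly comm_ring_hom_def ring_hom_def semiring_hom_def
       comm_monoid_add_hom_def monoid_add_hom_def zero_hom_def split: nat.split)

lemma class_alg_hom_alg_eval:
  assumes S: "algebra class_ring S" and \<iota>: "comm_ring_hom \<iota>" and a: "a \<in> carrier S"
    and \<rho>: "class_alg_hom \<iota> S \<rho>"
  shows "\<rho> (alg_eval S q a) = poly (map_poly \<iota> q) (\<rho> a)"
proof -
  interpret algebra class_ring S by (rule S)
  have "\<rho> \<zero>\<^bsub>S\<^esub> = 0" by (rule class_ring_hom_zero[OF class_alg_homD(5)[OF \<rho>]])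
  then show ?thesis
    using smult_closed
    by (induction q) (use a in \<open>simp_all add: alg_eval_pCons[OF S] alg_eval_closed[OF S]
      class_alg_homD[OF \<rho>] map_poly_pCons_hom[OF \<iota>]\<close>)
qed

lemma fps_to_fls_hom: "comm_ring_hom (fps_to_fls :: 'k::field fps \<Rightarrow> 'k fls)"
  by unfold_locales (simp, simp, simp, simp only: fls_times_fps_to_fls)

lemma field_hom_0_iff:
  fixes \<kappa> :: "'f::field \<Rightarrow> 'l::{comm_ring_1, zero_neq_one}"
  assumes "comm_ring_hom \<kappa>"
  shows "\<kappa> x = 0 \<longleftrightarrow> x = 0"
proof -
  interpret comm_ring_hom \<kappa> by (rule assms)
  have "\<kappa> x * \<kappa> (inverse x) = 1" if "x \<noteq> 0" using that by (simp flip: hom_mult)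
  then show ?thesis by (cases "x = 0") auto
qed

text \<open>
  A tangent vector lifts to a formal arc by Newton iteration, and along the arc an element that is
  algebraic over the base is constant.
\<close>

lemma standard_smooth_point_derivation:
  fixes \<kappa> :: "'f::field \<Rightarrow> 'l::alg_closed_field" and W :: "('f, 'w) module"
    and M :: "('r::comm_ring_1, 'b) module" and e :: "'r \<Rightarrow> 'f"
  assumes \<kappa>: "comm_ring_hom \<kappa>" and e: "comm_ring_hom e" and inj: "inj e"
    and M: "algebra class_ring M" and ss: "standard_smooth W"
    and \<rho>: "class_alg_hom (\<lambda>c. Dual (\<kappa> c) 0) W \<rho>"
    and j: "\<And>x. x \<in> carrier M \<Longrightarrow> j x \<in> carrier W"
    and j_add: "\<And>x y. x \<in> carrier M \<Longrightarrow> y \<in> carrier M \<Longrightarrow> j (x \<oplus>\<^bsub>M\<^esub> y) = j x \<oplus>\<^bsub>W\<^esub> j y"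
    and j_mult: "\<And>x y. x \<in> carrier M \<Longrightarrow> y \<in> carrier M \<Longrightarrow> j (x \<otimes>\<^bsub>M\<^esub> y) = j x \<otimes>\<^bsub>W\<^esub> j y"
    and j_smult: "\<And>r. j (r \<odot>\<^bsub>M\<^esub> \<one>\<^bsub>M\<^esub>) = e r \<odot>\<^bsub>W\<^esub> \<one>\<^bsub>W\<^esub>"
    and j_zero: "j \<zero>\<^bsub>M\<^esub> = \<zero>\<^bsub>W\<^esub>" and one: "\<one>\<^bsub>W\<^esub> \<in> carrier W"
    and a: "a \<in> carrier M" and q: "q \<noteq> 0" and root: "alg_eval M q a = \<zero>\<^bsub>M\<^esub>"
  shows "eps_dual (\<rho> (j a)) = 0"
proof -
  interpret M: algebra class_ring M by (rule M)
  interpret e: comm_ring_hom e by (rule e)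
  \<comment> \<open>Written as 0 times the unit, the zero of \<open>W\<close> is sent to 0 by the
    linearity of \<rho>. The identity is imported from \<open>M\<close> through
    \<open>j\<close>.\<close>
  have W0: "\<zero>\<^bsub>W\<^esub> = 0 \<odot>\<^bsub>W\<^esub> \<one>\<^bsub>W\<^esub>"
    using j_smult[of 0] j_zero M.smult_l_null[OF M.one_closed] by simp
  interpret \<kappa>: comm_ring_hom \<kappa> by (rule \<kappa>)
  define \<kappa>d where "\<kappa>d = (\<lambda>c. Dual (\<kappa> c) 0)"
  have \<kappa>d: "comm_ring_hom \<kappa>d" unfolding \<kappa>d_def by (rule dual_const_hom[OF \<kappa>])
  define \<kappa>f where "\<kappa>f = (\<lambda>c. fps_const (\<kappa> c))"
  have \<kappa>f: "comm_ring_hom \<kappa>f" unfolding \<kappa>f_def by (rule comm_ring_hom_comp[OF fps_const_comm_ring_hom \<kappa>])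
  obtain n c f h where cn: "c \<le> n" and f: "\<And>i. i < c \<Longrightarrow> f i \<in> carrier (mpoly_algebra n)"
    and h: "h \<in> alg_hom (mpoly_algebra n) W"
    and surj: "h ` carrier (mpoly_algebra n) = carrier W"
    and ker: "a_kernel (mpoly_algebra n) W h = genideal (mpoly_algebra n) (f ` {..<c})"
    and unit: "h (det (mat c c (\<lambda>(i, j). mpoly_pderiv j (f i)))) \<in> Units W"
    using ss unfolding standard_smooth_def by blast
  let ?P = "mpoly_algebra n :: ('f, _) module"
  interpret P: cring ?P by (rule mpoly_cring)
  have P_simps: "p \<otimes>\<^bsub>?P\<^esub> q = p * q" "p \<oplus>\<^bsub>?P\<^esub> q = p + q" "\<one>\<^bsub>?P\<^esub> = 1" "\<zero>\<^bsub>?P\<^esub> = 0"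
    "r \<odot>\<^bsub>?P\<^esub> p = Poly_Mapping.single 0 r * p" for p q r
    by (simp_all add: mpoly_algebra_def)
  have hcl: "h p \<in> carrier W" if "p \<in> carrier ?P" for p using surj that by blast
  have hr: "h \<in> Ring.ring_hom ?P W" using h by (simp add: alg_hom_def)
  have h_add: "h (p + q) = h p \<oplus>\<^bsub>W\<^esub> h q" and h_mult: "h (p * q) = h p \<otimes>\<^bsub>W\<^esub> h q"
    if "p \<in> carrier ?P" "q \<in> carrier ?P" for p q
    using Ring.ring_hom_add[OF hr that] Ring.ring_hom_mult[OF hr that] by (simp_all add: P_simps)
  have h_one: "h 1 = \<one>\<^bsub>W\<^esub>" using Ring.ring_hom_one[OF hr] by (simp add: P_simps)
  have h_const: "h (Poly_Mapping.single 0 r) = r \<odot>\<^bsub>W\<^esub> \<one>\<^bsub>W\<^esub>" for r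
  proof -
    have "h (r \<odot>\<^bsub>?P\<^esub> 1) = r \<odot>\<^bsub>W\<^esub> h 1"
      using h mpoly_carrier_1[of n] unfolding alg_hom_def by blast
    then show ?thesis by (simp add: P_simps h_one)
  qed
  define \<Phi> where "\<Phi> p = \<rho> (h p)" for p
  have \<Phi>_const: "\<Phi> (Poly_Mapping.single 0 r) = \<kappa>d r" for r
    by (simp add: \<Phi>_def h_const class_alg_homD[OF \<rho>] one \<kappa>d_def dual_eqI)
  have \<Phi>_add: "\<Phi> (p + q) = \<Phi> p + \<Phi> q" and \<Phi>_mult: "\<Phi> (p * q) = \<Phi> p * \<Phi> q"
    if "p \<in> carrier ?P" "q \<in> carrier ?P" for p q
    using that by (simp_all add: \<Phi>_def h_add h_mult class_alg_homD[OF \<rho>] hcl)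
  \<comment> \<open>The affine arc whose base point and direction are the real and \<epsilon>-parts
    of the images of the variables. Modulo X^2 it represents \<Phi>.\<close>
  define u where "u j = fps_const (re_dual (\<Phi> (mpoly_var j))) + fps_const (eps_dual (\<Phi> (mpoly_var j))) * fps_X" for j
  define \<tau> where "\<tau> = (\<lambda>f :: 'l fps. Dual (fps_nth f 0) (fps_nth f 1))"
  interpret \<tau>: comm_ring_hom \<tau> unfolding \<tau>_def by (rule fps_dual_hom)
  have \<tau>u: "\<tau> (mpoly_eval \<kappa>f u p) = \<Phi> p" if p: "p \<in> carrier ?P" for p
    using p
  proof (induction p rule: mpoly_induct)
    case (const r)
    then show ?case by (simp add: mpoly_eval_const[OF \<kappa>f] \<Phi>_const) (simp add: \<tau>_def \<kappa>f_def \<kappa>d_def)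
  next
    case (var j)
    have "fps_nth (u j) 0 = re_dual (\<Phi> (mpoly_var j))" "fps_nth (u j) 1 = eps_dual (\<Phi> (mpoly_var j))"
      by (simp_all add: u_def)
    then show ?case by (simp add: mpoly_eval_var[OF \<kappa>f] \<tau>_def)
  qed (simp_all add: mpoly_eval_add[OF \<kappa>f] mpoly_eval_mult[OF \<kappa>f] \<Phi>_add \<Phi>_mult \<tau>.hom_add \<tau>.hom_mult)
  have nth01: "fps_nth (mpoly_eval \<kappa>f u p) 0 = re_dual (\<Phi> p)" "fps_nth (mpoly_eval \<kappa>f u p) 1 = eps_dual (\<Phi> p)"
    if "p \<in> carrier ?P" for p
    using arg_cong[OF \<tau>u[OF that], of re_dual] arg_cong[OF \<tau>u[OF that], of eps_dual]
    by (simp_all add: \<tau>_def)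
  \<comment> \<open>The equations lie in the kernel of \<open>h\<close>, so \<Phi> kills their
    values and their derivatives: they vanish along the arc modulo X^2.\<close>
  have fz: "fps_X ^ 2 dvd mpoly_eval \<kappa>f u (f i)" if i: "i < c" for i
  proof -
    have "f i \<in> genideal ?P (f ` {..<c})"
      by (rule subsetD[OF P.genideal_self]) (use f i in auto)
    then have "h (f i) = \<zero>\<^bsub>W\<^esub>" unfolding ker[symmetric] a_kernel_def' by simp
    then have "\<Phi> (f i) = 0"
      by (simp add: \<Phi>_def W0 class_alg_homD[OF \<rho>] one dual_eqI)
    then show ?thesis
      using nth01[OF f[OF i]] by (subst fps_X_power_dvd_iff) (auto simp: less_Suc_eq numeral_2_eq_2)
  qed
  have u0: "mpoly_eval \<kappa> (\<lambda>j. fps_nth (u j) 0) p = re_dual (\<Phi> p)" if "p \<in> carrier ?P" for p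
    using mpoly_eval_nth_0[OF \<kappa> that, of u] nth01(1)[OF that] by (simp add: \<kappa>f_def)
  let ?J = "mat c c (\<lambda>(i, j). mpoly_pderiv j (f i))"
  have Jc: "det ?J \<in> carrier ?P"
    by (rule mpoly_carrier_det) (simp add: mpoly_pderiv_carrier f)
  \<comment> \<open>The Jacobian determinant is a unit in \<open>W\<close>, so its value at the base
    point of the arc is nonzero.\<close>
  have det: "det (mat c c (\<lambda>(i, j). mpoly_eval \<kappa> (\<lambda>j. fps_nth (u j) 0) (mpoly_pderiv j (f i)))) \<noteq> 0"
  proof -
    interpret E: comm_ring_hom "mpoly_eval \<kappa> (\<lambda>j. fps_nth (u j) 0)" by (rule mpoly_eval_hom[OF \<kappa>])
    have "mat c c (\<lambda>(i, j). mpoly_eval \<kappa> (\<lambda>j. fps_nth (u j) 0) (mpoly_pderiv j (f i)))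
      = map_mat (mpoly_eval \<kappa> (\<lambda>j. fps_nth (u j) 0)) ?J"
      by (rule eq_matI) auto
    then have "det (mat c c (\<lambda>(i, j). mpoly_eval \<kappa> (\<lambda>j. fps_nth (u j) 0) (mpoly_pderiv j (f i))))
      = re_dual (\<Phi> (det ?J))"
      by (simp only: E.hom_det u0[OF Jc])
    moreover obtain z where z: "z \<in> carrier W" "z \<otimes>\<^bsub>W\<^esub> h (det ?J) = \<one>\<^bsub>W\<^esub>"
      using unit unfolding Units_def by blast
    have "re_dual (\<rho> z * \<Phi> (det ?J)) = 1"
      unfolding \<Phi>_def using class_alg_homD(1)[OF \<rho> z(1) hcl[OF Jc]] class_alg_homD(3)[OF \<rho>]
      by (simp only: z(2)) simp
    ultimately show ?thesis by auto
  qed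
  \<comment> \<open>Starting from order 2 keeps the X-coefficients of the arc. The order 2 + degree
    q exceeds the degree q + 1 required by the test for algebraic elements.\<close>
  obtain u' where u': "\<And>j. fps_X ^ 2 dvd u' j - u j"
      "\<And>i. i < c \<Longrightarrow> fps_X ^ (2 + degree q) dvd mpoly_eval \<kappa>f u' (f i)"
    using mpoly_newton[OF \<kappa> _ cn f det fz[unfolded \<kappa>f_def], of "degree q"] unfolding \<kappa>f_def by auto
  obtain p where p: "p \<in> carrier ?P" "h p = j a" using surj j[OF a] by (metis imageE)
  define \<kappa>e where "\<kappa>e = (\<lambda>c. \<kappa>f (e c))"
  have \<kappa>e: "comm_ring_hom \<kappa>e" unfolding \<kappa>e_def by (rule comm_ring_hom_comp[OF \<kappa>f e])
  have \<kappa>e_eq: "\<kappa>f (e b) = \<kappa>e b" for b by (simp only: \<kappa>e_def)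
  \<comment> \<open>\<open>Q\<close> is q(p) formed inside the polynomial ring by Horner's scheme.
    It represents q(a) = 0, so it lies in the ideal of the equations and vanishes along the improved
    arc to the same order as they do.\<close>
  have "\<exists>Q. Q \<in> carrier ?P \<and> h Q = j (alg_eval M q a) \<and>
      mpoly_eval \<kappa>f u' Q = poly (map_poly \<kappa>e q) (mpoly_eval \<kappa>f u' p)"
  proof (induction q)
    case 0
    have "h 0 = \<zero>\<^bsub>W\<^esub>" using h_const[of 0] W0 by simp
    with j_zero show ?case
      by (intro exI[of _ 0]) (simp add: mpoly_carrier_0 mpoly_eval_def)
  next
    case (pCons b q)
    then obtain Q where Q: "Q \<in> carrier ?P" "h Q = j (alg_eval M q a)"
      "mpoly_eval \<kappa>f u' Q = poly (map_poly \<kappa>e q) (mpoly_eval \<kappa>f u' p)" by blast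
    let ?Q = "Poly_Mapping.single 0 (e b) + p * Q"
    have "?Q \<in> carrier ?P"
      by (intro mpoly_carrier_add mpoly_carrier_mult mpoly_carrier_const p Q)
    moreover have "h ?Q = j (alg_eval M (pCons b q) a)"
      using p Q M.smult_closed
      by (simp add: h_add h_mult mpoly_carrier_mult mpoly_carrier_const h_const a
          alg_eval_pCons[OF M a] alg_eval_closed[OF M a] j_add j_mult j_smult)
    ultimately show ?case
      using Q(3) \<kappa>e_eq by (intro exI[of _ ?Q])
        (simp add: mpoly_eval_add[OF \<kappa>f] mpoly_eval_mult[OF \<kappa>f] mpoly_eval_const[OF \<kappa>f]
          map_poly_pCons_hom[OF \<kappa>e])
  qed
  then obtain Q where Q: "Q \<in> carrier ?P" "h Q = \<zero>\<^bsub>W\<^esub>"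
      "mpoly_eval \<kappa>f u' Q = poly (map_poly \<kappa>e q) (mpoly_eval \<kappa>f u' p)" unfolding root j_zero by blast
  let ?I = "{p \<in> carrier ?P. mpoly_eval \<kappa>f u' p \<in> {x. fps_X ^ (2 + degree q) dvd x}}"
  have "ideal ?I ?P"
    by (rule P.class_ring_hom_vimage_ideal[OF mpoly_eval_class_hom[OF \<kappa>f]]) auto
  then have "genideal ?P (f ` {..<c}) \<subseteq> ?I"
    by (rule P.genideal_minimal) (use f u'(2) in auto)
  moreover have "Q \<in> a_kernel ?P W h" unfolding a_kernel_def' using Q by simp
  ultimately have dvd: "fps_X ^ (2 + degree q) dvd poly (map_poly \<kappa>e q) (mpoly_eval \<kappa>f u' p)"
    unfolding ker using Q(3) by auto
  define \<iota> where "\<iota> = (\<lambda>c. \<kappa> (e c))"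
  have mp: "map_poly \<kappa>e q = map_poly fps_const (map_poly \<iota> q)"
    unfolding \<kappa>e_def \<kappa>f_def \<iota>_def by (subst map_poly_map_poly) (simp_all add: o_def)
  have \<iota>0: "\<iota> x = 0 \<longleftrightarrow> x = 0" for x
    unfolding \<iota>_def field_hom_0_iff[OF \<kappa>] using inj_eq[OF inj, of x 0] by simp
  have "map_poly \<iota> q \<noteq> 0" using q by (simp add: poly_eq_iff coeff_map_poly \<iota>0)
  moreover have "degree (map_poly \<iota> q) = degree q" by (rule degree_map_poly) (simp add: \<iota>0)
  moreover have "fps_X ^ Suc (degree q) dvd poly (map_poly fps_const (map_poly \<iota> q)) (mpoly_eval \<kappa>f u' p)"
    using dvd unfolding mp by (rule power_le_dvd) simp
  ultimately have "fps_nth (mpoly_eval \<kappa>f u' p) 1 = 0"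
    using poly_fps_algebraic_coeff_1[of "map_poly \<iota> q" "mpoly_eval \<kappa>f u' p"] by simp
  moreover have "fps_X ^ 2 dvd mpoly_eval \<kappa>f u' p - mpoly_eval \<kappa>f u p"
    by (rule mpoly_eval_cong[OF \<kappa>f p(1) u'(1)])
  then have "fps_nth (mpoly_eval \<kappa>f u' p - mpoly_eval \<kappa>f u p) 1 = 0"
    unfolding fps_X_power_dvd_iff by simp
  ultimately have "fps_nth (mpoly_eval \<kappa>f u p) 1 = 0" by simp
  then show ?thesis using nth01(2)[OF p(1)] p(2) by (simp add: \<Phi>_def)
qed


context fps_algebra
begin

text \<open>The pair of \<chi> and \<open>D\<close> is a point with values in the dual numbers. It
  extends to the generic fibre and then to a principal open set of the smooth cover that contains
  \<chi>, where the argument with arcs applies.\<close>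

lemma smooth_point_derivation:
  fixes \<kappa> :: "'k fls \<Rightarrow> 'l::alg_closed_field"
  defines "\<iota> \<equiv> \<lambda>p. \<kappa> (fps_to_fls p)"
  assumes \<kappa>: "comm_ring_hom \<kappa>" and smooth: "smooth_algebra GF"
    and \<chi>: "class_alg_hom \<iota> M \<chi>"
    and D_add: "\<And>x y. x \<in> carrier M \<Longrightarrow> y \<in> carrier M \<Longrightarrow> D (x \<oplus>\<^bsub>M\<^esub> y) = D x + D y"
    and D_mult: "\<And>x y. x \<in> carrier M \<Longrightarrow> y \<in> carrier M \<Longrightarrow> D (x \<otimes>\<^bsub>M\<^esub> y) = \<chi> x * D y + D x * \<chi> y"
    and D_smult: "\<And>r x. x \<in> carrier M \<Longrightarrow> D (r \<odot>\<^bsub>M\<^esub> x) = \<iota> r * D x"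
    and a: "a \<in> carrier M" and q: "q \<noteq> 0" and root: "alg_eval M q a = \<zero>\<^bsub>M\<^esub>"
  shows "D a = 0"
proof -
  define \<kappa>d where "\<kappa>d = (\<lambda>c. Dual (\<kappa> c) 0)"
  have \<kappa>d: "comm_ring_hom \<kappa>d" unfolding \<kappa>d_def by (rule dual_const_hom[OF \<kappa>])
  define \<rho> where "\<rho> x = Dual (\<chi> x) (D x)" for x
  have D1: "D \<one>\<^bsub>M\<^esub> = 0"
    using D_mult[of "\<one>\<^bsub>M\<^esub>" "\<one>\<^bsub>M\<^esub>"]
    by (simp add: class_alg_homD(3)[OF \<chi>]) (metis add_cancel_right_right one_add_one zero_neq_one)
  have \<rho>: "class_alg_hom (\<lambda>p. \<kappa>d (fps_to_fls p)) M \<rho>"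
    unfolding class_alg_hom_def class_ring_hom_def \<rho>_def \<kappa>d_def
    by (auto simp: class_alg_homD[OF \<chi>] D_add D_mult D_smult D1 \<iota>_def intro!: dual_eqI)
  define \<rho>' where "\<rho>' = loc.lift \<rho> (\<kappa>d (inverse fls_X))"
  note \<rho>' = GF_alg_hom[OF \<kappa>d \<rho>, folded \<rho>'_def]
  obtain \<Gamma> where GFa: "algebra class_ring GF" and \<Gamma>: "\<Gamma> \<subseteq> carrier GF" "genideal GF \<Gamma> = carrier GF"
      and ss: "\<And>g. g \<in> \<Gamma> \<Longrightarrow> standard_smooth (localization GF g)"
    using smooth unfolding smooth_algebra_def by blast
  interpret GFa: algebra class_ring GF by (rule GFa)
  \<comment> \<open>The cover generates the unit ideal, on which the real part of \<rho>' cannot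
    vanish.\<close>
  have "\<exists>g\<in>\<Gamma>. re_dual (\<rho>' g) \<noteq> 0"
  proof (rule ccontr)
    assume no: "\<not> ?thesis"
    let ?I = "{x \<in> carrier GF. \<rho>' x \<in> {z. re_dual z = 0}}"
    have "ideal ?I GF"
      by (rule GFa.class_ring_hom_vimage_ideal[OF class_alg_homD(5)[OF \<rho>'(1)]]) auto
    then have "genideal GF \<Gamma> \<subseteq> ?I"
      by (rule GFa.genideal_minimal) (use no \<Gamma>(1) in auto)
    then have "\<one>\<^bsub>GF\<^esub> \<in> ?I" unfolding \<Gamma>(2) by (rule subsetD) simp
    then show False by (simp add: class_alg_homD(3)[OF \<rho>'(1)])
  qed
  then obtain g where g: "g \<in> \<Gamma>" "re_dual (\<rho>' g) \<noteq> 0" by blast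
  from dual_unit[OF g(2)] obtain w where w: "\<rho>' g * w = 1" by blast
  have gc: "g \<in> carrier GF" using g(1) \<Gamma>(1) by blast
  interpret l2: localization_at GF g by unfold_locales (rule gc)
  note l2frac = l2.lift_frac[OF class_alg_homD(5)[OF \<rho>'(1)] w]
  have smult2: "r \<odot>\<^bsub>l2.L\<^esub> l2.fr x n = l2.fr (r \<odot>\<^bsub>GF\<^esub> x) n" if "x \<in> carrier GF" for r x n
  proof (rule l2.smult_L[OF that])
    show "r \<odot>\<^bsub>GF\<^esub> y \<in> carrier GF" if "y \<in> carrier GF" for y
      using GFa.smult_closed that by simp
    show "r \<odot>\<^bsub>GF\<^esub> (y \<otimes>\<^bsub>GF\<^esub> z) = y \<otimes>\<^bsub>GF\<^esub> (r \<odot>\<^bsub>GF\<^esub> z)" if "y \<in> carrier GF" "z \<in> carrier GF" for y z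
      using GFa.smult_assoc2[of r z y] GFa.m_comm[of "r \<odot>\<^bsub>GF\<^esub> z" y] GFa.m_comm[of z y] that
        GFa.smult_closed[of r z] by simp
  qed
  define \<rho>2 where "\<rho>2 = l2.lift \<rho>' w"
  have \<rho>2: "class_alg_hom \<kappa>d l2.L \<rho>2"
    unfolding class_alg_hom_def
  proof (intro conjI allI ballI)
    show "class_ring_hom l2.L \<rho>2"
      unfolding \<rho>2_def by (rule l2.lift_ring_hom[OF class_alg_homD(5)[OF \<rho>'(1)] w])
    fix r U assume "U \<in> carrier l2.L"
    then show "\<rho>2 (r \<odot>\<^bsub>l2.L\<^esub> U) = \<kappa>d r * \<rho>2 U"
    proof (rule l2.L_cases)
      fix x n assume x: "x \<in> carrier GF" "U = l2.fr x n"
      have "r \<odot>\<^bsub>GF\<^esub> x \<in> carrier GF" using GFa.smult_closed x(1) by simp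
      then show ?thesis
        unfolding \<rho>2_def x(2) smult2[OF x(1)] using x(1)
        by (simp add: l2frac class_alg_homD[OF \<rho>'(1)] mult.assoc)
    qed
  qed
  define i where "i x = loc.fr x 0" for x
  have ic: "i x \<in> carrier GF" if "x \<in> carrier M" for x
    unfolding i_def GF_simps by (rule loc.frac_in_L[OF that])
  have i_add: "i (x \<oplus>\<^bsub>M\<^esub> y) = i x \<oplus>\<^bsub>GF\<^esub> i y" and i_mult: "i (x \<otimes>\<^bsub>M\<^esub> y) = i x \<otimes>\<^bsub>GF\<^esub> i y"
    if "x \<in> carrier M" "y \<in> carrier M" for x y
    using that by (simp_all add: i_def GF_simps loc.add_L loc.mult_L)
  have i_one: "i \<one>\<^bsub>M\<^esub> = \<one>\<^bsub>GF\<^esub>" and i_zero: "i \<zero>\<^bsub>M\<^esub> = \<zero>\<^bsub>GF\<^esub>"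
    by (simp_all add: i_def GF_simps loc.one_L loc.zero_L)
  have i_smult: "i (r \<odot>\<^bsub>M\<^esub> x) = fps_to_fls r \<odot>\<^bsub>GF\<^esub> i x" if "x \<in> carrier M" for r x
  proof -
    have "nat (- fls_subdegree (fps_to_fls r)) = 0" by (simp add: fls_subdegree_fls_to_fps)
    then show ?thesis unfolding i_def smult_GF[OF that] by simp
  qed
  define j where "j x = l2.fr (i x) 0" for x
  have "eps_dual (\<rho>2 (j a)) = 0"
  proof (rule standard_smooth_point_derivation[OF \<kappa> _ _ algebra_axioms ss[OF g(1)] \<rho>2[unfolded \<kappa>d_def] _ _ _ _ _ _ a q root])
    show "comm_ring_hom (fps_to_fls :: 'k fps \<Rightarrow> _)"
      by (rule fps_to_fls_hom)
    show "inj (fps_to_fls :: 'k fps \<Rightarrow> _)" by (rule injI) simp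
    show "j x \<in> carrier l2.L" if "x \<in> carrier M" for x
      unfolding j_def by (rule l2.frac_in_L[OF ic[OF that]])
    show "j (x \<oplus>\<^bsub>M\<^esub> y) = j x \<oplus>\<^bsub>l2.L\<^esub> j y" if "x \<in> carrier M" "y \<in> carrier M" for x y
      using that by (simp add: j_def i_add l2.add_L ic)
    show "j (x \<otimes>\<^bsub>M\<^esub> y) = j x \<otimes>\<^bsub>l2.L\<^esub> j y" if "x \<in> carrier M" "y \<in> carrier M" for x y
      using that by (simp add: j_def i_mult l2.mult_L ic)
    show "j (r \<odot>\<^bsub>M\<^esub> \<one>\<^bsub>M\<^esub>) = fps_to_fls r \<odot>\<^bsub>l2.L\<^esub> \<one>\<^bsub>l2.L\<^esub>" for r
      by (simp add: j_def i_smult i_one smult2 l2.one_L)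
    show "j \<zero>\<^bsub>M\<^esub> = \<zero>\<^bsub>l2.L\<^esub>" by (simp add: j_def i_zero l2.zero_L)
    show "\<one>\<^bsub>l2.L\<^esub> \<in> carrier l2.L" unfolding l2.one_L by (rule l2.frac_in_L) simp
  qed
  moreover have "\<rho>2 (j a) = \<rho> a"
    unfolding \<rho>2_def j_def l2frac[OF ic[OF a]] using \<rho>'(2)[OF a, of 0] by (simp add: i_def)
  ultimately show ?thesis by (simp add: \<rho>_def)
qed

end

section \<open>Linear functionals on a finite algebra without point derivations\<close>

text \<open>The linear functional on polynomials that sends x^i to \<open>s i\<close>. It replaces
  polynomials in an operator: for \<open>s i\<close> = \<xi>(a^i x) it applies p of the
  multiplication by a.\<close>

definition seq_apply :: "'l::comm_ring_1 poly \<Rightarrow> (nat \<Rightarrow> 'l) \<Rightarrow> 'l" where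
  "seq_apply p s = (\<Sum>i\<le>degree p. coeff p i * s i)"

lemma seq_apply_bound: "degree p \<le> n \<Longrightarrow> seq_apply p s = (\<Sum>i\<le>n. coeff p i * s i)"
  unfolding seq_apply_def by (rule sum.mono_neutral_left) (auto simp: coeff_eq_0)

lemma seq_apply_pCons: "seq_apply (pCons c p) s = c * s 0 + seq_apply p (\<lambda>i. s (Suc i))"
proof -
  have "degree (pCons c p) \<le> Suc (degree p)" by (rule degree_pCons_le)
  from seq_apply_bound[OF this, of s] show ?thesis
    by (simp add: seq_apply_def sum.atMost_Suc_shift del: sum.atMost_Suc)
qed

text \<open>Multiplication by the variable is the shift of the sequence, so a linear factor can be
  moved from the polynomial onto the sequence.\<close>

lemma seq_apply_linear_factor:
  "seq_apply ([:- \<alpha>, 1:] * p) s = seq_apply p (\<lambda>i. s (Suc i) - \<alpha> * s i)"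
proof -
  let ?n = "Suc (degree p)"
  have eq: "[:- \<alpha>, 1:] * p = pCons 0 p - Polynomial.smult \<alpha> p" by simp
  have "degree (pCons 0 p) \<le> ?n" "degree (Polynomial.smult \<alpha> p) \<le> ?n"
    using degree_smult_le[of \<alpha> p] by (auto intro: degree_pCons_le le_SucI)
  then have "degree ([:- \<alpha>, 1:] * p) \<le> ?n" unfolding eq by (rule degree_diff_le)
  then have "seq_apply ([:- \<alpha>, 1:] * p) s = (\<Sum>i\<le>?n. coeff (pCons 0 p) i * s i) - \<alpha> * (\<Sum>i\<le>?n. coeff p i * s i)"
    using seq_apply_bound[of "[:- \<alpha>, 1:] * p" ?n s] unfolding eq
    by (simp add: sum_distrib_left sum_subtractf left_diff_distrib mult.assoc distrib_left del: sum.atMost_Suc)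
  also have "(\<Sum>i\<le>?n. coeff (pCons 0 p) i * s i) = seq_apply p (\<lambda>i. s (Suc i))"
    by (simp add: seq_apply_def sum.atMost_Suc_shift del: sum.atMost_Suc)
  also have "(\<Sum>i\<le>?n. coeff p i * s i) = seq_apply p s"
    by (rule seq_apply_bound[symmetric]) simp
  finally show ?thesis
    by (simp add: seq_apply_def sum_distrib_left sum_subtractf right_diff_distrib mult_ac)
qed

lemma lagrange_delta:
  fixes f :: "'x \<Rightarrow> 'l::field"
  assumes "finite H" "inj_on f H" "\<psi> \<in> H"
  shows "\<exists>p. \<forall>\<chi>\<in>H. poly p (f \<chi>) = (if \<chi> = \<psi> then 1 else 0)"
proof -
  define p where "p = (\<Prod>\<chi>\<in>H - {\<psi>}. [:- f \<chi>, 1:])"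
  have p: "poly p z = (\<Prod>\<chi>\<in>H - {\<psi>}. z - f \<chi>)" for z by (simp add: p_def poly_prod)
  have nz: "poly p (f \<psi>) \<noteq> 0" unfolding p using assms by (auto dest: inj_onD)
  have z: "poly p (f \<chi>) = 0" if "\<chi> \<in> H" "\<chi> \<noteq> \<psi>" for \<chi>
    unfolding p using that assms(1) by (intro prod_zero) auto
  show ?thesis
    by (rule exI[of _ "Polynomial.smult (1 / poly p (f \<psi>)) p"]) (use nz z in auto)
qed

text \<open>Multiplication by \<open>a\<close> shifts the sequence f(a^i x), so Horner's scheme
  matches on both sides. If q(a) = 0, this is a linear recurrence for the sequence.\<close>

lemma linear_alg_eval:
  assumes M: "algebra class_ring M" and \<iota>: "comm_ring_hom \<iota>"
    and f_add: "\<And>x y. x \<in> carrier M \<Longrightarrow> y \<in> carrier M \<Longrightarrow> f (x \<oplus>\<^bsub>M\<^esub> y) = f x + f y"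
    and f_smult: "\<And>r x. x \<in> carrier M \<Longrightarrow> f (r \<odot>\<^bsub>M\<^esub> x) = \<iota> r * f x"
    and a: "a \<in> carrier M" and x: "x \<in> carrier M"
  shows "seq_apply (map_poly \<iota> q) (\<lambda>i. f ((a [^]\<^bsub>M\<^esub> i) \<otimes>\<^bsub>M\<^esub> x)) = f (alg_eval M q a \<otimes>\<^bsub>M\<^esub> x)"
proof -
  interpret algebra class_ring M by (rule M)
  have f0: "f \<zero>\<^bsub>M\<^esub> = 0" using f_add[of "\<zero>\<^bsub>M\<^esub>" "\<zero>\<^bsub>M\<^esub>"] by simp
  show ?thesis
    using x
  proof (induction q arbitrary: x)
    case 0
    then show ?case by (simp add: seq_apply_def f0)
  next
    case (pCons c q)
    note cl = alg_eval_closed[OF M a, of q]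
    have cx: "c \<odot>\<^bsub>M\<^esub> x \<in> carrier M" "c \<odot>\<^bsub>M\<^esub> \<one>\<^bsub>M\<^esub> \<in> carrier M"
      using smult_closed[of c] pCons(3) by auto
    have eq: "a [^]\<^bsub>M\<^esub> (Suc i) \<otimes>\<^bsub>M\<^esub> x = (a [^]\<^bsub>M\<^esub> i) \<otimes>\<^bsub>M\<^esub> (a \<otimes>\<^bsub>M\<^esub> x)" for i
      using a pCons(3) by (simp add: m_assoc)
    have "alg_eval M (pCons c q) a \<otimes>\<^bsub>M\<^esub> x
        = ((c \<odot>\<^bsub>M\<^esub> \<one>\<^bsub>M\<^esub>) \<otimes>\<^bsub>M\<^esub> x) \<oplus>\<^bsub>M\<^esub> ((a \<otimes>\<^bsub>M\<^esub> alg_eval M q a) \<otimes>\<^bsub>M\<^esub> x)"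
      unfolding alg_eval_pCons[OF M a] using pCons(3) cl cx a by (intro l_distr) auto
    also have "(c \<odot>\<^bsub>M\<^esub> \<one>\<^bsub>M\<^esub>) \<otimes>\<^bsub>M\<^esub> x = c \<odot>\<^bsub>M\<^esub> x"
      using smult_assoc2[of c "\<one>\<^bsub>M\<^esub>" x] pCons(3) by simp
    also have "(a \<otimes>\<^bsub>M\<^esub> alg_eval M q a) \<otimes>\<^bsub>M\<^esub> x = alg_eval M q a \<otimes>\<^bsub>M\<^esub> (a \<otimes>\<^bsub>M\<^esub> x)"
      using a pCons(3) cl by (simp add: m_ac)
    finally have "alg_eval M (pCons c q) a \<otimes>\<^bsub>M\<^esub> x = (c \<odot>\<^bsub>M\<^esub> x) \<oplus>\<^bsub>M\<^esub> (alg_eval M q a \<otimes>\<^bsub>M\<^esub> (a \<otimes>\<^bsub>M\<^esub> x))" .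
    then have "f (alg_eval M (pCons c q) a \<otimes>\<^bsub>M\<^esub> x) = \<iota> c * f x + f (alg_eval M q a \<otimes>\<^bsub>M\<^esub> (a \<otimes>\<^bsub>M\<^esub> x))"
      using a pCons(3) cl cx by (simp add: f_add f_smult)
    moreover have "seq_apply (map_poly \<iota> q) (\<lambda>i. f (a [^]\<^bsub>M\<^esub> (Suc i) \<otimes>\<^bsub>M\<^esub> x)) = f (alg_eval M q a \<otimes>\<^bsub>M\<^esub> (a \<otimes>\<^bsub>M\<^esub> x))"
      unfolding eq using a pCons(3) by (intro pCons(2)) simp
    ultimately show ?case
      unfolding map_poly_pCons_hom[OF \<iota>] seq_apply_pCons
      using a pCons(3) by (simp del: nat_pow_Suc)
  qed
qed

section \<open>Finite algebras and their geometric points\<close>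

locale finite_class_algebra = algebra class_ring M
  for M :: "('r::comm_ring_1, 'b) module" (structure) +
  fixes \<iota> :: "'r \<Rightarrow> 'l::{alg_closed_field, field_char_0}" and E :: "'b set"
  assumes \<iota>: "comm_ring_hom \<iota>"
    and E: "finite E" "E \<subseteq> carrier M"
    and gen: "\<And>a. a \<in> carrier M \<Longrightarrow> \<exists>r. a = (\<Oplus>\<^bsub>M\<^esub>e\<in>E. r e \<odot>\<^bsub>M\<^esub> e)"
    and algebraic: "\<And>a. a \<in> carrier M \<Longrightarrow> \<exists>q. map_poly \<iota> q \<noteq> 0 \<and> alg_eval M q a = \<zero>\<^bsub>M\<^esub>"
begin

sublocale \<iota>: comm_ring_hom \<iota> by (rule \<iota>)

lemma smult_cl [simp, intro]: "x \<in> carrier M \<Longrightarrow> r \<odot>\<^bsub>M\<^esub> x \<in> carrier M"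
  using smult_closed by simp

text \<open>These are the elements of the dual of M \<otimes> L, described without the tensor
  product.\<close>

definition lin :: "('b \<Rightarrow> 'l) \<Rightarrow> bool" where
  "lin \<xi> \<longleftrightarrow> (\<forall>x\<in>carrier M. (\<forall>y\<in>carrier M. \<xi> (x \<oplus>\<^bsub>M\<^esub> y) = \<xi> x + \<xi> y) \<and> (\<forall>r. \<xi> (r \<odot>\<^bsub>M\<^esub> x) = \<iota> r * \<xi> x))"

text \<open>The value 0 outside the carrier makes a point unique as a function, so that the points
  form a finite set.\<close>

definition homs :: "('b \<Rightarrow> 'l) set" where
  "homs = {\<chi>. class_alg_hom \<iota> M \<chi> \<and> (\<forall>x. x \<notin> carrier M \<longrightarrow> \<chi> x = 0)}"

definition hom_span :: "('b \<Rightarrow> 'l) \<Rightarrow> bool" where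
  "hom_span \<xi> \<longleftrightarrow> (\<exists>c. \<forall>x\<in>carrier M. \<xi> x = (\<Sum>\<chi>\<in>homs. c \<chi> * \<chi> x))"

lemma linD:
  assumes "lin \<xi>"
  shows "x \<in> carrier M \<Longrightarrow> y \<in> carrier M \<Longrightarrow> \<xi> (x \<oplus>\<^bsub>M\<^esub> y) = \<xi> x + \<xi> y"
    and "x \<in> carrier M \<Longrightarrow> \<xi> (r \<odot>\<^bsub>M\<^esub> x) = \<iota> r * \<xi> x"
  using assms by (auto simp: lin_def)

lemma lin_zero: "lin \<xi> \<Longrightarrow> \<xi> \<zero>\<^bsub>M\<^esub> = 0"
  using linD(1)[of \<xi> "\<zero>\<^bsub>M\<^esub>" "\<zero>\<^bsub>M\<^esub>"] by simp

lemma mult_smult: "x \<in> carrier M \<Longrightarrow> a \<in> carrier M \<Longrightarrow> a \<otimes>\<^bsub>M\<^esub> (r \<odot>\<^bsub>M\<^esub> x) = r \<odot>\<^bsub>M\<^esub> (a \<otimes>\<^bsub>M\<^esub> x)"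
  using smult_assoc2[of r x a] m_comm[of "r \<odot>\<^bsub>M\<^esub> x" a] m_comm[of x a] by simp

lemma smult_mult: "x \<in> carrier M \<Longrightarrow> y \<in> carrier M \<Longrightarrow> (r \<odot>\<^bsub>M\<^esub> x) \<otimes>\<^bsub>M\<^esub> y = r \<odot>\<^bsub>M\<^esub> (x \<otimes>\<^bsub>M\<^esub> y)"
  using smult_assoc2[of r x y] by simp

lemma lin_add: "lin \<xi> \<Longrightarrow> lin \<mu> \<Longrightarrow> lin (\<lambda>x. \<xi> x + \<mu> x)"
  unfolding lin_def by (simp add: algebra_simps)

lemma lin_scale: "lin \<xi> \<Longrightarrow> lin (\<lambda>x. k * \<xi> x)"
  unfolding lin_def by (simp add: algebra_simps)

lemma lin_translate: "lin \<xi> \<Longrightarrow> a \<in> carrier M \<Longrightarrow> lin (\<lambda>x. \<xi> (a \<otimes>\<^bsub>M\<^esub> x))"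
  unfolding lin_def by (simp add: r_distr mult_smult)

lemma lin_finsum:
  "lin \<xi> \<Longrightarrow> (\<And>i. i \<in> I \<Longrightarrow> f i \<in> carrier M) \<Longrightarrow> \<xi> (\<Oplus>\<^bsub>M\<^esub>i\<in>I. f i) = (\<Sum>i\<in>I. \<xi> (f i))"
  by (induction I rule: infinite_finite_induct) (simp_all add: lin_zero linD Pi_def)

lemma lin_eq_on_gens:
  assumes "lin \<xi>" "lin \<mu>" "\<And>e. e \<in> E \<Longrightarrow> \<xi> e = \<mu> e" "x \<in> carrier M"
  shows "\<xi> x = \<mu> x"
proof -
  obtain r where x: "x = (\<Oplus>\<^bsub>M\<^esub>e\<in>E. r e \<odot>\<^bsub>M\<^esub> e)" using gen[OF assms(4)] by blast
  have *: "\<xi> x = (\<Sum>e\<in>E. \<iota> (r e) * \<xi> e)" if "lin \<xi>" for \<xi>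
    unfolding x using E(2) by (subst lin_finsum[OF that]) (auto simp: linD[OF that] intro!: sum.cong)
  show ?thesis unfolding *[OF assms(1)] *[OF assms(2)] using assms(3) by simp
qed

lemma hom_lin: "class_alg_hom \<iota> M \<chi> \<Longrightarrow> lin \<chi>"
  by (auto simp: lin_def class_alg_homD)

lemma homsD: "\<chi> \<in> homs \<Longrightarrow> class_alg_hom \<iota> M \<chi>"
  by (simp add: homs_def)

lemma lin_hom_combination: "I \<subseteq> homs \<Longrightarrow> lin (\<lambda>x. \<Sum>\<psi>\<in>I. d \<psi> * \<psi> x)"
proof (induction I rule: infinite_finite_induct)
  case (insert \<psi> I)
  then have "lin (\<lambda>x. \<Sum>\<psi>\<in>I. d \<psi> * \<psi> x)" "lin (\<lambda>x. d \<psi> * \<psi> x)"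
    using lin_scale[OF hom_lin[OF homsD], of \<psi> "d \<psi>"] by simp_all
  from lin_add[OF this(2,1)] have "lin (\<lambda>x. d \<psi> * \<psi> x + (\<Sum>\<psi>\<in>I. d \<psi> * \<psi> x))" .
  then show ?case using insert by simp
qed (simp_all add: lin_def)

lemma homs_eqI:
  assumes "\<chi> \<in> homs" "\<psi> \<in> homs" "\<And>x. x \<in> carrier M \<Longrightarrow> \<chi> x = \<psi> x"
  shows "\<chi> = \<psi>"
  using assms unfolding homs_def by (intro ext) (case_tac "x \<in> carrier M", auto)

text \<open>A point is determined by its values on the generators, and each value is a root of a
  fixed nonzero polynomial.\<close>

lemma finite_homs: "finite homs"
proof -
  obtain q where q: "\<And>a. a \<in> carrier M \<Longrightarrow> map_poly \<iota> (q a) \<noteq> 0 \<and> alg_eval M (q a) a = \<zero>\<^bsub>M\<^esub>"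
    using algebraic by metis
  let ?R = "\<lambda>e. {z. poly (map_poly \<iota> (q e)) z = 0}"
  have "(\<lambda>\<chi>. restrict \<chi> E) ` homs \<subseteq> PiE E ?R"
  proof (rule image_subsetI)
    fix \<chi> assume "\<chi> \<in> homs"
    then have h: "class_alg_hom \<iota> M \<chi>" by (rule homsD)
    have "poly (map_poly \<iota> (q e)) (\<chi> e) = 0" if "e \<in> E" for e
      using that E(2) q[of e] class_alg_hom_alg_eval[OF algebra_axioms \<iota> _ h, of e "q e"] lin_zero[OF hom_lin[OF h]]
      by auto
    then show "restrict \<chi> E \<in> PiE E ?R" by auto
  qed
  moreover have "finite (PiE E ?R)"
    using E q by (intro finite_PiE) (auto intro!: poly_roots_finite)
  ultimately have "finite ((\<lambda>\<chi>. restrict \<chi> E) ` homs)" by (rule finite_subset)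
  moreover have "inj_on (\<lambda>\<chi>. restrict \<chi> E) homs"
  proof (rule inj_onI)
    fix \<chi> \<psi> assume *: "\<chi> \<in> homs" "\<psi> \<in> homs" "restrict \<chi> E = restrict \<psi> E"
    have "\<chi> e = \<psi> e" if "e \<in> E" for e using fun_cong[OF *(3), of e] that by simp
    then show "\<chi> = \<psi>"
      using lin_eq_on_gens[OF hom_lin[OF homsD[OF *(1)]] hom_lin[OF homsD[OF *(2)]]]
      by (intro homs_eqI[OF *(1,2)]) blast
  qed
  ultimately show ?thesis by (rule finite_imageD)
qed

lemma hom_span_add: "hom_span \<xi> \<Longrightarrow> hom_span \<mu> \<Longrightarrow> hom_span (\<lambda>x. \<xi> x + \<mu> x)"
proof -
  assume "hom_span \<xi>" "hom_span \<mu>"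
  then obtain c d where "\<forall>x\<in>carrier M. \<xi> x = (\<Sum>\<chi>\<in>homs. c \<chi> * \<chi> x)"
    "\<forall>x\<in>carrier M. \<mu> x = (\<Sum>\<chi>\<in>homs. d \<chi> * \<chi> x)" unfolding hom_span_def by blast
  then show ?thesis unfolding hom_span_def
    by (intro exI[of _ "\<lambda>\<chi>. c \<chi> + d \<chi>"]) (simp add: distrib_right sum.distrib)
qed

lemma hom_span_scale: "hom_span \<xi> \<Longrightarrow> hom_span (\<lambda>x. k * \<xi> x)"
proof -
  assume "hom_span \<xi>"
  then obtain c where "\<forall>x\<in>carrier M. \<xi> x = (\<Sum>\<chi>\<in>homs. c \<chi> * \<chi> x)" unfolding hom_span_def by blast
  then show ?thesis unfolding hom_span_def
    by (intro exI[of _ "\<lambda>\<chi>. k * c \<chi>"]) (simp add: sum_distrib_left mult.assoc)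
qed

lemma hom_span_cong: "(\<And>x. x \<in> carrier M \<Longrightarrow> \<xi> x = \<mu> x) \<Longrightarrow> hom_span \<xi> \<longleftrightarrow> hom_span \<mu>"
  by (simp add: hom_span_def)

lemma hom_span_transfer:
  "hom_span \<mu> \<Longrightarrow> (\<And>x. x \<in> carrier M \<Longrightarrow> \<xi> x = \<mu> x) \<Longrightarrow> hom_span \<xi>"
  by (simp add: hom_span_def)

lemma hom_span_zero: "hom_span (\<lambda>x. 0)"
  unfolding hom_span_def by (intro exI[of _ "\<lambda>_. 0"]) simp

lemma hom_span_diff: "hom_span \<xi> \<Longrightarrow> hom_span \<mu> \<Longrightarrow> hom_span (\<lambda>x. \<xi> x - \<mu> x)"
  using hom_span_add[OF _ hom_span_scale[of \<mu> "-1"], of \<xi>] by simp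

lemma hom_span_sum: "(\<And>i. i \<in> I \<Longrightarrow> hom_span (f i)) \<Longrightarrow> hom_span (\<lambda>x. \<Sum>i\<in>I. f i x)"
  by (induction I rule: infinite_finite_induct) (simp_all add: hom_span_zero hom_span_add)

lemma hom_span_hom: "\<chi> \<in> homs \<Longrightarrow> hom_span \<chi>"
  unfolding hom_span_def
  by (intro exI[of _ "\<lambda>\<psi>. if \<psi> = \<chi> then 1 else 0"])
     (simp add: finite_homs if_distrib[of "\<lambda>x. x * _"] cong: if_cong)

lemma hom_span_translate:
  assumes "hom_span \<xi>" "a \<in> carrier M" shows "hom_span (\<lambda>x. \<xi> (a \<otimes>\<^bsub>M\<^esub> x))"
proof -
  obtain c where c: "\<forall>x\<in>carrier M. \<xi> x = (\<Sum>\<chi>\<in>homs. c \<chi> * \<chi> x)"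
    using assms(1) unfolding hom_span_def by blast
  show ?thesis unfolding hom_span_def
    using c assms(2) by (intro exI[of _ "\<lambda>\<chi>. c \<chi> * \<chi> a"])
      (auto intro!: sum.cong simp: class_alg_homD[OF homsD] mult.assoc)
qed

text \<open>A generic element avoids finitely many kernels. If \<open>z\<close> works for
  \<open>F\<close> and \<open>y\<close> for \<open>f\<close>, then y + n z works for all but
  finitely many integers n, which are distinct in characteristic zero.\<close>

lemma separating_element:
  assumes "finite F" "N \<subseteq> carrier M" "\<zero>\<^bsub>M\<^esub> \<in> N"
    and N_add: "\<And>x y. x \<in> N \<Longrightarrow> y \<in> N \<Longrightarrow> x \<oplus>\<^bsub>M\<^esub> y \<in> N"
    and N_smult: "\<And>r x. x \<in> N \<Longrightarrow> r \<odot>\<^bsub>M\<^esub> x \<in> N"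
    and "\<And>f. f \<in> F \<Longrightarrow> lin f \<and> (\<exists>y\<in>N. f y \<noteq> 0)"
  shows "\<exists>z\<in>N. \<forall>f\<in>F. f z \<noteq> 0"
  using assms(1,6)
proof (induction F)
  case empty
  then show ?case using assms(3) by blast
next
  case (insert f F)
  then obtain z where z: "z \<in> N" "\<forall>g\<in>F. g z \<noteq> 0" by blast
  obtain y where y: "y \<in> N" "f y \<noteq> 0" using insert by blast
  let ?B = "\<lambda>g :: 'b \<Rightarrow> 'l. {n::nat. g y + of_nat n * g z = 0}"
  \<comment> \<open>If g z = 0, then g y \<noteq> 0 and no n is excluded; otherwise at most one
    is.\<close>
  have B: "finite (?B g)" if nz: "g z \<noteq> 0 \<or> g y \<noteq> 0" for g
  proof (cases "g z = 0")
    case True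
    then show ?thesis using nz by simp
  next
    case False
    have "?B g \<subseteq> {n. (of_nat n :: 'l) = - g y / g z}"
      using False by (auto simp: field_simps eq_neg_iff_add_eq_0)
    moreover have "finite {n :: nat. (of_nat n :: 'l) = - g y / g z}"
    proof (cases "\<exists>m. (of_nat m :: 'l) = - g y / g z")
      case True
      then obtain m where m: "(of_nat m :: 'l) = - g y / g z" by blast
      have "{n :: nat. (of_nat n :: 'l) = - g y / g z} = {m}"
        unfolding m[symmetric] of_nat_eq_iff by simp
      then show ?thesis by simp
    qed simp
    ultimately show ?thesis by (rule finite_subset)
  qed
  have "finite (\<Union>g\<in>insert f F. ?B g)"
    using insert(1) y(2) z(2) by (intro finite_UN_I B) auto
  then obtain n where n: "n \<notin> (\<Union>g\<in>insert f F. ?B g)"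
    using ex_new_if_finite[OF infinite_UNIV_nat] by blast
  have "y \<oplus>\<^bsub>M\<^esub> (of_nat n \<odot>\<^bsub>M\<^esub> z) \<in> N" using y z by (intro N_add N_smult)
  moreover have "g (y \<oplus>\<^bsub>M\<^esub> (of_nat n \<odot>\<^bsub>M\<^esub> z)) \<noteq> 0" if g: "g \<in> insert f F" for g
  proof -
    have "lin g" using insert(4)[OF g] by blast
    then have "g (y \<oplus>\<^bsub>M\<^esub> (of_nat n \<odot>\<^bsub>M\<^esub> z)) = g y + of_nat n * g z"
      using y(1) z(1) assms(2) \<iota>.hom_of_nat[of n] by (auto simp: linD subsetD)
    then show ?thesis using n g by auto
  qed
  ultimately show ?case by blast
qed

lemma poly_weighted_zero:
  assumes "\<And>i. (\<Sum>\<chi>\<in>H. g \<chi> * f \<chi> ^ i) = (0 :: 'l)"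
  shows "(\<Sum>\<chi>\<in>H. g \<chi> * poly p (f \<chi>)) = 0"
proof -
  have "(\<Sum>\<chi>\<in>H. g \<chi> * poly p (f \<chi>)) = (\<Sum>i\<le>degree p. poly.coeff p i * (\<Sum>\<chi>\<in>H. g \<chi> * f \<chi> ^ i))"
    unfolding poly_altdef sum_distrib_left by (subst sum.swap) (simp add: mult_ac)
  then show ?thesis using assms by simp
qed

text \<open>The values at the powers of a separating \<theta> form a Vandermonde system; a Lagrange
  polynomial isolates a single coefficient.\<close>

lemma homs_independent:
  assumes \<theta>: "\<theta> \<in> carrier M" "inj_on (\<lambda>\<chi>. \<chi> \<theta>) homs"
    and zero: "\<And>x. x \<in> carrier M \<Longrightarrow> (\<Sum>\<chi>\<in>homs. g \<chi> * \<chi> x) = 0" and \<psi>: "\<psi> \<in> homs"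
  shows "g \<psi> = 0"
proof -
  have "(\<Sum>\<chi>\<in>homs. g \<chi> * \<chi> \<theta> ^ i) = 0" for i
  proof -
    have "(\<Sum>\<chi>\<in>homs. g \<chi> * \<chi> \<theta> ^ i) = (\<Sum>\<chi>\<in>homs. g \<chi> * \<chi> (\<theta> [^]\<^bsub>M\<^esub> i))"
      using \<theta>(1) by (intro sum.cong) (auto simp: class_ring_hom_pow[OF class_alg_homD(5)[OF homsD]])
    then show ?thesis using zero \<theta>(1) by simp
  qed
  note * = poly_weighted_zero[OF this]
  obtain p where p: "\<forall>\<chi>\<in>homs. poly p (\<chi> \<theta>) = (if \<chi> = \<psi> then 1 else 0)"
    using lagrange_delta[OF finite_homs \<theta>(2) \<psi>] by blast
  have "(\<Sum>\<chi>\<in>homs. g \<chi> * poly p (\<chi> \<theta>)) = (\<Sum>\<chi>\<in>homs. if \<chi> = \<psi> then g \<chi> else 0)"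
    by (rule sum.cong) (auto simp: p)
  then show ?thesis using *[of p] \<psi> finite_homs by simp
qed

text \<open>Subspaces of the dual that are closed under translation by \<open>M\<close>. The empty
  set qualifies too, so a member is always carried along separately.\<close>

definition stable :: "('b \<Rightarrow> 'l) set \<Rightarrow> bool" where
  "stable W \<longleftrightarrow> (\<forall>\<xi>\<in>W. lin \<xi> \<and> (\<forall>\<mu>\<in>W. (\<lambda>x. \<xi> x + \<mu> x) \<in> W) \<and> (\<forall>k. (\<lambda>x. k * \<xi> x) \<in> W) \<and>
     (\<forall>a\<in>carrier M. (\<lambda>x. \<xi> (a \<otimes>\<^bsub>M\<^esub> x)) \<in> W))"

lemma stableD:
  assumes "stable W" "\<xi> \<in> W"
  shows "lin \<xi>" and "\<mu> \<in> W \<Longrightarrow> (\<lambda>x. \<xi> x + \<mu> x) \<in> W" and "(\<lambda>x. k * \<xi> x) \<in> W"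
    and "a \<in> carrier M \<Longrightarrow> (\<lambda>x. \<xi> (a \<otimes>\<^bsub>M\<^esub> x)) \<in> W"
  using assms by (simp_all add: stable_def)

lemma stable_shift: "stable W \<Longrightarrow> \<xi> \<in> W \<Longrightarrow> a \<in> carrier M \<Longrightarrow> (\<lambda>x. \<xi> (a \<otimes>\<^bsub>M\<^esub> x) - \<alpha> * \<xi> x) \<in> W"
  using stableD(2)[OF _ stableD(4)[of W \<xi> a] stableD(3)[of W \<xi> "- \<alpha>"]] by simp

lemma lin_alg_eval:
  assumes \<xi>: "lin \<xi>" and a: "a \<in> carrier M" and x: "x \<in> carrier M"
  shows "seq_apply (map_poly \<iota> q) (\<lambda>i. \<xi> ((a [^]\<^bsub>M\<^esub> i) \<otimes>\<^bsub>M\<^esub> x)) = \<xi> (alg_eval M q a \<otimes>\<^bsub>M\<^esub> x)"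
  by (rule linear_alg_eval[OF algebra_axioms \<iota> linD[OF \<xi>] a x])

text \<open>The polynomial of \<open>a\<close> annihilates \<xi>. Its linear factors are applied to
  \<xi> one at a time; the last functional outside the span is an eigenvector modulo the
  span.\<close>

lemma eigenvector_mod_span:
  assumes W: "stable W" and a: "a \<in> carrier M" and \<xi>: "\<xi> \<in> W" "\<not> hom_span \<xi>"
  shows "\<exists>\<alpha>. \<exists>\<mu>\<in>W. \<not> hom_span \<mu> \<and> hom_span (\<lambda>x. \<mu> (a \<otimes>\<^bsub>M\<^esub> x) - \<alpha> * \<mu> x)"
proof -
  have *: "\<exists>\<alpha>. \<exists>\<mu>\<in>W. \<not> hom_span \<mu> \<and> hom_span (\<lambda>x. \<mu> (a \<otimes>\<^bsub>M\<^esub> x) - \<alpha> * \<mu> x)"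
    if "p \<noteq> 0" "\<xi> \<in> W" "\<not> hom_span \<xi>"
      "\<And>x. x \<in> carrier M \<Longrightarrow> seq_apply p (\<lambda>i. \<xi> ((a [^]\<^bsub>M\<^esub> i) \<otimes>\<^bsub>M\<^esub> x)) = 0" for p \<xi>
    using that
  proof (induction "degree p" arbitrary: p \<xi>)
    case 0
    then obtain k where p: "p = [:k:]" "k \<noteq> 0" by (metis degree_eq_zeroE pCons_0_0)
    have "\<xi> x = 0" if "x \<in> carrier M" for x
      using 0(5)[OF that] that p by (simp add: seq_apply_def)
    then have "hom_span \<xi> \<longleftrightarrow> hom_span (\<lambda>x. 0)" by (rule hom_span_cong)
    then show ?case using 0(4) hom_span_zero by simp
  next
    case (Suc d)
    obtain \<alpha> where "poly p \<alpha> = 0" using Suc(2) by (metis alg_closed_imp_poly_has_root zero_less_Suc)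
    then obtain p1 where p1: "p = [:-\<alpha>, 1:] * p1" by (metis dvdE poly_eq_0_iff_dvd)
    then have p10: "p1 \<noteq> 0" using Suc(3) by auto
    have deg: "d = degree p1" using Suc(2) p10 unfolding p1 by (subst (asm) degree_mult_eq) auto
    define \<mu> where "\<mu> = (\<lambda>x. \<xi> (a \<otimes>\<^bsub>M\<^esub> x) - \<alpha> * \<xi> x)"
    have \<mu>W: "\<mu> \<in> W" unfolding \<mu>_def by (rule stable_shift[OF W Suc(4) a])
    show ?case
    proof (cases "hom_span \<mu>")
      case True
      then show ?thesis using Suc(4,5) unfolding \<mu>_def by blast
    next
      case False
      show ?thesis
      proof (rule Suc(1)[OF deg p10 \<mu>W False])
        fix x assume x: "x \<in> carrier M"
        have "(\<lambda>i. \<mu> ((a [^]\<^bsub>M\<^esub> i) \<otimes>\<^bsub>M\<^esub> x)) = (\<lambda>i. \<xi> ((a [^]\<^bsub>M\<^esub> Suc i) \<otimes>\<^bsub>M\<^esub> x) - \<alpha> * \<xi> ((a [^]\<^bsub>M\<^esub> i) \<otimes>\<^bsub>M\<^esub> x))"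
          using a x by (simp add: \<mu>_def m_ac)
        then show "seq_apply p1 (\<lambda>i. \<mu> ((a [^]\<^bsub>M\<^esub> i) \<otimes>\<^bsub>M\<^esub> x)) = 0"
          using Suc(6)[OF x] unfolding p1 seq_apply_linear_factor by simp
      qed
    qed
  qed
  obtain q where q: "map_poly \<iota> q \<noteq> 0" "alg_eval M q a = \<zero>\<^bsub>M\<^esub>" using algebraic[OF a] by blast
  have "lin \<xi>" using W \<xi>(1) unfolding stable_def by blast
  then have "seq_apply (map_poly \<iota> q) (\<lambda>i. \<xi> ((a [^]\<^bsub>M\<^esub> i) \<otimes>\<^bsub>M\<^esub> x)) = 0" if "x \<in> carrier M" for x
    using lin_alg_eval[OF _ a that, of \<xi> q] that q(2) by (simp add: lin_zero)
  from *[OF q(1) \<xi> this] show ?thesis .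
qed

text \<open>Translations commute, so the eigenvectors of one translation modulo the span again form
  a stable set, in which the next generator finds an eigenvector.\<close>

lemma common_eigenvector_gens:
  assumes \<xi>: "lin \<xi>" "\<not> hom_span \<xi>" and F: "finite F" "F \<subseteq> carrier M"
  shows "\<exists>W \<alpha>. stable W \<and> (\<exists>\<mu>\<in>W. \<not> hom_span \<mu>) \<and>
    (\<forall>e\<in>F. \<forall>\<mu>\<in>W. hom_span (\<lambda>x. \<mu> (e \<otimes>\<^bsub>M\<^esub> x) - \<alpha> e * \<mu> x))"
  using F
proof (induction F)
  case empty
  have "stable (Collect lin)"
    unfolding stable_def by (simp add: lin_add lin_scale lin_translate)
  then show ?case using \<xi> by (intro exI[of _ "Collect lin"]) auto
next
  case (insert e F)
  then obtain W \<alpha> \<mu> where W: "stable W" "\<mu> \<in> W" "\<not> hom_span \<mu>"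
    and eig: "\<forall>e\<in>F. \<forall>\<mu>\<in>W. hom_span (\<lambda>x. \<mu> (e \<otimes>\<^bsub>M\<^esub> x) - \<alpha> e * \<mu> x)" by auto
  have e: "e \<in> carrier M" using insert by simp
  from eigenvector_mod_span[OF W(1) e W(2,3)] obtain k \<nu> where
    \<nu>: "\<nu> \<in> W" "\<not> hom_span \<nu>" "hom_span (\<lambda>x. \<nu> (e \<otimes>\<^bsub>M\<^esub> x) - k * \<nu> x)" by blast
  define W' where "W' = {\<mu> \<in> W. hom_span (\<lambda>x. \<mu> (e \<otimes>\<^bsub>M\<^esub> x) - k * \<mu> x)}"
  have "stable W'"
    unfolding stable_def
  proof (intro ballI conjI allI)
    fix \<mu> assume \<mu>: "\<mu> \<in> W'"
    then have \<mu>W: "\<mu> \<in> W" and hs: "hom_span (\<lambda>x. \<mu> (e \<otimes>\<^bsub>M\<^esub> x) - k * \<mu> x)" by (auto simp: W'_def)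
    show "lin \<mu>" by (rule stableD(1)[OF W(1) \<mu>W])
    fix c
    have "(\<lambda>x. c * \<mu> x) \<in> W" by (rule stableD(3)[OF W(1) \<mu>W])
    moreover have "hom_span (\<lambda>x. c * \<mu> (e \<otimes>\<^bsub>M\<^esub> x) - k * (c * \<mu> x))"
      using hom_span_scale[OF hs, of c] by (simp add: right_diff_distrib mult_ac)
    ultimately show "(\<lambda>x. c * \<mu> x) \<in> W'" by (simp add: W'_def)
  next
    fix \<mu> \<nu> assume \<mu>: "\<mu> \<in> W'" and \<nu>: "\<nu> \<in> W'"
    have "(\<lambda>x. \<mu> x + \<nu> x) \<in> W"
      using \<mu> \<nu> by (intro stableD(2)[OF W(1)]) (auto simp: W'_def)
    moreover have "hom_span (\<lambda>x. (\<mu> (e \<otimes>\<^bsub>M\<^esub> x) - k * \<mu> x) + (\<nu> (e \<otimes>\<^bsub>M\<^esub> x) - k * \<nu> x))"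
      using \<mu> \<nu> by (intro hom_span_add) (auto simp: W'_def)
    ultimately show "(\<lambda>x. \<mu> x + \<nu> x) \<in> W'" by (simp add: W'_def algebra_simps)
  next
    fix \<mu> a assume \<mu>: "\<mu> \<in> W'" and a: "a \<in> carrier M"
    have "(\<lambda>x. \<mu> (a \<otimes>\<^bsub>M\<^esub> x)) \<in> W"
      using \<mu> by (intro stableD(4)[OF W(1) _ a]) (simp add: W'_def)
    moreover have "hom_span (\<lambda>x. \<mu> (e \<otimes>\<^bsub>M\<^esub> (a \<otimes>\<^bsub>M\<^esub> x)) - k * \<mu> (a \<otimes>\<^bsub>M\<^esub> x))"
      using \<mu> by (intro hom_span_translate[OF _ a, of "\<lambda>x. \<mu> (e \<otimes>\<^bsub>M\<^esub> x) - k * \<mu> x"]) (simp add: W'_def)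
    moreover have "\<mu> (e \<otimes>\<^bsub>M\<^esub> (a \<otimes>\<^bsub>M\<^esub> x)) = \<mu> (a \<otimes>\<^bsub>M\<^esub> (e \<otimes>\<^bsub>M\<^esub> x))" if "x \<in> carrier M" for x
      using m_lcomm[OF e a that] by simp
    ultimately show "(\<lambda>x. \<mu> (a \<otimes>\<^bsub>M\<^esub> x)) \<in> W'"
      unfolding W'_def
      using hom_span_cong[of "\<lambda>x. \<mu> (e \<otimes>\<^bsub>M\<^esub> (a \<otimes>\<^bsub>M\<^esub> x)) - k * \<mu> (a \<otimes>\<^bsub>M\<^esub> x)" "\<lambda>x. \<mu> (a \<otimes>\<^bsub>M\<^esub> (e \<otimes>\<^bsub>M\<^esub> x)) - k * \<mu> (a \<otimes>\<^bsub>M\<^esub> x)"]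
      by simp
  qed
  then show ?case
    using \<nu> eig insert(2)
    by (intro exI[of _ W'] exI[of _ "\<alpha>(e := k)"]) (auto simp: W'_def)
qed

text \<open>Eigenvalues on the generators combine to eigenvalues of all translations. Since \<mu>
  lies outside the span, each eigenvalue is unique, and uniqueness makes it additive, multiplicative
  and linear in the element: it is a point.\<close>

lemma common_eigenvector:
  assumes \<xi>: "lin \<xi>" "\<not> hom_span \<xi>"
  shows "\<exists>\<mu>. \<exists>\<chi>\<in>homs. lin \<mu> \<and> \<not> hom_span \<mu> \<and>
    (\<forall>a\<in>carrier M. hom_span (\<lambda>x. \<mu> (a \<otimes>\<^bsub>M\<^esub> x) - \<chi> a * \<mu> x))"
proof -
  obtain W \<alpha> \<mu> where W: "stable W" "\<mu> \<in> W" "\<not> hom_span \<mu>"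
    and eig: "\<And>e. e \<in> E \<Longrightarrow> hom_span (\<lambda>x. \<mu> (e \<otimes>\<^bsub>M\<^esub> x) - \<alpha> e * \<mu> x)"
    using common_eigenvector_gens[OF \<xi> E] by blast
  have \<mu>: "lin \<mu>" using W(1,2) unfolding stable_def by blast
  have ex: "\<exists>k. hom_span (\<lambda>x. \<mu> (a \<otimes>\<^bsub>M\<^esub> x) - k * \<mu> x)" if a: "a \<in> carrier M" for a
  proof -
    obtain r where r: "a = (\<Oplus>\<^bsub>M\<^esub>e\<in>E. r e \<odot>\<^bsub>M\<^esub> e)" using gen[OF a] by blast
    have "hom_span (\<lambda>x. \<Sum>e\<in>E. \<iota> (r e) * (\<mu> (e \<otimes>\<^bsub>M\<^esub> x) - \<alpha> e * \<mu> x))"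
      by (intro hom_span_sum hom_span_scale eig)
    moreover have "(\<Sum>e\<in>E. \<iota> (r e) * (\<mu> (e \<otimes>\<^bsub>M\<^esub> x) - \<alpha> e * \<mu> x))
        = \<mu> (a \<otimes>\<^bsub>M\<^esub> x) - (\<Sum>e\<in>E. \<iota> (r e) * \<alpha> e) * \<mu> x" if x: "x \<in> carrier M" for x
    proof -
      have "a \<otimes>\<^bsub>M\<^esub> x = (\<Oplus>\<^bsub>M\<^esub>e\<in>E. (r e \<odot>\<^bsub>M\<^esub> e) \<otimes>\<^bsub>M\<^esub> x)"
        unfolding r using E x by (intro finsum_ldistr) auto
      also have "\<mu> \<dots> = (\<Sum>e\<in>E. \<mu> ((r e \<odot>\<^bsub>M\<^esub> e) \<otimes>\<^bsub>M\<^esub> x))"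
        using E x by (intro lin_finsum[OF \<mu>]) auto
      also have "\<dots> = (\<Sum>e\<in>E. \<iota> (r e) * \<mu> (e \<otimes>\<^bsub>M\<^esub> x))"
        using E x by (intro sum.cong) (simp_all add: linD[OF \<mu>] subsetD smult_mult)
      finally show ?thesis
        by (simp add: right_diff_distrib sum_subtractf sum_distrib_right mult.assoc)
    qed
    ultimately show ?thesis
      using hom_span_cong[of "\<lambda>x. \<Sum>e\<in>E. \<iota> (r e) * (\<mu> (e \<otimes>\<^bsub>M\<^esub> x) - \<alpha> e * \<mu> x)"
        "\<lambda>x. \<mu> (a \<otimes>\<^bsub>M\<^esub> x) - (\<Sum>e\<in>E. \<iota> (r e) * \<alpha> e) * \<mu> x"] by blast
  qed
  \<comment> \<open>The default 0 puts \<chi> into the normal form required by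
    \<open>homs\<close>.\<close>
  define \<chi> where "\<chi> a = (if a \<in> carrier M then SOME k. hom_span (\<lambda>x. \<mu> (a \<otimes>\<^bsub>M\<^esub> x) - k * \<mu> x) else 0)" for a
  have \<chi>: "hom_span (\<lambda>x. \<mu> (a \<otimes>\<^bsub>M\<^esub> x) - \<chi> a * \<mu> x)" if "a \<in> carrier M" for a
    using someI_ex[OF ex[OF that]] that by (simp add: \<chi>_def)
  have uniq: "\<chi> a = k" if a: "a \<in> carrier M" and k: "hom_span (\<lambda>x. \<mu> (a \<otimes>\<^bsub>M\<^esub> x) - k * \<mu> x)" for a k
  proof (rule ccontr)
    assume ne: "\<chi> a \<noteq> k"
    have "hom_span (\<lambda>x. (\<mu> (a \<otimes>\<^bsub>M\<^esub> x) - k * \<mu> x) - (\<mu> (a \<otimes>\<^bsub>M\<^esub> x) - \<chi> a * \<mu> x))"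
      by (rule hom_span_diff[OF k \<chi>[OF a]])
    from hom_span_scale[OF this, of "1 / (\<chi> a - k)"]
    have "hom_span (\<lambda>x. 1 / (\<chi> a - k) * ((\<chi> a - k) * \<mu> x))" by (simp add: algebra_simps)
    then have "hom_span \<mu>" using ne by simp
    then show False using W(3) by blast
  qed
  have "class_alg_hom \<iota> M \<chi>"
    unfolding class_alg_hom_def class_ring_hom_def
  proof (intro conjI ballI allI)
    fix a b assume a: "a \<in> carrier M" and b: "b \<in> carrier M"
    have "hom_span (\<lambda>x. (\<mu> (a \<otimes>\<^bsub>M\<^esub> x) - \<chi> a * \<mu> x) + (\<mu> (b \<otimes>\<^bsub>M\<^esub> x) - \<chi> b * \<mu> x))"
      by (intro hom_span_add \<chi> a b)
    then have h: "hom_span (\<lambda>x. \<mu> ((a \<oplus>\<^bsub>M\<^esub> b) \<otimes>\<^bsub>M\<^esub> x) - (\<chi> a + \<chi> b) * \<mu> x)"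
      by (rule hom_span_transfer) (simp add: a b l_distr linD[OF \<mu>] algebra_simps)
    show "\<chi> (a \<oplus>\<^bsub>M\<^esub> b) = \<chi> a + \<chi> b" by (rule uniq[OF _ h]) (simp add: a b)
    have "hom_span (\<lambda>x. (\<mu> (a \<otimes>\<^bsub>M\<^esub> (b \<otimes>\<^bsub>M\<^esub> x)) - \<chi> a * \<mu> (b \<otimes>\<^bsub>M\<^esub> x)) + \<chi> a * (\<mu> (b \<otimes>\<^bsub>M\<^esub> x) - \<chi> b * \<mu> x))"
      by (rule hom_span_add[OF hom_span_translate[OF \<chi>[OF a] b] hom_span_scale[OF \<chi>[OF b]]])
    then have h: "hom_span (\<lambda>x. \<mu> ((a \<otimes>\<^bsub>M\<^esub> b) \<otimes>\<^bsub>M\<^esub> x) - (\<chi> a * \<chi> b) * \<mu> x)"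
      by (rule hom_span_transfer) (simp add: a b m_assoc right_diff_distrib mult.assoc)
    show "\<chi> (a \<otimes>\<^bsub>M\<^esub> b) = \<chi> a * \<chi> b" by (rule uniq[OF _ h]) (simp add: a b)
  next
    have h: "hom_span (\<lambda>x. \<mu> (\<one>\<^bsub>M\<^esub> \<otimes>\<^bsub>M\<^esub> x) - 1 * \<mu> x)"
      by (rule hom_span_transfer[OF hom_span_zero]) simp
    show "\<chi> \<one>\<^bsub>M\<^esub> = 1" by (rule uniq[OF _ h]) simp
  next
    fix r a assume a: "a \<in> carrier M"
    have "hom_span (\<lambda>x. \<iota> r * (\<mu> (a \<otimes>\<^bsub>M\<^esub> x) - \<chi> a * \<mu> x))"
      by (rule hom_span_scale[OF \<chi>[OF a]])
    then have h: "hom_span (\<lambda>x. \<mu> ((r \<odot>\<^bsub>M\<^esub> a) \<otimes>\<^bsub>M\<^esub> x) - (\<iota> r * \<chi> a) * \<mu> x)"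
      by (rule hom_span_transfer) (simp add: a smult_mult linD[OF \<mu>] right_diff_distrib mult.assoc)
    show "\<chi> (r \<odot>\<^bsub>M\<^esub> a) = \<iota> r * \<chi> a" by (rule uniq[OF _ h]) (simp add: a)
  qed
  then have "\<chi> \<in> homs" by (simp add: homs_def \<chi>_def)
  then show ?thesis using \<mu> W(3) \<chi> by blast
qed

text \<open>The generic choice is applied to differences of points, but only for pairs that differ
  on \<open>N\<close>; the other pairs cannot be separated inside \<open>N\<close>.\<close>

lemma separating_element_homs:
  assumes N: "N \<subseteq> carrier M" "\<zero>\<^bsub>M\<^esub> \<in> N" "\<And>x y. x \<in> N \<Longrightarrow> y \<in> N \<Longrightarrow> x \<oplus>\<^bsub>M\<^esub> y \<in> N"
      "\<And>r x. x \<in> N \<Longrightarrow> r \<odot>\<^bsub>M\<^esub> x \<in> N"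
  shows "\<exists>\<theta>\<in>N. \<forall>\<chi>\<in>homs. \<forall>\<psi>\<in>homs. \<chi> \<theta> = \<psi> \<theta> \<longrightarrow> (\<forall>x\<in>N. \<chi> x = \<psi> x)"
proof -
  define P where "P = {q \<in> homs \<times> homs. \<exists>y\<in>N. fst q y \<noteq> snd q y}"
  define F where "F = (\<lambda>q x. fst q x - snd q x) ` P"
  have "finite P"
    unfolding P_def by (rule finite_subset[OF _ finite_cartesian_product[OF finite_homs finite_homs]]) blast
  then have "finite F" unfolding F_def by (rule finite_imageI)
  moreover have "lin f \<and> (\<exists>y\<in>N. f y \<noteq> 0)" if "f \<in> F" for f
  proof -
    from that obtain q where q: "q \<in> P" and f: "f = (\<lambda>x. fst q x - snd q x)"
      unfolding F_def by (elim imageE)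
    have l: "lin (fst q)" "lin (snd q)"
      using q unfolding P_def by (simp_all add: hom_lin homsD mem_Times_iff)
    have "lin f" using lin_add[OF l(1) lin_scale[OF l(2), of "-1"]] by (simp add: f)
    then show ?thesis using q unfolding f P_def by simp
  qed
  ultimately obtain z where z: "z \<in> N" "\<forall>f\<in>F. f z \<noteq> 0"
    using separating_element[OF _ N] by metis
  have "\<chi> x = \<psi> x" if "\<chi> \<in> homs" "\<psi> \<in> homs" "\<chi> z = \<psi> z" "x \<in> N" for \<chi> \<psi> x
  proof (rule ccontr)
    assume "\<chi> x \<noteq> \<psi> x"
    then have "(\<chi>, \<psi>) \<in> P" using that unfolding P_def by auto
    then have "(\<lambda>x. \<chi> x - \<psi> x) \<in> F" unfolding F_def by (rule rev_image_eqI) simp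
    then show False using z(2) that(3) by fastforce
  qed
  then show ?thesis using z(1) by blast
qed

lemma homs_separating_element: "\<exists>\<theta>\<in>carrier M. inj_on (\<lambda>\<chi>. \<chi> \<theta>) homs"
proof -
  from separating_element_homs[of "carrier M"] obtain z where z: "z \<in> carrier M"
    "\<forall>\<chi>\<in>homs. \<forall>\<psi>\<in>homs. \<chi> z = \<psi> z \<longrightarrow> (\<forall>x\<in>carrier M. \<chi> x = \<psi> x)" by auto
  then have "inj_on (\<lambda>\<chi>. \<chi> z) homs" by (intro inj_onI homs_eqI) blast+
  then show ?thesis using z(1) by blast
qed

text \<open>
  The translations have a common eigenvector modulo the span of the points; if its eigenvalue is
  \<open>\<chi>\<close>, it yields a point derivation at \<open>\<chi>\<close>.
\<close>

theorem functionals_spanned_by_homs: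
  assumes no_derivations: "\<And>\<chi> D a. class_alg_hom \<iota> M \<chi> \<Longrightarrow> lin D \<Longrightarrow>
      (\<And>x y. x \<in> carrier M \<Longrightarrow> y \<in> carrier M \<Longrightarrow> D (x \<otimes>\<^bsub>M\<^esub> y) = \<chi> x * D y + D x * \<chi> y) \<Longrightarrow>
      a \<in> carrier M \<Longrightarrow> D a = 0"
    and \<xi>: "lin \<xi>"
  shows "hom_span \<xi>"
proof (rule ccontr)
  assume "\<not> hom_span \<xi>"
  from common_eigenvector[OF \<xi> this] obtain \<mu> \<chi> where \<mu>: "lin \<mu>" "\<not> hom_span \<mu>" and \<chi>: "\<chi> \<in> homs"
    and eig: "\<And>a. a \<in> carrier M \<Longrightarrow> hom_span (\<lambda>x. \<mu> (a \<otimes>\<^bsub>M\<^esub> x) - \<chi> a * \<mu> x)" by blast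
  note \<chi>h = homsD[OF \<chi>]
  obtain \<theta> where \<theta>: "\<theta> \<in> carrier M" "inj_on (\<lambda>\<chi>. \<chi> \<theta>) homs" using homs_separating_element by blast
  obtain c where c: "\<And>x. x \<in> carrier M \<Longrightarrow> \<mu> (\<theta> \<otimes>\<^bsub>M\<^esub> x) - \<chi> \<theta> * \<mu> x = (\<Sum>\<psi>\<in>homs. c \<psi> * \<psi> x)"
    using eig[OF \<theta>(1)] unfolding hom_span_def by blast
  have ne: "\<psi> \<theta> - \<chi> \<theta> \<noteq> 0" if "\<psi> \<in> homs" "\<psi> \<noteq> \<chi>" for \<psi>
    using \<theta>(2) that \<chi> by (auto dest: inj_onD)
  \<comment> \<open>The components of (\<theta> - \<chi> \<theta>)\<mu> at the other points are
    divided by \<psi> \<theta> - \<chi> \<theta>. After \<open>s\<close> is subtracted from \<mu>,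
    only a multiple of \<chi> is left.\<close>
  define s where "s x = (\<Sum>\<psi>\<in>homs - {\<chi>}. c \<psi> / (\<psi> \<theta> - \<chi> \<theta>) * \<psi> x)" for x
  have s_lin: "lin s"
    unfolding s_def by (rule lin_hom_combination) auto
  have s_span: "hom_span s"
    unfolding s_def by (intro hom_span_sum hom_span_scale hom_span_hom) auto
  have s_\<theta>: "s (\<theta> \<otimes>\<^bsub>M\<^esub> x) - \<chi> \<theta> * s x = (\<Sum>\<psi>\<in>homs - {\<chi>}. c \<psi> * \<psi> x)" if x: "x \<in> carrier M" for x
    unfolding s_def sum_distrib_left sum_subtractf[symmetric]
  proof (rule sum.cong[OF refl])
    fix \<psi> assume "\<psi> \<in> homs - {\<chi>}"
    then have \<psi>: "\<psi> \<in> homs" "\<psi> \<noteq> \<chi>" by auto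
    have "c \<psi> / (\<psi> \<theta> - \<chi> \<theta>) * \<psi> (\<theta> \<otimes>\<^bsub>M\<^esub> x) - \<chi> \<theta> * (c \<psi> / (\<psi> \<theta> - \<chi> \<theta>) * \<psi> x)
      = c \<psi> / (\<psi> \<theta> - \<chi> \<theta>) * ((\<psi> \<theta> - \<chi> \<theta>) * \<psi> x)"
      using class_alg_homD(1)[OF homsD[OF \<psi>(1)] \<theta>(1) x] by (simp add: algebra_simps)
    also have "\<dots> = c \<psi> * \<psi> x" using ne[OF \<psi>] by simp
    finally show "c \<psi> / (\<psi> \<theta> - \<chi> \<theta>) * \<psi> (\<theta> \<otimes>\<^bsub>M\<^esub> x) - \<chi> \<theta> * (c \<psi> / (\<psi> \<theta> - \<chi> \<theta>) * \<psi> x) = c \<psi> * \<psi> x" .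
  qed
  define \<nu> where "\<nu> x = \<mu> x - s x" for x
  have \<nu>_lin: "lin \<nu>"
    unfolding lin_def \<nu>_def by (auto simp: linD[OF \<mu>(1)] linD[OF s_lin] right_diff_distrib)
  have \<nu>_span: "\<not> hom_span \<nu>"
    using hom_span_add[OF _ s_span, of \<nu>] \<mu>(2) by (auto simp: \<nu>_def)
  have \<nu>_\<theta>: "\<nu> (\<theta> \<otimes>\<^bsub>M\<^esub> x) - \<chi> \<theta> * \<nu> x = c \<chi> * \<chi> x" if x: "x \<in> carrier M" for x
  proof -
    have "\<nu> (\<theta> \<otimes>\<^bsub>M\<^esub> x) - \<chi> \<theta> * \<nu> x
        = (\<mu> (\<theta> \<otimes>\<^bsub>M\<^esub> x) - \<chi> \<theta> * \<mu> x) - (s (\<theta> \<otimes>\<^bsub>M\<^esub> x) - \<chi> \<theta> * s x)"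
      by (simp add: \<nu>_def algebra_simps)
    also have "\<dots> = c \<chi> * \<chi> x"
      unfolding c[OF x] s_\<theta>[OF x] using sum.remove[OF finite_homs \<chi>, of "\<lambda>\<psi>. c \<psi> * \<psi> x"] by simp
    finally show ?thesis .
  qed
  \<comment> \<open>Applying \<theta> - \<chi> \<theta> to the expansion and commuting it past a -
    \<chi> a gives 0, because a - \<chi> a kills \<chi>. Independence of the points then leaves only
    the \<chi>-component.\<close>
  have "\<exists>d. \<forall>x\<in>carrier M. \<nu> (a \<otimes>\<^bsub>M\<^esub> x) - \<chi> a * \<nu> x = d * \<chi> x" if a: "a \<in> carrier M" for a
  proof -
    have "hom_span (\<lambda>x. (\<mu> (a \<otimes>\<^bsub>M\<^esub> x) - \<chi> a * \<mu> x) - (s (a \<otimes>\<^bsub>M\<^esub> x) - \<chi> a * s x))"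
      by (intro hom_span_diff eig a hom_span_translate hom_span_scale s_span)
    then obtain d where d': "\<forall>x\<in>carrier M. (\<mu> (a \<otimes>\<^bsub>M\<^esub> x) - \<chi> a * \<mu> x) - (s (a \<otimes>\<^bsub>M\<^esub> x) - \<chi> a * s x) = (\<Sum>\<psi>\<in>homs. d \<psi> * \<psi> x)"
      unfolding hom_span_def by blast
    have d: "\<nu> (a \<otimes>\<^bsub>M\<^esub> x) - \<chi> a * \<nu> x = (\<Sum>\<psi>\<in>homs. d \<psi> * \<psi> x)" if "x \<in> carrier M" for x
      unfolding d'[rule_format, OF that, symmetric] by (simp add: \<nu>_def algebra_simps)
    have "(\<Sum>\<psi>\<in>homs. d \<psi> * (\<psi> \<theta> - \<chi> \<theta>) * \<psi> x) = 0" if x: "x \<in> carrier M" for x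
    proof -
      have "(\<Sum>\<psi>\<in>homs. d \<psi> * (\<psi> \<theta> - \<chi> \<theta>) * \<psi> x)
        = (\<Sum>\<psi>\<in>homs. d \<psi> * \<psi> (\<theta> \<otimes>\<^bsub>M\<^esub> x)) - \<chi> \<theta> * (\<Sum>\<psi>\<in>homs. d \<psi> * \<psi> x)"
        unfolding sum_distrib_left sum_subtractf[symmetric]
        by (rule sum.cong) (simp_all add: class_alg_homD(1)[OF homsD] \<theta>(1) x algebra_simps)
      also have "\<dots> = (\<nu> (a \<otimes>\<^bsub>M\<^esub> (\<theta> \<otimes>\<^bsub>M\<^esub> x)) - \<chi> a * \<nu> (\<theta> \<otimes>\<^bsub>M\<^esub> x)) - \<chi> \<theta> * (\<nu> (a \<otimes>\<^bsub>M\<^esub> x) - \<chi> a * \<nu> x)"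
        using d x \<theta>(1) by simp
      also have "\<dots> = (\<nu> (\<theta> \<otimes>\<^bsub>M\<^esub> (a \<otimes>\<^bsub>M\<^esub> x)) - \<chi> \<theta> * \<nu> (a \<otimes>\<^bsub>M\<^esub> x)) - \<chi> a * (\<nu> (\<theta> \<otimes>\<^bsub>M\<^esub> x) - \<chi> \<theta> * \<nu> x)"
        using m_lcomm[OF a \<theta>(1) x] by (simp add: algebra_simps)
      also have "\<dots> = c \<chi> * \<chi> (a \<otimes>\<^bsub>M\<^esub> x) - \<chi> a * (c \<chi> * \<chi> x)"
        using a x by (simp add: \<nu>_\<theta>)
      also have "\<dots> = 0" using class_alg_homD(1)[OF \<chi>h a x] by simp
      finally show ?thesis .
    qed
    from homs_independent[OF \<theta> this] have "d \<psi> * (\<psi> \<theta> - \<chi> \<theta>) = 0" if "\<psi> \<in> homs" for \<psi>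
      using that by blast
    then have d0: "d \<psi> = 0" if "\<psi> \<in> homs - {\<chi>}" for \<psi> using ne[of \<psi>] that by auto
    have "\<nu> (a \<otimes>\<^bsub>M\<^esub> x) - \<chi> a * \<nu> x = d \<chi> * \<chi> x" if x: "x \<in> carrier M" for x
      unfolding d[OF x] sum.remove[OF finite_homs \<chi>] using d0 by simp
    then show ?thesis by blast
  qed
  then obtain d where d: "\<And>a x. a \<in> carrier M \<Longrightarrow> x \<in> carrier M \<Longrightarrow> \<nu> (a \<otimes>\<^bsub>M\<^esub> x) - \<chi> a * \<nu> x = d a * \<chi> x"
    by metis
  \<comment> \<open>Evaluation at 1 identifies the factor \<open>d\<close> with \<open>D\<close>,
    and the eigenvector relation for \<nu> becomes the Leibniz rule for \<open>D\<close>.\<close>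
  define D where "D x = \<nu> x - \<nu> \<one>\<^bsub>M\<^esub> * \<chi> x" for x
  have D_lin: "lin D"
    unfolding lin_def D_def
    by (auto simp: linD[OF \<nu>_lin] class_alg_homD[OF \<chi>h] algebra_simps)
  have d_eq: "d a = D a" if a: "a \<in> carrier M" for a
    using d[OF a one_closed] a by (simp add: D_def class_alg_homD[OF \<chi>h] mult.commute)
  have D0: "D a = 0" if a: "a \<in> carrier M" for a
  proof (rule no_derivations[OF \<chi>h D_lin _ a])
    fix x y assume x: "x \<in> carrier M" and y: "y \<in> carrier M"
    have "\<nu> (x \<otimes>\<^bsub>M\<^esub> y) = \<chi> x * \<nu> y + D x * \<chi> y"
      using d[OF x y] unfolding d_eq[OF x] by (simp add: algebra_simps)
    then show "D (x \<otimes>\<^bsub>M\<^esub> y) = \<chi> x * D y + D x * \<chi> y"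
      using x y by (simp add: D_def class_alg_homD[OF \<chi>h] algebra_simps)
  qed
  \<comment> \<open>With \<open>D\<close> = 0 the functional \<nu> is a multiple of the point
    \<chi>, although it lies outside the span.\<close>
  have "\<nu> x = \<nu> \<one>\<^bsub>M\<^esub> * \<chi> x" if "x \<in> carrier M" for x
    using D0[OF that] unfolding D_def by (simp only: right_minus_eq)
  then have "hom_span \<nu> \<longleftrightarrow> hom_span (\<lambda>x. \<nu> \<one>\<^bsub>M\<^esub> * \<chi> x)" by (rule hom_span_cong)
  then show False using \<nu>_span hom_span_scale[OF hom_span_hom[OF \<chi>]] by blast
qed

end

section \<open>A criterion for smoothness\<close>

text \<open>The points embed \<open>S\<close> into a power of a commutative ring, where the axioms
  hold componentwise. Negatives are multiples by -1.\<close>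

lemma algebra_of_class_homs:
  fixes S :: "('r::comm_ring_1, 's) module" and \<iota> :: "'r \<Rightarrow> 'l::comm_ring_1"
  assumes \<iota>: "comm_ring_hom \<iota>"
    and cl: "\<zero>\<^bsub>S\<^esub> \<in> carrier S" "\<one>\<^bsub>S\<^esub> \<in> carrier S"
      "\<And>x y. x \<in> carrier S \<Longrightarrow> y \<in> carrier S \<Longrightarrow> x \<oplus>\<^bsub>S\<^esub> y \<in> carrier S"
      "\<And>x y. x \<in> carrier S \<Longrightarrow> y \<in> carrier S \<Longrightarrow> x \<otimes>\<^bsub>S\<^esub> y \<in> carrier S"
      "\<And>r x. x \<in> carrier S \<Longrightarrow> r \<odot>\<^bsub>S\<^esub> x \<in> carrier S"
    and h: "\<And>\<chi>. \<chi> \<in> H \<Longrightarrow> class_alg_hom \<iota> S (f \<chi>)" "\<And>\<chi>. \<chi> \<in> H \<Longrightarrow> f \<chi> \<zero>\<^bsub>S\<^esub> = 0"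
    and inj: "\<And>x y. x \<in> carrier S \<Longrightarrow> y \<in> carrier S \<Longrightarrow> (\<And>\<chi>. \<chi> \<in> H \<Longrightarrow> f \<chi> x = f \<chi> y) \<Longrightarrow> x = y"
  shows "algebra class_ring S"
proof -
  interpret \<iota>: comm_ring_hom \<iota> by (rule \<iota>)
  note hs = class_alg_homD(1-4)[OF h(1)] h(2)
  have "abelian_group S"
  proof (rule abelian_groupI)
    show "\<exists>y\<in>carrier S. y \<oplus>\<^bsub>S\<^esub> x = \<zero>\<^bsub>S\<^esub>" if x: "x \<in> carrier S" for x
      by (rule bexI[of _ "(-1) \<odot>\<^bsub>S\<^esub> x"], rule inj) (simp_all add: cl x hs \<iota>.hom_uminus)
  qed (auto intro!: inj simp: cl hs add_ac)
  moreover have "Group.comm_monoid S"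
    by (rule comm_monoidI) (auto intro!: inj simp: cl hs mult_ac)
  ultimately have "cring S"
    by (rule cringI) (auto intro!: inj simp: cl hs distrib_right)
  then show ?thesis
    by (intro algebraI) (auto intro!: inj class_cring.cring_axioms simp: cl hs algebra_simps \<iota>.hom_add \<iota>.hom_mult)
qed

text \<open>A nonzero combination of minimal degree divides both polynomials. Were its degree
  positive, it would have a root in the algebraically closed field, common to both.\<close>

lemma poly_bezout_no_common_root:
  fixes p q :: "'f::field poly" and \<kappa> :: "'f \<Rightarrow> 'l::alg_closed_field"
  assumes \<kappa>: "comm_ring_hom \<kappa>" and p: "p \<noteq> 0"
    and no_root: "\<And>z. poly (map_poly \<kappa> p) z = 0 \<Longrightarrow> poly (map_poly \<kappa> q) z \<noteq> 0"
  shows "\<exists>u v. u * p + v * q = 1"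
proof -
  interpret \<kappa>: comm_ring_hom \<kappa> by (rule \<kappa>)
  interpret mp: map_poly_comm_ring_hom \<kappa> ..
  define P where "P d \<longleftrightarrow> d \<noteq> 0 \<and> (\<exists>u v. d = u * p + v * q)" for d
  have "P p" unfolding P_def using p by (intro conjI exI[of _ 1] exI[of _ 0]) simp_all
  then obtain d where d: "P d" and min: "\<And>e. P e \<Longrightarrow> degree d \<le> degree e"
    using ex_has_least_nat[of P p degree] by blast
  obtain u v where uv: "d = u * p + v * q" and d0: "d \<noteq> 0" using d by (auto simp: P_def)
  have dvd: "d dvd a * p + b * q" for a b
  proof (rule ccontr)
    let ?e = "(a * p + b * q) mod d" and ?k = "(a * p + b * q) div d"
    assume "\<not> d dvd a * p + b * q"
    then have e0: "?e \<noteq> 0" by (simp add: mod_eq_0_iff_dvd)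
    have "?e = (a * p + b * q) - ?k * d" by (simp add: minus_div_mult_eq_mod)
    also have "\<dots> = (a - ?k * u) * p + (b - ?k * v) * q"
      unfolding uv[symmetric] by (subst (2) uv) (simp add: algebra_simps)
    finally have "P ?e" unfolding P_def using e0 by blast
    then have "degree d \<le> degree ?e" by (rule min)
    moreover have "degree ?e < degree d" using degree_mod_less[OF d0, of "a * p + b * q"] e0 by simp
    ultimately show False by simp
  qed
  have dp: "d dvd p" and dq: "d dvd q" using dvd[of 1 0] dvd[of 0 1] by simp_all
  have deg: "degree (map_poly \<kappa> d) = degree d"
    by (rule degree_map_poly) (simp add: field_hom_0_iff[OF \<kappa>])
  have "degree d = 0"
  proof (rule ccontr)
    assume "degree d \<noteq> 0"
    then obtain z where z: "poly (map_poly \<kappa> d) z = 0"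
      using alg_closed_imp_poly_has_root[of "map_poly \<kappa> d"] deg by auto
    obtain k l where "p = d * k" "q = d * l" using dp dq by (auto elim!: dvdE)
    then show False using no_root[of z] z by (simp add: mp.hom_mult)
  qed
  then obtain c where c: "d = [:c:]" "c \<noteq> 0" using d0 by (metis degree_eq_zeroE pCons_0_0)
  have "[:1 / c:] * u * p + [:1 / c:] * v * q = [:1 / c:] * d"
    unfolding uv by (simp add: algebra_simps)
  also have "\<dots> = 1" using c by (simp add: one_pCons)
  finally show ?thesis by blast
qed

section \<open>Presentations in one variable\<close>

definition mpoly_to_poly :: "((nat \<Rightarrow>\<^sub>0 nat) \<Rightarrow>\<^sub>0 'f::comm_ring_1) \<Rightarrow> 'f poly" where
  "mpoly_to_poly = mpoly_eval (\<lambda>c. [:c:]) (\<lambda>j. [:0, 1:])"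

definition poly_to_mpoly :: "'f::comm_ring_1 poly \<Rightarrow> (nat \<Rightarrow>\<^sub>0 nat) \<Rightarrow>\<^sub>0 'f" where
  "poly_to_mpoly q = poly (map_poly (Poly_Mapping.single 0) q) (mpoly_var 0)"

lemma poly_const_hom: "comm_ring_hom (\<lambda>c :: 'f::comm_ring_1. [:c:])"
  by unfold_locales (simp_all add: one_pCons)

text \<open>The algebra \<open>mpoly_algebra 1\<close> is identified with univariate polynomials,
  where division with remainder and the counting of roots are available.\<close>

lemma univariate_mpoly:
  fixes q :: "'f::idom poly"
  shows "mpoly_to_poly (poly_to_mpoly q) = q"
    and "poly_to_mpoly q \<in> carrier (mpoly_algebra 1)"
    and "p \<in> carrier (mpoly_algebra 1) \<Longrightarrow> poly_to_mpoly (mpoly_to_poly p) = (p :: _ \<Rightarrow>\<^sub>0 'f)"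
    and "poly_to_mpoly (q * r) = poly_to_mpoly q * poly_to_mpoly r"
    and "mpoly_to_poly (mpoly_pderiv 0 (poly_to_mpoly q)) = pderiv q"
proof -
  define pm :: "'f poly \<Rightarrow> _" where "pm = poly_to_mpoly"
  define mp :: "_ \<Rightarrow> 'f poly" where "mp = mpoly_to_poly"
  note folds = pm_def[symmetric] mp_def[symmetric]
  note c = poly_const_hom[where 'f = 'f]
  have s: "comm_ring_hom (Poly_Mapping.single 0 :: 'f \<Rightarrow> (nat \<Rightarrow>\<^sub>0 nat) \<Rightarrow>\<^sub>0 'f)"
    by unfold_locales (simp_all add: single_add mult_single)
  interpret s: comm_ring_hom "Poly_Mapping.single 0 :: 'f \<Rightarrow> (nat \<Rightarrow>\<^sub>0 nat) \<Rightarrow>\<^sub>0 'f" by (rule s)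
  interpret sp: map_poly_comm_ring_hom "Poly_Mapping.single 0 :: 'f \<Rightarrow> (nat \<Rightarrow>\<^sub>0 nat) \<Rightarrow>\<^sub>0 'f" ..
  interpret mp: comm_ring_hom mp unfolding mp_def mpoly_to_poly_def by (rule mpoly_eval_hom[OF c])
  have pm_pCons: "pm (pCons a q) = Poly_Mapping.single 0 a + mpoly_var 0 * pm q" for a q
    by (simp add: pm_def poly_to_mpoly_def map_poly_pCons_hom[OF s])
  have pm0: "pm 0 = 0" by (simp add: pm_def poly_to_mpoly_def)
  have mp_simps: "mp (Poly_Mapping.single 0 a) = [:a:]" "mp (mpoly_var 0) = [:0, 1:]" for a
    by (simp_all add: mp_def mpoly_to_poly_def mpoly_eval_const[OF c] mpoly_eval_var[OF c])
  have mp_pm: "mp (pm q) = q" for q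
    by (induction q) (simp_all add: pm0 pm_pCons mp.hom_add mp.hom_mult mp_simps)
  have pm_cl: "pm q \<in> carrier (mpoly_algebra 1)" for q
    by (induction q) (auto simp: pm0 pm_pCons mpoly_carrier_0
        intro!: mpoly_carrier_add mpoly_carrier_mult mpoly_carrier_const mpoly_carrier_var)
  have pm_add: "pm (q + r) = pm q + pm r" for q r by (simp add: pm_def poly_to_mpoly_def sp.hom_add)
  have pm_mult: "pm (q * r) = pm q * pm r" for q r by (simp add: pm_def poly_to_mpoly_def sp.hom_mult)
  have pm_c: "pm [:a:] = Poly_Mapping.single 0 a" "pm [:0, 1:] = mpoly_var 0" for a
    by (simp_all add: pm_pCons pm0)
  have pm_mp: "pm (mp p) = p" if "p \<in> carrier (mpoly_algebra 1)" for p
    using that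
    by (induction p rule: mpoly_induct)
       (simp_all add: mp_simps pm_c mp.hom_add mp.hom_mult pm_add pm_mult)
  have "mp (mpoly_pderiv 0 (pm q)) = pderiv q" for q
    by (induction q)
       (simp_all add: pm0 pm_pCons mpoly_pderiv_add mpoly_pderiv_mult mpoly_pderiv_var mp.hom_add
         mp.hom_mult mp_simps mp_pm pderiv_pCons mpoly_pderiv_def[of _ 0])
  then show "mpoly_to_poly (mpoly_pderiv 0 (poly_to_mpoly q)) = pderiv q"
    unfolding folds .
  show "mpoly_to_poly (poly_to_mpoly q) = q" unfolding folds by (rule mp_pm)
  show "poly_to_mpoly q \<in> carrier (mpoly_algebra 1)" unfolding folds by (rule pm_cl)
  show "poly_to_mpoly (q * r) = poly_to_mpoly q * poly_to_mpoly r" unfolding folds by (rule pm_mult)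
  show "p \<in> carrier (mpoly_algebra 1) \<Longrightarrow> poly_to_mpoly (mpoly_to_poly p) = p" unfolding folds by (rule pm_mp)
qed

text \<open>
  \<open>S\<close> is generated by one element whose minimal polynomial is separable, so it is standard smooth
  with one variable and one equation.
\<close>

lemma standard_smooth_of_class_homs:
  fixes S :: "('f::field, 's) module" and \<kappa> :: "'f \<Rightarrow> 'l::alg_closed_field" and f :: "'h \<Rightarrow> 's \<Rightarrow> 'l"
  assumes \<kappa>: "comm_ring_hom \<kappa>" and S: "algebra class_ring S"
    and H: "finite H" and h: "\<And>\<chi>. \<chi> \<in> H \<Longrightarrow> class_alg_hom \<kappa> S (f \<chi>)"
    and inj: "\<And>x y. x \<in> carrier S \<Longrightarrow> y \<in> carrier S \<Longrightarrow> (\<And>\<chi>. \<chi> \<in> H \<Longrightarrow> f \<chi> x = f \<chi> y) \<Longrightarrow> x = y"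
    and \<theta>: "\<theta> \<in> carrier S" and sep: "inj_on (\<lambda>\<chi>. f \<chi> \<theta>) H"
    and gen: "\<And>s. s \<in> carrier S \<Longrightarrow> \<exists>q. \<forall>\<chi>\<in>H. f \<chi> s = poly (map_poly \<kappa> q) (f \<chi> \<theta>)"
    and \<mu>: "map_poly \<kappa> \<mu> = (\<Prod>\<chi>\<in>H. [:- f \<chi> \<theta>, 1:])"
  shows "standard_smooth S"
proof -
  interpret S: algebra class_ring S by (rule S)
  interpret \<kappa>: comm_ring_hom \<kappa> by (rule \<kappa>)
  interpret mpk: map_poly_comm_ring_hom \<kappa> ..
  have mpk_smult: "map_poly \<kappa> (Polynomial.smult r p) = Polynomial.smult (\<kappa> r) (map_poly \<kappa> p)" for r p
    by (rule poly_eqI) (simp add: coeff_map_poly \<kappa>.hom_mult)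
  note hs = class_alg_homD(1-4)[OF h]
  have h0: "f \<chi> \<zero>\<^bsub>S\<^esub> = 0" if "\<chi> \<in> H" for \<chi>
    by (rule S.class_ring_hom_zero[OF class_alg_homD(5)[OF h[OF that]]])
  have ex: "\<exists>s\<in>carrier S. \<forall>\<chi>\<in>H. f \<chi> s = poly (map_poly \<kappa> q) (f \<chi> \<theta>)" for q
  proof (intro bexI ballI)
    show "alg_eval S q \<theta> \<in> carrier S" by (rule alg_eval_closed[OF S \<theta>])
    show "f \<chi> (alg_eval S q \<theta>) = poly (map_poly \<kappa> q) (f \<chi> \<theta>)" if "\<chi> \<in> H" for \<chi>
      by (rule class_alg_hom_alg_eval[OF S \<kappa> \<theta> h[OF that]])
  qed
  define mp :: "_ \<Rightarrow> 'f poly" where "mp = mpoly_to_poly"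
  define pm :: "'f poly \<Rightarrow> _" where "pm = poly_to_mpoly"
  note c = poly_const_hom[where 'f = 'f]
  note um = univariate_mpoly[where 'f = 'f, folded mp_def pm_def]
  interpret mp: comm_ring_hom mp unfolding mp_def mpoly_to_poly_def by (rule mpoly_eval_hom[OF c])
  \<comment> \<open>The presentation sends the single variable to \<theta>.\<close>
  define hh where "hh p = alg_eval S (mp p) \<theta>" for p
  have hh_cl: "hh p \<in> carrier S" for p unfolding hh_def by (rule alg_eval_closed[OF S \<theta>])
  have hh: "f \<chi> (hh p) = poly (map_poly \<kappa> (mp p)) (f \<chi> \<theta>)" if "\<chi> \<in> H" for \<chi> p
    unfolding hh_def by (rule class_alg_hom_alg_eval[OF S \<kappa> \<theta> h[OF that]])
  let ?P = "mpoly_algebra 1 :: ('f, _) module"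
  interpret P: cring ?P by (rule mpoly_cring)
  have P_simps: "p \<otimes>\<^bsub>?P\<^esub> q = p * q" "p \<oplus>\<^bsub>?P\<^esub> q = p + q" "\<one>\<^bsub>?P\<^esub> = 1" "\<zero>\<^bsub>?P\<^esub> = 0"
    "r \<odot>\<^bsub>?P\<^esub> p = Poly_Mapping.single 0 r * p" for p q r
    by (simp_all add: mpoly_algebra_def)
  have mp_c: "mp (Poly_Mapping.single 0 a) = [:a:]" for a
    unfolding mp_def mpoly_to_poly_def by (rule mpoly_eval_const[OF c])
  have hom: "hh \<in> alg_hom ?P S"
    unfolding alg_hom_def
  proof (intro CollectI conjI allI ballI)
    show "hh \<in> Ring.ring_hom ?P S"
    proof (rule Ring.ring_hom_memI)
      show "hh (x \<otimes>\<^bsub>?P\<^esub> y) = hh x \<otimes>\<^bsub>S\<^esub> hh y" for x y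
        unfolding P_simps by (rule inj) (simp_all add: hh_cl hh hs mp.hom_mult mpk.hom_mult)
      show "hh (x \<oplus>\<^bsub>?P\<^esub> y) = hh x \<oplus>\<^bsub>S\<^esub> hh y" for x y
        unfolding P_simps by (rule inj) (simp_all add: hh_cl hh hs mp.hom_add mpk.hom_add)
      show "hh \<one>\<^bsub>?P\<^esub> = \<one>\<^bsub>S\<^esub>"
        unfolding P_simps by (rule inj) (simp_all add: hh_cl hh hs)
    qed (rule hh_cl)
    have scl: "r \<odot>\<^bsub>S\<^esub> hh x \<in> carrier S" for r x using S.smult_closed hh_cl by simp
    show "hh (r \<odot>\<^bsub>?P\<^esub> x) = r \<odot>\<^bsub>S\<^esub> hh x" for r x
      unfolding P_simps by (rule inj) (simp_all add: hh_cl scl hh hs mp.hom_mult mp_c mpk_smult)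
  qed
  have surj: "hh ` carrier ?P = carrier S"
  proof
    show "hh ` carrier ?P \<subseteq> carrier S" using hh_cl by blast
    show "carrier S \<subseteq> hh ` carrier ?P"
    proof
      fix s assume s: "s \<in> carrier S"
      obtain q where q: "\<forall>\<chi>\<in>H. f \<chi> s = poly (map_poly \<kappa> q) (f \<chi> \<theta>)" using gen[OF s] by blast
      have "s = hh (pm q)"
        by (rule inj) (simp_all add: s hh_cl hh um(1) q)
      then show "s \<in> hh ` carrier ?P" using um(2) by blast
    qed
  qed
  have root: "poly (map_poly \<kappa> \<mu>) z = 0 \<longleftrightarrow> (\<exists>\<chi>\<in>H. z = f \<chi> \<theta>)" for z
    unfolding \<mu> poly_prod using H by (simp add: prod_zero_iff)
  have \<mu>0: "\<mu> \<noteq> 0"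
  proof
    assume "\<mu> = 0"
    then have "(\<Prod>\<chi>\<in>H. [:- f \<chi> \<theta>, 1:]) = 0" using \<mu> by simp
    then show False using H by (simp add: prod_zero_iff)
  qed
  have \<mu>deg: "degree \<mu> = card H"
  proof -
    have "degree \<mu> = degree (map_poly \<kappa> \<mu>)"
      by (rule degree_map_poly[symmetric]) (simp add: field_hom_0_iff[OF \<kappa>])
    also have "\<dots> = card H" unfolding \<mu> by (subst degree_prod_eq_sum_degree) simp_all
    finally show ?thesis .
  qed
  \<comment> \<open>A nonzero remainder modulo \<mu> would have the \<open>card H\<close> distinct
    roots \<chi> \<theta> but smaller degree than \<mu>.\<close>
  have vanish: "(\<forall>\<chi>\<in>H. poly (map_poly \<kappa> q) (f \<chi> \<theta>) = 0) \<longleftrightarrow> \<mu> dvd q" for q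
  proof
    assume "\<mu> dvd q"
    then obtain k where "q = \<mu> * k" by (elim dvdE)
    then show "\<forall>\<chi>\<in>H. poly (map_poly \<kappa> q) (f \<chi> \<theta>) = 0"
      using root by (auto simp: mpk.hom_mult)
  next
    assume z: "\<forall>\<chi>\<in>H. poly (map_poly \<kappa> q) (f \<chi> \<theta>) = 0"
    let ?r = "q mod \<mu>"
    have q: "q = \<mu> * (q div \<mu>) + ?r" by simp
    have rz: "poly (map_poly \<kappa> ?r) (f \<chi> \<theta>) = 0" if "\<chi> \<in> H" for \<chi>
    proof -
      have "poly (map_poly \<kappa> q) (f \<chi> \<theta>) = poly (map_poly \<kappa> \<mu>) (f \<chi> \<theta>) * poly (map_poly \<kappa> (q div \<mu>)) (f \<chi> \<theta>)
        + poly (map_poly \<kappa> ?r) (f \<chi> \<theta>)"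
        by (subst q) (simp only: mpk.hom_mult mpk.hom_add poly_mult poly_add)
      then show ?thesis using z that root[of "f \<chi> \<theta>"] by auto
    qed
    have "?r = 0"
    proof (rule ccontr)
      assume r0: "?r \<noteq> 0"
      then have m0: "map_poly \<kappa> ?r \<noteq> 0"
        by (simp add: poly_eq_iff coeff_map_poly field_hom_0_iff[OF \<kappa>])
      have "card H = card ((\<lambda>\<chi>. f \<chi> \<theta>) ` H)" using sep by (simp add: card_image)
      also have "\<dots> \<le> card {z. poly (map_poly \<kappa> ?r) z = 0}"
        using rz by (intro card_mono poly_roots_finite m0) auto
      also have "\<dots> \<le> degree (map_poly \<kappa> ?r)" by (rule card_poly_roots_bound[OF m0])
      also have "\<dots> = degree ?r" by (rule degree_map_poly) (simp add: field_hom_0_iff[OF \<kappa>])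
      also have "\<dots> < degree \<mu>" using degree_mod_less[OF \<mu>0, of q] r0 by simp
      finally show False using \<mu>deg by simp
    qed
    then show "\<mu> dvd q" by (simp add: mod_eq_0_iff_dvd)
  qed
  have ker_iff: "hh p = \<zero>\<^bsub>S\<^esub> \<longleftrightarrow> \<mu> dvd mp p" for p
    unfolding vanish[symmetric] using inj[OF hh_cl[of p] S.zero_closed] by (auto simp: h0 simp flip: hh)
  have ker: "a_kernel ?P S hh = genideal ?P ((\<lambda>i. pm \<mu>) ` {..<1::nat})"
  proof -
    have img: "(\<lambda>i. pm \<mu>) ` {..<1::nat} = {pm \<mu>}" by auto
    have akl: "a_kernel ?P S hh = {p \<in> carrier ?P. mp p \<in> {x. \<mu> dvd x}}"
      unfolding a_kernel_def' by (simp add: ker_iff)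
    have "class_ring_hom ?P mp" unfolding mp_def mpoly_to_poly_def by (rule mpoly_eval_class_hom[OF c])
    then have id: "ideal {p \<in> carrier ?P. mp p \<in> {x. \<mu> dvd x}} ?P"
      by (rule P.class_ring_hom_vimage_ideal) auto
    have "genideal ?P {pm \<mu>} \<subseteq> a_kernel ?P S hh"
      unfolding akl by (rule P.genideal_minimal[OF id]) (use um(1,2)[of \<mu>] in simp)
    moreover have "a_kernel ?P S hh \<subseteq> genideal ?P {pm \<mu>}"
    proof
      fix p assume "p \<in> a_kernel ?P S hh"
      then have p: "p \<in> carrier ?P" and "\<mu> dvd mp p" unfolding akl by auto
      then obtain k where k: "mp p = \<mu> * k" by (elim dvdE)
      have "p = pm \<mu> * pm k" using um(3)[OF p] k um(4) by simp
      moreover have "pm \<mu> \<in> genideal ?P {pm \<mu>}"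
        by (rule P.genideal_self'[OF um(2)])
      ultimately show "p \<in> genideal ?P {pm \<mu>}"
        using ideal.I_r_closed[OF P.genideal_ideal[of "{pm \<mu>}"] _ um(2)[of k], of "pm \<mu>"] um(2)[of \<mu>]
        unfolding P_simps by simp
    qed
    ultimately show ?thesis unfolding img by blast
  qed
  have pd: "map_poly \<kappa> (pderiv q) = pderiv (map_poly \<kappa> q)" for q
    by (rule poly_eqI) (simp add: coeff_map_poly coeff_pderiv \<kappa>.hom_mult \<kappa>.hom_add \<kappa>.hom_of_nat)
  \<comment> \<open>The roots are simple: at \<chi> \<theta> the derivative is the product of the
    differences to the other roots.\<close>
  have "poly (map_poly \<kappa> (pderiv \<mu>)) z \<noteq> 0" if z: "poly (map_poly \<kappa> \<mu>) z = 0" for z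
  proof -
    obtain \<chi> where \<chi>: "\<chi> \<in> H" "z = f \<chi> \<theta>" using z root by blast
    define R where "R = (\<Prod>\<psi>\<in>H - {\<chi>}. [:- f \<psi> \<theta>, 1:])"
    have "map_poly \<kappa> \<mu> = [:- z, 1:] * R"
      unfolding \<mu> \<chi>(2) R_def by (rule prod.remove[OF H \<chi>(1)])
    then have "poly (map_poly \<kappa> (pderiv \<mu>)) z = poly R z"
      by (simp only: pd pderiv_mult poly_add poly_mult) (simp add: pderiv_pCons)
    then have "poly (map_poly \<kappa> (pderiv \<mu>)) z = (\<Prod>\<psi>\<in>H - {\<chi>}. z - f \<psi> \<theta>)"
      by (simp add: R_def poly_prod)
    then show ?thesis using H sep \<chi> by (auto simp: prod_zero_iff dest: inj_onD)
  qed
  \<comment> \<open>Modulo \<mu> the polynomial \<open>v\<close> is inverse to the derivative, which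
    is the Jacobian determinant of the presentation.\<close>
  from poly_bezout_no_common_root[OF \<kappa> \<mu>0 this] obtain u v where uv: "u * \<mu> + v * pderiv \<mu> = 1" by blast
  let ?J = "mat 1 1 (\<lambda>(i, j). mpoly_pderiv j ((\<lambda>i. pm \<mu>) i)) :: ((nat \<Rightarrow>\<^sub>0 nat) \<Rightarrow>\<^sub>0 'f) mat"
  have J: "det ?J = mpoly_pderiv 0 (pm \<mu>)" by (subst det_single) auto
  have inv: "hh (pm v) \<otimes>\<^bsub>S\<^esub> hh (det ?J) = \<one>\<^bsub>S\<^esub>"
  proof (rule inj)
    fix \<chi> assume \<chi>: "\<chi> \<in> H"
    have "poly (map_poly \<kappa> (u * \<mu> + v * pderiv \<mu>)) (f \<chi> \<theta>) = 1" unfolding uv by simp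
    then have "poly (map_poly \<kappa> v) (f \<chi> \<theta>) * poly (map_poly \<kappa> (pderiv \<mu>)) (f \<chi> \<theta>) = 1"
      using root[of "f \<chi> \<theta>"] \<chi> by (auto simp: mpk.hom_mult mpk.hom_add)
    then show "f \<chi> (hh (pm v) \<otimes>\<^bsub>S\<^esub> hh (det ?J)) = f \<chi> \<one>\<^bsub>S\<^esub>"
      using \<chi> by (simp only: J hs hh_cl hh um(1,5))
  qed (simp_all add: hh_cl)
  have "hh (det ?J) \<otimes>\<^bsub>S\<^esub> hh (pm v) = \<one>\<^bsub>S\<^esub>"
    using inv S.m_comm[OF hh_cl[of "pm v"] hh_cl[of "det ?J"]] by simp
  then have unit: "hh (det ?J) \<in> Units S"
    unfolding Units_def by (intro CollectI conjI bexI[of _ "hh (pm v)"] hh_cl inv)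
  show ?thesis
    unfolding standard_smooth_def
  proof (rule exI[of _ 1], rule exI[of _ 1], rule exI[of _ "\<lambda>i. pm \<mu>"], rule exI[of _ hh], intro conjI)
    show "\<forall>i<1::nat. pm \<mu> \<in> carrier ?P" using um(2) by blast
  qed (rule order_refl hom surj ker unit)+
qed

section \<open>Points of localizations and the trivial cover\<close>

lemma localization_alg_hom:
  fixes S :: "('f::comm_ring_1, 's) module"
  assumes S: "algebra class_ring S" and g: "g \<in> carrier S"
    and \<rho>: "class_alg_hom \<iota> S \<rho>" and w: "\<rho> g * w = 1"
  shows "class_alg_hom \<iota> (localization S g) (localization_at.lift \<rho> w)"
proof -
  interpret S: algebra class_ring S by (rule S)
  interpret l: localization_at S g by unfold_locales (rule g)
  have scl: "r \<odot>\<^bsub>S\<^esub> y \<in> carrier S" if "y \<in> carrier S" for r y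
    using S.smult_closed that by simp
  have smult: "r \<odot>\<^bsub>l.L\<^esub> l.fr x n = l.fr (r \<odot>\<^bsub>S\<^esub> x) n" if "x \<in> carrier S" for r x n
  proof (rule l.smult_L[OF that scl])
    show "r \<odot>\<^bsub>S\<^esub> (y \<otimes>\<^bsub>S\<^esub> z) = y \<otimes>\<^bsub>S\<^esub> (r \<odot>\<^bsub>S\<^esub> z)" if "y \<in> carrier S" "z \<in> carrier S" for y z
      using S.smult_assoc2[of r z y] S.m_comm[of "r \<odot>\<^bsub>S\<^esub> z" y] S.m_comm[of z y] that scl[of z r] by simp
  qed
  show ?thesis
    unfolding class_alg_hom_def
  proof (intro conjI allI ballI)
    show "class_ring_hom l.L (l.lift \<rho> w)"
      by (rule l.lift_ring_hom[OF class_alg_homD(5)[OF \<rho>] w])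
    fix r U assume "U \<in> carrier l.L"
    then show "l.lift \<rho> w (r \<odot>\<^bsub>l.L\<^esub> U) = \<iota> r * l.lift \<rho> w U"
    proof (rule l.L_cases)
      fix x n assume x: "x \<in> carrier S" "U = l.fr x n"
      show ?thesis
        unfolding x(2) smult[OF x(1)] using x(1) scl[OF x(1)]
        by (simp add: l.lift_frac[OF class_alg_homD(5)[OF \<rho>] w] class_alg_homD[OF \<rho>] mult.assoc)
    qed
  qed
qed

text \<open>\<open>smooth_algebra\<close> asks for a cover by localizations, and the cover by the
  single element 1 will be used. The algebra structure and the points are therefore carried over to
  the localization at 1, where a fraction has the same values as its numerator.\<close>

lemma localization_algebra:
  fixes S :: "('f::comm_ring_1, 's) module" and f :: "'h \<Rightarrow> 's \<Rightarrow> 'l::comm_ring_1"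
  assumes S: "algebra class_ring S" and \<iota>: "comm_ring_hom \<iota>"
    and hb: "\<forall>\<chi>\<in>H. class_alg_hom \<iota> S (f \<chi>)"
    and inj: "\<forall>x\<in>carrier S. \<forall>y\<in>carrier S. (\<forall>\<chi>\<in>H. f \<chi> x = f \<chi> y) \<longrightarrow> x = y"
  shows "algebra class_ring (localization S \<one>\<^bsub>S\<^esub>)"
    and "\<chi> \<in> H \<Longrightarrow> class_alg_hom \<iota> (localization S \<one>\<^bsub>S\<^esub>) (localization_at.lift (f \<chi>) 1)"
    and "\<chi> \<in> H \<Longrightarrow> x \<in> carrier S \<Longrightarrow> localization_at.lift (f \<chi>) 1 (loc_frac S \<one>\<^bsub>S\<^esub> x n) = f \<chi> x"
    and "U \<in> carrier (localization S \<one>\<^bsub>S\<^esub>) \<Longrightarrow> V \<in> carrier (localization S \<one>\<^bsub>S\<^esub>) \<Longrightarrow>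
      (\<And>\<chi>. \<chi> \<in> H \<Longrightarrow> localization_at.lift (f \<chi>) 1 U = localization_at.lift (f \<chi>) 1 V) \<Longrightarrow> U = V"
proof -
  interpret S: algebra class_ring S by (rule S)
  note h = hb[rule_format]
  interpret l: localization_at S "\<one>\<^bsub>S\<^esub>" by unfold_locales simp
  have w: "f \<chi> \<one>\<^bsub>S\<^esub> * 1 = 1" if "\<chi> \<in> H" for \<chi> by (simp add: class_alg_homD(3)[OF h[OF that]])
  show hom: "class_alg_hom \<iota> l.L (l.lift (f \<chi>) 1)" if "\<chi> \<in> H" for \<chi>
    by (rule localization_alg_hom[OF S _ h[OF that] w[OF that]]) simp
  show val: "l.lift (f \<chi>) 1 (l.fr x n) = f \<chi> x" if "\<chi> \<in> H" "x \<in> carrier S" for \<chi> x n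
    using l.lift_frac[OF class_alg_homD(5)[OF h[OF that(1)]] w[OF that(1)] that(2), of n] by simp
  show inj': "U = V" if U: "U \<in> carrier l.L" and V: "V \<in> carrier l.L"
    and eq: "\<And>\<chi>. \<chi> \<in> H \<Longrightarrow> l.lift (f \<chi>) 1 U = l.lift (f \<chi>) 1 V" for U V
  proof -
    obtain x n where x: "x \<in> carrier S" "U = l.fr x n" by (rule l.L_cases[OF U])
    obtain y m where y: "y \<in> carrier S" "V = l.fr y m" by (rule l.L_cases[OF V])
    have "x = y"
      using eq x y by (intro inj[rule_format]) (simp_all add: val)
    then show ?thesis unfolding x(2) y(2) l.frac_eq_iff[OF x(1) y(1)] using y(1) by simp
  qed
  have scl: "r \<odot>\<^bsub>S\<^esub> y \<in> carrier S" if "y \<in> carrier S" for r y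
    using S.smult_closed that by simp
  have smult: "r \<odot>\<^bsub>l.L\<^esub> l.fr x n = l.fr (r \<odot>\<^bsub>S\<^esub> x) n" if "x \<in> carrier S" for r x n
  proof (rule l.smult_L[OF that scl])
    show "r \<odot>\<^bsub>S\<^esub> (y \<otimes>\<^bsub>S\<^esub> z) = y \<otimes>\<^bsub>S\<^esub> (r \<odot>\<^bsub>S\<^esub> z)" if "y \<in> carrier S" "z \<in> carrier S" for y z
      using S.smult_assoc2[of r z y] S.m_comm[of "r \<odot>\<^bsub>S\<^esub> z" y] S.m_comm[of z y] that scl[of z r] by simp
  qed
  show "algebra class_ring l.L"
  proof (rule algebra_of_class_homs[OF \<iota>, of _ H "\<lambda>\<chi>. l.lift (f \<chi>) 1"])
    show "l.lift (f \<chi>) 1 \<zero>\<^bsub>l.L\<^esub> = 0" if "\<chi> \<in> H" for \<chi>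
      unfolding l.zero_L val[OF that S.zero_closed]
      by (rule S.class_ring_hom_zero[OF class_alg_homD(5)[OF h[OF that]]])
    show "x \<oplus>\<^bsub>l.L\<^esub> y \<in> carrier l.L" "x \<otimes>\<^bsub>l.L\<^esub> y \<in> carrier l.L" if x: "x \<in> carrier l.L" and y: "y \<in> carrier l.L" for x y
      by (rule l.L_cases[OF x], rule l.L_cases[OF y], simp add: l.add_L l.mult_L l.frac_in_L)+
    show "r \<odot>\<^bsub>l.L\<^esub> x \<in> carrier l.L" if x: "x \<in> carrier l.L" for r x
      by (rule l.L_cases[OF x]) (simp add: smult scl l.frac_in_L)
    show "x = y" if "x \<in> carrier l.L" "y \<in> carrier l.L" "\<And>\<chi>. \<chi> \<in> H \<Longrightarrow> l.lift (f \<chi>) 1 x = l.lift (f \<chi>) 1 y" for x y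
      by (rule inj'[OF that])
  qed (simp_all add: hom l.zero_L l.one_L l.frac_in_L)
qed

context fps_algebra
begin

text \<open>The hypotheses speak of \<open>M\<close> alone. They pass to a fraction a/t^n because
  its value at a point is the value of a divided by the image of t^n, and then to the localization
  at 1.\<close>

lemma smooth_GF_of_class_homs:
  fixes \<kappa> :: "'k fls \<Rightarrow> 'l::alg_closed_field" and H :: "('b \<Rightarrow> 'l) set"
  assumes \<kappa>: "comm_ring_hom \<kappa>"
    and H: "finite H" and h: "\<And>\<chi>. \<chi> \<in> H \<Longrightarrow> class_alg_hom (\<lambda>p. \<kappa> (fps_to_fls p)) M \<chi>"
    and inj: "\<And>x y. x \<in> carrier M \<Longrightarrow> y \<in> carrier M \<Longrightarrow> (\<And>\<chi>. \<chi> \<in> H \<Longrightarrow> \<chi> x = \<chi> y) \<Longrightarrow> x = y"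
    and \<theta>: "\<theta> \<in> carrier M" and sep: "inj_on (\<lambda>\<chi>. \<chi> \<theta>) H"
    and gen: "\<And>s. s \<in> carrier M \<Longrightarrow> \<exists>q. \<forall>\<chi>\<in>H. \<chi> s = poly (map_poly \<kappa> q) (\<chi> \<theta>)"
    and \<mu>: "map_poly \<kappa> \<mu> = (\<Prod>\<chi>\<in>H. [:- \<chi> \<theta>, 1:])"
  shows "smooth_algebra GF"
proof -
  interpret \<kappa>: comm_ring_hom \<kappa> by (rule \<kappa>)
  interpret mpk: map_poly_comm_ring_hom \<kappa> ..
  define w where "w = \<kappa> (inverse fls_X)"
  define F where "F \<chi> = loc.lift \<chi> w" for \<chi> :: "'b \<Rightarrow> 'l"
  note GFh = GF_alg_hom[OF \<kappa> h, folded w_def F_def]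
  have Xw: "\<kappa> fls_X * w = 1" unfolding w_def by (subst \<kappa>.hom_mult[symmetric]) simp
  have Xwn: "\<kappa> fls_X ^ n * w ^ n = 1" for n using Xw by (simp flip: power_mult_distrib)
  have chi_t: "\<chi> t = \<kappa> fls_X" if "\<chi> \<in> H" for \<chi>
    unfolding t_def using class_alg_homD[OF h[OF that]] by (simp add: fps_X_to_fls)
  have chi_tn: "\<chi> (loc.G n) = \<kappa> fls_X ^ n" if "\<chi> \<in> H" for \<chi> n
    using class_ring_hom_pow[OF class_alg_homD(5)[OF h[OF that]], of t n] chi_t[OF that] by simp
  have GFinj: "U = V" if U: "U \<in> carrier GF" and V: "V \<in> carrier GF"
    and eq: "\<And>\<chi>. \<chi> \<in> H \<Longrightarrow> F \<chi> U = F \<chi> V" for U V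
  proof -
    obtain a n where a: "a \<in> carrier M" "U = loc.fr a n" using U unfolding GF_simps by (rule loc.L_cases)
    obtain b m where b: "b \<in> carrier M" "V = loc.fr b m" using V unfolding GF_simps by (rule loc.L_cases)
    \<comment> \<open>Denominators are cleared, and the equality is checked at the points of
      \<open>M\<close>.\<close>
    have "loc.G m \<otimes>\<^bsub>M\<^esub> a = loc.G n \<otimes>\<^bsub>M\<^esub> b"
    proof (rule inj)
      fix \<chi> assume \<chi>: "\<chi> \<in> H"
      have e: "\<chi> a * w ^ n = \<chi> b * w ^ m"
        using eq[OF \<chi>] unfolding a(2) b(2) GFh(2)[OF \<chi> a(1)] GFh(2)[OF \<chi> b(1)] .
      have "\<kappa> fls_X ^ m * \<chi> a = \<kappa> fls_X ^ m * \<kappa> fls_X ^ n * (\<chi> a * w ^ n)"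
        using Xwn[of n] by (simp add: mult_ac)
      also have "\<dots> = \<kappa> fls_X ^ n * \<chi> b"
        unfolding e using Xwn[of m] by (simp add: mult_ac)
      finally show "\<chi> (loc.G m \<otimes>\<^bsub>M\<^esub> a) = \<chi> (loc.G n \<otimes>\<^bsub>M\<^esub> b)"
        using a(1) b(1) by (simp add: class_alg_homD[OF h[OF \<chi>]] chi_tn[OF \<chi>])
    qed (simp_all add: a b)
    then have "loc.G 0 \<otimes>\<^bsub>M\<^esub> (loc.G m \<otimes>\<^bsub>M\<^esub> a) = loc.G 0 \<otimes>\<^bsub>M\<^esub> (loc.G n \<otimes>\<^bsub>M\<^esub> b)" by simp
    then show ?thesis unfolding a(2) b(2) loc.frac_eq_iff[OF a(1) b(1)] by (rule exI)
  qed
  have zero: "F \<chi> \<zero>\<^bsub>GF\<^esub> = 0" if "\<chi> \<in> H" for \<chi>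
    unfolding GF_simps loc.zero_L GFh(2)[OF that zero_closed]
    using class_ring_hom_zero[OF class_alg_homD(5)[OF h[OF that]]] by simp
  have GFa: "algebra class_ring GF"
  proof (rule algebra_of_class_homs[OF \<kappa>, of _ H F])
    show "x \<oplus>\<^bsub>GF\<^esub> y \<in> carrier GF" "x \<otimes>\<^bsub>GF\<^esub> y \<in> carrier GF" if x: "x \<in> carrier GF" and y: "y \<in> carrier GF" for x y
      using x y unfolding GF_simps
      by (auto elim!: loc.L_cases simp: loc.add_L loc.mult_L intro!: loc.frac_in_L)
    show "r \<odot>\<^bsub>GF\<^esub> x \<in> carrier GF" if x: "x \<in> carrier GF" for r x
      using x unfolding GF_simps by (auto elim!: loc.L_cases simp: smult_GF intro!: loc.frac_in_L)
    show "\<zero>\<^bsub>GF\<^esub> \<in> carrier GF" "\<one>\<^bsub>GF\<^esub> \<in> carrier GF"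
      unfolding GF_simps loc.zero_L loc.one_L by (simp_all add: loc.frac_in_L)
    show "x = y" if "x \<in> carrier GF" "y \<in> carrier GF" "\<And>\<chi>. \<chi> \<in> H \<Longrightarrow> F \<chi> x = F \<chi> y" for x y
      by (rule GFinj[OF that])
  qed (simp_all add: GFh(1) zero)
  interpret GFa: algebra class_ring GF by (rule GFa)
  have hb: "\<forall>\<chi>\<in>H. class_alg_hom \<kappa> GF (F \<chi>)" by (intro ballI GFh(1))
  have injb: "\<forall>x\<in>carrier GF. \<forall>y\<in>carrier GF. (\<forall>\<chi>\<in>H. F \<chi> x = F \<chi> y) \<longrightarrow> x = y"
    by (intro ballI impI GFinj) auto
  note L = localization_algebra[OF GFa \<kappa> hb injb]
  let ?L = "localization GF \<one>\<^bsub>GF\<^esub>"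
  let ?f = "\<lambda>\<chi>. localization_at.lift (F \<chi>) 1"
  interpret l2: localization_at GF "\<one>\<^bsub>GF\<^esub>" by unfold_locales simp
  have frM: "loc.fr a n \<in> carrier GF" if "a \<in> carrier M" for a n
    unfolding GF_simps by (rule loc.frac_in_L[OF that])
  define \<theta>2 where "\<theta>2 = l2.fr (loc.fr \<theta> 0) 0"
  have \<theta>2: "?f \<chi> \<theta>2 = \<chi> \<theta>" if "\<chi> \<in> H" for \<chi>
    unfolding \<theta>2_def using L(3)[OF that frM[OF \<theta>]] GFh(2)[OF that \<theta>, of 0] by simp
  have "standard_smooth ?L"
  proof (rule standard_smooth_of_class_homs[OF \<kappa> L(1) H L(2)])
    show "x = y" if "x \<in> carrier ?L" "y \<in> carrier ?L" "\<And>\<chi>. \<chi> \<in> H \<Longrightarrow> ?f \<chi> x = ?f \<chi> y" for x y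
      by (rule L(4)[OF that])
    show "\<theta>2 \<in> carrier ?L" unfolding \<theta>2_def by (rule l2.frac_in_L[OF frM[OF \<theta>]])
    show "inj_on (\<lambda>\<chi>. ?f \<chi> \<theta>2) H" using sep \<theta>2 by (simp cong: inj_on_cong)
    show "map_poly \<kappa> \<mu> = (\<Prod>\<chi>\<in>H. [:- ?f \<chi> \<theta>2, 1:])" unfolding \<mu> using \<theta>2 by (intro prod.cong) simp_all
    fix s assume "s \<in> carrier ?L"
    then obtain U m where U: "U \<in> carrier GF" "s = l2.fr U m" by (rule l2.L_cases)
    obtain a n where a: "a \<in> carrier M" "U = loc.fr a n" using U(1) unfolding GF_simps by (rule loc.L_cases)
    obtain q where q: "\<forall>\<chi>\<in>H. \<chi> a = poly (map_poly \<kappa> q) (\<chi> \<theta>)" using gen[OF a(1)] by blast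
    \<comment> \<open>The constant factor t^(-n) accounts for the denominator of the
      fraction.\<close>
    have "?f \<chi> s = poly (map_poly \<kappa> ([:inverse fls_X ^ n:] * q)) (?f \<chi> \<theta>2)" if \<chi>: "\<chi> \<in> H" for \<chi>
    proof -
      have "?f \<chi> s = \<chi> a * w ^ n" unfolding U(2) L(3)[OF \<chi> U(1)] unfolding a(2) by (rule GFh(2)[OF \<chi> a(1)])
      moreover have "poly (map_poly \<kappa> ([:inverse fls_X ^ n:] * q)) (\<chi> \<theta>) = w ^ n * poly (map_poly \<kappa> q) (\<chi> \<theta>)"
        unfolding mpk.hom_mult map_poly_pCons_hom[OF \<kappa>] by (simp add: \<kappa>.hom_power w_def)
      ultimately show ?thesis using q \<chi> by (simp add: \<theta>2 mult.commute)
    qed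
    then show "\<exists>q. \<forall>\<chi>\<in>H. ?f \<chi> s = poly (map_poly \<kappa> q) (?f \<chi> \<theta>2)" by blast
  qed
  then show ?thesis
    unfolding smooth_algebra_def using GFa GFa.genideal_one
    by (intro conjI exI[of _ "{\<one>\<^bsub>GF\<^esub>}"]) auto
qed

end

section \<open>The special fibre\<close>

context fps_algebra
begin

lemma special_ideal_eq: "special_ideal M = PIdl\<^bsub>M\<^esub> t"
  by (simp add: special_ideal_def t_def)

lemma special_ideal: "ideal (special_ideal M) M"
  unfolding special_ideal_eq by (rule cgenideal_ideal) simp

lemma mem_special_ideal: "x \<in> special_ideal M \<longleftrightarrow> (\<exists>y\<in>carrier M. x = fps_X \<odot>\<^bsub>M\<^esub> y)"
proof -
  have h: "y \<otimes>\<^bsub>M\<^esub> t = fps_X \<odot>\<^bsub>M\<^esub> y" if "y \<in> carrier M" for y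
    using that t_mult[OF that] m_comm[OF that t_closed] by simp
  show ?thesis unfolding special_ideal_eq cgenideal_def mem_Collect_eq using h by metis
qed

lemma special_fibre_simps:
  "carrier (special_fibre M) = carrier (M Quot special_ideal M)"
  "mult (special_fibre M) = mult (M Quot special_ideal M)"
  "add (special_fibre M) = add (M Quot special_ideal M)"
  "one (special_fibre M) = one (M Quot special_ideal M)"
  "zero (special_fibre M) = zero (M Quot special_ideal M)"
  by (simp_all add: special_fibre_def ring.defs module.defs)

lemma special_fibre_ring_hom:
  "Ring.ring_hom (special_fibre M) A = Ring.ring_hom (M Quot special_ideal M) A"
  unfolding Ring.ring_hom_def special_fibre_simps ..

text \<open>Scalars map the ideal generated by t to itself, so all representatives of a coset give
  the same coset and the defining union collapses.\<close>

lemma special_fibre_smult: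
  assumes x: "x \<in> carrier M"
  shows "c \<odot>\<^bsub>special_fibre M\<^esub> (special_ideal M +>\<^bsub>M\<^esub> x) = special_ideal M +>\<^bsub>M\<^esub> (fps_const c \<odot>\<^bsub>M\<^esub> x)"
proof -
  interpret I: ideal "special_ideal M" M by (rule special_ideal)
  have sm: "c \<odot>\<^bsub>special_fibre M\<^esub> Z = (\<Union>x\<in>Z. special_ideal M +>\<^bsub>M\<^esub> (fps_const c \<odot>\<^bsub>M\<^esub> x))" for Z
    by (simp add: special_fibre_def ring.defs module.defs)
  have const: "special_ideal M +>\<^bsub>M\<^esub> (fps_const c \<odot>\<^bsub>M\<^esub> y) = special_ideal M +>\<^bsub>M\<^esub> (fps_const c \<odot>\<^bsub>M\<^esub> x)"
    if y: "y \<in> special_ideal M +>\<^bsub>M\<^esub> x" for y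
  proof -
    obtain i where i: "i \<in> special_ideal M" "y = i \<oplus>\<^bsub>M\<^esub> x" using y unfolding a_r_coset_def' by auto
    obtain z where z: "z \<in> carrier M" "i = fps_X \<odot>\<^bsub>M\<^esub> z" using i(1) mem_special_ideal by auto
    have e: "fps_const c \<odot>\<^bsub>M\<^esub> y = (fps_X \<odot>\<^bsub>M\<^esub> (fps_const c \<odot>\<^bsub>M\<^esub> z)) \<oplus>\<^bsub>M\<^esub> (fps_const c \<odot>\<^bsub>M\<^esub> x)"
      unfolding i(2) z(2) using x z(1) smult_r_distr[of "fps_const c" "fps_X \<odot>\<^bsub>M\<^esub> z" x]
      by (simp add: smult_assoc mult.commute)
    have "fps_X \<odot>\<^bsub>M\<^esub> (fps_const c \<odot>\<^bsub>M\<^esub> z) \<in> special_ideal M"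
      unfolding mem_special_ideal using z(1) by blast
    then have "fps_const c \<odot>\<^bsub>M\<^esub> y \<in> special_ideal M +>\<^bsub>M\<^esub> (fps_const c \<odot>\<^bsub>M\<^esub> x)"
      unfolding a_r_coset_def' e by blast
    then show ?thesis
      using I.a_repr_independence'[of "fps_const c \<odot>\<^bsub>M\<^esub> y" "fps_const c \<odot>\<^bsub>M\<^esub> x"] x by simp
  qed
  have ne: "special_ideal M +>\<^bsub>M\<^esub> x \<noteq> {}" using I.a_rcos_self[OF x] by blast
  show ?thesis unfolding sm by (rule SUP_eq_const[OF ne]) (rule const)
qed

text \<open>A reduction is a surjection onto the special fibre, described without cosets.\<close>

definition reduction :: "('k, 'a) module \<Rightarrow> ('b \<Rightarrow> 'a) \<Rightarrow> bool" where
  "reduction A \<pi> \<longleftrightarrow> \<pi> \<in> Ring.ring_hom M A \<and> \<pi> ` carrier M = carrier A \<and>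
     (\<forall>c. \<forall>x\<in>carrier M. \<pi> (fps_const c \<odot>\<^bsub>M\<^esub> x) = c \<odot>\<^bsub>A\<^esub> \<pi> x) \<and>
     (\<forall>x\<in>carrier M. \<pi> x = \<zero>\<^bsub>A\<^esub> \<longleftrightarrow> (\<exists>y\<in>carrier M. x = fps_X \<odot>\<^bsub>M\<^esub> y))"

text \<open>The quotient map is followed by the given isomorphism, whose injectivity identifies the
  kernel with the ideal generated by t.\<close>

lemma reduction_of_special_fibre:
  assumes A: "ring A" and \<phi>: "\<phi> \<in> alg_iso (special_fibre M) A"
  shows "reduction A (\<lambda>x. \<phi> (special_ideal M +>\<^bsub>M\<^esub> x))"
proof -
  interpret I: ideal "special_ideal M" M by (rule special_ideal)
  let ?Q = "M Quot special_ideal M" and ?q = "\<lambda>x. special_ideal M +>\<^bsub>M\<^esub> x"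
  have q: "?q \<in> Ring.ring_hom M ?Q" by (rule I.rcos_ring_hom)
  have \<phi>h: "\<phi> \<in> Ring.ring_hom ?Q A" and bij: "bij_betw \<phi> (carrier ?Q) (carrier A)"
    and lin: "\<And>c x. x \<in> carrier (special_fibre M) \<Longrightarrow> \<phi> (c \<odot>\<^bsub>special_fibre M\<^esub> x) = c \<odot>\<^bsub>A\<^esub> \<phi> x"
    using \<phi> by (auto simp: alg_iso_def alg_hom_def special_fibre_ring_hom special_fibre_simps)
  have qc: "?q x \<in> carrier ?Q" if "x \<in> carrier M" for x
    by (rule Ring.ring_hom_closed[OF q that])
  have "(\<lambda>x. \<phi> (?q x)) \<in> Ring.ring_hom M A"
    using Ring.ring_hom_closed[OF \<phi>h] Ring.ring_hom_mult[OF \<phi>h] Ring.ring_hom_add[OF \<phi>h] Ring.ring_hom_one[OF \<phi>h]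
      Ring.ring_hom_mult[OF q] Ring.ring_hom_add[OF q] Ring.ring_hom_one[OF q] qc
    by (intro Ring.ring_hom_memI) simp_all
  moreover have "(\<lambda>x. \<phi> (?q x)) ` carrier M = carrier A"
  proof -
    have "?q ` carrier M = carrier ?Q" by (auto simp: FactRing_def A_RCOSETS_def')
    then show ?thesis using bij unfolding bij_betw_def by (simp add: image_image[symmetric])
  qed
  moreover have "\<phi> (?q (fps_const c \<odot>\<^bsub>M\<^esub> x)) = c \<odot>\<^bsub>A\<^esub> \<phi> (?q x)" if "x \<in> carrier M" for c x
    using lin[of "?q x" c] qc[OF that] special_fibre_smult[OF that, of c] by (simp add: special_fibre_simps)
  moreover have "\<phi> (?q x) = \<zero>\<^bsub>A\<^esub> \<longleftrightarrow> (\<exists>y\<in>carrier M. x = fps_X \<odot>\<^bsub>M\<^esub> y)" if x: "x \<in> carrier M" for x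
  proof -
    have Q0: "\<zero>\<^bsub>?Q\<^esub> = special_ideal M" by (simp add: FactRing_def)
    have Qr: "ring ?Q" by (rule I.quotient_is_ring)
    have "\<phi> \<zero>\<^bsub>?Q\<^esub> = \<zero>\<^bsub>A\<^esub>" by (rule ring_hom_zero[OF \<phi>h Qr A])
    then have "\<phi> (?q x) = \<zero>\<^bsub>A\<^esub> \<longleftrightarrow> \<phi> (?q x) = \<phi> (special_ideal M)" by (simp add: Q0)
    also have "\<dots> \<longleftrightarrow> ?q x = special_ideal M"
      using bij_betw_imp_inj_on[OF bij] qc[OF x] ring.ring_simprules(2)[OF Qr] unfolding Q0 by (rule inj_on_eq_iff)
    also have "\<dots> \<longleftrightarrow> x \<in> special_ideal M"
      using I.a_rcos_self[OF x] I.a_rcos_const[of x] by auto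
    finally show ?thesis unfolding mem_special_ideal .
  qed
  ultimately show ?thesis unfolding reduction_def by blast
qed

text \<open>The kernel of \<pi> is the ideal generated by t, so the isomorphism theorem for rings
  applies; linearity is checked on representatives.\<close>

lemma special_fibre_of_reduction:
  assumes A: "ring A" and \<pi>: "reduction A \<pi>"
  shows "\<exists>\<phi>. \<phi> \<in> alg_iso (special_fibre M) A"
proof -
  have \<pi>h: "\<pi> \<in> Ring.ring_hom M A" using \<pi> by (simp add: reduction_def)
  interpret R: ring_hom_ring M A \<pi>
    by (rule ring_hom_ringI2[OF _ A \<pi>h]) (rule ring_axioms)
  have "x \<in> carrier M" if "x \<in> special_ideal M" for x
    using that by (auto simp: mem_special_ideal)
  moreover have "\<pi> x = \<zero>\<^bsub>A\<^esub> \<longleftrightarrow> x \<in> special_ideal M" if "x \<in> carrier M" for x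
    using \<pi> that by (simp add: reduction_def mem_special_ideal)
  ultimately have ker: "a_kernel M A \<pi> = special_ideal M"
    unfolding a_kernel_def' by blast
  have iso: "(\<lambda>Z. the_elem (\<pi> ` Z)) \<in> ring_iso (M Quot special_ideal M) A"
    using R.FactRing_iso_set \<pi> unfolding ker reduction_def by blast
  have "the_elem (\<pi> ` (c \<odot>\<^bsub>special_fibre M\<^esub> Z)) = c \<odot>\<^bsub>A\<^esub> the_elem (\<pi> ` Z)"
    if Z: "Z \<in> carrier (M Quot special_ideal M)" for c Z
  proof -
    obtain x where x: "x \<in> carrier M" "Z = special_ideal M +>\<^bsub>M\<^esub> x"
      using Z by (auto simp: FactRing_def A_RCOSETS_def')
    show ?thesis
      unfolding x(2) special_fibre_smult[OF x(1)] using x(1) \<pi> R.the_elem_simp[unfolded ker]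
      by (simp add: reduction_def)
  qed
  then have "(\<lambda>Z. the_elem (\<pi> ` Z)) \<in> alg_iso (special_fibre M) A"
    using iso unfolding alg_iso_def alg_hom_def ring_iso_def special_fibre_ring_hom special_fibre_simps by auto
  then show ?thesis by blast
qed

end

section \<open>Linear reductivity\<close>

text \<open>Meant for matrix coefficients of a representation, which are combinations of the
  functions occurring in a coaction.\<close>

lemma function_algebra_sum:
  assumes alg: "algebra class_ring (function_algebra Y \<O>)" and ext: "\<O> \<subseteq> extensional Y"
    and u: "\<And>l. l < (m::nat) \<Longrightarrow> u l \<in> \<O>"
  shows "(\<lambda>x\<in>Y. \<Sum>l<m. u l x * d l) \<in> \<O>"
proof -
  interpret algebra class_ring "function_algebra Y \<O>" by (rule alg)
  have add: "(\<lambda>x\<in>Y. f x + h x) \<in> \<O>" if "f \<in> \<O>" "h \<in> \<O>" for f h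
    using add.m_closed[of f h] that by (simp add: function_algebra_def)
  have smult: "(\<lambda>x\<in>Y. c * f x) \<in> \<O>" if "f \<in> \<O>" for c f
    using smult_closed[of c f] that by (simp add: function_algebra_def)
  have zero: "(\<lambda>x\<in>Y. 0) \<in> \<O>"
    using zero_closed by (simp add: function_algebra_def)
  show ?thesis
    using u
  proof (induction m)
    case 0
    show ?case using zero unfolding lessThan_0 sum.empty .
  next
    case (Suc m)
    have eq: "(\<lambda>x\<in>Y. (\<lambda>x\<in>Y. \<Sum>l<m. u l x * d l) x + (\<lambda>x\<in>Y. d m * u m x) x)
        = (\<lambda>x\<in>Y. \<Sum>l<Suc m. u l x * d l)"
      by (rule restrict_ext) (simp add: mult.commute)
    have "(\<lambda>x\<in>Y. (\<lambda>x\<in>Y. \<Sum>l<m. u l x * d l) x + (\<lambda>x\<in>Y. d m * u m x) x) \<in> \<O>"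
      using Suc by (intro add smult) auto
    then show ?case unfolding eq .
  qed
qed

text \<open>
  By the coaction, the orbit of \<open>b\<close> lies in a finite-dimensional subrepresentation.  Split it into
  its vectors in \<open>N\<close> and a complement: the component \<open>b'\<close> of \<open>b\<close> in the complement is moved
  by \<open>g\<close> by an element that also lies in \<open>N\<close>, hence not at all.
\<close>

lemma invariant_representative:
  fixes G :: "('g, 'm) monoid_scheme" and \<O> :: "('g \<Rightarrow> 'k::alg_closed_field) set"
    and sc :: "'k \<Rightarrow> 'v::ab_group_add \<Rightarrow> 'v" and \<gamma> :: "'g \<Rightarrow> 'v \<Rightarrow> 'v"
  assumes vs: "vector_space sc"
    and lr: "linearly_reductive G \<O>"
    and Y: "module.subspace sc Y"
    and N: "module.subspace sc N"
    and cl: "\<And>g x. g \<in> carrier G \<Longrightarrow> x \<in> Y \<Longrightarrow> \<gamma> g x \<in> Y"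
    and \<gamma>_add: "\<And>g x y. g \<in> carrier G \<Longrightarrow> x \<in> Y \<Longrightarrow> y \<in> Y \<Longrightarrow> \<gamma> g (x + y) = \<gamma> g x + \<gamma> g y"
    and \<gamma>_sc: "\<And>g c x. g \<in> carrier G \<Longrightarrow> x \<in> Y \<Longrightarrow> \<gamma> g (sc c x) = sc c (\<gamma> g x)"
    and \<gamma>_one: "\<And>x. x \<in> Y \<Longrightarrow> \<gamma> \<one>\<^bsub>G\<^esub> x = x"
    and \<gamma>_mult: "\<And>g h x. g \<in> carrier G \<Longrightarrow> h \<in> carrier G \<Longrightarrow> x \<in> Y \<Longrightarrow> \<gamma> (g \<otimes>\<^bsub>G\<^esub> h) x = \<gamma> g (\<gamma> h x)"
    and \<gamma>_N: "\<And>g x. g \<in> carrier G \<Longrightarrow> x \<in> Y \<Longrightarrow> x \<in> N \<Longrightarrow> \<gamma> g x \<in> N"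
    and coaction: "\<And>x. x \<in> Y \<Longrightarrow> \<exists>(m::nat) u v. (\<forall>i<m. u i \<in> \<O>) \<and>
        (\<forall>g\<in>carrier G. \<gamma> g x = (\<Sum>i<m. sc (u i g) (v i)))"
    and b: "b \<in> Y" and bN: "\<And>g. g \<in> carrier G \<Longrightarrow> \<gamma> g b - b \<in> N"
  shows "\<exists>b'\<in>Y. (\<forall>g\<in>carrier G. \<gamma> g b' = b') \<and> b' - b \<in> N"
proof -
  interpret V: vector_space sc by (rule vs)
  interpret VK: vector_space_pair sc "(*) :: 'k \<Rightarrow> 'k \<Rightarrow> 'k"
    by unfold_locales (simp_all add: algebra_simps)
  have aag: "affine_algebraic_group G \<O>"
    and cr: "\<And>n \<rho>. rational_representation G \<O> n \<rho> \<Longrightarrow> completely_reducible G n \<rho>"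
    using lr by (auto simp: linearly_reductive_def)
  interpret G: group G using aag by (simp add: affine_algebraic_group_def)
  have alg: "algebra class_ring (function_algebra (carrier G) \<O>)" and ext: "\<O> \<subseteq> extensional (carrier G)"
    using aag by (auto simp: affine_algebraic_group_def affine_variety_def fin_gen_algebra_def)
  define Orb where "Orb = {\<gamma> g b |g. g \<in> carrier G}"
  have OrbX: "Orb \<subseteq> Y" using cl b by (auto simp: Orb_def)
  obtain m :: nat and u v where u: "\<forall>i<m. u i \<in> \<O>" and uv: "\<forall>g\<in>carrier G. \<gamma> g b = (\<Sum>i<m. sc (u i g) (v i))"
    using coaction[OF b] by blast
  \<comment> \<open>The basis is taken from the orbit itself, so its span is stable under
    \<open>G\<close>. It is finite because the coaction places the orbit in the span of finitely
    many vectors.\<close>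
  obtain B where B: "B \<subseteq> Orb" "V.independent B" "Orb \<subseteq> V.span B"
    by (rule V.maximal_independent_subset)
  have "\<gamma> g b \<in> V.span (v ` {..<m})" if "g \<in> carrier G" for g
    unfolding uv[rule_format, OF that] by (intro V.span_sum V.span_scale V.span_base imageI)
  then have "B \<subseteq> V.span (v ` {..<m})" using B(1) by (auto simp: Orb_def)
  then have finB: "finite B" using V.independent_span_bound[OF _ B(2), of "v ` {..<m}"] by simp
  define n where "n = card B"
  obtain w where w: "bij_betw w {0..<n} B" unfolding n_def using ex_bij_betw_nat_finite[OF finB] by blast
  have wB: "w j \<in> B" if "j < n" for j using w that by (auto simp: bij_betw_def)
  have BX: "B \<subseteq> Y" using B(1) OrbX by blast
  have wX: "w j \<in> Y" if "j < n" for j using wB[OF that] BX by blast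
  have spanX: "V.span B \<subseteq> Y" by (rule V.span_minimal[OF BX Y])
  \<comment> \<open>\<open>lc\<close> identifies K^n with the span of \<open>B\<close>; its
    injectivity transfers identities of vectors back to coordinates.\<close>
  define lc where "lc c = (\<Sum>i\<in>{0..<n}. sc (vec_index c i) (w i))" for c
  have lcX: "lc c \<in> V.span B" for c
    unfolding lc_def by (intro V.span_sum V.span_scale V.span_base wB) simp
  have sum_w: "(\<Sum>i\<in>{0..<n}. sc (f (w i)) (w i)) = (\<Sum>x\<in>B. sc (f x) x)" for f
    using sum.reindex_bij_betw[OF w, of "\<lambda>x. sc (f x) x"] by simp
  have lc_rep: "lc (vec n (\<lambda>i. V.representation B x (w i))) = x" if "x \<in> V.span B" for x
  proof -
    have "lc (vec n (\<lambda>i. V.representation B x (w i))) = (\<Sum>i\<in>{0..<n}. sc (V.representation B x (w i)) (w i))"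
      unfolding lc_def by (rule sum.cong) simp_all
    also have "\<dots> = x" unfolding sum_w by (rule V.sum_representation_eq[OF B(2) that finB]) simp
    finally show ?thesis .
  qed
  have lc_zero: "c = 0\<^sub>v n" if c: "c \<in> carrier_vec n" and z: "lc c = 0" for c
  proof (rule eq_vecI)
    fix i assume "i < dim_vec (0\<^sub>v n :: 'k vec)"
    then have i: "i < n" by simp
    define f where "f x = vec_index c (the_inv_into {0..<n} w x)" for x
    have fw: "f (w j) = vec_index c j" if "j < n" for j
      using w that unfolding f_def by (simp add: bij_betw_def the_inv_into_f_f)
    have "(\<Sum>x\<in>B. sc (f x) x) = lc c"
      unfolding sum_w[symmetric] lc_def by (rule sum.cong) (simp_all add: fw)
    then have "f (w i) = 0" using V.independentD[OF B(2) finB order_refl _ wB[OF i], of f] z by simp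
    then show "vec_index c i = vec_index (0\<^sub>v n) i" using fw[OF i] i by simp
  qed (use c in simp)
  have lc_add: "lc (c + d) = lc c + lc d" if "c \<in> carrier_vec n" "d \<in> carrier_vec n" for c d
    using that by (simp add: lc_def V.scale_left_distrib sum.distrib)
  have lc_smult: "lc (k \<cdot>\<^sub>v c) = sc k (lc c)" if "c \<in> carrier_vec n" for c k
    using that by (simp add: lc_def V.scale_sum_right)
  have lc_minus: "lc (c - d) = lc c - lc d" if "c \<in> carrier_vec n" "d \<in> carrier_vec n" for c d
    using that by (simp add: lc_def V.scale_left_diff_distrib sum_subtractf)
  have lc_inj: "c = d" if c: "c \<in> carrier_vec n" and d: "d \<in> carrier_vec n" and eq: "lc c = lc d" for c d
  proof -
    have "c - d = 0\<^sub>v n" by (rule lc_zero) (use c d eq lc_minus in auto)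
    then have "vec_index c i - vec_index d i = 0" if "i < n" for i
      using c d that index_minus_vec(1)[of i d c] by (metis carrier_vecD index_zero_vec(1))
    then show ?thesis using c d by (intro eq_vecI) auto
  qed
  have \<gamma>0: "\<gamma> g 0 = 0" if "g \<in> carrier G" for g
    using \<gamma>_sc[OF that b, of 0] by simp
  have \<gamma>_sum: "\<gamma> g (\<Sum>i\<in>I. sc (c i) (z i)) = (\<Sum>i\<in>I. sc (c i) (\<gamma> g (z i)))"
    if g: "g \<in> carrier G" and I: "finite I" "\<And>i. i \<in> I \<Longrightarrow> z i \<in> Y" for g c I and z :: "nat \<Rightarrow> 'v"
    using I
  proof (induction I)
    case (insert i I)
    have "(\<Sum>i\<in>I. sc (c i) (z i)) \<in> Y" using insert by (auto intro!: V.subspace_sum[OF Y] V.subspace_scale[OF Y])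
    moreover have "sc (c i) (z i) \<in> Y" using insert by (auto intro!: V.subspace_scale[OF Y])
    ultimately show ?case using insert by (simp add: \<gamma>_add[OF g] \<gamma>_sc[OF g])
  qed (simp add: \<gamma>0 g)
  have \<gamma>B: "\<gamma> g (w j) \<in> V.span B" if g: "g \<in> carrier G" and j: "j < n" for g j
  proof -
    obtain h where h: "h \<in> carrier G" "w j = \<gamma> h b" using wB[OF j] B(1) by (auto simp: Orb_def)
    have "\<gamma> g (w j) = \<gamma> (g \<otimes>\<^bsub>G\<^esub> h) b" unfolding h(2) using \<gamma>_mult[OF g h(1) b] by simp
    moreover have "\<gamma> (g \<otimes>\<^bsub>G\<^esub> h) b \<in> Orb" unfolding Orb_def using G.m_closed[OF g h(1)] by blast
    ultimately show ?thesis using B(3) by auto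
  qed
  define \<rho> where "\<rho> g = mat n n (\<lambda>(i, j). V.representation B (\<gamma> g (w j)) (w i))" for g
  have \<rho>: "\<rho> g \<in> carrier_mat n n" for g by (simp add: \<rho>_def)
  have colc: "col (\<rho> g) j \<in> carrier_vec n" for g j
    using \<rho>[of g] unfolding carrier_vec_def by simp
  have lc_col: "lc (col (\<rho> g) j) = \<gamma> g (w j)" if "g \<in> carrier G" "j < n" for g j
  proof -
    have "col (\<rho> g) j = vec n (\<lambda>i. V.representation B (\<gamma> g (w j)) (w i))"
      using that by (intro eq_vecI) (simp_all add: \<rho>_def)
    then show ?thesis using lc_rep[OF \<gamma>B[OF that]] by simp
  qed
  have lc_\<rho>: "lc (\<rho> g *\<^sub>v c) = \<gamma> g (lc c)" if g: "g \<in> carrier G" and c: "c \<in> carrier_vec n" for g c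
  proof -
    have "lc (\<rho> g *\<^sub>v c) = (\<Sum>i\<in>{0..<n}. sc (\<Sum>j\<in>{0..<n}. vec_index (col (\<rho> g) j) i * vec_index c j) (w i))"
      unfolding lc_def using c \<rho>[of g]
      by (intro sum.cong arg_cong2[of _ _ _ _ sc] refl) (simp add: scalar_prod_def row_def col_def)
    also have "\<dots> = (\<Sum>i\<in>{0..<n}. \<Sum>j\<in>{0..<n}. sc (vec_index c j) (sc (vec_index (col (\<rho> g) j) i) (w i)))"
      by (simp add: V.scale_sum_left mult.commute)
    also have "\<dots> = (\<Sum>j\<in>{0..<n}. sc (vec_index c j) (lc (col (\<rho> g) j)))"
      unfolding lc_def V.scale_sum_right by (rule sum.swap)
    also have "\<dots> = (\<Sum>j\<in>{0..<n}. sc (vec_index c j) (\<gamma> g (w j)))"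
      by (rule sum.cong) (simp_all add: lc_col g)
    also have "\<dots> = \<gamma> g (lc c)"
      unfolding lc_def by (rule \<gamma>_sum[OF g, symmetric]) (simp_all add: wX)
    finally show ?thesis .
  qed
  have rr: "rational_representation G \<O> n \<rho>"
    unfolding rational_representation_def
  proof (intro conjI ballI allI impI)
    show "\<rho> g \<in> carrier_mat n n" for g by (rule \<rho>)
    show "\<rho> \<one>\<^bsub>G\<^esub> = 1\<^sub>m n"
    proof (rule eq_matI)
      fix i j assume "i < dim_row (1\<^sub>m n :: 'k mat)" "j < dim_col (1\<^sub>m n :: 'k mat)"
      then have ij: "i < n" "j < n" by auto
      have "w i = w j \<longleftrightarrow> i = j" using w ij by (auto simp: bij_betw_def dest: inj_onD)
      then show "\<rho> \<one>\<^bsub>G\<^esub> $$ (i, j) = 1\<^sub>m n $$ (i, j)"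
        using ij by (simp add: \<rho>_def \<gamma>_one wX V.representation_basis[OF B(2) wB])
    qed (simp_all add: \<rho>_def)
  next
    fix g h assume g: "g \<in> carrier G" and h: "h \<in> carrier G"
    show "\<rho> (g \<otimes>\<^bsub>G\<^esub> h) = \<rho> g * \<rho> h"
    proof (rule mat_col_eqI)
      fix j assume "j < dim_col (\<rho> g * \<rho> h)"
      then have j: "j < n" using \<rho>[of h] by simp
      have "lc (col (\<rho> (g \<otimes>\<^bsub>G\<^esub> h)) j) = \<gamma> g (\<gamma> h (w j))"
        using lc_col[of "g \<otimes>\<^bsub>G\<^esub> h" j] j g h \<gamma>_mult[OF g h wX[OF j]] by simp
      also have "\<dots> = lc (\<rho> g *\<^sub>v col (\<rho> h) j)"
        unfolding lc_\<rho>[OF g colc] lc_col[OF h j] ..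
      also have "\<rho> g *\<^sub>v col (\<rho> h) j = col (\<rho> g * \<rho> h) j"
        using col_mult2[OF \<rho> \<rho> j, of g h] by simp
      finally have eq: "lc (col (\<rho> (g \<otimes>\<^bsub>G\<^esub> h)) j) = lc (col (\<rho> g * \<rho> h) j)" .
      have "col (\<rho> g * \<rho> h) j \<in> carrier_vec n"
        using \<rho>[of g] unfolding carrier_vec_def by simp
      then show "col (\<rho> (g \<otimes>\<^bsub>G\<^esub> h)) j = col (\<rho> g * \<rho> h) j"
        by (intro lc_inj[OF colc _ eq])
    qed (use \<rho>[of g] \<rho>[of h] \<rho>[of "g \<otimes>\<^bsub>G\<^esub> h"] in auto)
  next
    fix i j assume i: "i < n" and j: "j < n"
    \<comment> \<open>The vectors of the coaction need not lie in the span of \<open>B\<close>, so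
      the coordinate at \<open>w i\<close> is extended to a functional on the whole space before it
      is applied to them.\<close>
    obtain \<xi> where \<xi>: "Vector_Spaces.linear sc (*) \<xi>" "\<forall>x\<in>B. \<xi> x = (if x = w i then 1 else 0)"
      using VK.linear_independent_extend[OF B(2), of "\<lambda>x. if x = w i then 1 else 0"] by blast
    interpret \<xi>: Vector_Spaces.linear sc "(*)" \<xi> by (rule \<xi>(1))
    have \<xi>w: "\<xi> (w k) = (if k = i then 1 else 0)" if "k < n" for k
    proof -
      have "w k = w i \<longleftrightarrow> k = i" using w i that by (auto simp: bij_betw_def dest: inj_onD)
      then show ?thesis using \<xi>(2) wB[OF that] by simp
    qed
    have \<xi>lc: "\<xi> (lc c) = vec_index c i" for c
    proof -
      have "\<xi> (lc c) = (\<Sum>k\<in>{0..<n}. vec_index c k * \<xi> (w k))"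
        unfolding lc_def by (simp add: \<xi>.sum \<xi>.scale)
      also have "\<dots> = (\<Sum>k\<in>{0..<n}. if k = i then vec_index c k else 0)"
        by (rule sum.cong) (simp_all add: \<xi>w)
      finally show ?thesis using i by simp
    qed
    obtain m :: nat and u v where u: "\<forall>l<m. u l \<in> \<O>" and uv: "\<forall>g\<in>carrier G. \<gamma> g (w j) = (\<Sum>l<m. sc (u l g) (v l))"
      using coaction[OF wX[OF j]] by blast
    have "\<rho> g $$ (i, j) = (\<Sum>l<(m::nat). u l g * \<xi> (v l))" if g: "g \<in> carrier G" for g
    proof -
      have "\<rho> g $$ (i, j) = vec_index (col (\<rho> g) j) i" using i j by (simp add: \<rho>_def)
      also have "\<dots> = \<xi> (\<gamma> g (w j))" unfolding \<xi>lc[symmetric] lc_col[OF g j] ..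
      also have "\<dots> = (\<Sum>l<m. u l g * \<xi> (v l))"
        using uv g by (simp add: \<xi>.sum \<xi>.scale)
      finally show ?thesis .
    qed
    then have "(\<lambda>g\<in>carrier G. \<rho> g $$ (i, j)) = (\<lambda>g\<in>carrier G. \<Sum>l<m. u l g * \<xi> (v l))"
      by (rule restrict_ext)
    then show "(\<lambda>g\<in>carrier G. \<rho> g $$ (i, j)) \<in> \<O>"
      using function_algebra_sum[OF alg ext, of m u] u by simp
  qed
  define W where "W = {c \<in> carrier_vec n. lc c \<in> N}"
  have N0: "0 \<in> N" by (rule V.subspace_0[OF N])
  have lc0: "lc (0\<^sub>v n) = 0" by (simp add: lc_def)
  have sub: "subrepresentation G n \<rho> W"
    unfolding subrepresentation_def
  proof (intro conjI ballI)
    show "LinearCombinations.submodule class_ring W (module_vec TYPE('k) n)"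
    proof (rule submodule.intro)
      show "module class_ring (module_vec TYPE('k) n)"
        by (rule vec_module)
    qed (auto simp: W_def module_vec_def lc_add lc_smult lc0 N0 V.subspace_add[OF N] V.subspace_scale[OF N])
    fix g c assume g: "g \<in> carrier G" and "c \<in> W"
    then have c: "c \<in> carrier_vec n" "lc c \<in> N" by (auto simp: W_def)
    have "\<gamma> g (lc c) \<in> N" using \<gamma>_N[OF g _ c(2)] lcX[of c] spanX by blast
    then show "\<rho> g *\<^sub>v c \<in> W"
      using lc_\<rho>[OF g c(1)] mult_mat_vec_carrier[OF \<rho> c(1)] by (simp add: W_def)
  qed
  from cr[OF rr, unfolded completely_reducible_def, rule_format, OF sub] obtain W' where
    W': "subrepresentation G n \<rho> W'" "W \<inter> W' = {0\<^sub>v n}"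
    and dec: "\<forall>v\<in>carrier_vec n. \<exists>w\<in>W. \<exists>w'\<in>W'. v = w + w'"
    by (elim exE conjE) (rule that; assumption)
  have sm: "LinearCombinations.submodule class_ring W' (module_vec TYPE('k) n)"
    and W'\<rho>: "\<And>g c. g \<in> carrier G \<Longrightarrow> c \<in> W' \<Longrightarrow> \<rho> g *\<^sub>v c \<in> W'"
    using W'(1) unfolding subrepresentation_def by simp_all
  have W'c: "W' \<subseteq> carrier_vec n"
    using submodule.subset[OF sm] by (simp add: module_vec_def)
  have W'm: "c - d \<in> W'" if "c \<in> W'" "d \<in> W'" for c d
  proof -
    have "c + (-1) \<cdot>\<^sub>v d \<in> W'"
      using submodule.m_closed[OF sm that(1) submodule.smult_closed[OF sm _ that(2), of "-1"]]
      by (simp add: module_vec_def)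
    moreover have "c + (-1) \<cdot>\<^sub>v d = c - d"
      using subsetD[OF W'c that(1)] subsetD[OF W'c that(2)] by (intro eq_vecI) auto
    ultimately show ?thesis by simp
  qed
  have bspan: "b \<in> V.span B"
  proof -
    have "\<gamma> \<one>\<^bsub>G\<^esub> b \<in> Orb" by (auto simp: Orb_def)
    then show ?thesis using B(3) \<gamma>_one[OF b] by auto
  qed
  obtain c d where c: "c \<in> W" and d: "d \<in> W'" and cd: "vec n (\<lambda>i. V.representation B b (w i)) = c + d"
    using dec[rule_format, OF vec_carrier] by blast
  have cc: "c \<in> carrier_vec n" "lc c \<in> N" using c by (auto simp: W_def)
  have dc: "d \<in> carrier_vec n" using d W'c by blast
  have bcd: "b = lc c + lc d" using lc_rep[OF bspan] unfolding cd lc_add[OF cc(1) dc] by simp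
  have fixed: "\<gamma> g (lc d) = lc d" if g: "g \<in> carrier G" for g
  proof -
    have \<rho>d: "\<rho> g *\<^sub>v d \<in> carrier_vec n" by (rule mult_mat_vec_carrier[OF \<rho> dc])
    have "\<rho> g *\<^sub>v d - d \<in> W'"
      by (rule W'm[OF W'\<rho>[OF g d] d])
    \<comment> \<open>Both b and its component \<open>lc c\<close> are invariant modulo
      \<open>N\<close>: b by hypothesis, and \<open>lc c\<close> because it lies in
      \<open>N\<close>, which the action preserves. Hence so is their difference
      \<open>lc d\<close>.\<close>
    moreover have "\<rho> g *\<^sub>v d - d \<in> W"
    proof -
      have X': "lc c \<in> Y" "lc d \<in> Y" using lcX spanX by blast+
      have "\<gamma> g b = \<gamma> g (lc c) + \<gamma> g (lc d)" unfolding bcd by (rule \<gamma>_add[OF g X'])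
      then have "\<gamma> g (lc d) - lc d = (\<gamma> g b - b) - (\<gamma> g (lc c) - lc c)"
        using bcd by (simp add: algebra_simps)
      also have "\<dots> \<in> N"
        using V.subspace_diff[OF N bN[OF g] V.subspace_diff[OF N \<gamma>_N[OF g X'(1) cc(2)] cc(2)]] .
      finally have "lc (\<rho> g *\<^sub>v d - d) \<in> N"
        unfolding lc_minus[OF \<rho>d dc] lc_\<rho>[OF g dc] .
      then show ?thesis using \<rho>d dc by (simp add: W_def)
    qed
    ultimately have "\<rho> g *\<^sub>v d - d = 0\<^sub>v n" using W'(2) by blast
    then have "lc (\<rho> g *\<^sub>v d) - lc d = 0" using lc_minus[OF \<rho>d dc] lc0 by simp
    then show ?thesis unfolding lc_\<rho>[OF g dc] by simp
  qed
  have "lc d - b = - lc c" unfolding bcd by simp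
  then have "lc d - b \<in> N" using V.subspace_neg[OF N cc(2)] by simp
  then show ?thesis using fixed lcX[of d] spanX by (intro bexI[of _ "lc d"]) auto
qed

section \<open>Free modules over the power series ring\<close>

text \<open>These are n linear equations in n + 1 unknowns. A zero row makes the matrix square with
  determinant 0, which gives a kernel vector over any integral domain; it is stored as the
  coefficients of a polynomial.\<close>

lemma zero_row_kernel_vector:
  fixes s :: "nat \<Rightarrow> nat \<Rightarrow> 'a::idom"
  shows "\<exists>q::'a poly. q \<noteq> 0 \<and> (\<forall>i<n. seq_apply q (s i) = 0)"
proof -
  define A where "A = mat (Suc n) (Suc n) (\<lambda>(i, j). if i < n then s i j else 0)"
  have A: "A \<in> carrier_mat (Suc n) (Suc n)" by (simp add: A_def)
  have "transpose_mat A *\<^sub>v unit_vec (Suc n) n = 0\<^sub>v (Suc n)"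
    by (rule eq_vecI) (simp_all add: A_def)
  moreover have "unit_vec (Suc n) n \<noteq> (0\<^sub>v (Suc n) :: 'a vec)"
  proof
    assume "unit_vec (Suc n) n = (0\<^sub>v (Suc n) :: 'a vec)"
    from arg_cong[OF this, of "\<lambda>v. vec_index v n"] show False by simp
  qed
  ultimately have "det (transpose_mat A) = 0"
    using iffD2[OF det_0_iff_vec_prod_zero[OF transpose_carrier_mat[THEN iffD2, OF A]]] unit_vec_carrier by blast
  then have "det A = 0" using det_transpose[OF A] by simp
  then obtain v where v: "v \<in> carrier_vec (Suc n)" "v \<noteq> 0\<^sub>v (Suc n)" "A *\<^sub>v v = 0\<^sub>v (Suc n)"
    using det_0_iff_vec_prod_zero[OF A] by blast
  define q where "q = (\<Sum>j\<le>n. monom (vec_index v j) j)"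
  have cq: "coeff q j = (if j \<le> n then vec_index v j else 0)" for j
    by (simp add: q_def coeff_sum)
  have "q \<noteq> 0"
  proof
    assume "q = 0"
    then have "vec_index v j = 0" if "j < Suc n" for j using cq[of j] that by simp
    then have "v = 0\<^sub>v (Suc n)" using v(1) by (intro eq_vecI) auto
    then show False using v(2) by simp
  qed
  moreover have "seq_apply q (s i) = 0" if i: "i < n" for i
  proof -
    have "degree q \<le> n" by (rule degree_le) (simp add: cq)
    then have "seq_apply q (s i) = (\<Sum>j\<le>n. vec_index v j * s i j)"
      by (simp add: seq_apply_bound cq)
    also have "\<dots> = (\<Sum>j\<in>{0..<Suc n}. s i j * vec_index v j)"
      by (rule sum.cong) (auto simp: mult.commute)
    also have "\<dots> = vec_index (A *\<^sub>v v) i"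
      using i v(1) by (simp add: A_def scalar_prod_def row_def)
    also have "\<dots> = 0" unfolding v(3) using i by simp
    finally show ?thesis .
  qed
  ultimately show ?thesis by blast
qed

context fps_algebra
begin

definition functional :: "('b \<Rightarrow> 'k fps) \<Rightarrow> bool" where
  "functional f \<longleftrightarrow> (\<forall>x\<in>carrier M. (\<forall>y\<in>carrier M. f (x \<oplus>\<^bsub>M\<^esub> y) = f x + f y) \<and> (\<forall>r. f (r \<odot>\<^bsub>M\<^esub> x) = r * f x))"

lemma functionalD:
  assumes "functional f"
  shows "x \<in> carrier M \<Longrightarrow> y \<in> carrier M \<Longrightarrow> f (x \<oplus>\<^bsub>M\<^esub> y) = f x + f y"
    and "x \<in> carrier M \<Longrightarrow> f (r \<odot>\<^bsub>M\<^esub> x) = r * f x"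
    and "f \<zero>\<^bsub>M\<^esub> = 0"
proof -
  show a: "x \<in> carrier M \<Longrightarrow> y \<in> carrier M \<Longrightarrow> f (x \<oplus>\<^bsub>M\<^esub> y) = f x + f y" for x y
    using assms by (simp add: functional_def)
  show "x \<in> carrier M \<Longrightarrow> f (r \<odot>\<^bsub>M\<^esub> x) = r * f x" using assms by (simp add: functional_def)
  show "f \<zero>\<^bsub>M\<^esub> = 0"
    using a[OF zero_closed zero_closed] unfolding l_zero[OF zero_closed] by (metis add_cancel_left_left)
qed

lemma functional_finsum:
  "functional f \<Longrightarrow> (\<And>i. i \<in> I \<Longrightarrow> g i \<in> carrier M) \<Longrightarrow> f (\<Oplus>\<^bsub>M\<^esub>i\<in>I. g i) = (\<Sum>i\<in>I. f (g i))"
  by (induction I rule: infinite_finite_induct) (simp_all add: functionalD Pi_def)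

lemma free_coordinates:
  assumes "free_of_finite_rank M"
  shows "\<exists>E co. finite E \<and> E \<subseteq> carrier M \<and> (\<forall>e\<in>E. functional (\<lambda>x. co x e)) \<and>
    (\<forall>x\<in>carrier M. x = (\<Oplus>\<^bsub>M\<^esub>e\<in>E. co x e \<odot>\<^bsub>M\<^esub> e))"
proof -
  obtain E where E: "finite E" "E \<subseteq> carrier M" and ind: "\<not> lin_dep E" and sp: "span E = carrier M"
    using assms unfolding free_of_finite_rank_def by blast
  have add: "lincomb (\<lambda>v. a v + b v) E = lincomb a E \<oplus>\<^bsub>M\<^esub> lincomb b E" for a b
    using lincomb_sum[OF E, of a b] by simp
  have smult: "lincomb (\<lambda>v. r * a v) E = r \<odot>\<^bsub>M\<^esub> lincomb a E" for r a
    using lincomb_smult[OF E(2), of a r] by simp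
  have cl: "lincomb a E \<in> carrier M" for a
    using lincomb_closed[OF E(2), of a] by simp
  have uniq: "a e = b e" if eq: "lincomb a E = lincomb b E" and e: "e \<in> E" for a b e
  proof (rule ccontr)
    assume ne: "a e \<noteq> b e"
    let ?d = "\<lambda>v. a v + (-1) * b v"
    have "lincomb ?d E = (1 \<odot>\<^bsub>M\<^esub> lincomb a E) \<oplus>\<^bsub>M\<^esub> ((-1) \<odot>\<^bsub>M\<^esub> lincomb a E)"
      unfolding add smult eq[symmetric] using cl smult_one by simp
    also have "\<dots> = (1 + (-1)) \<odot>\<^bsub>M\<^esub> lincomb a E"
      using smult_l_distr[of 1 "-1" "lincomb a E"] cl by simp
    also have "\<dots> = \<zero>\<^bsub>M\<^esub>" using smult_l_null[OF cl] by simp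
    finally have "lin_dep E"
      using lin_dep_crit[OF E(1) order_refl, of ?d e] e ne by simp
    then show False using ind by blast
  qed
  have "\<exists>a. lincomb a E = x" if "x \<in> carrier M" for x
    using finite_in_span[OF E, of x] sp that by blast
  then obtain co where co: "\<And>x. x \<in> carrier M \<Longrightarrow> lincomb (co x) E = x" by metis
  have "functional (\<lambda>x. co x e)" if e: "e \<in> E" for e
    unfolding functional_def
  proof (intro ballI conjI allI)
    fix x y assume x: "x \<in> carrier M" and y: "y \<in> carrier M"
    show "co (x \<oplus>\<^bsub>M\<^esub> y) e = co x e + co y e"
      using uniq[of "co (x \<oplus>\<^bsub>M\<^esub> y)" "\<lambda>v. co x v + co y v" e] e by (simp add: add co x y)
  next
    fix x r assume x: "x \<in> carrier M"
    show "co (r \<odot>\<^bsub>M\<^esub> x) e = r * co x e"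
      using uniq[of "co (r \<odot>\<^bsub>M\<^esub> x)" "\<lambda>v. r * co x v" e] e by (simp add: smult co x)
  qed
  moreover have "x = (\<Oplus>\<^bsub>M\<^esub>e\<in>E. co x e \<odot>\<^bsub>M\<^esub> e)" if "x \<in> carrier M" for x
    using co[OF that] unfolding lincomb_def by simp
  ultimately show ?thesis using E by blast
qed

lemma free_of_finite_rankI:
  assumes E: "finite E" "E \<subseteq> carrier M"
    and sp: "\<And>x. x \<in> carrier M \<Longrightarrow> \<exists>a. x = (\<Oplus>\<^bsub>M\<^esub>e\<in>E. a e \<odot>\<^bsub>M\<^esub> e)"
    and ind: "\<And>a e. (\<Oplus>\<^bsub>M\<^esub>e\<in>E. a e \<odot>\<^bsub>M\<^esub> e) = \<zero>\<^bsub>M\<^esub> \<Longrightarrow> e \<in> E \<Longrightarrow> a e = 0"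
  shows "free_of_finite_rank M"
proof -
  have "\<not> lin_dep E"
    by (rule finite_lin_indpt2[OF E]) (use ind in \<open>auto simp: lincomb_def\<close>)
  moreover have "span E = carrier M"
  proof
    show "span E \<subseteq> carrier M" by (rule span_is_subset2[OF E(2)])
    show "carrier M \<subseteq> span E"
    proof
      fix x assume "x \<in> carrier M"
      then obtain a where "x = lincomb a E" using sp unfolding lincomb_def by blast
      then show "x \<in> span E" unfolding finite_span[OF E] by auto
    qed
  qed
  ultimately show ?thesis unfolding free_of_finite_rank_def using E by blast
qed

text \<open>There is one more power of \<open>a\<close> than the rank, so the coordinates of the
  powers are linearly dependent over K[[t]]. The resulting polynomial need not be monic.\<close>

lemma free_algebraic:
  assumes E: "finite E" "E \<subseteq> carrier M" and co: "\<And>e. e \<in> E \<Longrightarrow> functional (\<lambda>x. co x e)"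
    and rep: "\<And>x. x \<in> carrier M \<Longrightarrow> x = (\<Oplus>\<^bsub>M\<^esub>e\<in>E. co x e \<odot>\<^bsub>M\<^esub> e)" and a: "a \<in> carrier M"
  shows "\<exists>q. q \<noteq> 0 \<and> alg_eval M q a = \<zero>\<^bsub>M\<^esub>"
proof -
  obtain en where en: "bij_betw en {0..<card E} E" using ex_bij_betw_nat_finite[OF E(1)] by blast
  obtain q :: "'k fps poly" where q: "q \<noteq> 0" "\<forall>i<card E. seq_apply q (\<lambda>j. co (a [^]\<^bsub>M\<^esub> j) (en i)) = 0"
    using zero_row_kernel_vector[of "card E" "\<lambda>i j. co (a [^]\<^bsub>M\<^esub> j) (en i)"] by blast
  have id: "comm_ring_hom (\<lambda>c :: 'k fps. c)" by unfold_locales simp_all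
  note cl = alg_eval_closed[OF algebra_axioms a, of q]
  have "co (alg_eval M q a) e = 0" if e: "e \<in> E" for e
  proof -
    obtain i where i: "i < card E" "e = en i" using en e unfolding bij_betw_def
      by (metis atLeastLessThan_iff imageE)
    have "map_poly (\<lambda>c. c) q = q" by (rule map_poly_idI) simp
    then have "seq_apply q (\<lambda>j. co ((a [^]\<^bsub>M\<^esub> j) \<otimes>\<^bsub>M\<^esub> \<one>\<^bsub>M\<^esub>) e) = co (alg_eval M q a \<otimes>\<^bsub>M\<^esub> \<one>\<^bsub>M\<^esub>) e"
      using linear_alg_eval[OF algebra_axioms id functionalD(1)[OF co[OF e]] functionalD(2)[OF co[OF e]] a one_closed, of q]
      by simp
    then show ?thesis using q(2) i cl a by simp
  qed
  then have "alg_eval M q a = (\<Oplus>\<^bsub>M\<^esub>e\<in>E. \<zero>\<^bsub>M\<^esub>)"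
    using E(2) smult_l_null by (subst rep[OF cl]) (intro finsum_cong', auto)
  then show ?thesis using q(1) by (intro exI[of _ q]) simp
qed

text \<open>A power series is its constant term plus a multiple of t, and multiples of t reduce to
  0.\<close>

lemma reduction_smult:
  assumes A: "algebra class_ring A" and \<pi>: "reduction A \<pi>" and x: "x \<in> carrier M"
  shows "\<pi> (p \<odot>\<^bsub>M\<^esub> x) = fps_nth p 0 \<odot>\<^bsub>A\<^esub> \<pi> x"
proof -
  interpret A: algebra class_ring A by (rule A)
  have \<pi>h: "\<pi> \<in> Ring.ring_hom M A" using \<pi> by (simp add: reduction_def)
  have p: "p = fps_const (fps_nth p 0) + fps_X * fps_shift 1 p"
    by (rule fps_ext) (simp add: fps_X_mult_nth)
  define y where "y = fps_shift 1 p \<odot>\<^bsub>M\<^esub> x"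
  have y: "y \<in> carrier M" using x by (simp add: y_def)
  have "p \<odot>\<^bsub>M\<^esub> x = (fps_const (fps_nth p 0) + fps_X * fps_shift 1 p) \<odot>\<^bsub>M\<^esub> x"
    by (rule arg_cong[OF p, of "\<lambda>z. z \<odot>\<^bsub>M\<^esub> x"])
  also have "\<dots> = (fps_const (fps_nth p 0) \<odot>\<^bsub>M\<^esub> x) \<oplus>\<^bsub>M\<^esub> (fps_X \<odot>\<^bsub>M\<^esub> y)"
    using smult_l_distr[of "fps_const (fps_nth p 0)" "fps_X * fps_shift 1 p" x] x
    by (simp add: y_def smult_assoc)
  finally have "p \<odot>\<^bsub>M\<^esub> x = (fps_const (fps_nth p 0) \<odot>\<^bsub>M\<^esub> x) \<oplus>\<^bsub>M\<^esub> (fps_X \<odot>\<^bsub>M\<^esub> y)" .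
  moreover have "\<pi> (fps_X \<odot>\<^bsub>M\<^esub> y) = \<zero>\<^bsub>A\<^esub>" using \<pi> y by (auto simp: reduction_def)
  moreover have "\<pi> (fps_const (fps_nth p 0) \<odot>\<^bsub>M\<^esub> x) = fps_nth p 0 \<odot>\<^bsub>A\<^esub> \<pi> x"
    using \<pi> x by (simp add: reduction_def)
  moreover have "fps_nth p 0 \<odot>\<^bsub>A\<^esub> \<pi> x \<in> carrier A"
    using A.smult_closed Ring.ring_hom_closed[OF \<pi>h x] by simp
  ultimately show ?thesis
    using Ring.ring_hom_add[OF \<pi>h, of "fps_const (fps_nth p 0) \<odot>\<^bsub>M\<^esub> x" "fps_X \<odot>\<^bsub>M\<^esub> y"] x y by simp
qed

text \<open>Lifts of a basis of the special fibre form a basis, because \<open>M\<close> is separated and torsion-free.\<close>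

lemma free_of_reduction:
  assumes A: "algebra class_ring A" and \<pi>: "reduction A \<pi>"
    and B: "finite B" "B \<subseteq> carrier A"
    and gen: "\<And>y. y \<in> carrier A \<Longrightarrow> \<exists>d. y = (\<Oplus>\<^bsub>A\<^esub>b\<in>B. d b \<odot>\<^bsub>A\<^esub> b)"
    and ind: "\<And>d b. (\<Oplus>\<^bsub>A\<^esub>b\<in>B. d b \<odot>\<^bsub>A\<^esub> b) = \<zero>\<^bsub>A\<^esub> \<Longrightarrow> b \<in> B \<Longrightarrow> d b = 0"
    and fs: "\<And>f. f \<in> Fs \<Longrightarrow> functional f"
    and inj: "\<And>x y. x \<in> carrier M \<Longrightarrow> y \<in> carrier M \<Longrightarrow> (\<And>f. f \<in> Fs \<Longrightarrow> f x = f y) \<Longrightarrow> x = y"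
  shows "free_of_finite_rank M"
proof -
  interpret A: algebra class_ring A by (rule A)
  have \<pi>h: "\<pi> \<in> Ring.ring_hom M A" and surj: "\<pi> ` carrier M = carrier A"
    and ker: "\<And>x. x \<in> carrier M \<Longrightarrow> \<pi> x = \<zero>\<^bsub>A\<^esub> \<Longrightarrow> \<exists>y\<in>carrier M. x = fps_X \<odot>\<^bsub>M\<^esub> y"
    using \<pi> by (auto simp: reduction_def)
  have "\<exists>x. x \<in> carrier M \<and> \<pi> x = b" if "b \<in> B" for b
    using B(2) that surj by (metis imageE subsetD)
  then obtain l where l: "\<And>b. b \<in> B \<Longrightarrow> l b \<in> carrier M" "\<And>b. b \<in> B \<Longrightarrow> \<pi> (l b) = b" by metis
  define S where "S p = (\<Oplus>\<^bsub>M\<^esub>b\<in>B. p b \<odot>\<^bsub>M\<^esub> l b)" for p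
  have S_cl: "S p \<in> carrier M" for p unfolding S_def using l(1) by (intro finsum_closed) auto
  have fS: "f (S p) = (\<Sum>b\<in>B. p b * f (l b))" if "f \<in> Fs" for f p
    unfolding S_def using l(1) by (subst functional_finsum[OF fs[OF that]]) (auto simp: functionalD[OF fs[OF that]])
  have \<pi>0: "\<pi> \<zero>\<^bsub>M\<^esub> = \<zero>\<^bsub>A\<^esub>" by (rule ring_hom_zero[OF \<pi>h ring_axioms A.ring_axioms])
  have \<pi>S: "\<pi> (S p) = (\<Oplus>\<^bsub>A\<^esub>b\<in>B. fps_nth (p b) 0 \<odot>\<^bsub>A\<^esub> b)" for p
  proof -
    have "\<pi> (\<Oplus>\<^bsub>M\<^esub>b\<in>C. p b \<odot>\<^bsub>M\<^esub> l b) = (\<Oplus>\<^bsub>A\<^esub>b\<in>C. fps_nth (p b) 0 \<odot>\<^bsub>A\<^esub> b)" if "finite C" "C \<subseteq> B" for C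
      using that
    proof (induction C)
      case empty
      then show ?case by (simp add: \<pi>0)
    next
      case (insert b C)
      have c1: "(\<lambda>b. p b \<odot>\<^bsub>M\<^esub> l b) \<in> C \<rightarrow> carrier M" using insert l(1) by auto
      have c2: "(\<lambda>b. fps_nth (p b) 0 \<odot>\<^bsub>A\<^esub> b) \<in> C \<rightarrow> carrier A" using insert B(2) A.smult_closed by auto
      have c3: "p b \<odot>\<^bsub>M\<^esub> l b \<in> carrier M" "fps_nth (p b) 0 \<odot>\<^bsub>A\<^esub> b \<in> carrier A"
        using insert l(1) B(2) A.smult_closed by auto
      have "\<pi> (p b \<odot>\<^bsub>M\<^esub> l b) = fps_nth (p b) 0 \<odot>\<^bsub>A\<^esub> b"
        using reduction_smult[OF A \<pi> l(1), of b "p b"] l(2)[of b] insert by simp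
      then show ?case
        using insert c1 c2 c3 Ring.ring_hom_add[OF \<pi>h c3(1) finsum_closed[OF c1]] by simp
    qed
    from this[OF B(1) order_refl] show ?thesis by (simp add: S_def)
  qed
  \<comment> \<open>Torsion-freeness: the functionals in \<open>Fs\<close> detect equality and take
    values in an integral domain.\<close>
  have X_cancel: "x = y" if "x \<in> carrier M" "y \<in> carrier M" "fps_X \<odot>\<^bsub>M\<^esub> x = fps_X \<odot>\<^bsub>M\<^esub> y" for x y
  proof (rule inj[OF that(1,2)])
    fix f assume f: "f \<in> Fs"
    have "fps_X * f x = fps_X * f y"
      using arg_cong[OF that(3), of f] that(1,2) by (simp add: functionalD[OF fs[OF f]])
    then show "f x = f y" by simp
  qed
  \<comment> \<open>Reducing a relation kills the constant terms of its coefficients, by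
    independence in the special fibre. Dividing by t gives a relation among the shifted
    coefficients, to which the induction applies.\<close>
  have indep: "fps_nth (p b) n = 0" if "S p = \<zero>\<^bsub>M\<^esub>" "b \<in> B" for p b n
    using that
  proof (induction n arbitrary: p b)
    case 0
    then show ?case using \<pi>S[of p] \<pi>0 ind[of "\<lambda>b. fps_nth (p b) 0" b] by simp
  next
    case (Suc n)
    have p0: "fps_nth (p b) 0 = 0" if "b \<in> B" for b
      using Suc(2) \<pi>S[of p] \<pi>0 ind[of "\<lambda>b. fps_nth (p b) 0" b] that by simp
    let ?p = "\<lambda>b. fps_shift 1 (p b)"
    have px: "p b = fps_X * ?p b" if "b \<in> B" for b
      using p0[OF that] by (intro fps_ext) (simp add: fps_X_mult_nth)
    have "fps_X \<odot>\<^bsub>M\<^esub> S ?p = S p"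
    proof (rule inj)
      fix f assume f: "f \<in> Fs"
      have "f (fps_X \<odot>\<^bsub>M\<^esub> S ?p) = (\<Sum>b\<in>B. fps_X * ?p b * f (l b))"
        by (simp add: functionalD[OF fs[OF f]] S_cl fS[OF f] sum_distrib_left mult.assoc)
      also have "\<dots> = f (S p)" unfolding fS[OF f]
        by (intro sum.cong refl arg_cong2[where f = "(*)"] px[symmetric])
      finally show "f (fps_X \<odot>\<^bsub>M\<^esub> S ?p) = f (S p)" .
    qed (simp_all add: S_cl)
    then have "fps_X \<odot>\<^bsub>M\<^esub> S ?p = fps_X \<odot>\<^bsub>M\<^esub> \<zero>\<^bsub>M\<^esub>"
      using Suc(2) smult_r_null[of fps_X] by simp
    then have "S ?p = \<zero>\<^bsub>M\<^esub>" by (rule X_cancel[OF S_cl zero_closed])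
    from Suc(1)[OF this Suc(3)] show ?case by simp
  qed
  \<comment> \<open>One step of t-adic expansion: the reduction determines the digits
    \<open>d\<close>, and the error is t times some \<open>y\<close>.\<close>
  have step: "\<exists>d y. y \<in> carrier M \<and> x = S (\<lambda>b. fps_const (d b)) \<oplus>\<^bsub>M\<^esub> (fps_X \<odot>\<^bsub>M\<^esub> y)" if x: "x \<in> carrier M" for x
  proof -
    obtain d where d: "\<pi> x = (\<Oplus>\<^bsub>A\<^esub>b\<in>B. d b \<odot>\<^bsub>A\<^esub> b)"
      using gen[of "\<pi> x"] Ring.ring_hom_closed[OF \<pi>h x] by blast
    let ?s = "S (\<lambda>b. fps_const (d b))"
    have eq: "\<pi> ?s = \<pi> x" unfolding d \<pi>S by simp
    have mc: "\<ominus>\<^bsub>M\<^esub> ?s \<in> carrier M" "x \<oplus>\<^bsub>M\<^esub> \<ominus>\<^bsub>M\<^esub> ?s \<in> carrier M" using x S_cl by auto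
    have pc: "\<pi> ?s \<in> carrier A" "\<pi> (\<ominus>\<^bsub>M\<^esub> ?s) \<in> carrier A"
      using Ring.ring_hom_closed[OF \<pi>h] S_cl mc by auto
    have "\<pi> (x \<oplus>\<^bsub>M\<^esub> \<ominus>\<^bsub>M\<^esub> ?s) = \<pi> ?s \<oplus>\<^bsub>A\<^esub> \<pi> (\<ominus>\<^bsub>M\<^esub> ?s)"
      using Ring.ring_hom_add[OF \<pi>h x mc(1)] eq by simp
    also have "\<dots> = \<pi> (?s \<oplus>\<^bsub>M\<^esub> \<ominus>\<^bsub>M\<^esub> ?s)" using Ring.ring_hom_add[OF \<pi>h S_cl mc(1)] by simp
    also have "\<dots> = \<zero>\<^bsub>A\<^esub>" using r_neg[OF S_cl] \<pi>0 by simp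
    finally obtain y where y: "y \<in> carrier M" "x \<oplus>\<^bsub>M\<^esub> \<ominus>\<^bsub>M\<^esub> ?s = fps_X \<odot>\<^bsub>M\<^esub> y"
      using ker[OF mc(2)] by blast
    have "x = ?s \<oplus>\<^bsub>M\<^esub> (fps_X \<odot>\<^bsub>M\<^esub> y)"
      unfolding y(2)[symmetric] using x S_cl[of "\<lambda>b. fps_const (d b)"] mc
      by (simp add: a_lcomm r_neg)
    then show ?thesis using y(1) by blast
  qed
  then obtain d s where s: "\<And>x. x \<in> carrier M \<Longrightarrow> s x \<in> carrier M"
    and ds: "\<And>x. x \<in> carrier M \<Longrightarrow> x = S (\<lambda>b. fps_const (d x b)) \<oplus>\<^bsub>M\<^esub> (fps_X \<odot>\<^bsub>M\<^esub> s x)" by metis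
  \<comment> \<open>The n-th coefficient is the digit of the n-th remainder.\<close>
  define p where "p x b = Abs_fps (\<lambda>n. d ((s ^^ n) x) b)" for x b
  have p_rec: "p x b = fps_const (d x b) + fps_X * p (s x) b" for x b
  proof (rule fps_ext)
    fix n
    show "fps_nth (p x b) n = fps_nth (fps_const (d x b) + fps_X * p (s x) b) n"
      by (cases n) (simp_all add: p_def fps_X_mult_nth funpow_Suc_right del: funpow.simps(2))
  qed
  have fx: "f x - f (S (p x)) = fps_X * (f (s x) - f (S (p (s x))))" if f: "f \<in> Fs" and x: "x \<in> carrier M" for f x
  proof -
    have "f x = (\<Sum>b\<in>B. fps_const (d x b) * f (l b)) + fps_X * f (s x)"
      using arg_cong[OF ds[OF x], of f] s[OF x] by (simp add: functionalD[OF fs[OF f]] S_cl fS[OF f])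
    moreover have "f (S (p x)) = (\<Sum>b\<in>B. fps_const (d x b) * f (l b)) + fps_X * f (S (p (s x)))"
    proof -
      have "f (S (p x)) = (\<Sum>b\<in>B. (fps_const (d x b) + fps_X * p (s x) b) * f (l b))"
        unfolding fS[OF f] p_rec[symmetric] ..
      then show ?thesis
        unfolding fS[OF f] by (simp add: distrib_right sum.distrib sum_distrib_left mult.assoc)
    qed
    ultimately show ?thesis by (simp add: right_diff_distrib)
  qed
  \<comment> \<open>The error at \<open>x\<close> is t times the error at the remainder
    \<open>s x\<close>, so all its coefficients vanish. Separatedness is thus read off from power
    series, through the functionals.\<close>
  have rem: "fps_nth (f x - f (S (p x))) n = 0" if f: "f \<in> Fs" and x: "x \<in> carrier M" for f x n
    using x
  proof (induction n arbitrary: x)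
    case 0
    show ?case unfolding fx[OF f 0] by simp
  next
    case (Suc n)
    show ?case unfolding fx[OF f Suc(2)] using Suc(1)[OF s[OF Suc(2)]] by (simp add: fps_X_mult_nth)
  qed
  have span: "x = S (p x)" if x: "x \<in> carrier M" for x
  proof (rule inj[OF x S_cl])
    fix f assume f: "f \<in> Fs"
    have "f x - f (S (p x)) = 0" by (rule fps_ext) (simp only: rem[OF f x] fps_zero_nth)
    then show "f x = f (S (p x))" by simp
  qed
  have injl: "inj_on l B" by (rule inj_onI) (metis l(2))
  have re: "(\<Oplus>\<^bsub>M\<^esub>e\<in>l ` B. a e \<odot>\<^bsub>M\<^esub> e) = S (\<lambda>b. a (l b))" for a
    unfolding S_def by (rule finsum_reindex[OF _ injl]) (use l(1) in auto)
  show ?thesis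
  proof (rule free_of_finite_rankI[of "l ` B"])
    show "finite (l ` B)" using B(1) by simp
    show "l ` B \<subseteq> carrier M" using l(1) by blast
    show "\<exists>a. x = (\<Oplus>\<^bsub>M\<^esub>e\<in>l ` B. a e \<odot>\<^bsub>M\<^esub> e)" if x: "x \<in> carrier M" for x
    proof -
      have "S (\<lambda>b. p x (the_inv_into B l (l b))) = S (p x)"
        unfolding S_def using l(1) by (intro finsum_cong') (auto simp: the_inv_into_f_f[OF injl])
      then show ?thesis
        unfolding re using span[OF x] by (intro exI[of _ "\<lambda>e. p x (the_inv_into B l e)"]) simp
    qed
    show "a e = 0" if z: "(\<Oplus>\<^bsub>M\<^esub>e\<in>l ` B. a e \<odot>\<^bsub>M\<^esub> e) = \<zero>\<^bsub>M\<^esub>" and e: "e \<in> l ` B" for a e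
    proof -
      obtain b where b: "b \<in> B" "e = l b" using e by blast
      show ?thesis
        using indep[OF z[unfolded re] b(1)] unfolding b(2) by (intro fps_ext) simp
    qed
  qed
qed

end

section \<open>Descent to the Laurent series field\<close>

lemma to_ac_hom: "comm_ring_hom (to_ac :: 'a::field \<Rightarrow> 'a alg_closure)"
  by unfold_locales simp_all

text \<open>A linear functional over the small field with value 1 at 1. It is in general not
  multiplicative, but it only has to carry linear equations down.\<close>

lemma field_retraction:
  fixes \<kappa> :: "'f::field \<Rightarrow> 'l::field"
  assumes "comm_ring_hom \<kappa>"
  shows "\<exists>\<pi>. (\<forall>x y. \<pi> (x + y) = \<pi> x + \<pi> y) \<and> (\<forall>c x. \<pi> (\<kappa> c * x) = c * \<pi> x) \<and> (\<forall>c. \<pi> (\<kappa> c) = c)"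
proof -
  interpret \<kappa>: comm_ring_hom \<kappa> by fact
  interpret P: vector_space_pair "\<lambda>c x. \<kappa> c * x" "(*) :: 'f \<Rightarrow> 'f \<Rightarrow> 'f"
    by unfold_locales (simp_all add: algebra_simps \<kappa>.hom_add \<kappa>.hom_mult)
  have "\<not> P.vs1.dependent {1}" unfolding P.vs1.dependent_single by simp
  from P.linear_independent_extend[OF this, of "\<lambda>_. 1"]
  obtain \<pi> where \<pi>: "Vector_Spaces.linear (\<lambda>c x. \<kappa> c * x) (*) \<pi>" "\<pi> 1 = 1" by auto
  have a: "\<pi> (x + y) = \<pi> x + \<pi> y" for x y by (rule P.linear_add[OF \<pi>(1)])
  have s: "\<pi> (\<kappa> c * x) = c * \<pi> x" for c x by (rule P.linear_scale[OF \<pi>(1)])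
  have "\<pi> (\<kappa> c) = c" for c using s[of c 1] \<pi>(2) by simp
  then show ?thesis using a s by blast
qed

lemma coeff_prod_linear:
  fixes f :: "'x \<Rightarrow> 'l::field"
  assumes "finite H"
  shows "coeff (\<Prod>\<psi>\<in>H. [:- f \<psi>, 1:]) (card H) = 1"
    and "i > card H \<Longrightarrow> coeff (\<Prod>\<psi>\<in>H. [:- f \<psi>, 1:]) i = 0"
proof -
  have d: "degree (\<Prod>\<psi>\<in>H. [:- f \<psi>, 1:]) = card H"
    by (subst degree_prod_eq_sum_degree) auto
  have "lead_coeff (\<Prod>\<psi>\<in>H. [:- f \<psi>, 1:]) = 1" unfolding lead_coeff_prod by simp
  then show "coeff (\<Prod>\<psi>\<in>H. [:- f \<psi>, 1:]) (card H) = 1" unfolding d .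
  show "i > card H \<Longrightarrow> coeff (\<Prod>\<psi>\<in>H. [:- f \<psi>, 1:]) i = 0" by (rule coeff_eq_0) (simp only: d)
qed

text \<open>A nonzero polynomial of degree below \<open>card H\<close> cannot have
  \<open>card H\<close> distinct roots.\<close>

lemma poly_interpolation_unique:
  fixes d :: "'l::field poly"
  assumes H: "finite H" "inj_on f H" and z: "\<And>\<psi>. \<psi> \<in> H \<Longrightarrow> poly d (f \<psi>) = 0"
    and deg: "\<And>i. i \<ge> card H \<Longrightarrow> coeff d i = 0"
  shows "d = 0"
proof (rule ccontr)
  assume d: "d \<noteq> 0"
  have "degree d < card H"
    using deg[of "degree d"] d by (metis leading_coeff_0_iff not_le)
  moreover have "card (f ` H) \<le> card {x. poly d x = 0}"
    by (rule card_mono[OF poly_roots_finite[OF d]]) (use z in auto)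
  moreover have "card {x. poly d x = 0} \<le> degree d" by (rule card_poly_roots_bound[OF d])
  ultimately show False using card_image[OF H(2)] by simp
qed

text \<open>
  Over \<open>K((t))\<close> such an algebra is generated by \<open>\<theta>\<close>, whose minimal polynomial has the distinct
  roots \<open>\<chi> \<theta>\<close>, one for each geometric point \<open>\<chi>\<close>.
\<close>

definition separably_generated ::
    "('k::field fps, 'b) module \<Rightarrow> ('b \<Rightarrow> 'k fls alg_closure) set \<Rightarrow> 'b \<Rightarrow> bool" where
  "separably_generated M H \<theta> \<longleftrightarrow> finite H \<and>
     (\<forall>\<chi>\<in>H. class_alg_hom (\<lambda>p. to_ac (fps_to_fls p)) M \<chi>) \<and>
     (\<forall>x\<in>carrier M. \<forall>y\<in>carrier M. (\<forall>\<chi>\<in>H. \<chi> x = \<chi> y) \<longrightarrow> x = y) \<and>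
     \<theta> \<in> carrier M \<and> inj_on (\<lambda>\<chi>. \<chi> \<theta>) H \<and>
     (\<forall>s\<in>carrier M. \<exists>q. \<forall>\<chi>\<in>H. \<chi> s = poly (map_poly to_ac q) (\<chi> \<theta>)) \<and>
     (\<exists>\<mu>. map_poly to_ac \<mu> = (\<Prod>\<chi>\<in>H. [:- \<chi> \<theta>, 1:]))"

lemma separably_generated_smooth:
  assumes M: "algebra class_ring M" and s: "separably_generated M H \<theta>"
  shows "smooth_algebra (generic_fibre M)"
proof -
  interpret fps_algebra M by (rule fps_algebra.intro[OF M])
  obtain \<mu> where \<mu>: "map_poly to_ac \<mu> = (\<Prod>\<chi>\<in>H. [:- \<chi> \<theta>, 1:])"
    using s unfolding separably_generated_def by blast
  show ?thesis
  proof (rule smooth_GF_of_class_homs[OF to_ac_hom, where H = H and \<theta> = \<theta> and \<mu> = \<mu>])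
    show "x = y" if "x \<in> carrier M" "y \<in> carrier M" "\<And>\<chi>. \<chi> \<in> H \<Longrightarrow> \<chi> x = \<chi> y" for x y
      using s that unfolding separably_generated_def by blast
  qed (use s \<mu> in \<open>simp_all add: separably_generated_def\<close>)
qed

context fps_algebra
begin

text \<open>Freeness makes every element algebraic over K[[t]], and smoothness excludes point
  derivations; these are the two inputs for expanding functionals in points.\<close>

lemma smooth_free_functionals:
  fixes \<kappa> :: "'k fls \<Rightarrow> 'l::{alg_closed_field, field_char_0}"
  defines "\<iota> \<equiv> \<lambda>p. \<kappa> (fps_to_fls p)"
  assumes \<kappa>: "comm_ring_hom \<kappa>" and smooth: "smooth_algebra GF"
    and E: "finite E" "E \<subseteq> carrier M" and co: "\<And>e. e \<in> E \<Longrightarrow> functional (\<lambda>x. co x e)"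
    and rep: "\<And>x. x \<in> carrier M \<Longrightarrow> x = (\<Oplus>\<^bsub>M\<^esub>e\<in>E. co x e \<odot>\<^bsub>M\<^esub> e)"
  shows "finite_class_algebra M \<iota> E"
    and "finite_class_algebra.lin M \<iota> \<xi> \<Longrightarrow> finite_class_algebra.hom_span M \<iota> \<xi>"
proof -
  have \<iota>: "comm_ring_hom \<iota>" unfolding \<iota>_def by (rule comm_ring_hom_comp[OF \<kappa> fps_to_fls_hom])
  have \<iota>0: "\<iota> p = 0 \<longleftrightarrow> p = 0" for p unfolding \<iota>_def field_hom_0_iff[OF \<kappa>] by simp
  show *: "finite_class_algebra M \<iota> E"
  proof (rule finite_class_algebra.intro[OF algebra_axioms finite_class_algebra_axioms.intro[OF \<iota> E]])
    show "\<exists>r. a = (\<Oplus>\<^bsub>M\<^esub>e\<in>E. r e \<odot>\<^bsub>M\<^esub> e)" if "a \<in> carrier M" for a using rep[OF that] by blast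
    show "\<exists>q. map_poly \<iota> q \<noteq> 0 \<and> alg_eval M q a = \<zero>\<^bsub>M\<^esub>" if a: "a \<in> carrier M" for a
    proof -
      obtain q where q: "q \<noteq> 0" "alg_eval M q a = \<zero>\<^bsub>M\<^esub>" using free_algebraic[OF E co rep a] by blast
      have "map_poly \<iota> q \<noteq> 0" using q(1) by (simp add: poly_eq_iff coeff_map_poly \<iota>0)
      then show ?thesis using q(2) by blast
    qed
  qed
  interpret F: finite_class_algebra M \<iota> E by (rule *)
  assume \<xi>: "F.lin \<xi>"
  show "F.hom_span \<xi>"
  proof (rule F.functionals_spanned_by_homs[OF _ \<xi>])
    fix \<chi> D a
    assume \<chi>: "class_alg_hom \<iota> M \<chi>" and D: "F.lin D"
      and D_mult: "\<And>x y. x \<in> carrier M \<Longrightarrow> y \<in> carrier M \<Longrightarrow> D (x \<otimes>\<^bsub>M\<^esub> y) = \<chi> x * D y + D x * \<chi> y"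
      and a: "a \<in> carrier M"
    obtain q where q: "q \<noteq> 0" "alg_eval M q a = \<zero>\<^bsub>M\<^esub>" using free_algebraic[OF E co rep a] by blast
    show "D a = 0"
      by (rule smooth_point_derivation[OF \<kappa> smooth \<chi>[unfolded \<iota>_def] F.linD(1)[OF D] D_mult
          F.linD(2)[OF D, unfolded \<iota>_def] a q])
  qed
qed

end

text \<open>
  A polynomial relation over the algebraic closure is a system of linear equations over \<open>K((t))\<close>
  in the coordinates, so it survives the retraction of its coefficients to \<open>K((t))\<close>.
\<close>

lemma smooth_subalgebra_separably_generated:
  fixes M :: "('k::field_char_0 fps, 'b) module"
  assumes M: "algebra class_ring M" and free: "free_of_finite_rank M"
    and smooth: "smooth_algebra (generic_fibre M)"
    and N: "N \<subseteq> carrier M" "\<zero>\<^bsub>M\<^esub> \<in> N" "\<And>x y. x \<in> N \<Longrightarrow> y \<in> N \<Longrightarrow> x \<oplus>\<^bsub>M\<^esub> y \<in> N"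
      "\<And>r x. x \<in> N \<Longrightarrow> r \<odot>\<^bsub>M\<^esub> x \<in> N"
    and N1: "\<one>\<^bsub>M\<^esub> \<in> N" "\<And>x y. x \<in> N \<Longrightarrow> y \<in> N \<Longrightarrow> x \<otimes>\<^bsub>M\<^esub> y \<in> N"
  shows "\<exists>H \<theta>. separably_generated (M\<lparr>carrier := N\<rparr>) H \<theta>"
proof -
  interpret fps_algebra M by (rule fps_algebra.intro[OF M])
  let ?\<kappa> = "to_ac :: 'k fls \<Rightarrow> 'k fls alg_closure"
  define \<iota> where "\<iota> = (\<lambda>p. ?\<kappa> (fps_to_fls p))"
  have \<kappa>: "comm_ring_hom ?\<kappa>" by (rule to_ac_hom)
  interpret \<kappa>: comm_ring_hom ?\<kappa> by (rule \<kappa>)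
  obtain E co where E: "finite E" "E \<subseteq> carrier M" and co: "\<And>e. e \<in> E \<Longrightarrow> functional (\<lambda>x. co x e)"
    and rep: "\<And>x. x \<in> carrier M \<Longrightarrow> x = (\<Oplus>\<^bsub>M\<^esub>e\<in>E. co x e \<odot>\<^bsub>M\<^esub> e)"
    using free_coordinates[OF free] by blast
  note fs = smooth_free_functionals[OF \<kappa> smooth E co rep, folded \<iota>_def]
  interpret F: finite_class_algebra M \<iota> E by (rule fs(1))
  have "F.lin (\<lambda>x. \<iota> (co x e))" if "e \<in> E" for e
    unfolding F.lin_def
    using functionalD[OF co[OF that]] by (simp add: F.\<iota>.hom_add F.\<iota>.hom_mult)
  then have "F.hom_span (\<lambda>x. \<iota> (co x e))" if "e \<in> E" for e using fs(2) that by blast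
  then have "\<forall>e\<in>E. \<exists>c. \<forall>x\<in>carrier M. \<iota> (co x e) = (\<Sum>\<chi>\<in>F.homs. c \<chi> * \<chi> x)"
    unfolding F.hom_span_def by (rule ballI)
  from bchoice[OF this] obtain c
    where c': "\<forall>e\<in>E. \<forall>x\<in>carrier M. \<iota> (co x e) = (\<Sum>\<chi>\<in>F.homs. c e \<chi> * \<chi> x)" by (rule exE)
  \<comment> \<open>Coordinates are combinations of points, and \<open>\<chi>_rep\<close> expresses
    points through coordinates. The two formulas translate equations at all points into equations
    over K((t)) and back.\<close>
  have c: "\<iota> (co x e) = (\<Sum>\<chi>\<in>F.homs. c e \<chi> * \<chi> x)" if "e \<in> E" "x \<in> carrier M" for e x
    by (rule bspec[OF bspec[OF c' that(1)] that(2)])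
  have \<chi>_rep: "\<chi> x = (\<Sum>e\<in>E. \<iota> (co x e) * \<chi> e)" if \<chi>: "\<chi> \<in> F.homs" and x: "x \<in> carrier M" for \<chi> x
  proof -
    have l: "F.lin \<chi>" by (rule F.hom_lin[OF F.homsD[OF \<chi>]])
    have "\<chi> x = \<chi> (\<Oplus>\<^bsub>M\<^esub>e\<in>E. co x e \<odot>\<^bsub>M\<^esub> e)" by (rule arg_cong[OF rep[OF x], of \<chi>])
    also have "\<dots> = (\<Sum>e\<in>E. \<chi> (co x e \<odot>\<^bsub>M\<^esub> e))" by (rule F.lin_finsum[OF l]) (use E(2) in auto)
    also have "\<dots> = (\<Sum>e\<in>E. \<iota> (co x e) * \<chi> e)" by (rule sum.cong) (use E(2) F.linD(2)[OF l] in auto)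
    finally show ?thesis .
  qed
  obtain \<pi> where \<pi>: "\<And>x y. \<pi> (x + y) = \<pi> x + \<pi> y" "\<And>c x. \<pi> (?\<kappa> c * x) = c * \<pi> x" "\<And>c. \<pi> (?\<kappa> c) = c"
    using field_retraction[OF \<kappa>] by blast
  have \<pi>0: "\<pi> 0 = 0" using \<pi>(3)[of 0] by simp
  have \<pi>_sum: "\<pi> (sum f I) = (\<Sum>i\<in>I. \<pi> (f i))" for f :: "nat \<Rightarrow> _" and I
    by (induction I rule: infinite_finite_induct) (simp_all add: \<pi>0 \<pi>(1))
  define descend where "descend q = map_poly \<pi> q" for q
  \<comment> \<open>The hypothesis at all points becomes a system of equations between coordinates,
    which lie in K[[t]]. The retraction is applied to the coefficients of \<open>q\<close>, and the
    new system is evaluated at the points again.\<close>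
  have descent: "poly (map_poly ?\<kappa> (descend q)) (\<chi> \<theta>) = \<chi> b"
    if \<theta>: "\<theta> \<in> carrier M" and b: "b \<in> carrier M" and q: "\<And>\<chi>. \<chi> \<in> F.homs \<Longrightarrow> poly q (\<chi> \<theta>) = \<chi> b"
      and \<chi>: "\<chi> \<in> F.homs" for q \<theta> b \<chi>
  proof -
    let ?n = "Polynomial.degree q" and ?r = "map_poly ?\<kappa> (descend q)"
    have pw: "\<theta> [^]\<^bsub>M\<^esub> i \<in> carrier M" for i :: nat using \<theta> by simp
    have pw_hom: "\<psi> (\<theta> [^]\<^bsub>M\<^esub> i) = \<psi> \<theta> ^ i" if "\<psi> \<in> F.homs" for \<psi> and i :: nat
      by (rule class_ring_hom_pow[OF class_alg_homD(5)[OF F.homsD[OF that]] \<theta>])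
    have rel: "(\<Sum>i\<le>?n. poly.coeff q i * \<iota> (co (\<theta> [^]\<^bsub>M\<^esub> i) e)) = \<iota> (co b e)" if e: "e \<in> E" for e
    proof -
      have "(\<Sum>i\<le>?n. poly.coeff q i * \<iota> (co (\<theta> [^]\<^bsub>M\<^esub> i) e)) =
          (\<Sum>i\<le>?n. \<Sum>\<psi>\<in>F.homs. poly.coeff q i * (c e \<psi> * \<psi> \<theta> ^ i))"
        by (simp add: c[OF e pw] pw_hom sum_distrib_left)
      also have "\<dots> = (\<Sum>\<psi>\<in>F.homs. \<Sum>i\<le>?n. poly.coeff q i * (c e \<psi> * \<psi> \<theta> ^ i))" by (rule sum.swap)
      also have "\<dots> = (\<Sum>\<psi>\<in>F.homs. c e \<psi> * poly q (\<psi> \<theta>))"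
        by (simp add: poly_altdef sum_distrib_left mult.left_commute)
      also have "\<dots> = \<iota> (co b e)" unfolding c[OF e b] by (rule sum.cong) (simp_all add: q)
      finally show ?thesis .
    qed
    have relF: "(\<Sum>i\<le>?n. \<pi> (poly.coeff q i) * fps_to_fls (co (\<theta> [^]\<^bsub>M\<^esub> i) e)) = fps_to_fls (co b e)"
      if e: "e \<in> E" for e
      using arg_cong[OF rel[OF e], of \<pi>] \<pi>(2) unfolding \<pi>_sum \<iota>_def \<pi>(3) by (simp add: mult.commute)
    have rel': "(\<Sum>i\<le>?n. poly.coeff ?r i * \<iota> (co (\<theta> [^]\<^bsub>M\<^esub> i) e)) = \<iota> (co b e)" if e: "e \<in> E" for e
    proof -
      have "poly.coeff ?r i = ?\<kappa> (\<pi> (poly.coeff q i))" for i by (simp add: descend_def coeff_map_poly \<pi>0)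
      then show ?thesis
        using arg_cong[OF relF[OF e], of ?\<kappa>] by (simp only: \<iota>_def to_ac_sum to_ac_mult)
    qed
    have "poly ?r (\<chi> \<theta>) = seq_apply ?r (\<lambda>i. \<chi> \<theta> ^ i)" by (simp add: poly_altdef seq_apply_def)
    also have "\<dots> = (\<Sum>i\<le>?n. poly.coeff ?r i * \<chi> \<theta> ^ i)"
      unfolding descend_def by (rule seq_apply_bound) (rule order_trans[OF degree_map_poly_le degree_map_poly_le])
    also have "\<dots> = (\<Sum>i\<le>?n. \<Sum>e\<in>E. poly.coeff ?r i * (\<iota> (co (\<theta> [^]\<^bsub>M\<^esub> i) e) * \<chi> e))"
      by (simp add: pw_hom[OF \<chi>, symmetric] \<chi>_rep[OF \<chi> pw] sum_distrib_left)
    also have "\<dots> = (\<Sum>e\<in>E. \<Sum>i\<le>?n. poly.coeff ?r i * (\<iota> (co (\<theta> [^]\<^bsub>M\<^esub> i) e) * \<chi> e))" by (rule sum.swap)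
    also have "\<dots> = (\<Sum>e\<in>E. \<iota> (co b e) * \<chi> e)"
      by (rule sum.cong) (simp_all add: rel'[symmetric] sum_distrib_right mult.assoc)
    also have "\<dots> = \<chi> b" by (rule \<chi>_rep[OF \<chi> b, symmetric])
    finally show ?thesis .
  qed
  obtain \<theta> where \<theta>: "\<theta> \<in> N"
    and sep: "\<And>\<chi> \<psi> x. \<chi> \<in> F.homs \<Longrightarrow> \<psi> \<in> F.homs \<Longrightarrow> \<chi> \<theta> = \<psi> \<theta> \<Longrightarrow> x \<in> N \<Longrightarrow> \<chi> x = \<psi> x"
    using F.separating_element_homs[OF N] by blast
  have \<theta>M: "\<theta> \<in> carrier M" using \<theta> N(1) by blast
  \<comment> \<open>Points that agree on \<open>N\<close> must be counted once. With the value 0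
    outside \<open>N\<close> their restrictions become the same function.\<close>
  define res where "res \<chi> = (\<lambda>x. if x \<in> N then \<chi> x else 0)" for \<chi> :: "'b \<Rightarrow> 'k fls alg_closure"
  define H where "H = res ` F.homs"
  have H_fin: "finite H" unfolding H_def using F.finite_homs by simp
  have H_inj: "inj_on (\<lambda>\<chi>. \<chi> \<theta>) H"
    unfolding H_def
  proof (rule inj_onI)
    fix \<chi>' \<psi>' assume "\<chi>' \<in> res ` F.homs" "\<psi>' \<in> res ` F.homs" and eq: "\<chi>' \<theta> = \<psi>' \<theta>"
    then obtain \<chi> \<psi> where h: "\<chi> \<in> F.homs" "\<chi>' = res \<chi>" "\<psi> \<in> F.homs" "\<psi>' = res \<psi>" by (elim imageE)
    have "\<chi> \<theta> = \<psi> \<theta>" using eq \<theta> by (simp add: h res_def)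
    from sep[OF h(1,3) this] show "\<chi>' = \<psi>'" unfolding h res_def by (intro ext) simp
  qed
  \<comment> \<open>Lagrange interpolation over the algebraic closure, followed by descent of the
    coefficients.\<close>
  have gen: "\<exists>q. \<forall>\<chi>\<in>H. \<chi> s = poly (map_poly ?\<kappa> q) (\<chi> \<theta>)" if s: "s \<in> N" for s
  proof -
    have "\<forall>\<psi>\<in>H. \<exists>p. \<forall>\<chi>\<in>H. poly p (\<chi> \<theta>) = (if \<chi> = \<psi> then 1 else 0)"
      using lagrange_delta[OF H_fin H_inj] by (rule ballI)
    from bchoice[OF this] obtain p
      where p': "\<forall>\<psi>\<in>H. \<forall>\<chi>\<in>H. poly (p \<psi>) (\<chi> \<theta>) = (if \<chi> = \<psi> then 1 else 0)" by (rule exE)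
    have p: "poly (p \<psi>) (\<chi> \<theta>) = (if \<chi> = \<psi> then 1 else 0)" if "\<psi> \<in> H" "\<chi> \<in> H" for \<psi> \<chi>
      by (rule bspec[OF bspec[OF p' that(1)] that(2)])
    let ?q = "\<Sum>\<psi>\<in>H. Polynomial.smult (\<psi> s) (p \<psi>)"
    have interp: "poly ?q (\<chi> \<theta>) = \<chi> s" if \<chi>: "\<chi> \<in> H" for \<chi>
    proof -
      have "poly ?q (\<chi> \<theta>) = (\<Sum>\<psi>\<in>H. if \<chi> = \<psi> then \<psi> s else 0)"
        unfolding poly_sum by (rule sum.cong) (simp_all add: p \<chi>)
      also have "\<dots> = \<chi> s" unfolding sum.delta'[OF H_fin] using \<chi> by simp
      finally show ?thesis .
    qed
    have q: "poly ?q (\<chi> \<theta>) = \<chi> s" if "\<chi> \<in> F.homs" for \<chi>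
    proof -
      have "res \<chi> \<in> H" unfolding H_def by (rule imageI[OF that])
      from interp[OF this] show ?thesis using \<theta> s by (simp add: res_def)
    qed
    have des: "poly (map_poly ?\<kappa> (descend ?q)) (\<chi> \<theta>) = \<chi> s" if "\<chi> \<in> F.homs" for \<chi>
      by (rule descent[OF \<theta>M subsetD[OF N(1) s] q that])
    show ?thesis
    proof (intro exI ballI)
      fix \<psi> assume "\<psi> \<in> H"
      then obtain \<chi> where \<chi>: "\<chi> \<in> F.homs" "\<psi> = res \<chi>" unfolding H_def by (rule imageE)
      show "\<psi> s = poly (map_poly ?\<kappa> (descend ?q)) (\<psi> \<theta>)"
        using des[OF \<chi>(1)] \<theta> s by (simp add: \<chi>(2) res_def)
    qed
  qed
  define m where "m = (\<Prod>\<chi>\<in>H. [:- \<chi> \<theta>, 1:])"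
  \<comment> \<open>\<open>m\<close> is monic of degree \<open>card H\<close>, so \<open>q\<close>
    has smaller degree, and it interpolates the values of \<theta>^(card H). Its descent
    interpolates the same values under the same degree bound, so the two coincide and
    \<open>m\<close> has coefficients in K((t)).\<close>
  define q where "q = Polynomial.monom 1 (card H) - m"
  have m0: "poly m (\<chi> \<theta>) = 0" if "\<chi> \<in> H" for \<chi>
    unfolding m_def poly_prod by (rule prod_zero[OF H_fin bexI[OF _ that]]) simp
  have q_hi: "poly.coeff q i = 0" if "i \<ge> card H" for i
    using coeff_prod_linear[OF H_fin, where f = "\<lambda>\<chi>. \<chi> \<theta>"] that
    unfolding q_def m_def by (cases "i = card H") simp_all
  have pwM: "\<theta> [^]\<^bsub>M\<^esub> card H \<in> carrier M" using \<theta>M by simp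
  have q: "poly q (\<chi> \<theta>) = \<chi> (\<theta> [^]\<^bsub>M\<^esub> card H)" if "\<chi> \<in> F.homs" for \<chi>
  proof -
    have "res \<chi> \<in> H" unfolding H_def by (rule imageI[OF that])
    from m0[OF this] have "poly m (\<chi> \<theta>) = 0" using \<theta> by (simp add: res_def)
    then show ?thesis
      unfolding class_ring_hom_pow[OF class_alg_homD(5)[OF F.homsD[OF that]] \<theta>M]
      by (simp add: q_def poly_monom)
  qed
  have des: "poly (map_poly ?\<kappa> (descend q)) (\<chi> \<theta>) = \<chi> (\<theta> [^]\<^bsub>M\<^esub> card H)" if "\<chi> \<in> F.homs" for \<chi>
    by (rule descent[OF \<theta>M pwM q that])
  have q_eq: "poly (map_poly ?\<kappa> (descend q)) (\<psi> \<theta>) = poly q (\<psi> \<theta>)" if \<psi>: "\<psi> \<in> H" for \<psi>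
  proof -
    obtain \<chi> where \<chi>: "\<chi> \<in> F.homs" "\<psi> = res \<chi>" using \<psi> unfolding H_def by (rule imageE)
    have "poly (map_poly ?\<kappa> (descend q)) (\<chi> \<theta>) = \<chi> \<theta> ^ card H"
      using des[OF \<chi>(1)] unfolding class_ring_hom_pow[OF class_alg_homD(5)[OF F.homsD[OF \<chi>(1)]] \<theta>M] .
    moreover have "poly q (\<psi> \<theta>) = \<psi> \<theta> ^ card H" using m0[OF \<psi>] by (simp add: q_def poly_monom)
    ultimately show ?thesis using \<theta> by (simp add: \<chi>(2) res_def)
  qed
  have "q - map_poly ?\<kappa> (descend q) = 0"
  proof (rule poly_interpolation_unique[OF H_fin H_inj])
    show "poly (q - map_poly ?\<kappa> (descend q)) (\<psi> \<theta>) = 0" if "\<psi> \<in> H" for \<psi>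
      by (simp add: q_eq[OF that])
    show "poly.coeff (q - map_poly ?\<kappa> (descend q)) i = 0" if "i \<ge> card H" for i
      by (simp add: q_hi[OF that] descend_def coeff_map_poly \<pi>0)
  qed
  then have qd: "map_poly ?\<kappa> (descend q) = q" by simp
  have "map_poly ?\<kappa> (Polynomial.monom 1 (card H) - descend q) = Polynomial.monom 1 (card H) - map_poly ?\<kappa> (descend q)"
    by (rule poly_eqI) (simp add: coeff_map_poly)
  also have "\<dots> = m" unfolding qd by (simp add: q_def)
  finally have \<mu>: "\<exists>\<mu>. map_poly ?\<kappa> \<mu> = (\<Prod>\<chi>\<in>H. [:- \<chi> \<theta>, 1:])" unfolding m_def by blast
  have inj: "x = y" if x: "x \<in> N" and y: "y \<in> N" and eq: "\<forall>\<chi>\<in>H. \<chi> x = \<chi> y" for x y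
  proof -
    note xM = subsetD[OF N(1) x] and yM = subsetD[OF N(1) y]
    have "\<chi> x = \<chi> y" if "\<chi> \<in> F.homs" for \<chi>
    proof -
      have "res \<chi> \<in> H" unfolding H_def by (rule imageI[OF that])
      with eq have "res \<chi> x = res \<chi> y" by (rule bspec)
      then show ?thesis using x y by (simp add: res_def)
    qed
    then have "\<iota> (co x e) = \<iota> (co y e)" if "e \<in> E" for e
      unfolding c[OF that xM] c[OF that yM] by (intro sum.cong) simp_all
    then have coe: "co x e = co y e" if "e \<in> E" for e using that by (simp add: \<iota>_def)
    have "(\<Oplus>\<^bsub>M\<^esub>e\<in>E. co x e \<odot>\<^bsub>M\<^esub> e) = (\<Oplus>\<^bsub>M\<^esub>e\<in>E. co y e \<odot>\<^bsub>M\<^esub> e)"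
      by (rule finsum_cong') (use coe E(2) in auto)
    then show ?thesis using rep[OF xM] rep[OF yM] by simp
  qed
  have "class_alg_hom \<iota> (M\<lparr>carrier := N\<rparr>) \<psi>" if \<psi>: "\<psi> \<in> H" for \<psi>
  proof -
    obtain \<chi> where \<chi>: "\<chi> \<in> F.homs" "\<psi> = res \<chi>" using \<psi> unfolding H_def by (rule imageE)
    show ?thesis
      using class_alg_homD[OF F.homsD[OF \<chi>(1)]] N N1
      unfolding class_alg_hom_def class_ring_hom_def \<chi>(2) by (simp add: res_def subset_iff)
  qed
  then have "separably_generated (M\<lparr>carrier := N\<rparr>) H \<theta>"
    unfolding separably_generated_def using H_fin H_inj inj \<theta> gen \<mu> by (simp add: \<iota>_def)
  then show ?thesis by blast
qed

section \<open>Subalgebras\<close>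

lemma subalgebra_algebra:
  fixes M :: "('r::comm_ring_1, 'b) module"
  assumes M: "algebra class_ring M"
    and N: "N \<subseteq> carrier M" "\<zero>\<^bsub>M\<^esub> \<in> N" "\<one>\<^bsub>M\<^esub> \<in> N"
      "\<And>x y. x \<in> N \<Longrightarrow> y \<in> N \<Longrightarrow> x \<oplus>\<^bsub>M\<^esub> y \<in> N" "\<And>x y. x \<in> N \<Longrightarrow> y \<in> N \<Longrightarrow> x \<otimes>\<^bsub>M\<^esub> y \<in> N"
      "\<And>r x. x \<in> N \<Longrightarrow> r \<odot>\<^bsub>M\<^esub> x \<in> N"
  shows "algebra class_ring (M\<lparr>carrier := N\<rparr>)"
proof -
  interpret algebra class_ring M by (rule M)
  have NM: "x \<in> carrier M" if "x \<in> N" for x using N(1) that by (rule subsetD)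
  have sm: "r \<odot>\<^bsub>M\<^esub> x \<in> carrier M" if "x \<in> carrier M" for r x using smult_closed[of r x] that by simp
  let ?S = "M\<lparr>carrier := N\<rparr>"
  have "abelian_group ?S"
  proof (rule abelian_groupI)
    show "\<exists>y\<in>carrier ?S. y \<oplus>\<^bsub>?S\<^esub> x = \<zero>\<^bsub>?S\<^esub>" if x: "x \<in> carrier ?S" for x
    proof (rule bexI)
      have x': "x \<in> N" using x by simp
      have "((-1) \<odot>\<^bsub>M\<^esub> x) \<oplus>\<^bsub>M\<^esub> x = ((-1) + 1) \<odot>\<^bsub>M\<^esub> x"
        using smult_l_distr[of "-1" 1 x] NM[OF x'] smult_one[of x] by simp
      also have "\<dots> = \<zero>\<^bsub>M\<^esub>" using smult_l_null[OF NM[OF x']] by simp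
      finally show "((-1) \<odot>\<^bsub>M\<^esub> x) \<oplus>\<^bsub>?S\<^esub> x = \<zero>\<^bsub>?S\<^esub>" by simp
      show "(-1) \<odot>\<^bsub>M\<^esub> x \<in> carrier ?S" using N(6)[OF x'] by simp
    qed
  qed (simp_all add: N NM a_ac)
  moreover have "Group.comm_monoid ?S"
    by (rule comm_monoidI) (simp_all add: N NM m_ac)
  ultimately have "cring ?S"
    by (rule cringI) (simp_all add: NM l_distr)
  moreover have "(q + r) \<odot>\<^bsub>M\<^esub> x = (q \<odot>\<^bsub>M\<^esub> x) \<oplus>\<^bsub>M\<^esub> (r \<odot>\<^bsub>M\<^esub> x)"
    "r \<odot>\<^bsub>M\<^esub> (x \<oplus>\<^bsub>M\<^esub> y) = (r \<odot>\<^bsub>M\<^esub> x) \<oplus>\<^bsub>M\<^esub> (r \<odot>\<^bsub>M\<^esub> y)"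
    "(q * r) \<odot>\<^bsub>M\<^esub> x = q \<odot>\<^bsub>M\<^esub> (r \<odot>\<^bsub>M\<^esub> x)" "1 \<odot>\<^bsub>M\<^esub> x = x"
    "(r \<odot>\<^bsub>M\<^esub> x) \<otimes>\<^bsub>M\<^esub> y = r \<odot>\<^bsub>M\<^esub> (x \<otimes>\<^bsub>M\<^esub> y)" if "x \<in> N" "y \<in> N" for q r x y
    using smult_l_distr[of q r x] smult_r_distr[of r x y] smult_assoc1[of q r x] smult_one[of x]
      smult_assoc2[of r x y] NM[OF that(1)] NM[OF that(2)] by simp_all
  ultimately show ?thesis
    by (intro algebraI class_cring.cring_axioms) (simp_all add: N)
qed

lemma subalgebra_finsum:
  fixes M :: "('r::comm_ring_1, 'b) module"
  assumes M: "abelian_group M" and S: "abelian_group (M\<lparr>carrier := N\<rparr>)" and N: "N \<subseteq> carrier M"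
    and f: "\<And>i. i \<in> I \<Longrightarrow> f i \<in> N"
  shows "finsum (M\<lparr>carrier := N\<rparr>) f I = finsum M f I"
proof -
  interpret M: abelian_group M by (rule M)
  interpret S: abelian_group "M\<lparr>carrier := N\<rparr>" by (rule S)
  have NM: "x \<in> carrier M" if "x \<in> N" for x using N that by (rule subsetD)
  show ?thesis
    using f
  proof (induction I rule: infinite_finite_induct)
    case (insert i I)
    have c1: "f \<in> I \<rightarrow> carrier (M\<lparr>carrier := N\<rparr>)" "f i \<in> carrier (M\<lparr>carrier := N\<rparr>)" using insert(4) by simp_all
    have c2: "f \<in> I \<rightarrow> carrier M" "f i \<in> carrier M" using insert(4) NM by simp_all
    show ?case
      unfolding S.finsum_insert[OF insert(1,2) c1] M.finsum_insert[OF insert(1,2) c2] using insert by simp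
  qed simp_all
qed

text \<open>Independent subsets of \<open>N\<close> are bounded in size by the dimension of
  \<open>A\<close>, so a maximal one exists, and maximality puts all of \<open>N\<close> into its
  span.\<close>

lemma finite_algebra_subspace_basis:
  fixes A :: "('k::field, 'a) module"
  assumes A: "finite_algebra A" and N: "N \<subseteq> carrier A"
  shows "\<exists>B. finite B \<and> B \<subseteq> N \<and> (\<forall>y\<in>N. \<exists>d. y = (\<Oplus>\<^bsub>A\<^esub>b\<in>B. d b \<odot>\<^bsub>A\<^esub> b)) \<and>
    (\<forall>d. (\<Oplus>\<^bsub>A\<^esub>b\<in>B. d b \<odot>\<^bsub>A\<^esub> b) = \<zero>\<^bsub>A\<^esub> \<longrightarrow> (\<forall>b\<in>B. d b = 0))"
proof -
  interpret A: algebra class_ring A using A by (simp add: finite_algebra_def)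
  interpret V: vectorspace class_ring A
    unfolding vectorspace_def using A.module_axioms class_field by blast
  have fd: "V.fin_dim" using A unfolding finite_algebra_def V.fin_dim_def by blast
  have "\<exists>B. finite B \<and> maximal B (\<lambda>S. S \<subseteq> N \<and> \<not> A.lin_dep S)"
  proof (rule maximal_exists[where N = V.dim and B = "{}"])
    show "finite S \<and> card S \<le> V.dim" if "S \<subseteq> N \<and> \<not> A.lin_dep S" for S
      using V.li_le_dim[OF fd order_trans[OF conjunct1[OF that] N]] that by blast
    show "{} \<subseteq> N \<and> \<not> A.lin_dep {}" by (simp add: A.lin_dep_def)
  qed
  then obtain B where B0: "finite B" "maximal B (\<lambda>S. S \<subseteq> N \<and> \<not> A.lin_dep S)"
    by (elim exE conjE)
  have B: "finite B" "B \<subseteq> N" "\<not> A.lin_dep B"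
    using B0 unfolding maximal_def by simp_all
  have mx: "S = B" if "S \<subseteq> N" "\<not> A.lin_dep S" "B \<subseteq> S" for S
    using B0(2) that unfolding maximal_def by simp
  have BA: "B \<subseteq> carrier A" using B(2) N by (rule order_trans)
  have "\<exists>d. y = (\<Oplus>\<^bsub>A\<^esub>b\<in>B. d b \<odot>\<^bsub>A\<^esub> b)" if y: "y \<in> N" for y
  proof -
    have "y \<in> A.span B"
    proof (cases "y \<in> B")
      case True
      then show ?thesis using A.in_own_span[OF BA] by blast
    next
      case False
      show ?thesis
      proof (rule ccontr)
        assume "y \<notin> A.span B"
        then have "\<not> A.lin_dep (B \<union> {y})"
          using V.lin_dep_iff_in_span[OF BA B(3) subsetD[OF N y] False] by blast
        then have "B \<union> {y} = B" using mx[of "B \<union> {y}"] B(2) y by blast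
        then show False using False by blast
      qed
    qed
    then show ?thesis using A.finite_in_span[OF B(1) BA] unfolding A.lincomb_def by metis
  qed
  moreover have "d b = 0" if "(\<Oplus>\<^bsub>A\<^esub>b\<in>B. d b \<odot>\<^bsub>A\<^esub> b) = \<zero>\<^bsub>A\<^esub>" "b \<in> B" for d b
  proof (rule ccontr)
    assume "d b \<noteq> 0"
    then have "A.lin_dep B"
      using A.lin_dep_crit[OF B(1) order_refl, of d b] that by (simp add: A.lincomb_def)
    then show False using B(3) by simp
  qed
  ultimately show ?thesis using B(1,2) by blast
qed

lemma finite_algebraI:
  assumes A: "algebra class_ring A" and B: "finite B" "B \<subseteq> carrier A"
    and gen: "\<And>y. y \<in> carrier A \<Longrightarrow> \<exists>d. y = (\<Oplus>\<^bsub>A\<^esub>b\<in>B. d b \<odot>\<^bsub>A\<^esub> b)"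
  shows "finite_algebra A"
proof -
  interpret A: algebra class_ring A by (rule A)
  have "A.span B = carrier A"
  proof
    show "A.span B \<subseteq> carrier A" by (rule A.span_is_subset2[OF B(2)])
    show "carrier A \<subseteq> A.span B"
    proof
      fix x assume "x \<in> carrier A"
      then obtain d where "x = A.lincomb d B" using gen unfolding A.lincomb_def by blast
      then show "x \<in> A.span B" unfolding A.finite_span[OF B] by auto
    qed
  qed
  then show ?thesis unfolding finite_algebra_def using A B by blast
qed

section \<open>Smoothings from reductions\<close>

text \<open>The data are those that can be checked on invariants: the basis \<open>B\<close> and the
  separating functionals give freeness, the reduction gives the special fibre, and separable
  generation gives smoothness.\<close>

lemma is_smoothingI:
  fixes M :: "('k::field fps, 'b) module" and A :: "('k, 'a) module"
  assumes M: "algebra class_ring M" and A: "algebra class_ring A"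
    and B: "finite B" "B \<subseteq> carrier A"
    and gen: "\<And>y. y \<in> carrier A \<Longrightarrow> \<exists>d. y = (\<Oplus>\<^bsub>A\<^esub>b\<in>B. d b \<odot>\<^bsub>A\<^esub> b)"
    and ind: "\<And>d b. (\<Oplus>\<^bsub>A\<^esub>b\<in>B. d b \<odot>\<^bsub>A\<^esub> b) = \<zero>\<^bsub>A\<^esub> \<Longrightarrow> b \<in> B \<Longrightarrow> d b = 0"
    and \<pi>: "fps_algebra.reduction M A \<pi>"
    and fs: "\<And>f. f \<in> Fs \<Longrightarrow> fps_algebra.functional M f"
    and inj: "\<And>x y. x \<in> carrier M \<Longrightarrow> y \<in> carrier M \<Longrightarrow> (\<And>f. f \<in> Fs \<Longrightarrow> f x = f y) \<Longrightarrow> x = y"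
    and sg: "separably_generated M H \<theta>"
  shows "is_smoothing A M"
proof -
  interpret fps_algebra M by (rule fps_algebra.intro[OF M])
  interpret A: algebra class_ring A by (rule A)
  obtain \<phi> where "\<phi> \<in> alg_iso (special_fibre M) A"
    using special_fibre_of_reduction[OF A.ring_axioms \<pi>] by blast
  moreover have "free_of_finite_rank M" 
  proof (rule free_of_reduction[OF A \<pi> B, where Fs = Fs])
    show "\<exists>d. y = (\<Oplus>\<^bsub>A\<^esub>b\<in>B. d b \<odot>\<^bsub>A\<^esub> b)" if "y \<in> carrier A" for y by (rule gen[OF that])
    show "d b = 0" if "(\<Oplus>\<^bsub>A\<^esub>b\<in>B. d b \<odot>\<^bsub>A\<^esub> b) = \<zero>\<^bsub>A\<^esub>" "b \<in> B" for d b by (rule ind[OF that])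
    show "functional f" if "f \<in> Fs" for f by (rule fs[OF that])
    show "x = y" if "x \<in> carrier M" "y \<in> carrier M" "\<And>f. f \<in> Fs \<Longrightarrow> f x = f y" for x y
      by (rule inj[OF that])
  qed
  moreover have "finite_algebra A" by (rule finite_algebraI[OF A B gen])
  ultimately show ?thesis
    unfolding is_smoothing_def smoothing_via_def using M separably_generated_smooth[OF M sg] by blast
qed

definition transport :: "('b \<Rightarrow> 'c) \<Rightarrow> ('r, 'b) module \<Rightarrow> ('r, 'c) module" where
  "transport e M = (let d = inv_into (carrier M) e in
     \<lparr>carrier = e ` carrier M, mult = (\<lambda>u v. e (d u \<otimes>\<^bsub>M\<^esub> d v)), one = e \<one>\<^bsub>M\<^esub>, zero = e \<zero>\<^bsub>M\<^esub>,
      add = (\<lambda>u v. e (d u \<oplus>\<^bsub>M\<^esub> d v)), smult = (\<lambda>r u. e (r \<odot>\<^bsub>M\<^esub> d u))\<rparr>)"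

text \<open>\<open>smoothable\<close> prescribes a carrier of vectors over K[[t]]. Finitely many
  separating functionals embed \<open>M\<close> into such vectors, and the algebra structure is
  transported together with all data of the criterion. The length of the vectors may exceed the
  rank.\<close>

lemma smoothableI:
  fixes M :: "('k::field fps, 'b) module" and A :: "('k, 'a) module"
  assumes M: "algebra class_ring M" and A: "algebra class_ring A"
    and B: "finite B" "B \<subseteq> carrier A"
    and gen: "\<And>y. y \<in> carrier A \<Longrightarrow> \<exists>d. y = (\<Oplus>\<^bsub>A\<^esub>b\<in>B. d b \<odot>\<^bsub>A\<^esub> b)"
    and ind: "\<And>d b. (\<Oplus>\<^bsub>A\<^esub>b\<in>B. d b \<odot>\<^bsub>A\<^esub> b) = \<zero>\<^bsub>A\<^esub> \<Longrightarrow> b \<in> B \<Longrightarrow> d b = 0"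
    and \<pi>: "fps_algebra.reduction M A \<pi>"
    and Fs: "finite Fs" and fs: "\<And>f. f \<in> Fs \<Longrightarrow> fps_algebra.functional M f"
    and inj: "\<And>x y. x \<in> carrier M \<Longrightarrow> y \<in> carrier M \<Longrightarrow> (\<And>f. f \<in> Fs \<Longrightarrow> f x = f y) \<Longrightarrow> x = y"
    and sg: "separably_generated M H \<theta>"
  shows "smoothable A"
proof -
  interpret fps_algebra M by (rule fps_algebra.intro[OF M])
  interpret A: algebra class_ring A by (rule A)
  obtain en where en: "bij_betw en {0..<card Fs} Fs" using ex_bij_betw_nat_finite[OF Fs] by blast
  define e where "e x = vec (card Fs) (\<lambda>i. en i x)" for x
  have e_inj: "inj_on e (carrier M)"
  proof (rule inj_onI, rule inj)
    fix x y f assume eq: "e x = e y" and "f \<in> Fs"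
    then obtain i where i: "i < card Fs" "f = en i"
      using en unfolding bij_betw_def by (metis atLeastLessThan_iff imageE)
    show "f x = f y" using arg_cong[OF eq, of "\<lambda>v. vec_index v i"] i by (simp add: e_def)
  qed
  define d where "d = inv_into (carrier M) e"
  let ?T = "transport e M"
  have de: "d (e x) = x" if "x \<in> carrier M" for x
    unfolding d_def by (rule inv_into_f_f[OF e_inj that])
  have dc: "d u \<in> carrier M" if "u \<in> carrier ?T" for u
    using that de by (auto simp: transport_def Let_def)
  have ed: "e (d u) = u" if "u \<in> carrier ?T" for u
    using that de by (auto simp: transport_def Let_def)
  have T: "carrier ?T = e ` carrier M" "u \<otimes>\<^bsub>?T\<^esub> v = e (d u \<otimes>\<^bsub>M\<^esub> d v)" "\<one>\<^bsub>?T\<^esub> = e \<one>\<^bsub>M\<^esub>"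
    "\<zero>\<^bsub>?T\<^esub> = e \<zero>\<^bsub>M\<^esub>" "u \<oplus>\<^bsub>?T\<^esub> v = e (d u \<oplus>\<^bsub>M\<^esub> d v)" "r \<odot>\<^bsub>?T\<^esub> u = e (r \<odot>\<^bsub>M\<^esub> d u)" for u v r
    by (simp_all add: transport_def d_def Let_def)
  have ec: "e x \<in> carrier ?T" if "x \<in> carrier M" for x unfolding T by (rule imageI[OF that])
  have dT: "d (u \<otimes>\<^bsub>?T\<^esub> v) = d u \<otimes>\<^bsub>M\<^esub> d v" "d (u \<oplus>\<^bsub>?T\<^esub> v) = d u \<oplus>\<^bsub>M\<^esub> d v" "d (r \<odot>\<^bsub>?T\<^esub> u) = r \<odot>\<^bsub>M\<^esub> d u"
    if "u \<in> carrier ?T" "v \<in> carrier ?T" for u v r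
    unfolding T using dc[OF that(1)] dc[OF that(2)] by (simp_all add: de)
  have d1: "d \<one>\<^bsub>?T\<^esub> = \<one>\<^bsub>M\<^esub>" "d \<zero>\<^bsub>?T\<^esub> = \<zero>\<^bsub>M\<^esub>" unfolding T by (simp_all add: de)
  have H: "finite H" "\<And>\<chi>. \<chi> \<in> H \<Longrightarrow> class_alg_hom (\<lambda>p. to_ac (fps_to_fls p)) M \<chi>"
    and H_inj: "\<And>x y. x \<in> carrier M \<Longrightarrow> y \<in> carrier M \<Longrightarrow> (\<And>\<chi>. \<chi> \<in> H \<Longrightarrow> \<chi> x = \<chi> y) \<Longrightarrow> x = y"
    and \<theta>: "\<theta> \<in> carrier M" "inj_on (\<lambda>\<chi>. \<chi> \<theta>) H"
    and H_gen: "\<And>s. s \<in> carrier M \<Longrightarrow> \<exists>q. \<forall>\<chi>\<in>H. \<chi> s = poly (map_poly to_ac q) (\<chi> \<theta>)"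
    and \<mu>: "\<exists>\<mu>. map_poly to_ac \<mu> = (\<Prod>\<chi>\<in>H. [:- \<chi> \<theta>, 1:])"
    using sg unfolding separably_generated_def by blast+
  let ?f = "\<lambda>\<chi> y. \<chi> (d y)"
  have hom: "class_alg_hom (\<lambda>p. to_ac (fps_to_fls p)) ?T (?f \<chi>)" if \<chi>: "\<chi> \<in> H" for \<chi>
    unfolding class_alg_hom_def class_ring_hom_def
    using class_alg_homD(1-4)[OF H(2)[OF \<chi>]] dc by (simp add: dT d1)
  have inj': "u = v" if "u \<in> carrier ?T" "v \<in> carrier ?T" "\<And>\<chi>. \<chi> \<in> H \<Longrightarrow> ?f \<chi> u = ?f \<chi> v" for u v
  proof -
    have "d u = d v" by (rule H_inj[OF dc[OF that(1)] dc[OF that(2)] that(3)])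
    then have "e (d u) = e (d v)" by (rule arg_cong)
    then show ?thesis unfolding ed[OF that(1)] ed[OF that(2)] .
  qed
  have algT: "algebra class_ring ?T"
  proof (rule algebra_of_class_homs[OF comm_ring_hom_comp[OF to_ac_hom fps_to_fls_hom], where H = H and f = ?f])
    show "?f \<chi> \<zero>\<^bsub>?T\<^esub> = 0" if "\<chi> \<in> H" for \<chi>
      unfolding d1 by (rule class_ring_hom_zero[OF class_alg_homD(5)[OF H(2)[OF that]]])
    show "\<zero>\<^bsub>?T\<^esub> \<in> carrier ?T" "\<one>\<^bsub>?T\<^esub> \<in> carrier ?T" unfolding T(3,4) by (simp_all add: ec)
    show "u \<oplus>\<^bsub>?T\<^esub> v \<in> carrier ?T" "u \<otimes>\<^bsub>?T\<^esub> v \<in> carrier ?T"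
      if "u \<in> carrier ?T" "v \<in> carrier ?T" for u v
      unfolding T(2,5) using dc[OF that(1)] dc[OF that(2)] by (simp_all add: ec)
    show "r \<odot>\<^bsub>?T\<^esub> u \<in> carrier ?T" if "u \<in> carrier ?T" for u r
      unfolding T(6) using dc[OF that] by (simp add: ec)
  qed (rule hom inj'; assumption)+
  interpret T: fps_algebra ?T by (rule fps_algebra.intro[OF algT])
  have redT: "T.reduction A (\<lambda>y. \<pi> (d y))"
  proof -
    have \<pi>h: "\<pi> \<in> Ring.ring_hom M A" and surj: "\<pi> ` carrier M = carrier A"
      and lin: "\<And>c x. x \<in> carrier M \<Longrightarrow> \<pi> (fps_const c \<odot>\<^bsub>M\<^esub> x) = c \<odot>\<^bsub>A\<^esub> \<pi> x"
      and ker: "\<And>x. x \<in> carrier M \<Longrightarrow> \<pi> x = \<zero>\<^bsub>A\<^esub> \<longleftrightarrow> (\<exists>y\<in>carrier M. x = fps_X \<odot>\<^bsub>M\<^esub> y)"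
      using \<pi> unfolding reduction_def by blast+
    have "(\<lambda>y. \<pi> (d y)) \<in> Ring.ring_hom ?T A"
      by (rule Ring.ring_hom_memI)
        (simp_all add: dT d1 dc Ring.ring_hom_closed[OF \<pi>h] Ring.ring_hom_mult[OF \<pi>h] Ring.ring_hom_add[OF \<pi>h] Ring.ring_hom_one[OF \<pi>h])
    moreover have "(\<lambda>y. \<pi> (d y)) ` carrier ?T = carrier A"
      unfolding T(1) image_image surj[symmetric] by (rule image_cong) (simp_all add: de)
    moreover have "\<pi> (d u) = \<zero>\<^bsub>A\<^esub> \<longleftrightarrow> (\<exists>v\<in>carrier ?T. u = fps_X \<odot>\<^bsub>?T\<^esub> v)" if u: "u \<in> carrier ?T" for u
    proof -
      have "(\<exists>y\<in>carrier M. d u = fps_X \<odot>\<^bsub>M\<^esub> y) \<longleftrightarrow> (\<exists>v\<in>carrier ?T. u = fps_X \<odot>\<^bsub>?T\<^esub> v)"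
      proof
        assume "\<exists>y\<in>carrier M. d u = fps_X \<odot>\<^bsub>M\<^esub> y"
        then obtain y where y: "y \<in> carrier M" "d u = fps_X \<odot>\<^bsub>M\<^esub> y" by (rule bexE)
        have "u = fps_X \<odot>\<^bsub>?T\<^esub> e y" unfolding T(6) de[OF y(1)] y(2)[symmetric] ed[OF u] ..
        then show "\<exists>v\<in>carrier ?T. u = fps_X \<odot>\<^bsub>?T\<^esub> v" by (rule bexI[OF _ ec[OF y(1)]])
      next
        assume "\<exists>v\<in>carrier ?T. u = fps_X \<odot>\<^bsub>?T\<^esub> v"
        then obtain v where v: "v \<in> carrier ?T" "u = fps_X \<odot>\<^bsub>?T\<^esub> v" by (rule bexE)
        show "\<exists>y\<in>carrier M. d u = fps_X \<odot>\<^bsub>M\<^esub> y"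
          by (rule bexI[OF _ dc[OF v(1)]]) (simp only: v(2) dT(3)[OF v(1) v(1)])
      qed
      then show ?thesis using ker[OF dc[OF u]] by simp
    qed
    ultimately show ?thesis
      unfolding T.reduction_def using lin dc by (simp add: dT(3))
  qed
  \<comment> \<open>Transported points stay distinct because their values at the image of \<theta>
    differ. This allows the product over the points to be reindexed.\<close>
  have re: "inj_on ?f H"
  proof (rule inj_onI)
    fix \<chi> \<psi> assume \<chi>: "\<chi> \<in> H" and \<psi>: "\<psi> \<in> H" and eq: "?f \<chi> = ?f \<psi>"
    from fun_cong[OF eq, of "e \<theta>"] have "\<chi> \<theta> = \<psi> \<theta>" by (simp add: de \<theta>(1))
    then show "\<chi> = \<psi>" using inj_onD[OF \<theta>(2) _ \<chi> \<psi>] by simp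
  qed
  have sgT: "separably_generated ?T (?f ` H) (e \<theta>)"
    unfolding separably_generated_def
  proof (intro conjI ballI impI)
    show "finite (?f ` H)" using H(1) by simp
    show "class_alg_hom (\<lambda>p. to_ac (fps_to_fls p)) ?T \<psi>" if "\<psi> \<in> ?f ` H" for \<psi>
      using that hom by (elim imageE) simp
    show "u = v" if "u \<in> carrier ?T" "v \<in> carrier ?T" "\<forall>\<psi>\<in>?f ` H. \<psi> u = \<psi> v" for u v
    proof (rule inj'[OF that(1,2)])
      fix \<chi> assume "\<chi> \<in> H"
      from bspec[OF that(3) imageI[OF this, of ?f]] show "\<chi> (d u) = \<chi> (d v)" by simp
    qed
    show "e \<theta> \<in> carrier ?T" by (rule ec[OF \<theta>(1)])
    show "inj_on (\<lambda>\<psi>. \<psi> (e \<theta>)) (?f ` H)"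
      by (rule inj_on_imageI) (use \<theta> in \<open>simp add: comp_def de\<close>)
    show "\<exists>q. \<forall>\<psi>\<in>?f ` H. \<psi> s = poly (map_poly to_ac q) (\<psi> (e \<theta>))" if s: "s \<in> carrier ?T" for s
    proof -
      obtain q where "\<forall>\<chi>\<in>H. \<chi> (d s) = poly (map_poly to_ac q) (\<chi> \<theta>)" using H_gen[OF dc[OF s]] by (rule exE)
      then show ?thesis by (intro exI[of _ q]) (simp add: de \<theta>(1))
    qed
    show "\<exists>\<mu>. map_poly to_ac \<mu> = (\<Prod>\<psi>\<in>?f ` H. [:- \<psi> (e \<theta>), 1:])"
      unfolding prod.reindex[OF re] using \<mu> by (simp add: comp_def de \<theta>(1))
  qed
  have "is_smoothing A ?T"
  proof (rule is_smoothingI[OF algT A B _ _ redT _ _ sgT, where Fs = "(\<lambda>f y. f (d y)) ` Fs"])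
    show "\<exists>d. y = (\<Oplus>\<^bsub>A\<^esub>b\<in>B. d b \<odot>\<^bsub>A\<^esub> b)" if "y \<in> carrier A" for y by (rule gen[OF that])
    show "d b = 0" if "(\<Oplus>\<^bsub>A\<^esub>b\<in>B. d b \<odot>\<^bsub>A\<^esub> b) = \<zero>\<^bsub>A\<^esub>" "b \<in> B" for d b by (rule ind[OF that])
    show "T.functional g" if g: "g \<in> (\<lambda>f y. f (d y)) ` Fs" for g
    proof -
      obtain f where f: "f \<in> Fs" "g = (\<lambda>y. f (d y))" using g by (rule imageE)
      show ?thesis
        unfolding T.functional_def f(2) using functionalD(1,2)[OF fs[OF f(1)]] dc by (simp add: dT)
    qed
    show "u = v" if u: "u \<in> carrier ?T" and v: "v \<in> carrier ?T"
      and eq: "\<And>g. g \<in> (\<lambda>f y. f (d y)) ` Fs \<Longrightarrow> g u = g v" for u v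
    proof -
      have "d u = d v"
      proof (rule inj[OF dc[OF u] dc[OF v]])
        fix f assume "f \<in> Fs"
        from eq[OF imageI[OF this, of "\<lambda>f y. f (d y)"]] show "f (d u) = f (d v)" by simp
      qed
      then have "e (d u) = e (d v)" by (rule arg_cong)
      then show ?thesis unfolding ed[OF u] ed[OF v] .
    qed
  qed
  then show ?thesis unfolding smoothable_def by blast
qed

section \<open>Lifting invariants\<close>

text \<open>Linear reductivity concerns vector spaces over K, so \<open>M\<close> is viewed as one,
  of infinite dimension in general, with the kernel of the reduction as a stable subspace. An
  element with invariant reduction is invariant modulo this kernel and can be corrected within
  it.\<close>

lemma invariant_lift:
  fixes M :: "('k::alg_closed_field fps, 'b) module" and G :: "('g, 'm) monoid_scheme"
  assumes M: "algebra class_ring M" and A: "algebra class_ring A" and lr: "linearly_reductive G \<O>"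
    and act: "algebraic_action G \<O> fps_const M \<beta>"
    and free: "free_of_finite_rank M" and \<pi>: "fps_algebra.reduction M A \<pi>"
    and \<pi>\<beta>: "\<And>g x y. g \<in> carrier G \<Longrightarrow> x \<in> carrier M \<Longrightarrow> y \<in> carrier M \<Longrightarrow> \<pi> x = \<pi> y \<Longrightarrow> \<pi> (\<beta> g x) = \<pi> (\<beta> g y)"
    and b: "b \<in> carrier M" and b\<pi>: "\<And>g. g \<in> carrier G \<Longrightarrow> \<pi> (\<beta> g b) = \<pi> b"
  shows "\<exists>b'\<in>carrier M. (\<forall>g\<in>carrier G. \<beta> g b' = b') \<and> \<pi> b' = \<pi> b"
proof -
  interpret fps_algebra M by (rule fps_algebra.intro[OF M])
  interpret A: algebra class_ring A by (rule A)
  interpret act: group_action G "carrier M" \<beta> using act by (simp add: algebraic_action_def)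
  obtain E co where E: "finite E" "E \<subseteq> carrier M" and co: "\<And>e. e \<in> E \<Longrightarrow> functional (\<lambda>x. co x e)"
    and rep: "\<And>x. x \<in> carrier M \<Longrightarrow> x = (\<Oplus>\<^bsub>M\<^esub>e\<in>E. co x e \<odot>\<^bsub>M\<^esub> e)"
    using free_coordinates[OF free] by blast
  \<comment> \<open>\<open>M\<close> is embedded into a vector space on a type by listing the
    coefficients of its coordinates. Indices outside \<open>E\<close> get the value 0, since
    \<open>co\<close> is known to be linear only on \<open>E\<close>.\<close>
  define j :: "'b \<Rightarrow> 'b \<times> nat \<Rightarrow> 'k" where "j x = (\<lambda>(e, n). if e \<in> E then fps_nth (co x e) n else 0)" for x
  define sc :: "'k \<Rightarrow> ('b \<times> nat \<Rightarrow> 'k) \<Rightarrow> 'b \<times> nat \<Rightarrow> 'k" where "sc c f = (\<lambda>z. c * f z)" for c f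
  interpret V: vector_space sc
    by unfold_locales (simp_all add: sc_def fun_eq_iff algebra_simps)
  have j_inj: "inj_on j (carrier M)"
  proof (rule inj_onI)
    fix x y assume x: "x \<in> carrier M" and y: "y \<in> carrier M" and eq: "j x = j y"
    have coe: "co x e = co y e" if "e \<in> E" for e
    proof (rule fps_ext)
      fix n
      show "fps_nth (co x e) n = fps_nth (co y e) n" using fun_cong[OF eq, of "(e, n)"] that by (simp add: j_def)
    qed
    have "(\<Oplus>\<^bsub>M\<^esub>e\<in>E. co x e \<odot>\<^bsub>M\<^esub> e) = (\<Oplus>\<^bsub>M\<^esub>e\<in>E. co y e \<odot>\<^bsub>M\<^esub> e)"
      by (rule finsum_cong') (use coe E(2) in auto)
    then show "x = y" using rep[OF x] rep[OF y] by simp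
  qed
  have j_add: "j (x \<oplus>\<^bsub>M\<^esub> y) = j x + j y" if "x \<in> carrier M" "y \<in> carrier M" for x y
    using functionalD(1)[OF co that] by (auto simp: j_def fun_eq_iff)
  have j_sc: "j (fps_const c \<odot>\<^bsub>M\<^esub> x) = sc c (j x)" if "x \<in> carrier M" for c x
    using functionalD(2)[OF co that] by (auto simp: j_def sc_def fun_eq_iff)
  have j0: "j \<zero>\<^bsub>M\<^esub> = 0"
    using functionalD(3)[OF co] by (auto simp: j_def fun_eq_iff)
  define d where "d = inv_into (carrier M) j"
  have dj: "d (j x) = x" if "x \<in> carrier M" for x unfolding d_def by (rule inv_into_f_f[OF j_inj that])
  have \<pi>h: "\<pi> \<in> Ring.ring_hom M A" and \<pi>sc: "\<And>c x. x \<in> carrier M \<Longrightarrow> \<pi> (fps_const c \<odot>\<^bsub>M\<^esub> x) = c \<odot>\<^bsub>A\<^esub> \<pi> x"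
    using \<pi> unfolding reduction_def by blast+
  have \<pi>0: "\<pi> \<zero>\<^bsub>M\<^esub> = \<zero>\<^bsub>A\<^esub>" by (rule ring_hom_zero[OF \<pi>h ring_axioms A.ring_axioms])
  have \<pi>c: "\<pi> x \<in> carrier A" if "x \<in> carrier M" for x by (rule Ring.ring_hom_closed[OF \<pi>h that])
  have \<beta>c: "\<beta> g x \<in> carrier M" if "g \<in> carrier G" "x \<in> carrier M" for g x
    by (rule act.element_image[OF that refl])
  have \<beta>h: "\<beta> g \<in> Ring.ring_hom M M" and \<beta>sm: "\<And>r x. x \<in> carrier M \<Longrightarrow> \<beta> g (r \<odot>\<^bsub>M\<^esub> x) = r \<odot>\<^bsub>M\<^esub> \<beta> g x"
    if "g \<in> carrier G" for g
    using act that unfolding algebraic_action_def alg_hom_def by blast+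
  have \<beta>0: "\<beta> g \<zero>\<^bsub>M\<^esub> = \<zero>\<^bsub>M\<^esub>" if "g \<in> carrier G" for g
    by (rule ring_hom_zero[OF \<beta>h[OF that] ring_axioms ring_axioms])
  define Y where "Y = j ` carrier M"
  define N where "N = j ` {x \<in> carrier M. \<pi> x = \<zero>\<^bsub>A\<^esub>}"
  define \<gamma> where "\<gamma> g v = j (\<beta> g (d v))" for g v
  have \<gamma>j: "\<gamma> g (j x) = j (\<beta> g x)" if "x \<in> carrier M" for g x
    unfolding \<gamma>_def dj[OF that] ..
  have jY: "j x \<in> Y" if "x \<in> carrier M" for x unfolding Y_def by (rule imageI[OF that])
  have jN: "j x \<in> N" if "x \<in> carrier M" "\<pi> x = \<zero>\<^bsub>A\<^esub>" for x unfolding N_def using that by (intro imageI) simp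
  have Y_cases: "\<exists>x. x \<in> carrier M \<and> v = j x" if "v \<in> Y" for v using that unfolding Y_def by blast
  have N_cases: "\<exists>x. x \<in> carrier M \<and> \<pi> x = \<zero>\<^bsub>A\<^esub> \<and> v = j x" if "v \<in> N" for v using that unfolding N_def by blast
  have Ysub: "module.subspace sc Y"
  proof (rule V.subspaceI)
    show "0 \<in> Y" using jY[OF zero_closed] by (simp only: j0)
    show "u + v \<in> Y" if u: "u \<in> Y" and v: "v \<in> Y" for u v
    proof -
      obtain x y where x: "x \<in> carrier M" "u = j x" and y: "y \<in> carrier M" "v = j y"
        using Y_cases[OF u] Y_cases[OF v] by blast
      show ?thesis unfolding x(2) y(2) j_add[OF x(1) y(1), symmetric] by (rule jY[OF a_closed[OF x(1) y(1)]])
    qed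
    show "sc c u \<in> Y" if u: "u \<in> Y" for c u
    proof -
      obtain x where x: "x \<in> carrier M" "u = j x" using Y_cases[OF u] by blast
      show ?thesis unfolding x(2) j_sc[OF x(1), symmetric] by (rule jY[OF smult_cl[OF x(1)]])
    qed
  qed
  have Nsub: "module.subspace sc N"
  proof (rule V.subspaceI)
    show "0 \<in> N" using jN[OF zero_closed \<pi>0] by (simp only: j0)
    show "u + v \<in> N" if u: "u \<in> N" and v: "v \<in> N" for u v
    proof -
      obtain x y where x: "x \<in> carrier M" "\<pi> x = \<zero>\<^bsub>A\<^esub>" "u = j x" and y: "y \<in> carrier M" "\<pi> y = \<zero>\<^bsub>A\<^esub>" "v = j y"
        using N_cases[OF u] N_cases[OF v] by blast
      have "\<pi> (x \<oplus>\<^bsub>M\<^esub> y) = \<zero>\<^bsub>A\<^esub>" using Ring.ring_hom_add[OF \<pi>h x(1) y(1)] by (simp add: x(2) y(2))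
      then show ?thesis unfolding x(3) y(3) j_add[OF x(1) y(1), symmetric] by (rule jN[OF a_closed[OF x(1) y(1)]])
    qed
    show "sc c u \<in> N" if u: "u \<in> N" for c u
    proof -
      obtain x where x: "x \<in> carrier M" "\<pi> x = \<zero>\<^bsub>A\<^esub>" "u = j x" using N_cases[OF u] by blast
      have "\<pi> (fps_const c \<odot>\<^bsub>M\<^esub> x) = \<zero>\<^bsub>A\<^esub>" unfolding \<pi>sc[OF x(1)] x(2) using A.smult_r_null by simp
      then show ?thesis unfolding x(3) j_sc[OF x(1), symmetric] by (rule jN[OF smult_cl[OF x(1)]])
    qed
  qed
  have j_diff: "j x - j y = j (x \<ominus>\<^bsub>M\<^esub> y)" if "x \<in> carrier M" "y \<in> carrier M" for x y
  proof -
    have "x = (x \<ominus>\<^bsub>M\<^esub> y) \<oplus>\<^bsub>M\<^esub> y" using that by (simp add: minus_eq a_assoc l_neg)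
    then have "j x = j (x \<ominus>\<^bsub>M\<^esub> y) + j y" using j_add[OF minus_closed[OF that] that(2)] by simp
    then show ?thesis by simp
  qed
  have \<pi>_diff: "\<pi> (x \<ominus>\<^bsub>M\<^esub> y) = \<zero>\<^bsub>A\<^esub> \<longleftrightarrow> \<pi> x = \<pi> y" if "x \<in> carrier M" "y \<in> carrier M" for x y
  proof -
    have "x = (x \<ominus>\<^bsub>M\<^esub> y) \<oplus>\<^bsub>M\<^esub> y" using that by (simp add: minus_eq a_assoc l_neg)
    then have "\<pi> x = \<pi> (x \<ominus>\<^bsub>M\<^esub> y) \<oplus>\<^bsub>A\<^esub> \<pi> y"
      using Ring.ring_hom_add[OF \<pi>h minus_closed[OF that] that(2)] by simp
    then show ?thesis using \<pi>c[OF that(2)] \<pi>c[OF minus_closed[OF that]] A.add.l_cancel_one by simp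
  qed
  have "\<exists>v\<in>Y. (\<forall>g\<in>carrier G. \<gamma> g v = v) \<and> v - j b \<in> N"
  proof (rule invariant_representative[OF V.vector_space_axioms lr Ysub Nsub])
    fix g u v assume g: "g \<in> carrier G" and u: "u \<in> Y"
    obtain x where x: "x \<in> carrier M" "u = j x" using Y_cases[OF u] by blast
    show "\<gamma> g u \<in> Y" unfolding x(2) \<gamma>j[OF x(1)] by (rule jY[OF \<beta>c[OF g x(1)]])
    show "\<gamma> g (sc c u) = sc c (\<gamma> g u)" for c
      unfolding x(2) \<gamma>j[OF x(1)] j_sc[OF x(1), symmetric] \<gamma>j[OF smult_cl[OF x(1)]] \<beta>sm[OF g x(1)]
      by (rule j_sc[OF \<beta>c[OF g x(1)]])
    show "\<gamma> g u \<in> N" if "u \<in> N"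
    proof -
      obtain y where y: "y \<in> carrier M" "\<pi> y = \<zero>\<^bsub>A\<^esub>" "u = j y" using N_cases[OF \<open>u \<in> N\<close>] by blast
      \<comment> \<open>The action descends to the special fibre, so an element with reduction 0 is
        compared with 0 itself.\<close>
      have "\<pi> (\<beta> g y) = \<pi> (\<beta> g \<zero>\<^bsub>M\<^esub>)" by (rule \<pi>\<beta>[OF g y(1) zero_closed]) (simp only: y(2) \<pi>0)
      then have "\<pi> (\<beta> g y) = \<zero>\<^bsub>A\<^esub>" unfolding \<beta>0[OF g] \<pi>0 .
      then show ?thesis unfolding y(3) \<gamma>j[OF y(1)] by (rule jN[OF \<beta>c[OF g y(1)]])
    qed
    assume v: "v \<in> Y"
    obtain y where y: "y \<in> carrier M" "v = j y" using Y_cases[OF v] by blast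
    show "\<gamma> g (u + v) = \<gamma> g u + \<gamma> g v"
      unfolding x(2) y(2) j_add[OF x(1) y(1), symmetric] \<gamma>j[OF x(1)] \<gamma>j[OF y(1)] \<gamma>j[OF a_closed[OF x(1) y(1)]]
        Ring.ring_hom_add[OF \<beta>h[OF g] x(1) y(1)]
      by (rule j_add[OF \<beta>c[OF g x(1)] \<beta>c[OF g y(1)]])
  next
    fix u assume u: "u \<in> Y"
    obtain x where x: "x \<in> carrier M" "u = j x" using Y_cases[OF u] by blast
    have "\<beta> \<one>\<^bsub>G\<^esub> x = x" using x(1) by (simp flip: act.id_eq_one)
    then show "\<gamma> \<one>\<^bsub>G\<^esub> u = u" unfolding x(2) \<gamma>j[OF x(1)] by simp
    show "\<gamma> (g \<otimes>\<^bsub>G\<^esub> h) u = \<gamma> g (\<gamma> h u)" if "g \<in> carrier G" "h \<in> carrier G" for g h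
      unfolding x(2) \<gamma>j[OF x(1)] \<gamma>j[OF \<beta>c[OF that(2) x(1)]] act.composition_rule[OF x(1) that] ..
    obtain m :: nat and w v where w: "\<And>i. i < m \<Longrightarrow> w i \<in> \<O>" "\<And>i. i < m \<Longrightarrow> v i \<in> carrier M"
      and wv: "\<And>g. g \<in> carrier G \<Longrightarrow> \<beta> g x = (\<Oplus>\<^bsub>M\<^esub>i\<in>{..<m}. fps_const (w i g) \<odot>\<^bsub>M\<^esub> v i)"
      using act x(1) unfolding algebraic_action_def by blast
    have jsum: "j (\<Oplus>\<^bsub>M\<^esub>i\<in>I. fps_const (w i g) \<odot>\<^bsub>M\<^esub> v i) = (\<Sum>i\<in>I. sc (w i g) (j (v i)))"
      if "finite I" "I \<subseteq> {..<m}" for I g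
      using that
    proof (induction I)
      case (insert i I)
      have c1: "(\<lambda>i. fps_const (w i g) \<odot>\<^bsub>M\<^esub> v i) \<in> I \<rightarrow> carrier M"
        and c2: "v i \<in> carrier M" "fps_const (w i g) \<odot>\<^bsub>M\<^esub> v i \<in> carrier M"
        using insert(4) w(2) by auto
      have "I \<subseteq> {..<m}" using insert(4) by simp
      then show ?case
        using insert(1,2) insert(3) c2 j_add[OF c2(2) finsum_closed[OF c1]] j_sc[OF c2(1)]
        by (simp add: finsum_insert[OF insert(1,2) c1 c2(2)])
    qed (simp add: j0)
    show "\<exists>(m::nat) w v. (\<forall>i<m. w i \<in> \<O>) \<and> (\<forall>g\<in>carrier G. \<gamma> g u = (\<Sum>i<m. sc (w i g) (v i)))"
    proof (intro exI conjI ballI allI impI)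
      show "i < m \<Longrightarrow> w i \<in> \<O>" for i by (rule w(1))
      show "\<gamma> g u = (\<Sum>i<m. sc (w i g) (j (v i)))" if "g \<in> carrier G" for g
        unfolding x(2) \<gamma>j[OF x(1)] wv[OF that] by (rule jsum) simp_all
    qed
  next
    show "j b \<in> Y" by (rule jY[OF b])
    show "\<gamma> g (j b) - j b \<in> N" if g: "g \<in> carrier G" for g
      unfolding \<gamma>j[OF b] j_diff[OF \<beta>c[OF g b] b]
      by (rule jN[OF minus_closed[OF \<beta>c[OF g b] b]]) (simp add: \<pi>_diff[OF \<beta>c[OF g b] b] b\<pi>[OF g])
  qed
  then obtain v where v: "v \<in> Y" "\<And>g. g \<in> carrier G \<Longrightarrow> \<gamma> g v = v" "v - j b \<in> N" by blast
  obtain b' where b': "b' \<in> carrier M" "v = j b'" using Y_cases[OF v(1)] by blast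
  have "\<beta> g b' = b'" if g: "g \<in> carrier G" for g
    using v(2)[OF g] unfolding b'(2) \<gamma>j[OF b'(1)] using inj_onD[OF j_inj _ \<beta>c[OF g b'(1)] b'(1)] by blast
  moreover have "\<pi> b' = \<pi> b"
  proof -
    obtain y where y: "y \<in> carrier M" "\<pi> y = \<zero>\<^bsub>A\<^esub>" "j (b' \<ominus>\<^bsub>M\<^esub> b) = j y"
      using N_cases[OF v(3)] unfolding b'(2) j_diff[OF b'(1) b] by blast
    have "b' \<ominus>\<^bsub>M\<^esub> b = y" by (rule inj_onD[OF j_inj y(3) minus_closed[OF b'(1) b] y(1)])
    then show ?thesis using \<pi>_diff[OF b'(1) b] y(2) by simp
  qed
  ultimately show ?thesis using b'(1) by blast
qed

theorem proposition1p2: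
  fixes G :: "('g, 'm) monoid_scheme"
    and \<O> :: "('g \<Rightarrow> 'k::{alg_closed_field, field_char_0}) set"
    and A :: "('k, 'a) module"
    and \<alpha> :: "'g \<Rightarrow> 'a \<Rightarrow> 'a"
    and \<A> :: "('k fps, 'b) module"
    and \<beta> :: "'g \<Rightarrow> 'b \<Rightarrow> 'b"
  assumes "linearly_reductive G \<O>"
    and "finite_algebra A"
    and "algebraic_action G \<O> (\<lambda>c. c) A \<alpha>"
    and "equivariant_smoothing G \<O> A \<alpha> \<A> \<beta>"
  shows "is_smoothing (invariant_algebra G A \<alpha>) (invariant_algebra G \<A> \<beta>) \<and>
         smoothable (invariant_algebra G A \<alpha>)"
proof -
  have algA: "algebra class_ring A" using assms(2) by (simp add: finite_algebra_def)
  obtain \<phi> where sm: "smoothing_via A \<A> \<phi>" and eqv: "\<And>g a. g \<in> carrier G \<Longrightarrow> a \<in> carrier \<A> \<Longrightarrow>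
      \<phi> (special_ideal \<A> +>\<^bsub>\<A>\<^esub> \<beta> g a) = \<alpha> g (\<phi> (special_ideal \<A> +>\<^bsub>\<A>\<^esub> a))"
    and act: "algebraic_action G \<O> fps_const \<A> \<beta>"
    using assms(4) unfolding equivariant_smoothing_def by blast
  have algM: "algebra class_ring \<A>" and free: "free_of_finite_rank \<A>"
    and smooth: "smooth_algebra (generic_fibre \<A>)" and \<phi>: "\<phi> \<in> alg_iso (special_fibre \<A>) A"
    using sm unfolding smoothing_via_def by blast+
  interpret M: fps_algebra \<A> by (rule fps_algebra.intro[OF algM])
  interpret A: algebra class_ring A by (rule algA)
  define \<pi> where "\<pi> = (\<lambda>x. \<phi> (special_ideal \<A> +>\<^bsub>\<A>\<^esub> x))"
  have \<pi>: "M.reduction A \<pi>" unfolding \<pi>_def by (rule M.reduction_of_special_fibre[OF A.ring_axioms \<phi>])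
  have \<pi>\<beta>: "\<pi> (\<beta> g x) = \<alpha> g (\<pi> x)" if "g \<in> carrier G" "x \<in> carrier \<A>" for g x
    unfolding \<pi>_def by (rule eqv[OF that])
  have \<pi>h: "\<pi> \<in> Ring.ring_hom \<A> A" and surj: "\<pi> ` carrier \<A> = carrier A"
    and lin: "\<And>c x. x \<in> carrier \<A> \<Longrightarrow> \<pi> (fps_const c \<odot>\<^bsub>\<A>\<^esub> x) = c \<odot>\<^bsub>A\<^esub> \<pi> x"
    and ker: "\<And>x. x \<in> carrier \<A> \<Longrightarrow> \<pi> x = \<zero>\<^bsub>A\<^esub> \<longleftrightarrow> (\<exists>y\<in>carrier \<A>. x = fps_X \<odot>\<^bsub>\<A>\<^esub> y)"
    using \<pi> unfolding M.reduction_def by blast+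
  obtain E co where E: "finite E" "E \<subseteq> carrier \<A>" and co: "\<And>e. e \<in> E \<Longrightarrow> M.functional (\<lambda>x. co x e)"
    and rep: "\<And>x. x \<in> carrier \<A> \<Longrightarrow> x = (\<Oplus>\<^bsub>\<A>\<^esub>e\<in>E. co x e \<odot>\<^bsub>\<A>\<^esub> e)"
    using M.free_coordinates[OF free] by blast
  have co_inj: "x = y" if x: "x \<in> carrier \<A>" and y: "y \<in> carrier \<A>" and coe: "\<And>e. e \<in> E \<Longrightarrow> co x e = co y e" for x y
  proof -
    have "(\<Oplus>\<^bsub>\<A>\<^esub>e\<in>E. co x e \<odot>\<^bsub>\<A>\<^esub> e) = (\<Oplus>\<^bsub>\<A>\<^esub>e\<in>E. co y e \<odot>\<^bsub>\<A>\<^esub> e)"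
      by (rule M.finsum_cong') (use coe E(2) in auto)
    then show "x = y" using rep[OF x] rep[OF y] by simp
  qed
  define NM where "NM = {b \<in> carrier \<A>. \<forall>g\<in>carrier G. \<beta> g b = b}"
  define NA where "NA = {a \<in> carrier A. \<forall>g\<in>carrier G. \<alpha> g a = a}"
  let ?M = "\<A>\<lparr>carrier := NM\<rparr>" and ?A = "A\<lparr>carrier := NA\<rparr>"
  have \<beta>h: "\<beta> g \<in> Ring.ring_hom \<A> \<A>" and \<beta>sm: "\<And>r x. x \<in> carrier \<A> \<Longrightarrow> \<beta> g (r \<odot>\<^bsub>\<A>\<^esub> x) = r \<odot>\<^bsub>\<A>\<^esub> \<beta> g x"
    if "g \<in> carrier G" for g
    using act that unfolding algebraic_action_def alg_hom_def by blast+
  have \<alpha>h: "\<alpha> g \<in> Ring.ring_hom A A" and \<alpha>sm: "\<And>r x. x \<in> carrier A \<Longrightarrow> \<alpha> g (r \<odot>\<^bsub>A\<^esub> x) = r \<odot>\<^bsub>A\<^esub> \<alpha> g x"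
    if "g \<in> carrier G" for g
    using assms(3) that unfolding algebraic_action_def alg_hom_def by blast+
  have NMc: "x \<in> carrier \<A>" and NMi: "\<And>g. g \<in> carrier G \<Longrightarrow> \<beta> g x = x" if "x \<in> NM" for x
    using that unfolding NM_def by blast+
  have NAc: "x \<in> carrier A" and NAi: "\<And>g. g \<in> carrier G \<Longrightarrow> \<alpha> g x = x" if "x \<in> NA" for x
    using that unfolding NA_def by blast+
  have smA: "r \<odot>\<^bsub>A\<^esub> x \<in> carrier A" if "x \<in> carrier A" for r x using A.smult_closed[of r x] that by simp
  have NM: "NM \<subseteq> carrier \<A>" "\<zero>\<^bsub>\<A>\<^esub> \<in> NM" "\<one>\<^bsub>\<A>\<^esub> \<in> NM"
    "\<And>x y. x \<in> NM \<Longrightarrow> y \<in> NM \<Longrightarrow> x \<oplus>\<^bsub>\<A>\<^esub> y \<in> NM" "\<And>x y. x \<in> NM \<Longrightarrow> y \<in> NM \<Longrightarrow> x \<otimes>\<^bsub>\<A>\<^esub> y \<in> NM"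
    "\<And>r x. x \<in> NM \<Longrightarrow> r \<odot>\<^bsub>\<A>\<^esub> x \<in> NM"
    using ring_hom_zero[OF \<beta>h M.ring_axioms M.ring_axioms] Ring.ring_hom_one[OF \<beta>h] Ring.ring_hom_add[OF \<beta>h]
      Ring.ring_hom_mult[OF \<beta>h] \<beta>sm
    unfolding NM_def by auto
  have NA: "NA \<subseteq> carrier A" "\<zero>\<^bsub>A\<^esub> \<in> NA" "\<one>\<^bsub>A\<^esub> \<in> NA"
    "\<And>x y. x \<in> NA \<Longrightarrow> y \<in> NA \<Longrightarrow> x \<oplus>\<^bsub>A\<^esub> y \<in> NA" "\<And>x y. x \<in> NA \<Longrightarrow> y \<in> NA \<Longrightarrow> x \<otimes>\<^bsub>A\<^esub> y \<in> NA"
    "\<And>r x. x \<in> NA \<Longrightarrow> r \<odot>\<^bsub>A\<^esub> x \<in> NA"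
    using ring_hom_zero[OF \<alpha>h A.ring_axioms A.ring_axioms] Ring.ring_hom_one[OF \<alpha>h] Ring.ring_hom_add[OF \<alpha>h]
      Ring.ring_hom_mult[OF \<alpha>h] \<alpha>sm smA
    unfolding NA_def by auto
  have algM': "algebra class_ring ?M" by (rule subalgebra_algebra[OF algM NM])
  have algA': "algebra class_ring ?A" by (rule subalgebra_algebra[OF algA NA])
  interpret M': fps_algebra ?M by (rule fps_algebra.intro[OF algM'])
  interpret A': algebra class_ring ?A by (rule algA')
  have \<pi>N: "\<pi> x \<in> NA" if x: "x \<in> NM" for x
  proof -
    have "\<alpha> g (\<pi> x) = \<pi> x" if g: "g \<in> carrier G" for g
      using \<pi>\<beta>[OF g NMc[OF x]] NMi[OF x g] by simp
    then show ?thesis using Ring.ring_hom_closed[OF \<pi>h NMc[OF x]] unfolding NA_def by blast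
  qed
  have red: "M'.reduction ?A \<pi>"
  proof -
    have "\<pi> \<in> Ring.ring_hom ?M ?A"
      by (rule Ring.ring_hom_memI)
        (simp_all add: \<pi>N NMc Ring.ring_hom_mult[OF \<pi>h] Ring.ring_hom_add[OF \<pi>h] Ring.ring_hom_one[OF \<pi>h])
    moreover have "\<pi> ` carrier ?M = carrier ?A"
    proof
      show "\<pi> ` carrier ?M \<subseteq> carrier ?A" using \<pi>N by (intro image_subsetI) simp
      show "carrier ?A \<subseteq> \<pi> ` carrier ?M"
      proof
        fix y assume "y \<in> carrier ?A"
        then have y: "y \<in> NA" by simp
        obtain b where b: "b \<in> carrier \<A>" "\<pi> b = y" using NAc[OF y] unfolding surj[symmetric] by blast
        \<comment> \<open>Surjectivity onto the invariants of the special fibre is the point where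
          linear reductivity is used.\<close>
        have "\<exists>b'\<in>carrier \<A>. (\<forall>g\<in>carrier G. \<beta> g b' = b') \<and> \<pi> b' = \<pi> b"
          by (rule invariant_lift[OF algM algA assms(1) act free \<pi> _ b(1)])
            (simp_all add: \<pi>\<beta> b NAi[OF y])
        then obtain b' where "b' \<in> NM" "\<pi> b' = y" unfolding NM_def b(2) by blast
        then show "y \<in> \<pi> ` carrier ?M" by (intro image_eqI[of _ _ b']) simp_all
      qed
    qed
    moreover have "\<pi> x = \<zero>\<^bsub>A\<^esub> \<longleftrightarrow> (\<exists>y\<in>NM. x = fps_X \<odot>\<^bsub>\<A>\<^esub> y)" if x: "x \<in> NM" for x
    proof
      assume "\<pi> x = \<zero>\<^bsub>A\<^esub>"
      then obtain y where y: "y \<in> carrier \<A>" "x = fps_X \<odot>\<^bsub>\<A>\<^esub> y" using ker[OF NMc[OF x]] by blast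
      \<comment> \<open>Saturation: if t y is invariant, then so is y, because t can be cancelled in
        every coordinate of \<A>.\<close>
      have "\<beta> g y = y" if g: "g \<in> carrier G" for g
      proof (rule co_inj[OF Ring.ring_hom_closed[OF \<beta>h[OF g] y(1)] y(1)])
        fix e assume e: "e \<in> E"
        have "fps_X \<odot>\<^bsub>\<A>\<^esub> \<beta> g y = fps_X \<odot>\<^bsub>\<A>\<^esub> y"
          using NMi[OF x g] unfolding y(2) \<beta>sm[OF g y(1)] .
        from arg_cong[OF this, of "\<lambda>z. co z e"] have "fps_X * co (\<beta> g y) e = fps_X * co y e"
          unfolding M.functionalD(2)[OF co[OF e] y(1)]
            M.functionalD(2)[OF co[OF e] Ring.ring_hom_closed[OF \<beta>h[OF g] y(1)]] .
        then show "co (\<beta> g y) e = co y e" by simp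
      qed
      then have "y \<in> NM" using y(1) unfolding NM_def by blast
      then show "\<exists>y\<in>NM. x = fps_X \<odot>\<^bsub>\<A>\<^esub> y" using y(2) by blast
    next
      assume "\<exists>y\<in>NM. x = fps_X \<odot>\<^bsub>\<A>\<^esub> y"
      then show "\<pi> x = \<zero>\<^bsub>A\<^esub>" using ker[OF NMc[OF x]] NMc by blast
    qed
    ultimately show ?thesis unfolding M'.reduction_def using lin NMc by simp
  qed
  obtain B where B: "finite B" "B \<subseteq> NA"
    and gen: "\<And>y. y \<in> NA \<Longrightarrow> \<exists>d. y = (\<Oplus>\<^bsub>A\<^esub>b\<in>B. d b \<odot>\<^bsub>A\<^esub> b)"
    and ind: "\<And>d b. (\<Oplus>\<^bsub>A\<^esub>b\<in>B. d b \<odot>\<^bsub>A\<^esub> b) = \<zero>\<^bsub>A\<^esub> \<Longrightarrow> b \<in> B \<Longrightarrow> d b = 0"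
    using finite_algebra_subspace_basis[OF assms(2) NA(1)] by blast
  have fsum: "(\<Oplus>\<^bsub>?A\<^esub>b\<in>B. d b \<odot>\<^bsub>?A\<^esub> b) = (\<Oplus>\<^bsub>A\<^esub>b\<in>B. d b \<odot>\<^bsub>A\<^esub> b)" for d
    using subalgebra_finsum[OF A.abelian_group_axioms A'.abelian_group_axioms NA(1), of B "\<lambda>b. d b \<odot>\<^bsub>A\<^esub> b"] NA(6) B(2)
    by auto
  have B': "B \<subseteq> carrier ?A" using B(2) by simp
  have gen': "\<exists>d. y = (\<Oplus>\<^bsub>?A\<^esub>b\<in>B. d b \<odot>\<^bsub>?A\<^esub> b)" if "y \<in> carrier ?A" for y
    unfolding fsum by (rule gen) (use that in simp)
  have ind': "d b = 0" if "(\<Oplus>\<^bsub>?A\<^esub>b\<in>B. d b \<odot>\<^bsub>?A\<^esub> b) = \<zero>\<^bsub>?A\<^esub>" "b \<in> B" for d b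
  proof -
    have "(\<Oplus>\<^bsub>A\<^esub>b\<in>B. d b \<odot>\<^bsub>A\<^esub> b) = \<zero>\<^bsub>A\<^esub>" using that(1) unfolding fsum by simp
    then show ?thesis using that(2) by (rule ind)
  qed
  \<comment> \<open>The coordinates of \<A> may be linearly dependent on the invariants, but they
    still separate elements, which yields freeness and the embedding into vectors.\<close>
  define Fs where "Fs = (\<lambda>e x. co x e) ` E"
  have Fs: "finite Fs" using E(1) by (simp add: Fs_def)
  have fs: "M'.functional f" if f: "f \<in> Fs" for f
  proof -
    obtain e where e: "e \<in> E" "f = (\<lambda>x. co x e)" using f unfolding Fs_def by (rule imageE)
    show ?thesis
      unfolding M'.functional_def e(2) using M.functionalD(1,2)[OF co[OF e(1)]] NMc by simp
  qed
  have inj: "x = y" if x: "x \<in> carrier ?M" and y: "y \<in> carrier ?M" and eq: "\<And>f. f \<in> Fs \<Longrightarrow> f x = f y" for x y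
  proof (rule co_inj)
    show "x \<in> carrier \<A>" "y \<in> carrier \<A>" using x y NMc by simp_all
    fix e assume "e \<in> E"
    from eq[unfolded Fs_def, OF imageI[OF this]] show "co x e = co y e" .
  qed
  have "\<exists>H \<theta>. separably_generated ?M H \<theta>"
    by (rule smooth_subalgebra_separably_generated[OF algM free smooth NM(1,2) _ _ NM(3)])
      (rule NM(4,5,6); assumption)+
  then obtain H \<theta> where sg: "separably_generated ?M H \<theta>" by (elim exE)
  have "is_smoothing ?A ?M"
  proof (rule is_smoothingI[OF algM' algA' B(1) B' _ _ red _ _ sg, where Fs = Fs])
    show "\<exists>d. y = (\<Oplus>\<^bsub>?A\<^esub>b\<in>B. d b \<odot>\<^bsub>?A\<^esub> b)" if "y \<in> carrier ?A" for y by (rule gen'[OF that])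
    show "d b = 0" if "(\<Oplus>\<^bsub>?A\<^esub>b\<in>B. d b \<odot>\<^bsub>?A\<^esub> b) = \<zero>\<^bsub>?A\<^esub>" "b \<in> B" for d b by (rule ind'[OF that])
    show "M'.functional f" if "f \<in> Fs" for f by (rule fs[OF that])
    show "x = y" if "x \<in> carrier ?M" "y \<in> carrier ?M" "\<And>f. f \<in> Fs \<Longrightarrow> f x = f y" for x y by (rule inj[OF that])
  qed
  moreover have "smoothable ?A"
  proof (rule smoothableI[OF algM' algA' B(1) B' _ _ red Fs _ _ sg])
    show "\<exists>d. y = (\<Oplus>\<^bsub>?A\<^esub>b\<in>B. d b \<odot>\<^bsub>?A\<^esub> b)" if "y \<in> carrier ?A" for y by (rule gen'[OF that])
    show "d b = 0" if "(\<Oplus>\<^bsub>?A\<^esub>b\<in>B. d b \<odot>\<^bsub>?A\<^esub> b) = \<zero>\<^bsub>?A\<^esub>" "b \<in> B" for d b by (rule ind'[OF that])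
    show "M'.functional f" if "f \<in> Fs" for f by (rule fs[OF that])
    show "x = y" if "x \<in> carrier ?M" "y \<in> carrier ?M" "\<And>f. f \<in> Fs \<Longrightarrow> f x = f y" for x y by (rule inj[OF that])
  qed
  ultimately show ?thesis unfolding invariant_algebra_def NM_def NA_def by (rule conjI)
qed

end
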